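(* Let $A$ be a cellularly stratified algebra with stratification data $(B_0,V_0,\dots,B_r,V_r)$ whose input algebras $B_l$ are isomorphic to group algebras of symmetric groups or to their Iwahori–Hecke algebras, with embeddings of algebras $B_l\hookrightarrow e_lAe_l$ for $0\le l\le r$. Let $(l,\lambda)\in\Lambda_r$ and assume that $e_lAe_l\simeq B_l\oplus e_lJ_{l-1}e_l$ as $(B_l,B_l)$-bimodules. Then $\mathrm{Ind}_lM^\lambda$ has a unique indecomposable direct summand with a quotient isomorphic to $\mathrm{ind}_lY^\lambda$; that is, in a decomposition of $\mathrm{Ind}_lM^\lambda$ into indecomposable direct summands there is exactly one summand that has a quotient isomorphic to $\mathrm{ind}_lY^\lambda$.
   Context: $k$ is an algebraically closed field; modules are finite-dimensional left modules unless stated otherwise. $\Sigma_m$ is the symmetric group on $m$ letters and $\mathcal H_{k,q}(\Sigma_m)$ its Iwahori–Hecke algebra, $q\in k$ a unit. Cellularly stratified algebras: a $k$-algebra $A$ is cellularly stratified with stratification data $(B_0,V_0,\dots,B_r,V_r)$ if (1) each $B_l$ is a (finite-dimensional) cellular algebra, each $V_l$ a finite-dimensional vector space, and $A=\bigoplus_{l=0}^rB_l\otimes_kV_l\otimes_kV_l$ is an iterated inflation (in the sense of König and Xi) of the $B_l$ along the $V_l$; in particular $J_l:=\bigoplus_{j\le l}B_j\otimes V_j\otimes V_j$ is a two-sided ideal of $A$, and in $J_l/J_{l-1}$ (with $J_{-1}:=0$) one has $(b\otimes x\otimes y)(b'\otimes x'\otimes y')=b\varphi_l(y,x')b'\otimes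 x\otimes y'$ for a bilinear form $\varphi_l:V_l\otimes_kV_l\to B_l$; (2) for every $l$ there are $u_l,v_l\in V_l\setminus\{0\}$ such that $e_l:=1_{B_l}\otimes u_l\otimes v_l$ is an idempotent and $e_le_{l'}=e_l=e_{l'}e_l$ for all $l'\ge l$. Then $J_l=Ae_lA$ and $e_lAe_l/e_lJ_{l-1}e_l\simeq B_l$. The input algebra $B_l$ is viewed as a subalgebra of $e_lAe_l$ by identifying $b$ with $b\otimes u_l\otimes v_l$. Functors $B_l\text{-mod}\to A\text{-mod}$: $\mathrm{ind}_lX:=Ae_l\otimes_{e_lAe_l}X$, where $e_lAe_l$ acts on $X$ through the quotient map $e_lAe_l\twoheadrightarrow B_l$; and $\mathrm{Ind}_lX:=Ae_l\otimes_{B_l}X$. Write $l'$ for the index of the symmetric group with $B_l\simeq k\Sigma_{l'}$ or $B_l\simeq\mathcal H_{k,q}(\Sigma_{l'})$. $\Lambda_r:=\{(l,\lambda)\mid 0\le l\le r,\ \lambda\vdash l'\}$. For $\lambda\vdash l'$: $M^\lambda$ is the permutation module of $B_l$ ($M^\lambda=k\Sigma_{l'}\otimes_{k\Sigma_\lambda}k$, with $\Sigma_\lambda$ the Young subgroup, respectively $M^\lambda=\mathcal H x_\lambda$ with $x_\lambda=\sum_{w\in\Sigma_\lambda}T_w$ in the Hecke case); $S^\lambda\subseteq M^\lambda$ is the Specht module; $Y^\lambda$ is the Young module, i.e. the unique indecomposable direct summand of $M^\lambda$ containing $S^\lambda$. *)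

theory Defs
  imports "HOL-Combinatorics.Permutations" "HOL-Algebra.Algebra"
begin

section \<open>Algebras over a field and their left modules\<close>

text \<open>
  A \<open>K\<close>-algebra is a record of type \<^typ>\<open>('k, 'a) module\<close> whose ring part carries the
  multiplication and whose scalar multiplication is the action of \<open>K\<close>.  The locale
  \<^locale>\<open>algebra\<close> of the library demands commutativity, hence the separate locale below.

  A left module over a ring \<open>R\<close> that need not be commutative is represented by the same
  record type: only carrier, addition, zero and scalar multiplication matter, the fields for
  multiplication and unit are junk.  Submodules are the library's \<^locale>\<open>submodule\<close>, which
  does not presuppose a commutative ring; a submodule \<open>N\<close> of \<open>M\<close>, seen as a module, is
  \<open>M\<lparr>carrier := N\<rparr>\<close>.
\<close>

locale assoc_algebra = module K A + ring A for K (structure) and A (structure) +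
  assumes smult_mult_left: "\<lbrakk>c \<in> carrier K; x \<in> carrier A; y \<in> carrier A\<rbrakk>
      \<Longrightarrow> (c \<odot>\<^bsub>A\<^esub> x) \<otimes>\<^bsub>A\<^esub> y = c \<odot>\<^bsub>A\<^esub> (x \<otimes>\<^bsub>A\<^esub> y)"
    and smult_mult_right: "\<lbrakk>c \<in> carrier K; x \<in> carrier A; y \<in> carrier A\<rbrakk>
      \<Longrightarrow> x \<otimes>\<^bsub>A\<^esub> (c \<odot>\<^bsub>A\<^esub> y) = c \<odot>\<^bsub>A\<^esub> (x \<otimes>\<^bsub>A\<^esub> y)"

definition mod_hom ::
    "('r, 'c) ring_scheme \<Rightarrow> ('r, 'm) module \<Rightarrow> ('r, 'n) module \<Rightarrow> ('m \<Rightarrow> 'n) set" where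
  "mod_hom R M N = {f \<in> carrier M \<rightarrow> carrier N.
     (\<forall>x\<in>carrier M. \<forall>y\<in>carrier M. f (x \<oplus>\<^bsub>M\<^esub> y) = f x \<oplus>\<^bsub>N\<^esub> f y) \<and>
     (\<forall>r\<in>carrier R. \<forall>x\<in>carrier M. f (r \<odot>\<^bsub>M\<^esub> x) = r \<odot>\<^bsub>N\<^esub> f x)}"

definition mod_isomorphic ::
    "('r, 'c) ring_scheme \<Rightarrow> ('r, 'm) module \<Rightarrow> ('r, 'n) module \<Rightarrow> bool" where
  "mod_isomorphic R M N \<longleftrightarrow> (\<exists>f \<in> mod_hom R M N. bij_betw f (carrier M) (carrier N))"

definition quotient_module :: "('r, 'm) module \<Rightarrow> 'm set \<Rightarrow> ('r, 'm set) module" where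
  "quotient_module M U =
    \<lparr>carrier = a_rcosets\<^bsub>M\<^esub> U, monoid.mult = (\<lambda>_ _. undefined), monoid.one = undefined,
     ring.zero = U, ring.add = set_add M, module.smult = (\<lambda>r c. \<Union>x\<in>c. U +>\<^bsub>M\<^esub> (r \<odot>\<^bsub>M\<^esub> x))\<rparr>"

definition has_quotient_isomorphic_to ::
    "('r, 'c) ring_scheme \<Rightarrow> ('r, 'm) module \<Rightarrow> ('r, 'n) module \<Rightarrow> bool" where
  "has_quotient_isomorphic_to R M Q \<longleftrightarrow>
    (\<exists>U. submodule U R M \<and> mod_isomorphic R (quotient_module M U) Q)"

definition complementary ::
    "('r, 'c) ring_scheme \<Rightarrow> ('r, 'm) module \<Rightarrow> 'm set \<Rightarrow> 'm set \<Rightarrow> bool" where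
  "complementary R M N N' \<longleftrightarrow> submodule N R M \<and> submodule N' R M \<and>
     N \<inter> N' = {\<zero>\<^bsub>M\<^esub>} \<and> N <+>\<^bsub>M\<^esub> N' = carrier M"

definition direct_summand :: "('r, 'c) ring_scheme \<Rightarrow> ('r, 'm) module \<Rightarrow> 'm set \<Rightarrow> bool" where
  "direct_summand R M N \<longleftrightarrow> (\<exists>N'. complementary R M N N')"

definition indecomposable :: "('r, 'c) ring_scheme \<Rightarrow> ('r, 'm) module \<Rightarrow> bool" where
  "indecomposable R M \<longleftrightarrow> carrier M \<noteq> {\<zero>\<^bsub>M\<^esub>} \<and>
     (\<forall>N N'. complementary R M N N' \<longrightarrow> N = {\<zero>\<^bsub>M\<^esub>} \<or> N' = {\<zero>\<^bsub>M\<^esub>})"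

definition internal_direct_sum ::
    "('r, 'c) ring_scheme \<Rightarrow> ('r, 'm) module \<Rightarrow> 'i set \<Rightarrow> ('i \<Rightarrow> 'm set) \<Rightarrow> bool" where
  "internal_direct_sum R M I N \<longleftrightarrow> (\<forall>i\<in>I. submodule (N i) R M) \<and>
     (\<forall>x\<in>carrier M. \<exists>!f. f \<in> (\<Pi>\<^sub>E i\<in>I. N i) \<and> x = (\<Oplus>\<^bsub>M\<^esub>i\<in>I. f i))"

definition indecomposable_decomposition ::
    "('r, 'c) ring_scheme \<Rightarrow> ('r, 'm) module \<Rightarrow> nat \<Rightarrow> (nat \<Rightarrow> 'm set) \<Rightarrow> bool" where
  "indecomposable_decomposition R M n N \<longleftrightarrow> internal_direct_sum R M {..<n} N \<and>
     (\<forall>i<n. indecomposable R (M\<lparr>carrier := N i\<rparr>))"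

definition regular_module :: "('k, 'a) module \<Rightarrow> ('a, 'a) module" where
  "regular_module A = \<lparr>carrier = carrier A, monoid.mult = monoid.mult A, monoid.one = \<one>\<^bsub>A\<^esub>,
     ring.zero = \<zero>\<^bsub>A\<^esub>, ring.add = ring.add A, module.smult = monoid.mult A\<rparr>"

definition left_ideal_module :: "('k, 'a) module \<Rightarrow> 'a \<Rightarrow> ('a, 'a) module" where
  "left_ideal_module A e = regular_module A\<lparr>carrier := {a \<otimes>\<^bsub>A\<^esub> e | a. a \<in> carrier A}\<rparr>"

text \<open>The algebra \<open>eAe\<close> for an idempotent \<open>e\<close>.\<close>

definition corner :: "('k, 'a) module \<Rightarrow> 'a \<Rightarrow> ('k, 'a) module" where
  "corner A e = A\<lparr>carrier := {e \<otimes>\<^bsub>A\<^esub> a \<otimes>\<^bsub>A\<^esub> e | a. a \<in> carrier A}, one := e\<rparr>"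

definition restrict_scalars :: "('a \<Rightarrow> 'b) \<Rightarrow> ('b, 'm) module \<Rightarrow> ('a, 'm) module" where
  "restrict_scalars f Z = \<lparr>carrier = carrier Z, monoid.mult = monoid.mult Z, monoid.one = \<one>\<^bsub>Z\<^esub>,
     ring.zero = \<zero>\<^bsub>Z\<^esub>, ring.add = ring.add Z, module.smult = (\<lambda>a x. f a \<odot>\<^bsub>Z\<^esub> x)\<rparr>"

definition cyclic_submodule :: "('r, 'c) ring_scheme \<Rightarrow> ('r, 'm) module \<Rightarrow> 'm \<Rightarrow> 'm set" where
  "cyclic_submodule R M x = {r \<odot>\<^bsub>M\<^esub> x | r. r \<in> carrier R}"

definition algebra_embedding ::
    "'k ring \<Rightarrow> ('k, 'b) module \<Rightarrow> ('k, 'a) module \<Rightarrow> ('b \<Rightarrow> 'a) \<Rightarrow> bool" where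
  "algebra_embedding K B A f \<longleftrightarrow>
     f \<in> ring_hom B A \<and> f \<in> mod_hom K B A \<and> inj_on f (carrier B)"

definition anti_involution :: "'k ring \<Rightarrow> ('k, 'a) module \<Rightarrow> ('a \<Rightarrow> 'a) \<Rightarrow> bool" where
  "anti_involution K A \<iota> \<longleftrightarrow> \<iota> \<in> mod_hom K A A \<and>
     (\<forall>x\<in>carrier A. \<forall>y\<in>carrier A. \<iota> (x \<otimes>\<^bsub>A\<^esub> y) = \<iota> y \<otimes>\<^bsub>A\<^esub> \<iota> x) \<and>
     (\<forall>x\<in>carrier A. \<iota> (\<iota> x) = x)"

definition lin_basis :: "'k ring \<Rightarrow> ('k, 'v) module \<Rightarrow> 'i set \<Rightarrow> ('i \<Rightarrow> 'v) \<Rightarrow> bool" where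
  "lin_basis K V I b \<longleftrightarrow> finite I \<and> b \<in> I \<rightarrow> carrier V \<and>
     (\<forall>x\<in>carrier V. \<exists>!c. c \<in> I \<rightarrow>\<^sub>E carrier K \<and> x = (\<Oplus>\<^bsub>V\<^esub>i\<in>I. c i \<odot>\<^bsub>V\<^esub> b i))"

definition lin_coord ::
    "'k ring \<Rightarrow> ('k, 'v) module \<Rightarrow> 'i set \<Rightarrow> ('i \<Rightarrow> 'v) \<Rightarrow> 'v \<Rightarrow> 'i \<Rightarrow> 'k" where
  "lin_coord K V I b x =
     (THE c. c \<in> I \<rightarrow>\<^sub>E carrier K \<and> x = (\<Oplus>\<^bsub>V\<^esub>i\<in>I. c i \<odot>\<^bsub>V\<^esub> b i))"

definition fin_dim :: "'k ring \<Rightarrow> ('k, 'v) module \<Rightarrow> bool" where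
  "fin_dim K V \<longleftrightarrow> (\<exists>n b. lin_basis K V {..<n::nat} b)"

definition lin_span :: "'k ring \<Rightarrow> ('k, 'v) module \<Rightarrow> 'v set \<Rightarrow> 'v set" where
  "lin_span K V S = \<Inter>{W. submodule W K V \<and> S \<subseteq> W}"


section \<open>Tensor products\<close>

text \<open>
  \<open>M \<otimes>\<^sub>R N\<close> for a right \<open>R\<close>-module \<open>M\<close> and a left \<open>R\<close>-module \<open>N\<close> is the free abelian group
  on the set of pairs modulo the usual relations.  The right action of \<open>R\<close> on \<open>M\<close> is the
  function \<open>ra\<close>.  The scalar multiplication of the record \<open>M\<close> is a left action on \<open>M\<close>
  (of some other ring, commuting with \<open>ra\<close>), and it is the one that \<open>M \<otimes>\<^sub>R N\<close> inherits.
\<close>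

type_synonym ('m, 'n) tens = "(('m \<times> 'n) \<Rightarrow>\<^sub>0 int) set"

definition tensor_free :: "('a, 'm) module \<Rightarrow> ('r, 'n) module \<Rightarrow> (('m \<times> 'n) \<Rightarrow>\<^sub>0 int) monoid" where
  "tensor_free M N = free_Abelian_group (carrier M \<times> carrier N)"

definition tensor_rel ::
    "('r, 'c) ring_scheme \<Rightarrow> ('m \<Rightarrow> 'r \<Rightarrow> 'm) \<Rightarrow> ('a, 'm) module \<Rightarrow> ('r, 'n) module \<Rightarrow> ('m, 'n) tens" where
  "tensor_rel R ra M N = generate (tensor_free M N)
     ({frag_of (x \<oplus>\<^bsub>M\<^esub> x', y) - frag_of (x, y) - frag_of (x', y) | x x' y.
         x \<in> carrier M \<and> x' \<in> carrier M \<and> y \<in> carrier N} \<union>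
      {frag_of (x, y \<oplus>\<^bsub>N\<^esub> y') - frag_of (x, y) - frag_of (x, y') | x y y'.
         x \<in> carrier M \<and> y \<in> carrier N \<and> y' \<in> carrier N} \<union>
      {frag_of (ra x r, y) - frag_of (x, r \<odot>\<^bsub>N\<^esub> y) | x r y.
         x \<in> carrier M \<and> r \<in> carrier R \<and> y \<in> carrier N})"

definition tensor ::
    "('r, 'c) ring_scheme \<Rightarrow> ('m \<Rightarrow> 'r \<Rightarrow> 'm) \<Rightarrow> ('a, 'm) module \<Rightarrow> ('r, 'n) module
      \<Rightarrow> ('a, ('m, 'n) tens) module" where
  "tensor R ra M N =
    (let F = tensor_free M N; U = tensor_rel R ra M N; Q = F Mod U in
     \<lparr>carrier = carrier Q, monoid.mult = (\<lambda>_ _. undefined), monoid.one = undefined,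
      ring.zero = monoid.one Q, ring.add = monoid.mult Q,
      module.smult = (\<lambda>a c. \<Union>p\<in>c. U #>\<^bsub>F\<^esub> frag_extend (\<lambda>(x, y). frag_of (a \<odot>\<^bsub>M\<^esub> x, y)) p)\<rparr>)"

definition pure_tensor ::
    "('r, 'c) ring_scheme \<Rightarrow> ('m \<Rightarrow> 'r \<Rightarrow> 'm) \<Rightarrow> ('a, 'm) module \<Rightarrow> ('r, 'n) module
      \<Rightarrow> 'm \<Rightarrow> 'n \<Rightarrow> ('m, 'n) tens" where
  "pure_tensor R ra M N x y = tensor_rel R ra M N #>\<^bsub>tensor_free M N\<^esub> frag_of (x, y)"

abbreviation vs_tensor :: "'k ring \<Rightarrow> ('k, 'v) module \<Rightarrow> ('k, 'w) module \<Rightarrow> ('k, ('v, 'w) tens) module" where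
  "vs_tensor K V W \<equiv> tensor K (\<lambda>x c. c \<odot>\<^bsub>V\<^esub> x) V W"

abbreviation vs_pure :: "'k ring \<Rightarrow> ('k, 'v) module \<Rightarrow> ('k, 'w) module \<Rightarrow> 'v \<Rightarrow> 'w \<Rightarrow> ('v, 'w) tens" where
  "vs_pure K V W \<equiv> pure_tensor K (\<lambda>x c. c \<odot>\<^bsub>V\<^esub> x) V W"


section \<open>Cellular and cellularly stratified algebras\<close>

text \<open>
  Cellular algebras in the sense of Graham and Lehrer, with respect to the anti-involution
  \<open>\<iota>\<close>.  The coefficients \<open>\<rho> s' s\<close> may depend on \<open>a\<close> and \<open>\<alpha>\<close>, but not on \<open>t\<close>.  The finite poset
  and the finite index sets of the cells are taken to consist of natural numbers.
\<close>

definition cellular :: "'k ring \<Rightarrow> ('k, 'a) module \<Rightarrow> ('a \<Rightarrow> 'a) \<Rightarrow> bool" where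
  "cellular K A \<iota> \<longleftrightarrow> assoc_algebra K A \<and> anti_involution K A \<iota> \<and>
    (\<exists>(\<Lambda>::nat set) less (I :: nat \<Rightarrow> nat set) C.
      finite \<Lambda> \<and> (\<forall>\<alpha>\<in>\<Lambda>. \<not> less \<alpha> \<alpha>) \<and>
      (\<forall>\<alpha>\<in>\<Lambda>. \<forall>\<beta>\<in>\<Lambda>. \<forall>\<gamma>\<in>\<Lambda>. less \<alpha> \<beta> \<longrightarrow> less \<beta> \<gamma> \<longrightarrow> less \<alpha> \<gamma>) \<and>
      (\<forall>\<alpha>\<in>\<Lambda>. finite (I \<alpha>)) \<and>
      lin_basis K A (SIGMA \<alpha>:\<Lambda>. I \<alpha> \<times> I \<alpha>) (\<lambda>(\<alpha>, s, t). C \<alpha> s t) \<and>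
      (\<forall>\<alpha>\<in>\<Lambda>. \<forall>s\<in>I \<alpha>. \<forall>t\<in>I \<alpha>. \<iota> (C \<alpha> s t) = C \<alpha> t s) \<and>
      (\<forall>a\<in>carrier A. \<forall>\<alpha>\<in>\<Lambda>. \<exists>\<rho>. (\<forall>s'\<in>I \<alpha>. \<forall>s\<in>I \<alpha>. \<rho> s' s \<in> carrier K) \<and>
        (\<forall>s\<in>I \<alpha>. \<forall>t\<in>I \<alpha>.
          a \<otimes>\<^bsub>A\<^esub> C \<alpha> s t \<ominus>\<^bsub>A\<^esub> (\<Oplus>\<^bsub>A\<^esub>s'\<in>I \<alpha>. \<rho> s' s \<odot>\<^bsub>A\<^esub> C \<alpha> s' t)
            \<in> lin_span K A {C \<beta> s' t' | \<beta> s' t'. \<beta> \<in> \<Lambda> \<and> less \<beta> \<alpha> \<and> s' \<in> I \<beta> \<and> t' \<in> I \<beta>})))"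

text \<open>
  Stratification data for an algebra \<open>A\<close>: the number \<open>depth = r\<close>, the input algebras \<open>B\<^sub>l\<close>, the
  vector spaces \<open>V\<^sub>l\<close>, the inclusions \<open>B\<^sub>l \<otimes> V\<^sub>l \<otimes> V\<^sub>l \<rightarrow> A\<close> and the vectors \<open>u\<^sub>l, v\<^sub>l\<close>, where
  \<open>0 \<le> l \<le> r\<close>.
\<close>

record ('k, 'a, 'b, 'v) strat_data =
  depth :: nat
  input :: "nat \<Rightarrow> ('k, 'b) module"
  space :: "nat \<Rightarrow> ('k, 'v) module"
  incl :: "nat \<Rightarrow> (('b, 'v) tens, 'v) tens \<Rightarrow> 'a"
  uvec :: "nat \<Rightarrow> 'v"
  vvec :: "nat \<Rightarrow> 'v"

definition layer_space ::
    "'k ring \<Rightarrow> ('k, 'a, 'b, 'v) strat_data \<Rightarrow> nat \<Rightarrow> ('k, (('b, 'v) tens, 'v) tens) module" where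
  "layer_space K D l = vs_tensor K (vs_tensor K (input D l) (space D l)) (space D l)"

text \<open>The element of \<open>A\<close> denoted by \<open>b \<otimes> x \<otimes> y\<close> in layer \<open>l\<close>.\<close>

definition layer_elem ::
    "'k ring \<Rightarrow> ('k, 'a, 'b, 'v) strat_data \<Rightarrow> nat \<Rightarrow> 'b \<Rightarrow> 'v \<Rightarrow> 'v \<Rightarrow> 'a" where
  "layer_elem K D l b x y = incl D l
     (vs_pure K (vs_tensor K (input D l) (space D l)) (space D l)
       (vs_pure K (input D l) (space D l) b x) y)"

definition layer :: "'k ring \<Rightarrow> ('k, 'a, 'b, 'v) strat_data \<Rightarrow> nat \<Rightarrow> 'a set" where
  "layer K D l = incl D l ` carrier (layer_space K D l)"

text \<open>
  The sum of the layers with index less than \<open>n\<close>.  So \<open>J\<^sub>l\<close> is the value at \<open>Suc l\<close>, and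
  \<open>J\<^sub>l\<^sub>-\<^sub>1\<close> is the value at \<open>l\<close>, which also covers \<open>J\<^sub>-\<^sub>1 = 0\<close>.
\<close>

definition layers_below ::
    "'k ring \<Rightarrow> ('k, 'a) module \<Rightarrow> ('k, 'a, 'b, 'v) strat_data \<Rightarrow> nat \<Rightarrow> 'a set" where
  "layers_below K A D n = {\<Oplus>\<^bsub>A\<^esub>j\<in>{..<n}. f j | f. \<forall>j<n. f j \<in> layer K D j}"

text \<open>
  Iterated inflation along \<open>D\<close> in the sense of Koenig and Xi: \<open>A\<close> has an anti-involution \<open>\<iota>\<close>, the
  input algebras have anti-involutions \<open>i l\<close>, and these are related as in a single inflation.
\<close>

definition iterated_inflation ::
    "'k ring \<Rightarrow> ('k, 'a) module \<Rightarrow> ('a \<Rightarrow> 'a) \<Rightarrow> (nat \<Rightarrow> 'b \<Rightarrow> 'b) \<Rightarrow> (nat \<Rightarrow> 'v \<Rightarrow> 'v \<Rightarrow> 'b)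
      \<Rightarrow> ('k, 'a, 'b, 'v) strat_data \<Rightarrow> bool" where
  "iterated_inflation K A \<iota> i \<phi> D \<longleftrightarrow>
    assoc_algebra K A \<and> anti_involution K A \<iota> \<and>
    (\<forall>l\<le>depth D.
      assoc_algebra K (input D l) \<and> anti_involution K (input D l) (i l) \<and>
      module K (space D l) \<and> fin_dim K (space D l) \<and>
      incl D l \<in> mod_hom K (layer_space K D l) A \<and>
      inj_on (incl D l) (carrier (layer_space K D l)) \<and>
      (\<forall>x\<in>carrier (space D l). \<phi> l x \<in> mod_hom K (space D l) (input D l)) \<and>
      (\<forall>y\<in>carrier (space D l). (\<lambda>x. \<phi> l x y) \<in> mod_hom K (space D l) (input D l)) \<and>
      (\<forall>x\<in>carrier (space D l). \<forall>y\<in>carrier (space D l). i l (\<phi> l x y) = \<phi> l y x) \<and>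
      ideal (layers_below K A D (Suc l)) A \<and>
      (\<forall>b\<in>carrier (input D l). \<forall>x\<in>carrier (space D l). \<forall>y\<in>carrier (space D l).
        \<iota> (layer_elem K D l b x y) = layer_elem K D l (i l b) y x) \<and>
      (\<forall>b\<in>carrier (input D l). \<forall>b'\<in>carrier (input D l).
        \<forall>x\<in>carrier (space D l). \<forall>y\<in>carrier (space D l).
        \<forall>x'\<in>carrier (space D l). \<forall>y'\<in>carrier (space D l).
          layer_elem K D l b x y \<otimes>\<^bsub>A\<^esub> layer_elem K D l b' x' y'
            \<ominus>\<^bsub>A\<^esub> layer_elem K D l (b \<otimes>\<^bsub>input D l\<^esub> \<phi> l y x' \<otimes>\<^bsub>input D l\<^esub> b') x y'
          \<in> layers_below K A D l)) \<and>
    internal_direct_sum K A {..depth D} (layer K D)"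

text \<open>The idempotents \<open>e\<^sub>l = 1 \<otimes> u\<^sub>l \<otimes> v\<^sub>l\<close> and the maps \<open>b \<mapsto> b \<otimes> u\<^sub>l \<otimes> v\<^sub>l\<close>.\<close>

definition idem :: "'k ring \<Rightarrow> ('k, 'a, 'b, 'v) strat_data \<Rightarrow> nat \<Rightarrow> 'a" where
  "idem K D l = layer_elem K D l \<one>\<^bsub>input D l\<^esub> (uvec D l) (vvec D l)"

definition input_emb :: "'k ring \<Rightarrow> ('k, 'a, 'b, 'v) strat_data \<Rightarrow> nat \<Rightarrow> 'b \<Rightarrow> 'a" where
  "input_emb K D l b = layer_elem K D l b (uvec D l) (vvec D l)"

definition cellularly_stratified ::
    "'k ring \<Rightarrow> ('k, 'a) module \<Rightarrow> ('k, 'a, 'b, 'v) strat_data \<Rightarrow> bool" where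
  "cellularly_stratified K A D \<longleftrightarrow>
    (\<exists>\<iota> i \<phi>. iterated_inflation K A \<iota> i \<phi> D \<and> (\<forall>l\<le>depth D. cellular K (input D l) (i l))) \<and>
    (\<forall>l\<le>depth D.
      uvec D l \<in> carrier (space D l) - {\<zero>\<^bsub>space D l\<^esub>} \<and>
      vvec D l \<in> carrier (space D l) - {\<zero>\<^bsub>space D l\<^esub>} \<and>
      idem K D l \<otimes>\<^bsub>A\<^esub> idem K D l = idem K D l \<and>
      (\<forall>l'. l \<le> l' \<and> l' \<le> depth D \<longrightarrow>
        idem K D l \<otimes>\<^bsub>A\<^esub> idem K D l' = idem K D l \<and>
        idem K D l' \<otimes>\<^bsub>A\<^esub> idem K D l = idem K D l))"

text \<open>
  The quotient map \<open>e\<^sub>l A e\<^sub>l \<rightarrow> e\<^sub>l A e\<^sub>l / e\<^sub>l J\<^sub>l\<^sub>-\<^sub>1 e\<^sub>l \<simeq> B\<^sub>l\<close>, in which the class of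
  \<open>b \<otimes> u\<^sub>l \<otimes> v\<^sub>l\<close> corresponds to \<open>b\<close>.
\<close>

definition corner_proj ::
    "'k ring \<Rightarrow> ('k, 'a) module \<Rightarrow> ('k, 'a, 'b, 'v) strat_data \<Rightarrow> nat \<Rightarrow> 'a \<Rightarrow> 'b" where
  "corner_proj K A D l a =
    (THE b. b \<in> carrier (input D l) \<and> a \<ominus>\<^bsub>A\<^esub> input_emb K D l b \<in> layers_below K A D l)"

text \<open>\<open>ind\<^sub>l X = A e\<^sub>l \<otimes>\<^bsub>e\<^sub>l A e\<^sub>l\<^esub> X\<close> and \<open>Ind\<^sub>l X = A e\<^sub>l \<otimes>\<^bsub>B\<^sub>l\<^esub> X\<close>.\<close>

definition ind_small ::
    "'k ring \<Rightarrow> ('k, 'a) module \<Rightarrow> ('k, 'a, 'b, 'v) strat_data \<Rightarrow> nat \<Rightarrow> ('b, 'x) module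
      \<Rightarrow> ('a, ('a, 'x) tens) module" where
  "ind_small K A D l Z = tensor (corner A (idem K D l)) (monoid.mult A)
     (left_ideal_module A (idem K D l)) (restrict_scalars (corner_proj K A D l) Z)"

definition ind_big ::
    "'k ring \<Rightarrow> ('k, 'a) module \<Rightarrow> ('k, 'a, 'b, 'v) strat_data \<Rightarrow> nat \<Rightarrow> ('b, 'x) module
      \<Rightarrow> ('a, ('a, 'x) tens) module" where
  "ind_big K A D l Z = tensor (input D l) (\<lambda>x b. x \<otimes>\<^bsub>A\<^esub> input_emb K D l b)
     (left_ideal_module A (idem K D l)) Z"

text \<open>
  \<open>e\<^sub>l A e\<^sub>l \<simeq> B\<^sub>l \<oplus> e\<^sub>l J\<^sub>l\<^sub>-\<^sub>1 e\<^sub>l\<close> as \<open>(B\<^sub>l, B\<^sub>l)\<close>-bimodules, where \<open>B\<^sub>l\<close> acts on \<open>e\<^sub>l A e\<^sub>l\<close> and on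
  \<open>e\<^sub>l J\<^sub>l\<^sub>-\<^sub>1 e\<^sub>l\<close> through its embedding into \<open>e\<^sub>l A e\<^sub>l\<close>.
\<close>

definition corner_splits ::
    "'k ring \<Rightarrow> ('k, 'a) module \<Rightarrow> ('k, 'a, 'b, 'v) strat_data \<Rightarrow> nat \<Rightarrow> bool" where
  "corner_splits K A D l \<longleftrightarrow>
    (let B = input D l; e = idem K D l; E = carrier (corner A e); h = input_emb K D l in
     \<exists>f g. bij_betw (\<lambda>a. (f a, g a)) E
         (carrier B \<times> {e \<otimes>\<^bsub>A\<^esub> j \<otimes>\<^bsub>A\<^esub> e | j. j \<in> layers_below K A D l}) \<and>
       (\<forall>a\<in>E. \<forall>a'\<in>E. f (a \<oplus>\<^bsub>A\<^esub> a') = f a \<oplus>\<^bsub>B\<^esub> f a' \<and> g (a \<oplus>\<^bsub>A\<^esub> a') = g a \<oplus>\<^bsub>A\<^esub> g a') \<and>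
       (\<forall>b\<in>carrier B. \<forall>a\<in>E.
         f (h b \<otimes>\<^bsub>A\<^esub> a) = b \<otimes>\<^bsub>B\<^esub> f a \<and> g (h b \<otimes>\<^bsub>A\<^esub> a) = h b \<otimes>\<^bsub>A\<^esub> g a \<and>
         f (a \<otimes>\<^bsub>A\<^esub> h b) = f a \<otimes>\<^bsub>B\<^esub> b \<and> g (a \<otimes>\<^bsub>A\<^esub> h b) = g a \<otimes>\<^bsub>A\<^esub> h b))"


section \<open>Partitions and tableaux\<close>

text \<open>
  Partitions are weakly decreasing lists of positive numbers.  Rows and columns of the Young
  diagram are numbered from \<open>0\<close>, whereas tableaux have entries \<open>1, \<dots>, m\<close>.
\<close>

definition is_partition :: "nat list \<Rightarrow> nat \<Rightarrow> bool" where
  "is_partition lam m \<longleftrightarrow> sorted_wrt (\<ge>) lam \<and> 0 \<notin> set lam \<and> sum_list lam = m"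

definition conj_partition :: "nat list \<Rightarrow> nat list" where
  "conj_partition lam =
    map (\<lambda>j. card {i. i < length lam \<and> j < lam ! i}) [0..<(if lam = [] then 0 else hd lam)]"

text \<open>The tableaux filled row by row, respectively column by column.\<close>

definition row_tableau :: "nat list \<Rightarrow> nat \<Rightarrow> nat \<Rightarrow> nat" where
  "row_tableau lam i j = sum_list (take i lam) + j + 1"

definition col_tableau :: "nat list \<Rightarrow> nat \<Rightarrow> nat \<Rightarrow> nat" where
  "col_tableau lam i j = sum_list (take j (conj_partition lam)) + i + 1"

text \<open>The Young subgroup of \<open>lam\<close>, that is, the row stabilizer of \<^term>\<open>row_tableau lam\<close>.\<close>

definition young_subgroup :: "nat \<Rightarrow> nat list \<Rightarrow> (nat \<Rightarrow> nat) set" where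
  "young_subgroup m lam = {w \<in> carrier (sym_group m). \<forall>i<length lam.
     w ` {row_tableau lam i j | j. j < lam ! i} = {row_tableau lam i j | j. j < lam ! i}}"

definition column_stabilizer :: "nat \<Rightarrow> nat list \<Rightarrow> (nat \<Rightarrow> nat) set" where
  "column_stabilizer m lam = {w \<in> carrier (sym_group m). \<forall>j.
     w ` {row_tableau lam i j | i. i < length lam \<and> j < lam ! i}
       = {row_tableau lam i j | i. i < length lam \<and> j < lam ! i}}"

text \<open>The permutation taking the entries of the first tableau to those of the second.\<close>

definition tableau_perm :: "nat \<Rightarrow> nat list \<Rightarrow> (nat \<Rightarrow> nat)" where
  "tableau_perm m lam = (THE w. w \<in> carrier (sym_group m) \<and>
     (\<forall>i<length lam. \<forall>j<lam ! i. w (row_tableau lam i j) = col_tableau lam i j))"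

text \<open>The Coxeter length of a permutation of \<open>1, \<dots>, m\<close> is its number of inversions.\<close>

definition perm_length :: "nat \<Rightarrow> (nat \<Rightarrow> nat) \<Rightarrow> nat" where
  "perm_length m w = card {(i, j). 1 \<le> i \<and> i < j \<and> j \<le> m \<and> w j < w i}"


section \<open>Group algebras of symmetric groups\<close>

text \<open>
  \<open>B\<close> is isomorphic to the group algebra of the symmetric group on \<open>m\<close> letters, where \<open>T w\<close> is
  the element of \<open>B\<close> corresponding to the permutation \<open>w\<close>.
\<close>

definition is_sym_group_algebra ::
    "'k ring \<Rightarrow> nat \<Rightarrow> ('k, 'b) module \<Rightarrow> ((nat \<Rightarrow> nat) \<Rightarrow> 'b) \<Rightarrow> bool" where
  "is_sym_group_algebra K m B T \<longleftrightarrow> assoc_algebra K B \<and>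
     lin_basis K B (carrier (sym_group m)) T \<and> T id = \<one>\<^bsub>B\<^esub> \<and>
     (\<forall>v\<in>carrier (sym_group m). \<forall>w\<in>carrier (sym_group m). T v \<otimes>\<^bsub>B\<^esub> T w = T (v \<circ> w))"

text \<open>
  The trivial module \<open>k\<close>: every permutation acts as the identity, hence an element of the group
  algebra acts as the sum of its coefficients.
\<close>

definition trivial_module ::
    "'k ring \<Rightarrow> nat \<Rightarrow> ('k, 'b) module \<Rightarrow> ((nat \<Rightarrow> nat) \<Rightarrow> 'b) \<Rightarrow> ('b, 'k) module" where
  "trivial_module K m B T = \<lparr>carrier = carrier K, monoid.mult = monoid.mult K, monoid.one = \<one>\<^bsub>K\<^esub>,
     ring.zero = \<zero>\<^bsub>K\<^esub>, ring.add = ring.add K,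
     module.smult = (\<lambda>b c. (\<Oplus>\<^bsub>K\<^esub>w\<in>carrier (sym_group m).
                lin_coord K B (carrier (sym_group m)) T b w) \<otimes>\<^bsub>K\<^esub> c)\<rparr>"

definition young_subalgebra ::
    "'k ring \<Rightarrow> nat \<Rightarrow> ('k, 'b) module \<Rightarrow> ((nat \<Rightarrow> nat) \<Rightarrow> 'b) \<Rightarrow> nat list \<Rightarrow> ('k, 'b) module" where
  "young_subalgebra K m B T lam = B\<lparr>carrier := lin_span K B (T ` young_subgroup m lam)\<rparr>"

text \<open>\<open>M\<^sup>\<lambda> = k\<Sigma>\<^sub>m \<otimes>\<^bsub>k\<Sigma>\<^sub>\<lambda>\<^esub> k\<close>; the tabloid of the tableau \<open>w t\<close>, with \<open>t\<close> the
  tableau \<^const>\<open>row_tableau\<close>, is \<open>w \<otimes> 1\<close>.\<close>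

definition perm_module_sym ::
    "'k ring \<Rightarrow> nat \<Rightarrow> ('k, 'b) module \<Rightarrow> ((nat \<Rightarrow> nat) \<Rightarrow> 'b) \<Rightarrow> nat list
      \<Rightarrow> ('b, ('b, 'k) tens) module" where
  "perm_module_sym K m B T lam =
     tensor (young_subalgebra K m B T lam) (monoid.mult B) (regular_module B) (trivial_module K m B T)"

text \<open>The Specht module is generated by the polytabloid of \<^const>\<open>row_tableau\<close>.\<close>

definition specht_sym ::
    "'k ring \<Rightarrow> nat \<Rightarrow> ('k, 'b) module \<Rightarrow> ((nat \<Rightarrow> nat) \<Rightarrow> 'b) \<Rightarrow> nat list \<Rightarrow> ('b, 'k) tens set" where
  "specht_sym K m B T lam =
    (let \<kappa> = (\<Oplus>\<^bsub>B\<^esub>w\<in>column_stabilizer m lam. if evenperm w then T w else \<ominus>\<^bsub>B\<^esub> T w);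
         M = perm_module_sym K m B T lam;
         tabloid = pure_tensor (young_subalgebra K m B T lam) (monoid.mult B) (regular_module B)
           (trivial_module K m B T) \<one>\<^bsub>B\<^esub> \<one>\<^bsub>K\<^esub>
     in cyclic_submodule B M (\<kappa> \<odot>\<^bsub>M\<^esub> tabloid))"


section \<open>Iwahori--Hecke algebras of symmetric groups\<close>

text \<open>
  \<open>B\<close> is isomorphic to the Iwahori--Hecke algebra of the symmetric group on \<open>m\<close> letters with
  parameter \<open>q\<close>, where \<open>T w\<close> is the element of \<open>B\<close> corresponding to the standard basis element
  \<open>T\<^sub>w\<close>.  The relations determine the multiplication, by induction on the length of the left
  factor.  The simple reflections satisfy \<open>(T\<^sub>s - q) (T\<^sub>s + 1) = 0\<close>.
\<close>

definition is_hecke_algebra ::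
    "'k ring \<Rightarrow> 'k \<Rightarrow> nat \<Rightarrow> ('k, 'b) module \<Rightarrow> ((nat \<Rightarrow> nat) \<Rightarrow> 'b) \<Rightarrow> bool" where
  "is_hecke_algebra K q m B T \<longleftrightarrow> q \<in> Units K \<and> assoc_algebra K B \<and>
     lin_basis K B (carrier (sym_group m)) T \<and> T id = \<one>\<^bsub>B\<^esub> \<and>
     (\<forall>i w. 1 \<le> i \<and> i < m \<and> w \<in> carrier (sym_group m) \<longrightarrow>
       (let s = transpose i (Suc i) in
        T s \<otimes>\<^bsub>B\<^esub> T w =
         (if perm_length m w < perm_length m (s \<circ> w) then T (s \<circ> w)
          else q \<odot>\<^bsub>B\<^esub> T (s \<circ> w) \<oplus>\<^bsub>B\<^esub> (q \<ominus>\<^bsub>K\<^esub> \<one>\<^bsub>K\<^esub>) \<odot>\<^bsub>B\<^esub> T w)))"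

definition hecke_x ::
    "nat \<Rightarrow> ('k, 'b) module \<Rightarrow> ((nat \<Rightarrow> nat) \<Rightarrow> 'b) \<Rightarrow> nat list \<Rightarrow> 'b" where
  "hecke_x m B T lam = (\<Oplus>\<^bsub>B\<^esub>w\<in>young_subgroup m lam. T w)"

definition hecke_y ::
    "'k ring \<Rightarrow> 'k \<Rightarrow> nat \<Rightarrow> ('k, 'b) module \<Rightarrow> ((nat \<Rightarrow> nat) \<Rightarrow> 'b) \<Rightarrow> nat list \<Rightarrow> 'b" where
  "hecke_y K q m B T lam = (\<Oplus>\<^bsub>B\<^esub>w\<in>young_subgroup m lam.
     (inv\<^bsub>K\<^esub> (\<ominus>\<^bsub>K\<^esub> q) [^]\<^bsub>K\<^esub> perm_length m w) \<odot>\<^bsub>B\<^esub> T w)"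

definition perm_module_hecke ::
    "nat \<Rightarrow> ('k, 'b) module \<Rightarrow> ((nat \<Rightarrow> nat) \<Rightarrow> 'b) \<Rightarrow> nat list \<Rightarrow> ('b, 'b) module" where
  "perm_module_hecke m B T lam = left_ideal_module B (hecke_x m B T lam)"

text \<open>
  The Specht module of Dipper and James, in the version for left modules: it is generated by
  \<open>y\<^bsub>\<lambda>'\<^esub> T\<^sub>w x\<^sub>\<lambda>\<close>, where \<open>\<lambda>'\<close> is the conjugate partition and \<open>w\<close> is \<^const>\<open>tableau_perm\<close>.
\<close>

definition specht_hecke ::
    "'k ring \<Rightarrow> 'k \<Rightarrow> nat \<Rightarrow> ('k, 'b) module \<Rightarrow> ((nat \<Rightarrow> nat) \<Rightarrow> 'b) \<Rightarrow> nat list \<Rightarrow> 'b set" where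
  "specht_hecke K q m B T lam = cyclic_submodule B (perm_module_hecke m B T lam)
     (hecke_y K q m B T (conj_partition lam) \<otimes>\<^bsub>B\<^esub> T (tableau_perm m lam)
       \<otimes>\<^bsub>B\<^esub> hecke_x m B T lam)"


section \<open>Young modules\<close>

text \<open>
  \<open>Y\<close> is an indecomposable direct summand, containing the Specht module \<open>S\<close>, of the permutation
  module \<open>M\<close>.  This determines \<open>Y\<close> up to isomorphism only, not as a subset of \<open>M\<close>.
\<close>

definition is_young_module ::
    "('b, 'c) ring_scheme \<Rightarrow> ('b, 'm) module \<Rightarrow> 'm set \<Rightarrow> 'm set \<Rightarrow> bool" where
  "is_young_module B M S Y \<longleftrightarrow>
     direct_summand B M Y \<and> indecomposable B (M\<lparr>carrier := Y\<rparr>) \<and> S \<subseteq> Y"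

definition unique_summand_with_quotient ::
    "('r, 'c) ring_scheme \<Rightarrow> ('r, 'm) module \<Rightarrow> ('r, 'n) module \<Rightarrow> bool" where
  "unique_summand_with_quotient R M Q \<longleftrightarrow>
     (\<exists>n N. indecomposable_decomposition R M n N) \<and>
     (\<forall>n N. indecomposable_decomposition R M n N \<longrightarrow>
       (\<exists>!i. i < n \<and> has_quotient_isomorphic_to R (M\<lparr>carrier := N i\<rparr>) Q))"

end

theory Submission imports Defs begin

text \<open>The Young module \<open>Y = Y\<^sup>\<lambda>\<close> is separated from the other summands of \<open>M = M\<^sup>\<lambda>\<close> by one element of
  \<open>B\<^sub>l\<close>: let \<open>x\<close> be the sum of the basis elements over the row stabilizer and \<open>\<eta>\<close> the alternating
  (\<open>q\<close>-)sum over the Young subgroup of the conjugate partition.  Then \<open>\<eta> T\<^sub>w x\<close> vanishes unless \<open>w\<close>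
  lies in the double coset of one permutation \<open>w\<^sub>\<lambda>\<close>, so \<open>\<eta> M\<close> is the line spanned by a nonzero vector
  \<open>z\<close>, which lies in the Specht module and hence in \<open>Y\<close>.

  Since \<open>e\<^sub>l ind Y = Y\<close>, one has \<open>Hom\<^sub>A (Ind M, ind Y) = Hom\<^sub>B (M, Y)\<close>.  The projection
  \<open>M \<rightarrow> Y\<close> induces a surjection \<open>Ind M \<rightarrow> ind Y\<close>; by Fitting's lemma for \<open>Y\<close>, its restriction to some
  indecomposable summand is still surjective.  If two summands mapped onto \<open>ind Y\<close>, each map would
  yield a homomorphism \<open>M \<rightarrow> Y\<close> that does not kill \<open>z\<close>.  But the projection of \<open>Ind M\<close> onto the second
  summand acts on \<open>1 \<otimes> z\<close>, modulo the kernel of \<open>Ind M \<rightarrow> M\<close>, by a scalar, which the first map forces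
  to be zero and the second map forces to be nonzero.\<close>

section \<open>Left modules\<close>

text \<open>The statement ranges over all decompositions of \<open>Ind M\<close>, so no summand can
  be chosen in advance, and the endomorphism rings of the summands are not under direct control.
  Existence and uniqueness are therefore both tested on the single vector \<open>z\<close>: being of
  the form \<open>\<eta> t0\<close>, it can only be scaled by a homomorphism
  \<open>M \<rightarrow> Y\<close>, and over a field a nonzero scalar can be undone. This replaces
  local endomorphism rings and exchange arguments.

  The obstacle is that the retraction \<open>Ind M \<rightarrow> M\<close> is linear only over
  \<open>B\<close>, so an \<open>A\<close>-endomorphism of \<open>Ind M\<close> need not preserve
  its kernel. It suffices that every \<open>A\<close>-map \<open>Ind M \<rightarrow> ind Y\<close>,
  followed by \<open>ind Y \<rightarrow> Y\<close>, factors through this retraction.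

  A group algebra is treated as the Hecke algebra at \<open>q = 1\<close>, so the combinatorics is
  done once; only the tensor-product form of the permutation module and the polytabloid have to be
  matched separately. Finiteness is kept as a bounded, strictly increasing rank on submodules, which
  passes along surjections and so reaches tensor products without any dimension count.\<close>

locale left_module = R: ring R + M: abelian_group M
  for R :: "('r, 'c) ring_scheme" (structure) and M :: "('r, 'm) module" (structure) +
  assumes smult_closed: "\<lbrakk>r \<in> carrier R; x \<in> carrier M\<rbrakk> \<Longrightarrow> r \<odot>\<^bsub>M\<^esub> x \<in> carrier M"
    and smult_add_left: "\<lbrakk>r \<in> carrier R; s \<in> carrier R; x \<in> carrier M\<rbrakk>
      \<Longrightarrow> (r \<oplus>\<^bsub>R\<^esub> s) \<odot>\<^bsub>M\<^esub> x = r \<odot>\<^bsub>M\<^esub> x \<oplus>\<^bsub>M\<^esub> s \<odot>\<^bsub>M\<^esub> x"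
    and smult_add_right: "\<lbrakk>r \<in> carrier R; x \<in> carrier M; y \<in> carrier M\<rbrakk>
      \<Longrightarrow> r \<odot>\<^bsub>M\<^esub> (x \<oplus>\<^bsub>M\<^esub> y) = r \<odot>\<^bsub>M\<^esub> x \<oplus>\<^bsub>M\<^esub> r \<odot>\<^bsub>M\<^esub> y"
    and smult_assoc: "\<lbrakk>r \<in> carrier R; s \<in> carrier R; x \<in> carrier M\<rbrakk>
      \<Longrightarrow> (r \<otimes>\<^bsub>R\<^esub> s) \<odot>\<^bsub>M\<^esub> x = r \<odot>\<^bsub>M\<^esub> (s \<odot>\<^bsub>M\<^esub> x)"
    and smult_one: "x \<in> carrier M \<Longrightarrow> \<one>\<^bsub>R\<^esub> \<odot>\<^bsub>M\<^esub> x = x"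
begin

lemma smult_zero_left: 
  assumes x: "x \<in> carrier M" shows "\<zero>\<^bsub>R\<^esub> \<odot>\<^bsub>M\<^esub> x = \<zero>\<^bsub>M\<^esub>"
proof -
  have "\<zero>\<^bsub>R\<^esub> \<odot>\<^bsub>M\<^esub> x \<oplus>\<^bsub>M\<^esub> \<zero>\<^bsub>R\<^esub> \<odot>\<^bsub>M\<^esub> x = \<zero>\<^bsub>R\<^esub> \<odot>\<^bsub>M\<^esub> x"
    using smult_add_left[of "\<zero>\<^bsub>R\<^esub>" "\<zero>\<^bsub>R\<^esub>" x] x by simp
  then show ?thesis by (metis M.add.r_cancel_one' R.zero_closed smult_closed x)
qed

lemma smult_zero_right:
  assumes r: "r \<in> carrier R" shows "r \<odot>\<^bsub>M\<^esub> \<zero>\<^bsub>M\<^esub> = \<zero>\<^bsub>M\<^esub>"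
proof -
  have "r \<odot>\<^bsub>M\<^esub> \<zero>\<^bsub>M\<^esub> \<oplus>\<^bsub>M\<^esub> r \<odot>\<^bsub>M\<^esub> \<zero>\<^bsub>M\<^esub> = r \<odot>\<^bsub>M\<^esub> \<zero>\<^bsub>M\<^esub>"
    using smult_add_right[of r "\<zero>\<^bsub>M\<^esub>" "\<zero>\<^bsub>M\<^esub>"] r by simp
  then show ?thesis by (metis M.add.r_cancel_one' M.zero_closed smult_closed r)
qed

lemma smult_minus_left:
  assumes r: "r \<in> carrier R" and x: "x \<in> carrier M"
  shows "(\<ominus>\<^bsub>R\<^esub> r) \<odot>\<^bsub>M\<^esub> x = \<ominus>\<^bsub>M\<^esub> (r \<odot>\<^bsub>M\<^esub> x)"
proof -
  have "(\<ominus>\<^bsub>R\<^esub> r) \<odot>\<^bsub>M\<^esub> x \<oplus>\<^bsub>M\<^esub> r \<odot>\<^bsub>M\<^esub> x = \<zero>\<^bsub>M\<^esub>"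
    using smult_add_left[of "\<ominus>\<^bsub>R\<^esub> r" r x] r x by (simp add: R.l_neg smult_zero_left)
  then show ?thesis using M.minus_equality r x smult_closed by simp
qed

text \<open>Negatives need no premise of their own: \<open>- x\<close> is \<open>(- 1) x\<close>, so
  closure under scalars yields the subgroup property.\<close>

lemma left_submoduleI:
  assumes "N \<subseteq> carrier M" "\<zero>\<^bsub>M\<^esub> \<in> N"
    and "\<And>x y. \<lbrakk>x \<in> N; y \<in> N\<rbrakk> \<Longrightarrow> x \<oplus>\<^bsub>M\<^esub> y \<in> N"
    and sm: "\<And>r x. \<lbrakk>r \<in> carrier R; x \<in> N\<rbrakk> \<Longrightarrow> r \<odot>\<^bsub>M\<^esub> x \<in> N"
  shows "submodule N R M"
proof (intro submodule.intro subgroup.intro submodule_axioms.intro)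
  fix x assume x: "x \<in> N"
  have "\<ominus>\<^bsub>M\<^esub> x = (\<ominus>\<^bsub>R\<^esub> \<one>\<^bsub>R\<^esub>) \<odot>\<^bsub>M\<^esub> x"
    using x assms(1) by (simp add: smult_minus_left smult_one subsetD)
  then have "\<ominus>\<^bsub>M\<^esub> x \<in> N" using sm[OF _ x] by simp
  then show "inv\<^bsub>add_monoid M\<^esub> x \<in> N" by (simp add: a_inv_def)
qed (use assms in auto)

lemma submoduleD:
  assumes "submodule N R M"
  shows "N \<subseteq> carrier M" "x \<in> N \<Longrightarrow> x \<in> carrier M" "\<zero>\<^bsub>M\<^esub> \<in> N"
    "\<lbrakk>x \<in> N; y \<in> N\<rbrakk> \<Longrightarrow> x \<oplus>\<^bsub>M\<^esub> y \<in> N" "x \<in> N \<Longrightarrow> \<ominus>\<^bsub>M\<^esub> x \<in> N"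
    "\<lbrakk>r \<in> carrier R; x \<in> N\<rbrakk> \<Longrightarrow> r \<odot>\<^bsub>M\<^esub> x \<in> N"
proof -
  interpret submodule N R M by fact
  show "N \<subseteq> carrier M" using subset by simp
  then show "x \<in> N \<Longrightarrow> x \<in> carrier M" by auto
  show "\<zero>\<^bsub>M\<^esub> \<in> N" using one_closed by simp
  show "\<lbrakk>x \<in> N; y \<in> N\<rbrakk> \<Longrightarrow> x \<oplus>\<^bsub>M\<^esub> y \<in> N" using m_closed[of x y] by simp
  show "x \<in> N \<Longrightarrow> \<ominus>\<^bsub>M\<^esub> x \<in> N" using m_inv_closed[of x] by (simp add: a_inv_def)
  show "\<lbrakk>r \<in> carrier R; x \<in> N\<rbrakk> \<Longrightarrow> r \<odot>\<^bsub>M\<^esub> x \<in> N" using smult_closed[of r x] by simp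
qed

lemma submodule_abelian_subgroup: "submodule N R M \<Longrightarrow> abelian_subgroup N M"
  by (rule abelian_subgroupI3[OF additive_subgroup.intro M.abelian_group_axioms])
    (rule submodule.axioms(1))

lemma coset_self: "\<lbrakk>submodule N R M; x \<in> carrier M\<rbrakk> \<Longrightarrow> x \<in> N +>\<^bsub>M\<^esub> x"
  by (rule abelian_subgroup.a_rcos_self[OF submodule_abelian_subgroup])

lemma coset_eqI:
  "\<lbrakk>submodule N R M; y \<in> N +>\<^bsub>M\<^esub> x; x \<in> carrier M\<rbrakk> \<Longrightarrow> N +>\<^bsub>M\<^esub> y = N +>\<^bsub>M\<^esub> x"
  using M.add.repr_independence[of y N x] by (simp add: submodule.axioms(1) a_r_coset_def)

lemma quotient_add:
  "\<lbrakk>submodule N R M; x \<in> carrier M; y \<in> carrier M\<rbrakk>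
    \<Longrightarrow> (N +>\<^bsub>M\<^esub> x) \<oplus>\<^bsub>quotient_module M N\<^esub> (N +>\<^bsub>M\<^esub> y) = N +>\<^bsub>M\<^esub> (x \<oplus>\<^bsub>M\<^esub> y)"
  by (simp add: quotient_module_def abelian_subgroup.a_rcos_sum[OF submodule_abelian_subgroup])

text \<open>The scalar action on \<open>quotient_module\<close> is a union over all members of a
  coset. Every member contributes the same coset, and there is at least one member, so the union is
  that single coset.\<close>

lemma quotient_smult:
  assumes N: "submodule N R M" and r: "r \<in> carrier R" and x: "x \<in> carrier M"
  shows "r \<odot>\<^bsub>quotient_module M N\<^esub> (N +>\<^bsub>M\<^esub> x) = N +>\<^bsub>M\<^esub> r \<odot>\<^bsub>M\<^esub> x"
proof -
  have "N +>\<^bsub>M\<^esub> r \<odot>\<^bsub>M\<^esub> y = N +>\<^bsub>M\<^esub> r \<odot>\<^bsub>M\<^esub> x" if "y \<in> N +>\<^bsub>M\<^esub> x" for y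
  proof -
    obtain u where u: "u \<in> N" "y = u \<oplus>\<^bsub>M\<^esub> x" using \<open>y \<in> N +>\<^bsub>M\<^esub> x\<close> unfolding a_r_coset_def' by blast
    have "r \<odot>\<^bsub>M\<^esub> y = r \<odot>\<^bsub>M\<^esub> u \<oplus>\<^bsub>M\<^esub> r \<odot>\<^bsub>M\<^esub> x"
      unfolding u(2) by (rule smult_add_right[OF r submoduleD(2)[OF N u(1)] x])
    moreover have "r \<odot>\<^bsub>M\<^esub> u \<in> N" by (rule submoduleD(6)[OF N r u(1)])
    ultimately have "r \<odot>\<^bsub>M\<^esub> y \<in> N +>\<^bsub>M\<^esub> r \<odot>\<^bsub>M\<^esub> x" unfolding a_r_coset_def' by blast
    then show ?thesis using coset_eqI[OF N] smult_closed[OF r x] by blast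
  qed
  then have "(\<Union>y\<in>N +>\<^bsub>M\<^esub> x. N +>\<^bsub>M\<^esub> r \<odot>\<^bsub>M\<^esub> y) = (\<Union>y\<in>N +>\<^bsub>M\<^esub> x. N +>\<^bsub>M\<^esub> r \<odot>\<^bsub>M\<^esub> x)"
    by (rule SUP_cong[OF refl])
  moreover have "N +>\<^bsub>M\<^esub> x \<noteq> {}" using coset_self[OF N x] by (metis empty_iff)
  ultimately show ?thesis by (simp only: quotient_module_def module.select_convs UN_constant if_False)
qed

lemma submodule_left_module:
  assumes N: "submodule N R M"
  shows "left_module R (M\<lparr>carrier := N\<rparr>)"
proof -
  have "abelian_group (M\<lparr>carrier := N\<rparr>)"
  proof (rule abelian_groupI)
    fix x assume "x \<in> carrier (M\<lparr>carrier := N\<rparr>)"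
    then show "\<exists>y\<in>carrier (M\<lparr>carrier := N\<rparr>). y \<oplus>\<^bsub>M\<lparr>carrier := N\<rparr>\<^esub> x = \<zero>\<^bsub>M\<lparr>carrier := N\<rparr>\<^esub>"
      using submoduleD[OF N] M.l_neg by (intro bexI[of _ "\<ominus>\<^bsub>M\<^esub> x"]) auto
  qed (use submoduleD[OF N] M.a_assoc M.a_comm in auto)
  then show ?thesis
    using submoduleD[OF N]
    by (intro left_module.intro left_module_axioms.intro R.ring_axioms)
      (auto simp: smult_add_left smult_add_right smult_assoc smult_one)
qed

text \<open>Keeps one ambient module: submodules of a submodule can be ranked, split and reassembled
  inside \<open>M\<close>.\<close>

lemma submodule_restrict_iff:
  assumes N: "submodule N R M"
  shows "submodule P R (M\<lparr>carrier := N\<rparr>) \<longleftrightarrow> submodule P R M \<and> P \<subseteq> N"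
proof
  interpret N: left_module R "M\<lparr>carrier := N\<rparr>" by (rule submodule_left_module[OF N])
  show "submodule P R M \<and> P \<subseteq> N" if P: "submodule P R (M\<lparr>carrier := N\<rparr>)"
    using N.submoduleD[OF P] submoduleD[OF N] by (intro conjI left_submoduleI) auto
  show "submodule P R (M\<lparr>carrier := N\<rparr>)" if P: "submodule P R M \<and> P \<subseteq> N"
    using submoduleD[of P] P by (intro N.left_submoduleI) auto
qed

lemma carrier_submodule: "submodule (carrier M) R M"
  by (rule left_submoduleI) (auto simp: smult_closed)

lemma zero_submodule: "submodule {\<zero>\<^bsub>M\<^esub>} R M"
  by (rule left_submoduleI) (auto simp: smult_zero_right)

lemma submodule_finsum_closed:
  assumes N: "submodule N R M"
  shows "\<lbrakk>finite I; f \<in> I \<rightarrow> N\<rbrakk> \<Longrightarrow> (\<Oplus>\<^bsub>M\<^esub>i\<in>I. f i) \<in> N"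
proof (induction I rule: finite_induct)
  case (insert i I)
  then have "f \<in> I \<rightarrow> carrier M" "f i \<in> carrier M" using submoduleD[OF N] by auto
  then show ?case using insert submoduleD[OF N] by simp
qed (use submoduleD[OF N] in simp)

end

section \<open>Homomorphisms and the first isomorphism theorem\<close>

lemma mod_homD:
  assumes "f \<in> mod_hom R M N"
  shows "x \<in> carrier M \<Longrightarrow> f x \<in> carrier N"
    "\<lbrakk>x \<in> carrier M; y \<in> carrier M\<rbrakk> \<Longrightarrow> f (x \<oplus>\<^bsub>M\<^esub> y) = f x \<oplus>\<^bsub>N\<^esub> f y"
    "\<lbrakk>r \<in> carrier R; x \<in> carrier M\<rbrakk> \<Longrightarrow> f (r \<odot>\<^bsub>M\<^esub> x) = r \<odot>\<^bsub>N\<^esub> f x"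
  using assms by (auto simp: mod_hom_def)

lemma mod_homI:
  assumes "\<And>x. x \<in> carrier M \<Longrightarrow> f x \<in> carrier N"
    "\<And>x y. \<lbrakk>x \<in> carrier M; y \<in> carrier M\<rbrakk> \<Longrightarrow> f (x \<oplus>\<^bsub>M\<^esub> y) = f x \<oplus>\<^bsub>N\<^esub> f y"
    "\<And>r x. \<lbrakk>r \<in> carrier R; x \<in> carrier M\<rbrakk> \<Longrightarrow> f (r \<odot>\<^bsub>M\<^esub> x) = r \<odot>\<^bsub>N\<^esub> f x"
  shows "f \<in> mod_hom R M N"
  using assms by (auto simp: mod_hom_def)

lemma mod_hom_comp:
  "\<lbrakk>f \<in> mod_hom R L M; g \<in> mod_hom R M N\<rbrakk> \<Longrightarrow> (\<lambda>x. g (f x)) \<in> mod_hom R L N"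
  by (auto simp: mod_hom_def Pi_def)

lemma mod_hom_restrict:
  assumes "f \<in> mod_hom R M N" "P \<subseteq> carrier M"
  shows "f \<in> mod_hom R (M\<lparr>carrier := P\<rparr>) N"
  using assms unfolding mod_hom_def by (auto simp: Pi_def subset_iff)

locale left_module_hom = M: left_module R M + N: left_module R N
  for R :: "('r, 'c) ring_scheme" (structure) and M :: "('r, 'm) module" (structure)
    and N :: "('r, 'n) module" (structure) +
  fixes f
  assumes hom: "f \<in> mod_hom R M N"
begin

lemmas hom_closed = mod_homD(1)[OF hom]
  and hom_add = mod_homD(2)[OF hom]
  and hom_smult = mod_homD(3)[OF hom]

lemma hom_zero: "f \<zero>\<^bsub>M\<^esub> = \<zero>\<^bsub>N\<^esub>"
  using hom_add[of "\<zero>\<^bsub>M\<^esub>" "\<zero>\<^bsub>M\<^esub>"] hom_closed[of "\<zero>\<^bsub>M\<^esub>"] by simp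

lemma hom_minus: "x \<in> carrier M \<Longrightarrow> f (\<ominus>\<^bsub>M\<^esub> x) = \<ominus>\<^bsub>N\<^esub> f x"
  using hom_add[of "\<ominus>\<^bsub>M\<^esub> x" x] hom_closed hom_zero
  by (metis M.M.add.inv_closed M.M.l_neg N.M.minus_equality)

lemma hom_finsum:
  "\<lbrakk>finite I; g \<in> I \<rightarrow> carrier M\<rbrakk> \<Longrightarrow> f (\<Oplus>\<^bsub>M\<^esub>i\<in>I. g i) = (\<Oplus>\<^bsub>N\<^esub>i\<in>I. f (g i))"
  by (induction I rule: finite_induct) (auto simp: Pi_def hom_zero hom_add hom_closed)

lemma vimage_submodule:
  assumes "submodule P R N"
  shows "submodule {x \<in> carrier M. f x \<in> P} R M"
  using N.submoduleD[OF assms]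
  by (intro M.left_submoduleI) (auto simp: hom_zero hom_add hom_smult M.smult_closed)

lemma image_submodule:
  assumes "submodule P R M"
  shows "submodule (f ` P) R N"
proof (rule N.left_submoduleI)
  note P = M.submoduleD[OF assms]
  show "f ` P \<subseteq> carrier N" using P hom_closed by auto
  show "\<zero>\<^bsub>N\<^esub> \<in> f ` P" using P(3) hom_zero by force
  show "x \<oplus>\<^bsub>N\<^esub> y \<in> f ` P" if "x \<in> f ` P" "y \<in> f ` P" for x y
    using that P by (auto simp: hom_add[symmetric])
  show "r \<odot>\<^bsub>N\<^esub> x \<in> f ` P" if "r \<in> carrier R" "x \<in> f ` P" for r x
    using that P by (auto simp: hom_smult[symmetric])
qed

lemma kernel_submodule: "submodule {x \<in> carrier M. f x = \<zero>\<^bsub>N\<^esub>} R M"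
  using vimage_submodule[OF N.zero_submodule] by simp

text \<open>The first isomorphism theorem, applied to the kernel of \<open>f\<close>.\<close>

lemma surj_has_quotient:
  assumes surj: "f ` carrier M = carrier N"
  shows "has_quotient_isomorphic_to R M N"
proof -
  define U where "U = {x \<in> carrier M. f x = \<zero>\<^bsub>N\<^esub>}"
  have U: "submodule U R M" unfolding U_def by (rule kernel_submodule)
  have f_coset: "f y = f x" "y \<in> carrier M" if x: "x \<in> carrier M" and y: "y \<in> U +>\<^bsub>M\<^esub> x" for x y
  proof -
    obtain u where u: "u \<in> U" "y = u \<oplus>\<^bsub>M\<^esub> x" using y unfolding a_r_coset_def' by blast
    then have "u \<in> carrier M" "f u = \<zero>\<^bsub>N\<^esub>" by (simp_all add: U_def)
    then show "f y = f x" "y \<in> carrier M" using u(2) x by (simp_all add: hom_add hom_closed)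
  qed
  \<comment> \<open>Any representative serves, since \<open>f\<close> is constant on each coset of
    its kernel.\<close>
  define g where "g c = f (SOME x. x \<in> c)" for c
  have g: "g (U +>\<^bsub>M\<^esub> x) = f x" if "x \<in> carrier M" for x
    unfolding g_def using M.coset_self[OF U that] f_coset(1)[OF that] by (metis someI_ex)
  have carr: "carrier (quotient_module M U) = (\<lambda>x. U +>\<^bsub>M\<^esub> x) ` carrier M"
    unfolding quotient_module_def A_RCOSETS_def' by auto
  have coset_eq: "U +>\<^bsub>M\<^esub> y = U +>\<^bsub>M\<^esub> x" if "x \<in> carrier M" "y \<in> carrier M" "f x = f y" for x y
  proof -
    have "y \<ominus>\<^bsub>M\<^esub> x \<in> U" unfolding U_def a_minus_def using that 
      by (simp add: hom_add hom_minus N.M.r_neg hom_closed)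
    moreover have "y = (y \<ominus>\<^bsub>M\<^esub> x) \<oplus>\<^bsub>M\<^esub> x"
      using that by (simp add: a_minus_def M.M.a_assoc M.M.l_neg)
    ultimately have "y \<in> U +>\<^bsub>M\<^esub> x" unfolding a_r_coset_def' by blast
    then show ?thesis using M.coset_eqI[OF U] that by simp
  qed
  have "g \<in> mod_hom R (quotient_module M U) N"
  proof (rule mod_homI)
    fix c assume "c \<in> carrier (quotient_module M U)"
    then obtain x where x: "x \<in> carrier M" "c = U +>\<^bsub>M\<^esub> x" unfolding carr by blast
    show "g c \<in> carrier N" using x by (simp add: g hom_closed)
    show "g (c \<oplus>\<^bsub>quotient_module M U\<^esub> d) = g c \<oplus>\<^bsub>N\<^esub> g d"
      if d: "d \<in> carrier (quotient_module M U)" for d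
    proof -
      obtain y where "y \<in> carrier M" "d = U +>\<^bsub>M\<^esub> y" using d unfolding carr by blast
      then show ?thesis using x by (simp add: M.quotient_add[OF U] g hom_add)
    qed
    show "g (r \<odot>\<^bsub>quotient_module M U\<^esub> c) = r \<odot>\<^bsub>N\<^esub> g c" if r: "r \<in> carrier R" for r
      using x r by (simp add: M.quotient_smult[OF U] g hom_smult M.smult_closed)
  qed
  moreover have "bij_betw g (carrier (quotient_module M U)) (carrier N)"
    unfolding bij_betw_def
  proof
    show "inj_on g (carrier (quotient_module M U))"
    proof (rule inj_onI)
      fix c d assume "c \<in> carrier (quotient_module M U)" "d \<in> carrier (quotient_module M U)"
        and eq: "g c = g d"
      then obtain x y where xy: "x \<in> carrier M" "y \<in> carrier M"
        and cd: "c = U +>\<^bsub>M\<^esub> x" "d = U +>\<^bsub>M\<^esub> y"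
        unfolding carr by blast
      have "f y = f x" using eq unfolding cd g[OF xy(1)] g[OF xy(2)] by simp
      then show "c = d" unfolding cd by (rule coset_eq[OF xy(2,1)])
    qed
    show "g ` carrier (quotient_module M U) = carrier N"
      unfolding carr surj[symmetric] image_image by (rule image_cong[OF refl]) (rule g)
  qed
  ultimately have "mod_isomorphic R (quotient_module M U) N"
    unfolding mod_isomorphic_def by (intro bexI)
  then show ?thesis
    using U unfolding has_quotient_isomorphic_to_def by (intro exI conjI)
qed

end

text \<open>The isomorphism is composed with the canonical map onto cosets.\<close>

lemma (in left_module) has_quotientD:
  assumes "has_quotient_isomorphic_to R M Q"
  obtains f where "f \<in> mod_hom R M Q" "f ` carrier M = carrier Q"
proof -
  obtain U where U: "submodule U R M" and iso: "mod_isomorphic R (quotient_module M U) Q"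
    using assms unfolding has_quotient_isomorphic_to_def by (elim exE conjE)
  then obtain g where g: "g \<in> mod_hom R (quotient_module M U) Q"
    and bij: "bij_betw g (carrier (quotient_module M U)) (carrier Q)"
    unfolding mod_isomorphic_def by (elim bexE)
  have carr: "carrier (quotient_module M U) = (\<lambda>x. U +>\<^bsub>M\<^esub> x) ` carrier M"
    unfolding quotient_module_def A_RCOSETS_def' by auto
  have coset_carr: "U +>\<^bsub>M\<^esub> x \<in> carrier (quotient_module M U)" if "x \<in> carrier M" for x
    using that unfolding carr by (rule imageI)
  show thesis
  proof
    show "(\<lambda>x. g (U +>\<^bsub>M\<^esub> x)) \<in> mod_hom R M Q"
    proof (rule mod_homI)
      fix x assume x: "x \<in> carrier M"
      show "g (U +>\<^bsub>M\<^esub> x) \<in> carrier Q" by (rule mod_homD(1)[OF g coset_carr[OF x]])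
      show "g (U +>\<^bsub>M\<^esub> (x \<oplus>\<^bsub>M\<^esub> y)) = g (U +>\<^bsub>M\<^esub> x) \<oplus>\<^bsub>Q\<^esub> g (U +>\<^bsub>M\<^esub> y)"
        if y: "y \<in> carrier M" for y
        using mod_homD(2)[OF g coset_carr[OF x] coset_carr[OF y]] by (simp add: quotient_add[OF U x y])
      show "g (U +>\<^bsub>M\<^esub> r \<odot>\<^bsub>M\<^esub> x) = r \<odot>\<^bsub>Q\<^esub> g (U +>\<^bsub>M\<^esub> x)" if r: "r \<in> carrier R" for r
        using mod_homD(3)[OF g r coset_carr[OF x]] by (simp add: quotient_smult[OF U r x])
    qed
    show "(\<lambda>x. g (U +>\<^bsub>M\<^esub> x)) ` carrier M = carrier Q"
      using bij unfolding bij_betw_def carr image_image by (rule conjunct2)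
  qed
qed

section \<open>Tensor products\<close>

text \<open>Of the two actions of \<open>R\<close> only closure is asked: the relations are imposed
  on the free abelian group one pair at a time and never consult the ring structure of
  \<open>R\<close>. So an input algebra, a corner, a Young subalgebra and the base field can all
  stand for \<open>R\<close>.\<close>

locale tensor_product = A: ring A + M: left_module A M + N: abelian_group N
  for A :: "('a, 'd) ring_scheme" and M :: "('a, 'm) module"
    and R :: "('r, 'c) ring_scheme" and ra :: "'m \<Rightarrow> 'r \<Rightarrow> 'm" and N :: "('r, 'n) module" +
  assumes ra_closed: "\<lbrakk>x \<in> carrier M; r \<in> carrier R\<rbrakk> \<Longrightarrow> ra x r \<in> carrier M"
    and ra_smult: "\<lbrakk>a \<in> carrier A; x \<in> carrier M; r \<in> carrier R\<rbrakk>
      \<Longrightarrow> ra (a \<odot>\<^bsub>M\<^esub> x) r = a \<odot>\<^bsub>M\<^esub> ra x r"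
    and N_smult_closed: "\<lbrakk>r \<in> carrier R; y \<in> carrier N\<rbrakk> \<Longrightarrow> r \<odot>\<^bsub>N\<^esub> y \<in> carrier N"
begin

definition Fr where "Fr = tensor_free M N"
definition Rel where "Rel = tensor_rel R ra M N"
abbreviation T where "T \<equiv> tensor R ra M N"
abbreviation pure where "pure \<equiv> pure_tensor R ra M N"
definition cls where "cls p = Rel #>\<^bsub>Fr\<^esub> p"

definition gens where "gens = 
     ({frag_of (x \<oplus>\<^bsub>M\<^esub> x', y) - frag_of (x, y) - frag_of (x', y) | x x' y.
         x \<in> carrier M \<and> x' \<in> carrier M \<and> y \<in> carrier N} \<union>
      {frag_of (x, y \<oplus>\<^bsub>N\<^esub> y') - frag_of (x, y) - frag_of (x, y') | x y y'.
         x \<in> carrier M \<and> y \<in> carrier N \<and> y' \<in> carrier N} \<union>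
      {frag_of (ra x r, y) - frag_of (x, r \<odot>\<^bsub>N\<^esub> y) | x r y.
         x \<in> carrier M \<and> r \<in> carrier R \<and> y \<in> carrier N})"

lemma Fr_carrier: "p \<in> carrier Fr \<longleftrightarrow> Poly_Mapping.keys p \<subseteq> carrier M \<times> carrier N"
  by (simp add: Fr_def tensor_free_def)

lemma Fr_mult: "p \<otimes>\<^bsub>Fr\<^esub> q = p + q"
  by (simp add: Fr_def tensor_free_def)

lemma Fr_one: "\<one>\<^bsub>Fr\<^esub> = 0"
  by (simp add: Fr_def tensor_free_def)

lemma Fr_comm_group: "comm_group Fr"
  by (simp add: Fr_def tensor_free_def abelian_free_Abelian_group)

sublocale Fr: comm_group Fr by (rule Fr_comm_group)

lemma frag_of_Fr: "\<lbrakk>x \<in> carrier M; y \<in> carrier N\<rbrakk> \<Longrightarrow> frag_of (x, y) \<in> carrier Fr"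
  by (simp add: Fr_carrier)

lemma Fr_inv: "p \<in> carrier Fr \<Longrightarrow> inv\<^bsub>Fr\<^esub> p = - p"
  by (simp add: Fr_def tensor_free_def)

lemma Fr_diff: "\<lbrakk>p \<in> carrier Fr; q \<in> carrier Fr\<rbrakk> \<Longrightarrow> p - q \<in> carrier Fr"
  unfolding Fr_carrier using keys_diff[of p q] by blast

lemma gens_Fr: "gens \<subseteq> carrier Fr"
  unfolding gens_def
  using M.M.a_closed N.a_closed ra_closed N_smult_closed
  by (auto intro!: Fr_diff frag_of_Fr)

lemma gens_left: "\<lbrakk>x \<in> carrier M; x' \<in> carrier M; y \<in> carrier N\<rbrakk>
    \<Longrightarrow> frag_of (x \<oplus>\<^bsub>M\<^esub> x', y) - frag_of (x, y) - frag_of (x', y) \<in> gens"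
  unfolding gens_def by blast

lemma gens_right: "\<lbrakk>x \<in> carrier M; y \<in> carrier N; y' \<in> carrier N\<rbrakk>
    \<Longrightarrow> frag_of (x, y \<oplus>\<^bsub>N\<^esub> y') - frag_of (x, y) - frag_of (x, y') \<in> gens"
  unfolding gens_def by blast

lemma gens_balanced: "\<lbrakk>x \<in> carrier M; r \<in> carrier R; y \<in> carrier N\<rbrakk>
    \<Longrightarrow> frag_of (ra x r, y) - frag_of (x, r \<odot>\<^bsub>N\<^esub> y) \<in> gens"
  unfolding gens_def by blast

lemma gens_cases [consumes 1, case_names left right balanced]:
  assumes "p \<in> gens"
  obtains x x' y where "p = frag_of (x \<oplus>\<^bsub>M\<^esub> x', y) - frag_of (x, y) - frag_of (x', y)"
      "x \<in> carrier M" "x' \<in> carrier M" "y \<in> carrier N"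
    | x y y' where "p = frag_of (x, y \<oplus>\<^bsub>N\<^esub> y') - frag_of (x, y) - frag_of (x, y')"
      "x \<in> carrier M" "y \<in> carrier N" "y' \<in> carrier N"
    | x r y where "p = frag_of (ra x r, y) - frag_of (x, r \<odot>\<^bsub>N\<^esub> y)"
      "x \<in> carrier M" "r \<in> carrier R" "y \<in> carrier N"
  using assms unfolding gens_def by (elim UnE CollectE exE conjE)

lemma Rel_generate: "Rel = generate Fr gens"
  unfolding Rel_def tensor_rel_def gens_def Fr_def ..

lemma Rel_subgroup: "subgroup Rel Fr"
  unfolding Rel_generate by (rule Fr.generate_is_subgroup[OF gens_Fr])

lemma Rel_normal: "normal Rel Fr"
  by (rule Fr.subgroup_imp_normal[OF Rel_subgroup])

lemma gens_Rel: "p \<in> gens \<Longrightarrow> p \<in> Rel"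
  unfolding Rel_generate by (rule generate.incl)

lemma cls_eqI:
  assumes "p \<in> carrier Fr" "q \<in> carrier Fr" "p - q \<in> Rel"
  shows "cls p = cls q"
proof -
  have "p \<in> Rel #>\<^bsub>Fr\<^esub> q" using assms(3) unfolding r_coset_def Fr_mult
    by (auto intro!: bexI[of _ "p - q"])
  then show ?thesis
    unfolding cls_def using Fr.repr_independence[OF _ assms(2) Rel_subgroup] by simp
qed

lemma cls_self: "p \<in> carrier Fr \<Longrightarrow> p \<in> cls p"
  unfolding cls_def by (rule Fr.rcos_self[OF _ Rel_subgroup])

lemma cls_mem:
  assumes "q \<in> cls p" "p \<in> carrier Fr"
  obtains u where "u \<in> Rel" "q = u + p"
  using assms(1) unfolding cls_def r_coset_def Fr_mult by auto

lemma T_carrier: "carrier T = cls ` carrier Fr"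
  unfolding tensor_def Let_def cls_def Fr_def Rel_def
  by (auto simp: FactGroup_def RCOSETS_def)

lemma cls_closed: "p \<in> carrier Fr \<Longrightarrow> cls p \<in> carrier T"
  unfolding T_carrier by (rule imageI)

lemma T_cases:
  assumes "u \<in> carrier T" obtains p where "p \<in> carrier Fr" "u = cls p"
  using assms unfolding T_carrier by (elim imageE)

lemma T_add: "\<lbrakk>p \<in> carrier Fr; q \<in> carrier Fr\<rbrakk> \<Longrightarrow> cls p \<oplus>\<^bsub>T\<^esub> cls q = cls (p + q)"
  using normal.rcos_sum[OF Rel_normal, of p q]
  unfolding tensor_def Let_def cls_def Fr_mult by (simp add: FactGroup_def Fr_def Rel_def)

lemma T_zero: "\<zero>\<^bsub>T\<^esub> = cls 0"
proof -
  have "cls 0 = Rel"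
    unfolding cls_def using Fr.coset_mult_one[of Rel] subgroup.subset[OF Rel_subgroup] Fr_one by simp
  then show ?thesis unfolding tensor_def Let_def by (simp add: FactGroup_def Rel_def)
qed

lemma T_abelian_group: "abelian_group T"
proof (rule abelian_groupI)
  fix u v w assume "u \<in> carrier T" "v \<in> carrier T" "w \<in> carrier T"
  then obtain p q r where pqr: "p \<in> carrier Fr" "q \<in> carrier Fr" "r \<in> carrier Fr"
    and u: "u = cls p" "v = cls q" "w = cls r" by (elim T_cases)
  have pq: "p + q \<in> carrier Fr" "q + r \<in> carrier Fr"
    using pqr Fr.m_closed unfolding Fr_mult by auto
  show "u \<oplus>\<^bsub>T\<^esub> v \<in> carrier T" using pqr pq u by (simp add: T_add cls_closed)
  show "u \<oplus>\<^bsub>T\<^esub> v \<oplus>\<^bsub>T\<^esub> w = u \<oplus>\<^bsub>T\<^esub> (v \<oplus>\<^bsub>T\<^esub> w)" using pqr pq u by (simp add: T_add add.assoc)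
  show "u \<oplus>\<^bsub>T\<^esub> v = v \<oplus>\<^bsub>T\<^esub> u" using pqr u by (simp add: T_add add.commute)
next
  have z: "0 \<in> carrier Fr" by (simp add: Fr_carrier)
  then show "\<zero>\<^bsub>T\<^esub> \<in> carrier T" unfolding T_zero by (rule cls_closed)
  fix u assume "u \<in> carrier T"
  then obtain p where p: "p \<in> carrier Fr" "u = cls p" by (elim T_cases)
  show "\<zero>\<^bsub>T\<^esub> \<oplus>\<^bsub>T\<^esub> u = u" unfolding T_zero using p z by (simp add: T_add)
  have "- p \<in> carrier Fr" using p(1) by (simp add: Fr_carrier)
  then show "\<exists>v\<in>carrier T. v \<oplus>\<^bsub>T\<^esub> u = \<zero>\<^bsub>T\<^esub>"
    using p by (intro bexI[of _ "cls (- p)"]) (simp_all add: T_add T_zero cls_closed)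
qed

sublocale T: abelian_group T by (rule T_abelian_group)

lemma pure_cls: "pure x y = cls (frag_of (x, y))"
  by (simp add: pure_tensor_def cls_def Rel_def Fr_def)

lemma pure_closed: "\<lbrakk>x \<in> carrier M; y \<in> carrier N\<rbrakk> \<Longrightarrow> pure x y \<in> carrier T"
  unfolding pure_cls by (intro cls_closed frag_of_Fr)

lemma pure_add_left:
  assumes "x \<in> carrier M" "x' \<in> carrier M" "y \<in> carrier N"
  shows "pure (x \<oplus>\<^bsub>M\<^esub> x') y = pure x y \<oplus>\<^bsub>T\<^esub> pure x' y"
proof -
  have F: "frag_of (x \<oplus>\<^bsub>M\<^esub> x', y) \<in> carrier Fr" "frag_of (x, y) \<in> carrier Fr" "frag_of (x', y) \<in> carrier Fr"
    using assms by (auto intro!: frag_of_Fr)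
  have "frag_of (x \<oplus>\<^bsub>M\<^esub> x', y) - frag_of (x, y) - frag_of (x', y) \<in> Rel"
    using assms by (intro gens_Rel gens_left)
  then have "cls (frag_of (x \<oplus>\<^bsub>M\<^esub> x', y)) = cls (frag_of (x, y) + frag_of (x', y))"
    using F Fr.m_closed[OF F(2,3)] unfolding Fr_mult
    by (intro cls_eqI) (simp_all add: algebra_simps)
  then show ?thesis unfolding pure_cls using F by (simp add: T_add)
qed

lemma pure_add_right:
  assumes "x \<in> carrier M" "y \<in> carrier N" "y' \<in> carrier N"
  shows "pure x (y \<oplus>\<^bsub>N\<^esub> y') = pure x y \<oplus>\<^bsub>T\<^esub> pure x y'"
proof -
  have F: "frag_of (x, y \<oplus>\<^bsub>N\<^esub> y') \<in> carrier Fr" "frag_of (x, y) \<in> carrier Fr" "frag_of (x, y') \<in> carrier Fr"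
    using assms by (auto intro!: frag_of_Fr)
  have "frag_of (x, y \<oplus>\<^bsub>N\<^esub> y') - frag_of (x, y) - frag_of (x, y') \<in> Rel"
    using assms by (intro gens_Rel gens_right)
  then have "cls (frag_of (x, y \<oplus>\<^bsub>N\<^esub> y')) = cls (frag_of (x, y) + frag_of (x, y'))"
    using F Fr.m_closed[OF F(2,3)] unfolding Fr_mult
    by (intro cls_eqI) (simp_all add: algebra_simps)
  then show ?thesis unfolding pure_cls using F by (simp add: T_add)
qed

lemma pure_balanced:
  assumes "x \<in> carrier M" "r \<in> carrier R" "y \<in> carrier N"
  shows "pure (ra x r) y = pure x (r \<odot>\<^bsub>N\<^esub> y)"
  unfolding pure_cls
proof (rule cls_eqI)
  show "frag_of (ra x r, y) - frag_of (x, r \<odot>\<^bsub>N\<^esub> y) \<in> Rel"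
    using assms by (intro gens_Rel gens_balanced)
qed (use assms ra_closed N_smult_closed in \<open>auto intro!: frag_of_Fr\<close>)

lemma pure_zero_left: "y \<in> carrier N \<Longrightarrow> pure \<zero>\<^bsub>M\<^esub> y = \<zero>\<^bsub>T\<^esub>"
  using pure_add_left[of "\<zero>\<^bsub>M\<^esub>" "\<zero>\<^bsub>M\<^esub>" y] pure_closed[of "\<zero>\<^bsub>M\<^esub>" y] by simp

lemma pure_zero_right: "x \<in> carrier M \<Longrightarrow> pure x \<zero>\<^bsub>N\<^esub> = \<zero>\<^bsub>T\<^esub>"
  using pure_add_right[of x "\<zero>\<^bsub>N\<^esub>" "\<zero>\<^bsub>N\<^esub>"] pure_closed[of x "\<zero>\<^bsub>N\<^esub>"] by simp

lemma pure_minus_left: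
  assumes "x \<in> carrier M" "y \<in> carrier N" shows "pure (\<ominus>\<^bsub>M\<^esub> x) y = \<ominus>\<^bsub>T\<^esub> pure x y"
proof -
  have "pure (\<ominus>\<^bsub>M\<^esub> x) y \<oplus>\<^bsub>T\<^esub> pure x y = \<zero>\<^bsub>T\<^esub>"
    using assms pure_add_left[of "\<ominus>\<^bsub>M\<^esub> x" x y] by (simp add: M.M.l_neg pure_zero_left)
  then show ?thesis using assms by (simp add: T.minus_equality pure_closed)
qed

text \<open>Sums of pure tensors suffice, without differences, because the negative of a pure tensor
  is again pure (\<open>pure_minus_left\<close>) and zero is pure as well.\<close>

lemma tensor_induct [consumes 1, case_names pure add]:
  assumes u: "u \<in> carrier T"
    and pure: "\<And>x y. \<lbrakk>x \<in> carrier M; y \<in> carrier N\<rbrakk> \<Longrightarrow> P (pure x y)"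
    and add: "\<And>u v. \<lbrakk>u \<in> carrier T; v \<in> carrier T; P u; P v\<rbrakk> \<Longrightarrow> P (u \<oplus>\<^bsub>T\<^esub> v)"
  shows "P u"
proof -
  have zero: "P \<zero>\<^bsub>T\<^esub>" using pure[of "\<zero>\<^bsub>M\<^esub>" "\<zero>\<^bsub>N\<^esub>"] by (simp add: pure_zero_left)
  have minus: "\<ominus>\<^bsub>T\<^esub> cls p = cls (- p)" if "p \<in> carrier Fr" for p
  proof -
    have "- p \<in> carrier Fr" using that by (simp add: Fr_carrier)
    then show ?thesis
      using that by (intro T.minus_equality) (simp_all add: T_add T_zero cls_closed)
  qed
  \<comment> \<open>The claim for \<open>- p\<close> is carried along because the induction rule for
    free abelian groups proceeds by differences.\<close>
  have "P (cls p) \<and> P (cls (- p))" if "p \<in> carrier Fr" for p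
  proof (rule free_Abelian_group_induct[of p "carrier M \<times> carrier N"])
    show "Poly_Mapping.keys p \<subseteq> carrier M \<times> carrier N" using that by (simp add: Fr_carrier)
    show "P (cls 0) \<and> P (cls (- 0))" using zero by (simp add: T_zero)
  next
    fix p q :: "'m \<times> 'n \<Rightarrow>\<^sub>0 int"
    assume "Poly_Mapping.keys p \<subseteq> carrier M \<times> carrier N" "Poly_Mapping.keys q \<subseteq> carrier M \<times> carrier N"
      and IH: "P (cls p) \<and> P (cls (- p))" "P (cls q) \<and> P (cls (- q))"
    then have F: "p \<in> carrier Fr" "q \<in> carrier Fr" "- p \<in> carrier Fr" "- q \<in> carrier Fr"
      by (simp_all add: Fr_carrier)
    show "P (cls (p - q)) \<and> P (cls (- (p - q)))"
      using add[of "cls p" "cls (- q)"] add[of "cls (- p)" "cls q"] IH F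
      by (simp add: T_add cls_closed)
  next
    fix a assume "a \<in> carrier M \<times> carrier N"
    then obtain x y where a: "a = (x, y)" "x \<in> carrier M" "y \<in> carrier N" by auto
    have "P (cls (- frag_of (x, y)))"
      using pure[of "\<ominus>\<^bsub>M\<^esub> x" y] a minus[OF frag_of_Fr[OF a(2,3)]] pure_minus_left[OF a(2,3)]
      by (simp add: pure_cls)
    then show "P (cls (frag_of a)) \<and> P (cls (- frag_of a))"
      using pure[OF a(2,3)] a by (simp add: pure_cls)
  qed
  then show ?thesis using u by (auto elim!: T_cases)
qed

text \<open>The universal property for balanced biadditive maps into a bare abelian group. The
  extension of \<open>\<beta>\<close> to the free group kills the three families of generators,
  hence \<open>Rel\<close>. Linearity over a further ring is checked separately where it is
  wanted.\<close>

lemma tensor_lift: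
  fixes G :: "('r2, 'g) ring_scheme"
  assumes G: "abelian_group G"
    and cl: "\<And>x y. \<lbrakk>x \<in> carrier M; y \<in> carrier N\<rbrakk> \<Longrightarrow> \<beta> x y \<in> carrier G"
    and left: "\<And>x x' y. \<lbrakk>x \<in> carrier M; x' \<in> carrier M; y \<in> carrier N\<rbrakk>
      \<Longrightarrow> \<beta> (x \<oplus>\<^bsub>M\<^esub> x') y = \<beta> x y \<oplus>\<^bsub>G\<^esub> \<beta> x' y"
    and right: "\<And>x y y'. \<lbrakk>x \<in> carrier M; y \<in> carrier N; y' \<in> carrier N\<rbrakk>
      \<Longrightarrow> \<beta> x (y \<oplus>\<^bsub>N\<^esub> y') = \<beta> x y \<oplus>\<^bsub>G\<^esub> \<beta> x y'"
    and bal: "\<And>x r y. \<lbrakk>x \<in> carrier M; r \<in> carrier R; y \<in> carrier N\<rbrakk>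
      \<Longrightarrow> \<beta> (ra x r) y = \<beta> x (r \<odot>\<^bsub>N\<^esub> y)"
  obtains h where "\<And>u. u \<in> carrier T \<Longrightarrow> h u \<in> carrier G"
    "\<And>u v. \<lbrakk>u \<in> carrier T; v \<in> carrier T\<rbrakk> \<Longrightarrow> h (u \<oplus>\<^bsub>T\<^esub> v) = h u \<oplus>\<^bsub>G\<^esub> h v"
    "\<And>x y. \<lbrakk>x \<in> carrier M; y \<in> carrier N\<rbrakk> \<Longrightarrow> h (pure x y) = \<beta> x y"
proof -
  interpret G: abelian_group G by (rule G)
  have "(\<lambda>(x, y). \<beta> x y) ` (carrier M \<times> carrier N) \<subseteq> carrier (add_monoid G)"
    using cl by auto
  from comm_group.free_Abelian_group_universal[OF G.a_comm_group this]
  obtain \<phi> where \<phi>: "\<phi> \<in> hom Fr (add_monoid G)"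
    and \<phi>_of: "\<And>a. a \<in> carrier M \<times> carrier N \<Longrightarrow> \<phi> (frag_of a) = (\<lambda>(x, y). \<beta> x y) a"
    unfolding Fr_def tensor_free_def by metis
  interpret \<phi>: group_hom Fr "add_monoid G" \<phi>
    by (simp add: group_hom_def group_hom_axioms_def \<phi> Fr.is_group G.a_group)
  have add: "\<phi> (p + q) = \<phi> p \<oplus>\<^bsub>G\<^esub> \<phi> q" if "p \<in> carrier Fr" "q \<in> carrier Fr" for p q
    using \<phi>.hom_mult[OF that] by (simp add: Fr_mult)
  have cl': "\<phi> p \<in> carrier G" if "p \<in> carrier Fr" for p
    using \<phi>.hom_closed[OF that] by simp
  have diff: "\<phi> (p - q) = \<phi> p \<ominus>\<^bsub>G\<^esub> \<phi> q" if pq: "p \<in> carrier Fr" "q \<in> carrier Fr" for p q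
  proof -
    have "\<phi> p = \<phi> (p - q) \<oplus>\<^bsub>G\<^esub> \<phi> q" using add[OF Fr_diff[OF pq] pq(2)] by simp
    then show ?thesis
      using cl'[OF Fr_diff[OF pq]] cl'[OF pq(2)] by (simp add: a_minus_def G.a_assoc G.r_neg)
  qed
  have fr: "\<phi> (frag_of (x, y)) = \<beta> x y" if "x \<in> carrier M" "y \<in> carrier N" for x y
    using \<phi>_of[of "(x, y)"] that by simp
  have cancel: "g \<oplus>\<^bsub>G\<^esub> g' \<ominus>\<^bsub>G\<^esub> g \<ominus>\<^bsub>G\<^esub> g' = \<zero>\<^bsub>G\<^esub>" if "g \<in> carrier G" "g' \<in> carrier G" for g g'
    using that by (simp add: a_minus_def G.a_assoc G.a_comm[of g' "\<ominus>\<^bsub>G\<^esub> g"] G.r_neg G.r_neg1)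
  have gens0: "\<phi> p = \<zero>\<^bsub>G\<^esub>" if "p \<in> gens" for p
    using that
  proof (cases rule: gens_cases)
    case (left x x' y)
    note c = left(2-)
    have "\<phi> p = (\<beta> x y \<oplus>\<^bsub>G\<^esub> \<beta> x' y) \<ominus>\<^bsub>G\<^esub> \<beta> x y \<ominus>\<^bsub>G\<^esub> \<beta> x' y"
      unfolding left(1) using c by (simp add: diff Fr_diff frag_of_Fr fr assms(3))
    also have "\<dots> = \<zero>\<^bsub>G\<^esub>" by (rule cancel[OF cl[OF c(1,3)] cl[OF c(2,3)]])
    finally show ?thesis .
  next
    case (right x y y')
    note c = right(2-)
    have "\<phi> p = (\<beta> x y \<oplus>\<^bsub>G\<^esub> \<beta> x y') \<ominus>\<^bsub>G\<^esub> \<beta> x y \<ominus>\<^bsub>G\<^esub> \<beta> x y'"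
      unfolding right(1) using c by (simp add: diff Fr_diff frag_of_Fr fr assms(4))
    also have "\<dots> = \<zero>\<^bsub>G\<^esub>" by (rule cancel[OF cl[OF c(1,2)] cl[OF c(1,3)]])
    finally show ?thesis .
  next
    case (balanced x r y)
    then show ?thesis
      by (simp add: diff frag_of_Fr fr ra_closed N_smult_closed bal cl a_minus_def G.r_neg)
  qed
  have "gens \<subseteq> kernel Fr (add_monoid G) \<phi>"
    using gens0 gens_Fr by (auto simp: kernel_def)
  then have Rel0: "Rel \<subseteq> kernel Fr (add_monoid G) \<phi>"
    unfolding Rel_generate by (rule Fr.generate_subgroup_incl[OF _ \<phi>.subgroup_kernel])
  \<comment> \<open>Two members of a class differ by an element of \<open>Rel\<close>, on which
    \<open>\<phi>\<close> vanishes, so the choice does not matter.\<close>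
  define h where "h c = \<phi> (SOME p. p \<in> c)" for c
  have h: "h (cls p) = \<phi> p" if p: "p \<in> carrier Fr" for p
  proof -
    have "(SOME q. q \<in> cls p) \<in> cls p" using cls_self[OF p] by (rule someI)
    then obtain u where u: "u \<in> Rel" "(SOME q. q \<in> cls p) = u + p" using p by (elim cls_mem)
    have "u \<in> carrier Fr" "\<phi> u = \<zero>\<^bsub>G\<^esub>" using u(1) Rel0 by (auto simp: kernel_def)
    then show ?thesis unfolding h_def u(2) using p by (simp add: add cl')
  qed
  show thesis
  proof
    show "h u \<in> carrier G" if "u \<in> carrier T" for u
      using that by (elim T_cases) (simp add: h cl')
    show "h (pure x y) = \<beta> x y" if "x \<in> carrier M" "y \<in> carrier N" for x y
      using that by (simp add: pure_cls h frag_of_Fr fr)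
    show "h (u \<oplus>\<^bsub>T\<^esub> v) = h u \<oplus>\<^bsub>G\<^esub> h v" if uv: "u \<in> carrier T" "v \<in> carrier T" for u v
    proof -
      obtain p q where pq: "p \<in> carrier Fr" "q \<in> carrier Fr" and "u = cls p" "v = cls q"
        using uv by (elim T_cases)
      moreover have "p + q \<in> carrier Fr" using Fr.m_closed[OF pq] by (simp add: Fr_mult)
      ultimately show ?thesis by (simp add: T_add h add)
    qed
  qed
qed

text \<open>\<open>E\<close> acts on first entries and sends each kind of generator of
  \<open>Rel\<close> to one of the same kind; for the balanced kind this is \<open>ra_smult\<close>,
  the commuting of the two actions on \<open>M\<close>. So \<open>E\<close> preserves
  \<open>Rel\<close>, and the union defining the scalar action collapses to one class.\<close>

lemma T_smult_cls:
  assumes a: "a \<in> carrier A" and p: "p \<in> carrier Fr"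
  defines "E \<equiv> frag_extend (\<lambda>(x, y). frag_of (a \<odot>\<^bsub>M\<^esub> x, y))"
  shows "a \<odot>\<^bsub>T\<^esub> cls p = cls (E p)" "E p \<in> carrier Fr"
proof -
  have E_carr: "E q \<in> carrier Fr" if "q \<in> carrier Fr" for q
  proof -
    have "Poly_Mapping.keys (E q) \<subseteq> (\<Union>a'\<in>Poly_Mapping.keys q.
        Poly_Mapping.keys ((\<lambda>(x, y). frag_of (a \<odot>\<^bsub>M\<^esub> x, y)) a'))"
      unfolding E_def by (rule keys_frag_extend)
    also have "\<dots> \<subseteq> carrier M \<times> carrier N"
    proof (rule UN_least)
      fix z assume z: "z \<in> Poly_Mapping.keys q"
      obtain x y where xy: "z = (x, y)" by (cases z)
      then have "x \<in> carrier M" "y \<in> carrier N" using z that unfolding Fr_carrier by auto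
      then show "Poly_Mapping.keys ((\<lambda>(x, y). frag_of (a \<odot>\<^bsub>M\<^esub> x, y)) z) \<subseteq> carrier M \<times> carrier N"
        unfolding xy using M.smult_closed[OF a] by simp
    qed
    finally show ?thesis unfolding Fr_carrier .
  qed
  then show "E p \<in> carrier Fr" using p .
  have E_diff: "E (p - q) = E p - E q" for p q unfolding E_def by (rule frag_extend_diff)
  have E_add: "E (p + q) = E p + E q" for p q unfolding E_def by (rule frag_extend_add)
  have E_of: "E (frag_of (x, y)) = frag_of (a \<odot>\<^bsub>M\<^esub> x, y)" for x y
    unfolding E_def by simp
  have E_gens: "E q \<in> gens" if "q \<in> gens" for q
    using that
  proof (cases rule: gens_cases)
    case (left x x' y)
    have "E q = frag_of (a \<odot>\<^bsub>M\<^esub> x \<oplus>\<^bsub>M\<^esub> a \<odot>\<^bsub>M\<^esub> x', y) - frag_of (a \<odot>\<^bsub>M\<^esub> x, y) - frag_of (a \<odot>\<^bsub>M\<^esub> x', y)"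
      unfolding left(1) E_diff E_of using left(2-) a by (simp add: M.smult_add_right)
    then show ?thesis using gens_left M.smult_closed[OF a] left(2-) by simp
  next
    case (right x y y')
    have "E q = frag_of (a \<odot>\<^bsub>M\<^esub> x, y \<oplus>\<^bsub>N\<^esub> y') - frag_of (a \<odot>\<^bsub>M\<^esub> x, y) - frag_of (a \<odot>\<^bsub>M\<^esub> x, y')"
      unfolding right(1) E_diff E_of ..
    then show ?thesis using gens_right M.smult_closed[OF a] right(2-) by simp
  next
    case (balanced x r y)
    have "E q = frag_of (ra (a \<odot>\<^bsub>M\<^esub> x) r, y) - frag_of (a \<odot>\<^bsub>M\<^esub> x, r \<odot>\<^bsub>N\<^esub> y)"
      unfolding balanced(1) E_diff E_of using balanced(2-) a by (simp add: ra_smult)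
    then show ?thesis using gens_balanced M.smult_closed[OF a] balanced(2-) by simp
  qed
  have E_Rel: "E q \<in> Rel" if "q \<in> Rel" for q
    using that unfolding Rel_generate
  proof (induction q rule: generate.induct)
    case one
    then show ?case using generate.one[of Fr gens] by (simp add: Fr_one E_def)
  next
    case (incl q)
    then show ?case using E_gens generate.incl by metis
  next
    case (inv q)
    have "E (inv\<^bsub>Fr\<^esub> q) = inv\<^bsub>Fr\<^esub> (E q)"
      using inv gens_Fr E_gens by (auto simp: Fr_inv subset_iff E_def frag_extend_minus)
    then show ?case using E_gens[OF inv] generate.inv by metis
  next
    case (eng q r)
    then show ?case using generate.eng[of "E q" Fr gens "E r"] by (simp add: Fr_mult E_add)
  qed
  have "a \<odot>\<^bsub>T\<^esub> cls p = (\<Union>q\<in>cls p. cls (E q))"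
    unfolding tensor_def Let_def E_def cls_def Rel_def Fr_def by simp
  also have "\<dots> = (\<Union>q\<in>cls p. cls (E p))"
  proof (rule SUP_cong[OF refl])
    fix q assume "q \<in> cls p"
    then obtain u where u: "u \<in> Rel" "q = u + p" using p by (rule cls_mem)
    have "u \<in> carrier Fr" using u(1) subgroup.subset[OF Rel_subgroup] by auto
    then have "q \<in> carrier Fr" using u p Fr.m_closed by (metis Fr_mult)
    moreover have "E q - E p = E u" unfolding u(2) E_add by simp
    ultimately show "cls (E q) = cls (E p)"
      using E_carr p E_Rel[OF u(1)] by (intro cls_eqI) auto
  qed
  also have "\<dots> = cls (E p)"
    using cls_self[OF p] by auto
  finally show "a \<odot>\<^bsub>T\<^esub> cls p = cls (E p)" .
qed

lemma smult_pure:
  "\<lbrakk>a \<in> carrier A; x \<in> carrier M; y \<in> carrier N\<rbrakk> \<Longrightarrow> a \<odot>\<^bsub>T\<^esub> pure x y = pure (a \<odot>\<^bsub>M\<^esub> x) y"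
  unfolding pure_cls by (simp add: T_smult_cls frag_of_Fr)

lemma T_smult_closed: "\<lbrakk>a \<in> carrier A; u \<in> carrier T\<rbrakk> \<Longrightarrow> a \<odot>\<^bsub>T\<^esub> u \<in> carrier T"
  by (elim T_cases) (simp add: T_smult_cls cls_closed)

lemma T_smult_add:
  assumes "a \<in> carrier A" "u \<in> carrier T" "v \<in> carrier T"
  shows "a \<odot>\<^bsub>T\<^esub> (u \<oplus>\<^bsub>T\<^esub> v) = a \<odot>\<^bsub>T\<^esub> u \<oplus>\<^bsub>T\<^esub> a \<odot>\<^bsub>T\<^esub> v"
proof -
  obtain p q where pq: "p \<in> carrier Fr" "q \<in> carrier Fr" and "u = cls p" "v = cls q"
    using assms(2,3) by (elim T_cases)
  moreover have "p + q \<in> carrier Fr" using Fr.m_closed[OF pq] by (simp add: Fr_mult)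
  ultimately show ?thesis
    using assms(1) T_smult_cls(2)[OF assms(1)] by (simp add: T_add T_smult_cls(1) frag_extend_add)
qed

lemma T_left_module: "left_module A T"
proof (intro left_module.intro left_module_axioms.intro A.ring_axioms T_abelian_group)
  fix a b u assume a: "a \<in> carrier A" and b: "b \<in> carrier A" and u: "u \<in> carrier T"
  show "(a \<oplus>\<^bsub>A\<^esub> b) \<odot>\<^bsub>T\<^esub> u = a \<odot>\<^bsub>T\<^esub> u \<oplus>\<^bsub>T\<^esub> b \<odot>\<^bsub>T\<^esub> u"
    using u
  proof (induction rule: tensor_induct)
    case (pure x y)
    then show ?case using a b by (simp add: smult_pure M.smult_add_left pure_add_left M.smult_closed)
  next
    case (add u v)
    then show ?case
      using a b by (simp add: T_smult_add T_smult_closed T.a_ac T.a_closed)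
  qed
  show "(a \<otimes>\<^bsub>A\<^esub> b) \<odot>\<^bsub>T\<^esub> u = a \<odot>\<^bsub>T\<^esub> (b \<odot>\<^bsub>T\<^esub> u)"
    using u
  proof (induction rule: tensor_induct)
    case (pure x y)
    then show ?case using a b by (simp add: smult_pure M.smult_assoc M.smult_closed)
  next
    case (add u v)
    then show ?case using a b by (simp add: T_smult_add T_smult_closed)
  qed
next
  fix u assume "u \<in> carrier T"
  then show "\<one>\<^bsub>A\<^esub> \<odot>\<^bsub>T\<^esub> u = u"
  proof (induction rule: tensor_induct)
    case (pure x y)
    then show ?case by (simp add: smult_pure M.smult_one)
  next
    case (add u v)
    then show ?case by (simp add: T_smult_add T_smult_closed)
  qed
qed (simp_all add: T_smult_closed T_smult_add)

end

section \<open>Finite length\<close>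

text \<open>A bounded strictly monotone rank stands in for composition series and dimension. It is
  exactly what stationarity arguments and inductions over submodules consume, and it can be
  restricted to submodules and pulled back along surjections.\<close>

definition finite_length :: "('r, 'c) ring_scheme \<Rightarrow> ('r, 'm) module \<Rightarrow> bool" where
  "finite_length R M \<longleftrightarrow> (\<exists>(rk :: 'm set \<Rightarrow> nat) b. (\<forall>N. submodule N R M \<longrightarrow> rk N \<le> b) \<and>
     (\<forall>N N'. submodule N R M \<longrightarrow> submodule N' R M \<longrightarrow> N \<subset> N' \<longrightarrow> rk N < rk N'))"

lemma finite_lengthI:
  fixes rk :: "'m set \<Rightarrow> nat"
  assumes "\<And>N. submodule N R (M :: ('r, 'm) module) \<Longrightarrow> rk N \<le> b"
    "\<And>N N'. \<lbrakk>submodule N R M; submodule N' R M; N \<subset> N'\<rbrakk> \<Longrightarrow> rk N < rk N'"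
  shows "finite_length R M"
  unfolding finite_length_def using assms by (intro exI[of _ rk] exI[of _ b]) simp

lemma (in left_module) finite_length_submodule:
  assumes "finite_length R M" and P: "submodule P R M"
  shows "finite_length R (M\<lparr>carrier := P\<rparr>)"
proof -
  obtain rk :: "'m set \<Rightarrow> nat" and b where "\<forall>N. submodule N R M \<longrightarrow> rk N \<le> b"
    "\<forall>N N'. submodule N R M \<longrightarrow> submodule N' R M \<longrightarrow> N \<subset> N' \<longrightarrow> rk N < rk N'"
    using assms(1) unfolding finite_length_def by (elim exE conjE)
  then show ?thesis
    by (intro finite_lengthI[of R _ rk b]) (simp_all add: submodule_restrict_iff[OF P])
qed

text \<open>A submodule of the image is ranked by its preimage; surjectivity keeps strict inclusions
  strict.\<close>

lemma (in left_module_hom) finite_length_surj: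
  assumes "finite_length R M" and surj: "f ` carrier M = carrier N"
  shows "finite_length R N"
proof -
  obtain rk :: "'m set \<Rightarrow> nat" and b where *: "\<forall>N. submodule N R M \<longrightarrow> rk N \<le> b"
    "\<forall>N N'. submodule N R M \<longrightarrow> submodule N' R M \<longrightarrow> N \<subset> N' \<longrightarrow> rk N < rk N'"
    using assms(1) unfolding finite_length_def by (elim exE conjE)
  note rk = *[rule_format]
  let ?v = "\<lambda>P. {x \<in> carrier M. f x \<in> P}"
  show ?thesis
  proof (rule finite_lengthI[of R N "\<lambda>P. rk (?v P)" b])
    fix P assume P: "submodule P R N"
    show "rk (?v P) \<le> b" by (rule rk(1)[OF vimage_submodule[OF P]])
    fix P' assume P': "submodule P' R N" and lt: "P \<subset> P'"
    then obtain y where y: "y \<in> P'" "y \<notin> P" by blast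
    then have "y \<in> f ` carrier M" using N.submoduleD(2)[OF P'] surj by simp
    then obtain x where "x \<in> carrier M" "f x = y" by blast
    then have "?v P \<subset> ?v P'" using lt y by blast
    then show "rk (?v P) < rk (?v P')"
      by (rule rk(2)[OF vimage_submodule[OF P] vimage_submodule[OF P']])
  qed
qed

lemma mono_bounded_stationary:
  fixes a :: "nat \<Rightarrow> nat"
  assumes mono: "\<And>n. a n \<le> a (Suc n)" and bound: "\<And>n. a n \<le> b"
  shows "\<exists>N. \<forall>n\<ge>N. a n = a N"
proof -
  have m: "m \<le> n \<Longrightarrow> a m \<le> a n" for m n using lift_Suc_mono_le[of a] mono by blast
  have "finite (range a)" using bound finite_nat_set_iff_bounded_le by auto
  then have "Max (range a) \<in> range a" by (intro Max_in) auto
  then obtain N where N: "a N = Max (range a)" by (metis imageE)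
  have "a n = a N" if "N \<le> n" for n
    using m[OF that] Max_ge[OF \<open>finite (range a)\<close>, of "a n"] N by auto
  then show ?thesis by blast
qed

lemma mod_hom_funpow:
  "f \<in> mod_hom R M M \<Longrightarrow> (f ^^ n) \<in> mod_hom R M M"
proof (induction n)
  case 0
  then show ?case by (auto intro: mod_homI)
next
  case (Suc n)
  then have "(\<lambda>x. f ((f ^^ n) x)) \<in> mod_hom R M M" by (intro mod_hom_comp[of "f ^^ n" R M M f M]) simp_all
  then show ?case unfolding funpow.simps comp_def .
qed

text \<open>Fitting's lemma. Kernels of the powers of \<open>f\<close> grow and their images shrink
  until both are stationary; for such a power \<open>M\<close> is the direct sum of kernel and
  image, and indecomposability makes one of the two zero.\<close>

lemma (in left_module) indecomposable_endomorphism: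
  assumes fl: "finite_length R M" and ind: "indecomposable R M" and f: "f \<in> mod_hom R M M"
  shows "f ` carrier M = carrier M \<or> (\<exists>n. \<forall>x\<in>carrier M. (f ^^ n) x = \<zero>\<^bsub>M\<^esub>)"
proof -
  obtain rk :: "'m set \<Rightarrow> nat" and b where *: "\<forall>N. submodule N R M \<longrightarrow> rk N \<le> b"
    "\<forall>N N'. submodule N R M \<longrightarrow> submodule N' R M \<longrightarrow> N \<subset> N' \<longrightarrow> rk N < rk N'"
    using fl unfolding finite_length_def by (elim exE conjE)
  note rk_le = *(1)[rule_format] and rk_less = *(2)[rule_format]
  have hom: "left_module_hom R M M (f ^^ n)" for n
    by (intro left_module_hom.intro left_module_hom_axioms.intro left_module_axioms mod_hom_funpow f)
  define ker where "ker n = {x \<in> carrier M. (f ^^ n) x = \<zero>\<^bsub>M\<^esub>}" for n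
  define im where "im n = (f ^^ n) ` carrier M" for n
  have ker: "submodule (ker n) R M" for n
    unfolding ker_def by (rule left_module_hom.kernel_submodule[OF hom])
  have im: "submodule (im n) R M" for n
    unfolding im_def by (rule left_module_hom.image_submodule[OF hom carrier_submodule])
  have ker_mono: "ker m \<subseteq> ker n" if "m \<le> n" for m n
  proof
    fix x assume x: "x \<in> ker m"
    have "(f ^^ n) x = (f ^^ (n - m)) ((f ^^ m) x)"
      using that by (metis comp_apply funpow_add le_add_diff_inverse2)
    then show "x \<in> ker n" using x left_module_hom.hom_zero[OF hom] by (simp add: ker_def)
  qed
  have im_mono: "im n \<subseteq> im m" if "m \<le> n" for m n
  proof
    fix y assume "y \<in> im n"
    then obtain x where x: "x \<in> carrier M" "y = (f ^^ n) x" unfolding im_def by blast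
    then have "y = (f ^^ m) ((f ^^ (n - m)) x)"
      using that by (metis comp_apply funpow_add le_add_diff_inverse)
    then show "y \<in> im m" using x(1) left_module_hom.hom_closed[OF hom] unfolding im_def by blast
  qed
  have rk_mono: "rk N \<le> rk N'" if "submodule N R M" "submodule N' R M" "N \<subseteq> N'" for N N'
    using rk_less[of N N'] that by (metis less_imp_le order_refl psubsetI)
  have "\<exists>N. \<forall>n\<ge>N. rk (ker n) = rk (ker N)"
    by (rule mono_bounded_stationary[OF rk_mono[OF ker ker ker_mono] rk_le[OF ker]]) simp
  then obtain N1 where N1: "\<forall>n\<ge>N1. rk (ker n) = rk (ker N1)" ..
  \<comment> \<open>Ranks of images fall, so the numbers \<open>b - rk\<close> serve as the
    increasing sequence; every rank is at most \<open>b\<close>, so the truncated subtraction loses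
    nothing.\<close>
  have "\<exists>N. \<forall>n\<ge>N. b - rk (im n) = b - rk (im N)"
    by (rule mono_bounded_stationary[of _ b, OF diff_le_mono2[OF rk_mono[OF im im im_mono]]]) simp_all
  then obtain N2 where N2: "\<forall>n\<ge>N2. b - rk (im n) = b - rk (im N2)" ..
  \<comment> \<open>Beyond both stationary points, and positive, so that the image of this power
    lies inside the image of \<open>f\<close> itself.\<close>
  define n where "n = Suc (N1 + N2)"
  have "rk (ker (n + n)) = rk (ker n)" using N1[rule_format, of n] N1[rule_format, of "n + n"] by (simp add: n_def)
  then have ker_eq: "ker (n + n) = ker n"
    using rk_less[OF ker ker, of n "n + n"] ker_mono[of n "n + n"] by auto
  have "rk (im (n + n)) = rk (im n)"
    using N2[rule_format, of n] N2[rule_format, of "n + n"] rk_le[OF im, of n] rk_le[OF im, of "n + n"] by (simp add: n_def)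
  then have im_eq: "im (n + n) = im n"
    using rk_less[OF im im, of "n + n" n] im_mono[of n "n + n"] by auto
  define g where "g = f ^^ n"
  interpret g: left_module_hom R M M g unfolding g_def by (rule hom)
  have gg: "(f ^^ (n + n)) x = g (g x)" for x by (simp add: g_def funpow_add)
  have "ker n \<inter> im n = {\<zero>\<^bsub>M\<^esub>}"
  proof (rule equalityI)
    show "ker n \<inter> im n \<subseteq> {\<zero>\<^bsub>M\<^esub>}"
    proof
      fix y assume y: "y \<in> ker n \<inter> im n"
      then obtain x where x: "x \<in> carrier M" "y = g x" unfolding im_def g_def by blast
      have "g y = \<zero>\<^bsub>M\<^esub>" using y by (simp add: ker_def g_def)
      then have "x \<in> ker (n + n)" using x by (simp add: ker_def gg)
      then have "g x = \<zero>\<^bsub>M\<^esub>" unfolding ker_eq by (simp add: ker_def g_def)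
      then show "y \<in> {\<zero>\<^bsub>M\<^esub>}" using x by simp
    qed
    show "{\<zero>\<^bsub>M\<^esub>} \<subseteq> ker n \<inter> im n" using submoduleD(3)[OF ker] submoduleD(3)[OF im] by simp
  qed
  moreover have "ker n <+>\<^bsub>M\<^esub> im n = carrier M"
  proof (rule equalityI)
    show "ker n <+>\<^bsub>M\<^esub> im n \<subseteq> carrier M"
      using submoduleD(2)[OF ker] submoduleD(2)[OF im] by (auto simp: set_add_def')
    show "carrier M \<subseteq> ker n <+>\<^bsub>M\<^esub> im n"
    proof
      fix x assume x: "x \<in> carrier M"
      \<comment> \<open>Stationary images provide \<open>w\<close> with
        \<open>g x = g (g w)\<close>; then \<open>x - g w\<close> is in the kernel and
        \<open>g w\<close> in the image.\<close>
      have "g x \<in> im (n + n)" unfolding im_eq using x by (auto simp: im_def g_def)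
      then obtain w where w: "w \<in> carrier M" "g x = g (g w)" unfolding im_def gg by blast
      have k: "x \<ominus>\<^bsub>M\<^esub> g w \<in> ker n"
        using x w by (simp add: ker_def g_def[symmetric] a_minus_def g.hom_add g.hom_minus g.hom_closed M.r_neg)
      have i: "g w \<in> im n" using w(1) by (auto simp: im_def g_def)
      have "x = (x \<ominus>\<^bsub>M\<^esub> g w) \<oplus>\<^bsub>M\<^esub> g w"
        using x g.hom_closed[OF w(1)] by (simp add: a_minus_def M.a_assoc M.l_neg)
      then show "x \<in> ker n <+>\<^bsub>M\<^esub> im n" using k i unfolding set_add_def' by blast
    qed
  qed
  ultimately have "complementary R M (ker n) (im n)"
    using ker im by (simp add: complementary_def)
  then consider "ker n = {\<zero>\<^bsub>M\<^esub>}" | "im n = {\<zero>\<^bsub>M\<^esub>}"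
    using ind unfolding indecomposable_def by blast
  then show ?thesis
  proof cases
    case 1
    have "carrier M \<subseteq> im n"
    proof -
      have "ker n <+>\<^bsub>M\<^esub> im n \<subseteq> im n"
        using submoduleD(2)[OF im] unfolding 1 by (auto simp: set_add_def')
      then show ?thesis using \<open>ker n <+>\<^bsub>M\<^esub> im n = carrier M\<close> by simp
    qed
    also have "im n \<subseteq> im 1" by (rule im_mono) (simp add: n_def)
    finally have "carrier M \<subseteq> f ` carrier M" by (simp add: im_def)
    moreover have "f ` carrier M \<subseteq> carrier M" using mod_homD(1)[OF f] by auto
    ultimately show ?thesis by blast
  next
    case 2
    then have "\<forall>x\<in>carrier M. (f ^^ n) x = \<zero>\<^bsub>M\<^esub>" unfolding im_def by blast
    then show ?thesis by blast
  qed
qed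

section \<open>Spans, and finite length of finitely spanned vector spaces\<close>

lemma module_imp_left_module:
  assumes "module K V" shows "left_module K V"
proof -
  interpret module K V by fact
  show ?thesis
    by (intro left_module.intro left_module_axioms.intro R.ring_axioms M.abelian_group_axioms)
      (simp_all add: smult_l_distr smult_r_distr smult_assoc1)
qed

lemma lin_span_submodule:
  assumes "left_module K V" and S: "S \<subseteq> carrier V"
  shows "submodule (lin_span K V S) K V"
proof -
  interpret left_module K V by fact
  have "carrier V \<in> {W. submodule W K V \<and> S \<subseteq> W}" using S carrier_submodule by simp
  then have "lin_span K V S \<subseteq> carrier V" unfolding lin_span_def by (rule Inter_lower)
  then show ?thesis
    unfolding lin_span_def using submoduleD by (intro left_submoduleI) auto
qed

lemma lin_span_superset: "S \<subseteq> lin_span K V S"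
  unfolding lin_span_def by blast

lemma lin_span_least: "\<lbrakk>submodule W K V; S \<subseteq> W\<rbrakk> \<Longrightarrow> lin_span K V S \<subseteq> W"
  unfolding lin_span_def by blast

text \<open>The rank of \<open>W\<close> is the number of jumps of the filtration that the spans of the first
  \<open>i\<close> members of a finite spanning family induce on \<open>W\<close>.\<close>

lemma finite_length_vector_space:
  assumes K: "field K" and V: "left_module K V" and S: "finite S" "S \<subseteq> carrier V"
    and span: "lin_span K V S = carrier V"
  shows "finite_length K V"
proof -
  interpret K: field K by (rule K)
  interpret V: left_module K V by (rule V)
  obtain n :: nat and s where s: "S = s ` {i. i < n}"
    using finite_imp_nat_seg_image_inj_on[OF S(1)] by metis
  have s_closed: "s i \<in> carrier V" if "i < n" for i using s S(2) that by auto
  define F where "F i = lin_span K V (s ` {..<i})" for i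
  have F: "submodule (F i) K V" if "i \<le> n" for i
    unfolding F_def using s_closed that by (intro lin_span_submodule V) auto
  have F0: "F 0 = {\<zero>\<^bsub>V\<^esub>}"
    using lin_span_least[OF V.zero_submodule, of "{}"] V.submoduleD(3)[OF F[of 0]]
    unfolding F_def by auto
  have Fn: "F n = carrier V" using span s by (simp add: F_def lessThan_def)
  \<comment> \<open>The vectors \<open>c s_i + x\<close> with \<open>x\<close> in \<open>F i\<close>
    form a subspace containing all generators of \<open>F (Suc i)\<close>.\<close>
  have step: "\<exists>c\<in>carrier K. \<exists>x\<in>F i. w = c \<odot>\<^bsub>V\<^esub> s i \<oplus>\<^bsub>V\<^esub> x" if i: "i < n" and w: "w \<in> F (Suc i)" for i w
  proof -
    note Fi = V.submoduleD[OF F[of i]]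
    let ?W = "{c \<odot>\<^bsub>V\<^esub> s i \<oplus>\<^bsub>V\<^esub> x | c x. c \<in> carrier K \<and> x \<in> F i}"
    have WI: "v \<in> ?W" if "v = c \<odot>\<^bsub>V\<^esub> s i \<oplus>\<^bsub>V\<^esub> x" "c \<in> carrier K" "x \<in> F i" for v c x
      using that by (intro CollectI exI[of _ c] exI[of _ x] conjI)
    have "submodule ?W K V"
    proof (rule V.left_submoduleI)
      show "?W \<subseteq> carrier V" using Fi(2) i s_closed V.smult_closed by auto
      have "\<zero>\<^bsub>V\<^esub> = \<zero>\<^bsub>K\<^esub> \<odot>\<^bsub>V\<^esub> s i \<oplus>\<^bsub>V\<^esub> \<zero>\<^bsub>V\<^esub>" using s_closed[OF i] by (simp add: V.smult_zero_left)
      then show "\<zero>\<^bsub>V\<^esub> \<in> ?W" using Fi(3) i by (intro WI[of _ "\<zero>\<^bsub>K\<^esub>" "\<zero>\<^bsub>V\<^esub>"]) simp_all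
    next
      fix u v assume "u \<in> ?W" "v \<in> ?W"
      then obtain c x d y where *: "u = c \<odot>\<^bsub>V\<^esub> s i \<oplus>\<^bsub>V\<^esub> x" "c \<in> carrier K" "x \<in> F i"
        "v = d \<odot>\<^bsub>V\<^esub> s i \<oplus>\<^bsub>V\<^esub> y" "d \<in> carrier K" "y \<in> F i" by blast
      have xy: "x \<in> carrier V" "y \<in> carrier V" using * Fi(2) i by auto
      have "u \<oplus>\<^bsub>V\<^esub> v = (c \<oplus>\<^bsub>K\<^esub> d) \<odot>\<^bsub>V\<^esub> s i \<oplus>\<^bsub>V\<^esub> (x \<oplus>\<^bsub>V\<^esub> y)"
        using * xy s_closed[OF i] by (simp add: V.smult_add_left V.smult_closed V.M.a_ac)
      moreover have "x \<oplus>\<^bsub>V\<^esub> y \<in> F i" using * Fi(4) i by simp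
      ultimately show "u \<oplus>\<^bsub>V\<^esub> v \<in> ?W" using *(2,5) by (intro WI[of _ "c \<oplus>\<^bsub>K\<^esub> d" "x \<oplus>\<^bsub>V\<^esub> y"]) simp_all
    next
      fix r u assume r: "r \<in> carrier K" and "u \<in> ?W"
      then obtain c x where *: "u = c \<odot>\<^bsub>V\<^esub> s i \<oplus>\<^bsub>V\<^esub> x" "c \<in> carrier K" "x \<in> F i" by blast
      have x: "x \<in> carrier V" using * Fi(2) i by auto
      have "r \<odot>\<^bsub>V\<^esub> u = (r \<otimes>\<^bsub>K\<^esub> c) \<odot>\<^bsub>V\<^esub> s i \<oplus>\<^bsub>V\<^esub> r \<odot>\<^bsub>V\<^esub> x"
        using * r x s_closed[OF i] by (simp add: V.smult_add_right V.smult_assoc V.smult_closed)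
      moreover have "r \<odot>\<^bsub>V\<^esub> x \<in> F i" using * Fi(6) i r by simp
      ultimately show "r \<odot>\<^bsub>V\<^esub> u \<in> ?W" using *(2) r by (intro WI[of _ "r \<otimes>\<^bsub>K\<^esub> c" "r \<odot>\<^bsub>V\<^esub> x"]) simp_all
    qed
    moreover have "s ` {..<Suc i} \<subseteq> ?W"
    proof (rule image_subsetI)
      fix j assume j: "j \<in> {..<Suc i}"
      show "s j \<in> ?W"
      proof (cases "j = i")
        case True
        have "s i = \<one>\<^bsub>K\<^esub> \<odot>\<^bsub>V\<^esub> s i \<oplus>\<^bsub>V\<^esub> \<zero>\<^bsub>V\<^esub>" using s_closed[OF i] by (simp add: V.smult_one)
        then show ?thesis unfolding True using Fi(3) i by (intro WI[of _ "\<one>\<^bsub>K\<^esub>" "\<zero>\<^bsub>V\<^esub>"]) simp_all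
      next
        case False
        then have "s j \<in> F i" using j lin_span_superset[of "s ` {..<i}" K V] by (auto simp: F_def)
        moreover have "s j = \<zero>\<^bsub>K\<^esub> \<odot>\<^bsub>V\<^esub> s i \<oplus>\<^bsub>V\<^esub> s j"
          using s_closed[OF i] s_closed[of j] i j by (simp add: V.smult_zero_left)
        ultimately show ?thesis by (intro WI[of _ "\<zero>\<^bsub>K\<^esub>" "s j"]) simp_all
      qed
    qed
    ultimately have "F (Suc i) \<subseteq> ?W" unfolding F_def by (rule lin_span_least)
    then show ?thesis using w by blast
  qed
  define jumps where "jumps W = {i. i < n \<and> \<not> W \<inter> F (Suc i) \<subseteq> F i}" for W
  have fin: "finite (jumps W)" for W unfolding jumps_def by simp
  show ?thesis
  proof (rule finite_lengthI[of K V "\<lambda>W. card (jumps W)" n])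
    fix W assume W: "submodule W K V"
    note sW = V.submoduleD[OF W]
    have "jumps W \<subseteq> {..<n}" by (auto simp: jumps_def)
    then show "card (jumps W) \<le> n" using card_mono[of "{..<n}"] by simp
    fix W' assume W': "submodule W' K V" and lt: "W \<subset> W'"
    note sW' = V.submoduleD[OF W']
    have sub: "jumps W \<subseteq> jumps W'" using lt by (auto simp: jumps_def)
    have "jumps W \<noteq> jumps W'"
    proof
      assume eq: "jumps W = jumps W'"
      \<comment> \<open>Nested subspaces with the same jumps coincide: climbing the filtration, at
        each jump a vector of \<open>W\<close> with nonzero coefficient at \<open>s i\<close> clears
        the leading term of a vector of \<open>W'\<close>.\<close>
      have "W' \<inter> F i \<subseteq> W" if "i \<le> n" for i
        using that
      proof (induction i)
        case 0
        then show ?case using F0 sW(3) by auto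
      next
        case (Suc i)
        then have i: "i < n" and IH: "W' \<inter> F i \<subseteq> W" by auto
        note Fi = V.submoduleD[OF F[of i]]
        show ?case
        proof
          fix w' assume w': "w' \<in> W' \<inter> F (Suc i)"
          show "w' \<in> W"
          proof (cases "i \<in> jumps W'")
            case False
            then have "w' \<in> F i" using w' i unfolding jumps_def by blast
            then show ?thesis using w' IH by auto
          next
            case True
            then have "i \<in> jumps W" using eq by simp
            then obtain w where w: "w \<in> W" "w \<in> F (Suc i)" "w \<notin> F i" unfolding jumps_def by blast
            obtain c x where c: "c \<in> carrier K" "x \<in> F i" "w = c \<odot>\<^bsub>V\<^esub> s i \<oplus>\<^bsub>V\<^esub> x"
              using step[OF i w(2)] by blast
            obtain d y where d: "d \<in> carrier K" "y \<in> F i" "w' = d \<odot>\<^bsub>V\<^esub> s i \<oplus>\<^bsub>V\<^esub> y"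
              using step[OF i, of w'] w' by blast
            have xy: "x \<in> carrier V" "y \<in> carrier V" using c d Fi(2) i by auto
            have "c \<noteq> \<zero>\<^bsub>K\<^esub>" using c w(3) xy s_closed[OF i] by (auto simp: V.smult_zero_left)
            then have inv: "inv\<^bsub>K\<^esub> c \<in> carrier K" "inv\<^bsub>K\<^esub> c \<otimes>\<^bsub>K\<^esub> c = \<one>\<^bsub>K\<^esub>"
              using c(1) K.field_Units by auto
            \<comment> \<open>The multiple \<open>e w\<close> has the same coefficient
              \<open>d\<close> at \<open>s i\<close> as \<open>w'\<close>, so the difference drops
              to \<open>F i\<close>, where the induction hypothesis applies.\<close>
            define e where "e = d \<otimes>\<^bsub>K\<^esub> inv\<^bsub>K\<^esub> c"
            have e: "e \<in> carrier K" "e \<otimes>\<^bsub>K\<^esub> c = d"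
              using inv c(1) d(1) by (simp_all add: e_def K.m_assoc)
            have ew: "e \<odot>\<^bsub>V\<^esub> w = d \<odot>\<^bsub>V\<^esub> s i \<oplus>\<^bsub>V\<^esub> e \<odot>\<^bsub>V\<^esub> x"
              using c e xy s_closed[OF i]
              by (simp add: V.smult_add_right V.smult_closed V.smult_assoc[symmetric])
            have ex: "e \<odot>\<^bsub>V\<^esub> x \<in> F i" using Fi(6) i e c by simp
            have exV: "e \<odot>\<^bsub>V\<^esub> x \<in> carrier V" "d \<odot>\<^bsub>V\<^esub> s i \<in> carrier V"
              using e xy V.smult_closed d s_closed[OF i] by auto
            have "w' = e \<odot>\<^bsub>V\<^esub> w \<oplus>\<^bsub>V\<^esub> (y \<oplus>\<^bsub>V\<^esub> \<ominus>\<^bsub>V\<^esub> (e \<odot>\<^bsub>V\<^esub> x))"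
              unfolding ew d(3) using exV xy
              by (simp add: V.M.a_assoc V.M.a_lcomm[of "e \<odot>\<^bsub>V\<^esub> x" y "\<ominus>\<^bsub>V\<^esub> (e \<odot>\<^bsub>V\<^esub> x)"] V.M.r_neg)
            moreover have "y \<oplus>\<^bsub>V\<^esub> \<ominus>\<^bsub>V\<^esub> (e \<odot>\<^bsub>V\<^esub> x) \<in> W"
            proof -
              have ewW: "e \<odot>\<^bsub>V\<^esub> w \<in> W" using sW(6) e w by simp
              have "e \<odot>\<^bsub>V\<^esub> w \<in> carrier V" using ewW sW(2) by simp
              then have "y \<oplus>\<^bsub>V\<^esub> \<ominus>\<^bsub>V\<^esub> (e \<odot>\<^bsub>V\<^esub> x) = \<ominus>\<^bsub>V\<^esub> (e \<odot>\<^bsub>V\<^esub> w) \<oplus>\<^bsub>V\<^esub> w'"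
                using \<open>w' = e \<odot>\<^bsub>V\<^esub> w \<oplus>\<^bsub>V\<^esub> (y \<oplus>\<^bsub>V\<^esub> \<ominus>\<^bsub>V\<^esub> (e \<odot>\<^bsub>V\<^esub> x))\<close> xy exV
                by (metis V.M.a_closed V.M.a_inv_closed V.M.r_neg1)
              moreover have "\<ominus>\<^bsub>V\<^esub> (e \<odot>\<^bsub>V\<^esub> w) \<oplus>\<^bsub>V\<^esub> w' \<in> W'"
                using ewW lt w' by (intro sW'(4) sW'(5)) auto
              moreover have "y \<oplus>\<^bsub>V\<^esub> \<ominus>\<^bsub>V\<^esub> (e \<odot>\<^bsub>V\<^esub> x) \<in> F i" using Fi(4,5) i d ex by simp
              ultimately show ?thesis using IH by auto
            qed
            moreover have "e \<odot>\<^bsub>V\<^esub> w \<in> W" using sW(6) e w by simp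
            ultimately show ?thesis using sW(4) by simp
          qed
        qed
      qed
      from this[of n] have "W' \<subseteq> W" using Fn sW'(1) by auto
      then show False using lt by auto
    qed
    then show "card (jumps W) < card (jumps W')" using sub fin by (intro psubset_card_mono) auto
  qed
qed

section \<open>Direct sum decompositions\<close>

context left_module begin

lemma finsum_lessThan_split:
  fixes n k :: nat
  shows "\<lbrakk>f \<in> {..<n} \<rightarrow> carrier M; g \<in> {..<k} \<rightarrow> carrier M\<rbrakk> \<Longrightarrow>
    (\<Oplus>\<^bsub>M\<^esub>i\<in>{..<n + k}. if i < n then f i else g (i - n))
      = (\<Oplus>\<^bsub>M\<^esub>i\<in>{..<n}. f i) \<oplus>\<^bsub>M\<^esub> (\<Oplus>\<^bsub>M\<^esub>i\<in>{..<k}. g i)"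
proof (induction k)
  case 0
  have "(\<Oplus>\<^bsub>M\<^esub>i\<in>{..<n}. if i < n then f i else g (i - n)) = (\<Oplus>\<^bsub>M\<^esub>i\<in>{..<n}. f i)"
    using 0 by (intro M.finsum_cong') auto
  then show ?case using 0 M.finsum_closed[of f "{..<n}"] by simp
next
  case (Suc k)
  have g: "g \<in> {..<k} \<rightarrow> carrier M" "g k \<in> carrier M" using Suc by auto
  have c: "(\<lambda>i. if i < n then f i else g (i - n)) \<in> {..<n + k} \<rightarrow> carrier M"
  proof
    fix i assume "i \<in> {..<n + k}"
    then show "(if i < n then f i else g (i - n)) \<in> carrier M"
      using funcset_mem[OF Suc.prems(1), of i] funcset_mem[OF g(1), of "i - n"] by (cases "i < n") auto
  qed
  have "(\<Oplus>\<^bsub>M\<^esub>i\<in>{..<n + Suc k}. if i < n then f i else g (i - n))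
      = g k \<oplus>\<^bsub>M\<^esub> (\<Oplus>\<^bsub>M\<^esub>i\<in>{..<n + k}. if i < n then f i else g (i - n))"
    using c g(2) by (simp add: lessThan_Suc)
  also have "\<dots> = (\<Oplus>\<^bsub>M\<^esub>i\<in>{..<n}. f i) \<oplus>\<^bsub>M\<^esub> (g k \<oplus>\<^bsub>M\<^esub> (\<Oplus>\<^bsub>M\<^esub>i\<in>{..<k}. g i))"
    unfolding Suc.IH[OF Suc.prems(1) g(1)] using Suc.prems(1) g by (simp add: M.a_lcomm)
  also have "g k \<oplus>\<^bsub>M\<^esub> (\<Oplus>\<^bsub>M\<^esub>i\<in>{..<k}. g i) = (\<Oplus>\<^bsub>M\<^esub>i\<in>{..<Suc k}. g i)"
    using g by (simp add: lessThan_Suc)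
  finally show ?case .
qed

text \<open>Independence is stated as triviality of zero sums, and the pieces remain subsets of the
  ambient \<open>M\<close>. In this form two decompositions can simply be concatenated; unique
  coordinates are recovered only at the end.\<close>

definition decomposes_into :: "'m set \<Rightarrow> nat \<Rightarrow> (nat \<Rightarrow> 'm set) \<Rightarrow> bool" where
  "decomposes_into N n f \<longleftrightarrow>
     (\<forall>i<n. submodule (f i) R M \<and> f i \<subseteq> N \<and> indecomposable R (M\<lparr>carrier := f i\<rparr>)) \<and>
     (\<forall>x\<in>N. \<exists>g. (\<forall>i<n. g i \<in> f i) \<and> x = (\<Oplus>\<^bsub>M\<^esub>i\<in>{..<n}. g i)) \<and>
     (\<forall>g. (\<forall>i<n. g i \<in> f i) \<longrightarrow> (\<Oplus>\<^bsub>M\<^esub>i\<in>{..<n}. g i) = \<zero>\<^bsub>M\<^esub> \<longrightarrow> (\<forall>i<n. g i = \<zero>\<^bsub>M\<^esub>))"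

lemma decomposes_into_plus:
  assumes P: "submodule P R M" and P': "submodule P' R M"
    and int: "P \<inter> P' = {\<zero>\<^bsub>M\<^esub>}" and sum: "P <+>\<^bsub>M\<^esub> P' = N"
    and f: "decomposes_into P n f" and f': "decomposes_into P' n' f'"
  shows "decomposes_into N (n + n') (\<lambda>i. if i < n then f i else f' (i - n))"
proof -
  note sP = submoduleD[OF P] and sP' = submoduleD[OF P']
  have PN: "P \<subseteq> N" 
  proof
    fix x assume "x \<in> P"
    then have "x = x \<oplus>\<^bsub>M\<^esub> \<zero>\<^bsub>M\<^esub>" "x \<in> P" "\<zero>\<^bsub>M\<^esub> \<in> P'" using sP(2) sP'(3) by simp_all
    then show "x \<in> N" unfolding sum[symmetric] set_add_def' by (intro UN_I[of x] UN_I[of "\<zero>\<^bsub>M\<^esub>"]) simp_all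
  qed
  have P'N: "P' \<subseteq> N" 
  proof
    fix x assume "x \<in> P'"
    then have "x = \<zero>\<^bsub>M\<^esub> \<oplus>\<^bsub>M\<^esub> x" "x \<in> P'" "\<zero>\<^bsub>M\<^esub> \<in> P" using sP'(2) sP(3) by simp_all
    then show "x \<in> N" unfolding sum[symmetric] set_add_def' by (intro UN_I[of "\<zero>\<^bsub>M\<^esub>"] UN_I[of x]) simp_all
  qed
  have f1: "\<And>i. i < n \<Longrightarrow> f i \<subseteq> P" and f1': "\<And>i. i < n' \<Longrightarrow> f' i \<subseteq> P'"
    using f f' unfolding decomposes_into_def by auto
  show ?thesis
    unfolding decomposes_into_def
  proof (intro conjI ballI allI impI)
    fix i assume i: "i < n + n'"
    have f: "submodule (f i) R M \<and> indecomposable R (M\<lparr>carrier := f i\<rparr>)" if "i < n"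
      using f that unfolding decomposes_into_def by simp
    have f': "submodule (f' (i - n)) R M \<and> indecomposable R (M\<lparr>carrier := f' (i - n)\<rparr>)" "i - n < n'"
      if "\<not> i < n" using f' that i unfolding decomposes_into_def by simp_all
    show "submodule (if i < n then f i else f' (i - n)) R M" using f f' by (cases "i < n") simp_all
    show "(if i < n then f i else f' (i - n)) \<subseteq> N"
      using f1[of i] f1'[of "i - n"] f'(2) PN P'N by (cases "i < n") auto
    show "indecomposable R (M\<lparr>carrier := if i < n then f i else f' (i - n)\<rparr>)"
      using f f' by (cases "i < n") simp_all
  next
    fix x assume "x \<in> N"
    then obtain y z where yz: "y \<in> P" "z \<in> P'" "x = y \<oplus>\<^bsub>M\<^esub> z"
      unfolding sum[symmetric] set_add_def' by blast
    obtain g where g: "\<forall>i<n. g i \<in> f i" "y = (\<Oplus>\<^bsub>M\<^esub>i\<in>{..<n}. g i)"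
      using f yz(1) unfolding decomposes_into_def by blast
    obtain g' where g': "\<forall>i<n'. g' i \<in> f' i" "z = (\<Oplus>\<^bsub>M\<^esub>i\<in>{..<n'}. g' i)"
      using f' yz(2) unfolding decomposes_into_def by blast
    have "g \<in> {..<n} \<rightarrow> carrier M" "g' \<in> {..<n'} \<rightarrow> carrier M"
      using g g' f1 f1' sP(1) sP'(1) by (auto simp: Pi_def subset_iff)
    then have "x = (\<Oplus>\<^bsub>M\<^esub>i\<in>{..<n + n'}. if i < n then g i else g' (i - n))"
      unfolding yz(3) g(2) g'(2) by (rule finsum_lessThan_split[symmetric])
    moreover have "\<forall>i<n + n'. (if i < n then g i else g' (i - n)) \<in> (if i < n then f i else f' (i - n))"
      using g(1) g'(1) by auto
    ultimately show "\<exists>g. (\<forall>i<n + n'. g i \<in> (if i < n then f i else f' (i - n))) \<and>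
        x = (\<Oplus>\<^bsub>M\<^esub>i\<in>{..<n + n'}. g i)" by (intro exI conjI)
  next
    fix g i assume g: "\<forall>i<n + n'. g i \<in> (if i < n then f i else f' (i - n))"
      and 0: "(\<Oplus>\<^bsub>M\<^esub>i\<in>{..<n + n'}. g i) = \<zero>\<^bsub>M\<^esub>" and i: "i < n + n'"
    have g1: "\<forall>i<n. g i \<in> f i" using g by (metis trans_less_add1)
    have g2: "\<forall>i<n'. g (n + i) \<in> f' i" using g by (metis add_diff_cancel_left' nat_add_left_cancel_less not_add_less1)
    let ?y = "\<Oplus>\<^bsub>M\<^esub>i\<in>{..<n}. g i" and ?z = "\<Oplus>\<^bsub>M\<^esub>i\<in>{..<n'}. g (n + i)"
    have yP: "?y \<in> P" using g1 f1 by (intro submodule_finsum_closed[OF P]) auto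
    have zP: "?z \<in> P'" using g2 f1' by (intro submodule_finsum_closed[OF P']) auto
    have c: "g \<in> {..<n} \<rightarrow> carrier M" "(\<lambda>i. g (n + i)) \<in> {..<n'} \<rightarrow> carrier M"
      using g1 g2 f1 f1' sP(1) sP'(1) by (auto simp: Pi_def subset_iff)
    have "?y \<oplus>\<^bsub>M\<^esub> ?z = (\<Oplus>\<^bsub>M\<^esub>i\<in>{..<n + n'}. if i < n then g i else g (n + (i - n)))"
      by (rule finsum_lessThan_split[OF c, symmetric])
    also have "\<dots> = (\<Oplus>\<^bsub>M\<^esub>i\<in>{..<n + n'}. g i)"
    proof (rule M.finsum_cong')
      show "g \<in> {..<n + n'} \<rightarrow> carrier M"
      proof
        fix i assume "i \<in> {..<n + n'}"
        then show "g i \<in> carrier M" using c(1) funcset_mem[OF c(2), of "i - n"] by (cases "i < n") auto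
      qed
    qed auto
    finally have yz: "?y \<oplus>\<^bsub>M\<^esub> ?z = \<zero>\<^bsub>M\<^esub>" using 0 by simp
    \<comment> \<open>A zero sum forces both partial sums into the intersection of \<open>P\<close>
      and \<open>P'\<close>; so each vanishes, and each half falls back on its own
      independence.\<close>
    then have "?y = \<ominus>\<^bsub>M\<^esub> ?z" using sP(2)[OF yP] sP'(2)[OF zP] by (metis M.minus_equality)
    then have "?y \<in> P'" using sP'(5)[OF zP] by simp
    then have y0: "?y = \<zero>\<^bsub>M\<^esub>" using yP int by auto
    then have z0: "?z = \<zero>\<^bsub>M\<^esub>" using yz sP'(2)[OF zP] by simp
    have a: "\<forall>i<n. g i = \<zero>\<^bsub>M\<^esub>" using f g1 y0 unfolding decomposes_into_def by blast
    have b: "\<forall>i<n'. g (n + i) = \<zero>\<^bsub>M\<^esub>"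
      using f' g2 z0 unfolding decomposes_into_def by (metis (no_types, lifting))
    show "g i = \<zero>\<^bsub>M\<^esub>"
    proof (cases "i < n")
      case False
      then have "g (n + (i - n)) = \<zero>\<^bsub>M\<^esub>" using b[rule_format, of "i - n"] i by linarith
      then show ?thesis using False by simp
    qed (use a in simp)
  qed
qed

text \<open>Induction on the rank. In a nontrivial splitting each part is proper, because the other
  is nonzero and meets it only in zero, so both have smaller rank. The zero module, which does not
  count as indecomposable, receives the empty decomposition.\<close>

lemma exists_decomposes_into:
  assumes fl: "finite_length R M" and N: "submodule N R M"
  shows "\<exists>n f. decomposes_into N n f"
proof -
  obtain rk :: "'m set \<Rightarrow> nat" and b where *: "\<forall>N. submodule N R M \<longrightarrow> rk N \<le> b"
    "\<forall>N N'. submodule N R M \<longrightarrow> submodule N' R M \<longrightarrow> N \<subset> N' \<longrightarrow> rk N < rk N'"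
    using fl unfolding finite_length_def by (elim exE conjE)
  note rk = *[rule_format]
  from N show ?thesis
  proof (induction "rk N" arbitrary: N rule: less_induct)
    case less
    note N = less.prems
    note sN = submoduleD[OF N]
    consider "N = {\<zero>\<^bsub>M\<^esub>}" | "indecomposable R (M\<lparr>carrier := N\<rparr>)"
      | P P' where "complementary R (M\<lparr>carrier := N\<rparr>) P P'" "P \<noteq> {\<zero>\<^bsub>M\<^esub>}" "P' \<noteq> {\<zero>\<^bsub>M\<^esub>}"
      unfolding indecomposable_def by auto
    then show ?case
    proof cases
      case 1
      then have "decomposes_into N 0 (\<lambda>_. {})" by (simp add: decomposes_into_def)
      then show ?thesis by blast
    next
      case 2
      have sum: "(\<Oplus>\<^bsub>M\<^esub>i\<in>{..<Suc 0}. g i) = g 0" if "g 0 \<in> carrier M" for g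
        using that by (simp add: lessThan_Suc)
      have "decomposes_into N (Suc 0) (\<lambda>_. N)"
        unfolding decomposes_into_def
      proof (intro conjI ballI allI impI)
        fix x assume "x \<in> N"
        then show "\<exists>g. (\<forall>i<Suc 0. g i \<in> N) \<and> x = (\<Oplus>\<^bsub>M\<^esub>i\<in>{..<Suc 0}. g i)"
          using sum[of "\<lambda>_. x"] sN(2) by (intro exI[of _ "\<lambda>_. x"]) simp
      next
        fix g i assume "\<forall>i<Suc 0. g i \<in> N" "(\<Oplus>\<^bsub>M\<^esub>i\<in>{..<Suc 0}. g i) = \<zero>\<^bsub>M\<^esub>" "i < Suc 0"
        then show "g i = \<zero>\<^bsub>M\<^esub>" using sum[of g] sN(2) by simp
      qed (use N 2 in simp_all)
      then show ?thesis by blast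
    next
      case (3 P P')
      have P: "submodule P R M" "P \<subseteq> N" "submodule P' R M" "P' \<subseteq> N"
        and int: "P \<inter> P' = {\<zero>\<^bsub>M\<^esub>}" and sum: "P <+>\<^bsub>M\<^esub> P' = N"
        using 3(1) submodule_restrict_iff[OF N]
        by (auto simp: complementary_def set_add_def')
      have "P \<noteq> N" using int 3(3) P(4) by auto
      then have "rk P < rk N" using rk(2)[OF P(1) N] P(2) by auto
      then obtain n f where f: "decomposes_into P n f" using less.hyps P(1) by blast
      have "P' \<noteq> N" using int 3(2) P(2) by auto
      then have "rk P' < rk N" using rk(2)[OF P(3) N] P(4) by auto
      then obtain n' f' where f': "decomposes_into P' n' f'" using less.hyps P(3) by blast
      show ?thesis using decomposes_into_plus[OF P(1,3) int sum f f'] by blast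
    qed
  qed
qed

lemma exists_indecomposable_decomposition:
  assumes fl: "finite_length R M"
  shows "\<exists>n N. indecomposable_decomposition R M n N"
proof -
  obtain n f where f: "decomposes_into (carrier M) n f"
    using exists_decomposes_into[OF fl carrier_submodule] by blast
  then have sub: "\<And>i. i < n \<Longrightarrow> submodule (f i) R M"
    and ind: "\<And>i. i < n \<Longrightarrow> indecomposable R (M\<lparr>carrier := f i\<rparr>)"
    and ex: "\<And>x. x \<in> carrier M \<Longrightarrow> \<exists>g. (\<forall>i<n. g i \<in> f i) \<and> x = (\<Oplus>\<^bsub>M\<^esub>i\<in>{..<n}. g i)"
    and indep: "\<And>g. \<lbrakk>\<forall>i<n. g i \<in> f i; (\<Oplus>\<^bsub>M\<^esub>i\<in>{..<n}. g i) = \<zero>\<^bsub>M\<^esub>\<rbrakk> \<Longrightarrow> \<forall>i<n. g i = \<zero>\<^bsub>M\<^esub>"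
    unfolding decomposes_into_def by blast+
  have "internal_direct_sum R M {..<n} f"
    unfolding internal_direct_sum_def
  proof (intro conjI ballI)
    fix x assume "x \<in> carrier M"
    then obtain g where g: "\<forall>i<n. g i \<in> f i" "x = (\<Oplus>\<^bsub>M\<^esub>i\<in>{..<n}. g i)" using ex by blast
    have gc: "g \<in> {..<n} \<rightarrow> carrier M" using g(1) submoduleD(2)[OF sub] by auto
    show "\<exists>!h. h \<in> (\<Pi>\<^sub>E i\<in>{..<n}. f i) \<and> x = (\<Oplus>\<^bsub>M\<^esub>i\<in>{..<n}. h i)"
    proof (rule ex1I[of _ "restrict g {..<n}"])
      have "(\<Oplus>\<^bsub>M\<^esub>i\<in>{..<n}. restrict g {..<n} i) = (\<Oplus>\<^bsub>M\<^esub>i\<in>{..<n}. g i)"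
        by (rule M.finsum_cong'[OF refl gc]) simp
      then show "restrict g {..<n} \<in> (\<Pi>\<^sub>E i\<in>{..<n}. f i) \<and> x = (\<Oplus>\<^bsub>M\<^esub>i\<in>{..<n}. restrict g {..<n} i)"
        using g by auto
      fix h assume h: "h \<in> (\<Pi>\<^sub>E i\<in>{..<n}. f i) \<and> x = (\<Oplus>\<^bsub>M\<^esub>i\<in>{..<n}. h i)"
      then have hf: "\<forall>i<n. h i \<in> f i" by (auto simp: PiE_def Pi_def)
      have hc: "h \<in> {..<n} \<rightarrow> carrier M" using hf submoduleD(2)[OF sub] by auto
      \<comment> \<open>Uniqueness of the expansion is reduced to zero sums by subtracting one
        family from the other.\<close>
      have dc: "(\<lambda>i. h i \<ominus>\<^bsub>M\<^esub> g i) \<in> {..<n} \<rightarrow> carrier M" using hc gc by auto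
      have "(\<Oplus>\<^bsub>M\<^esub>i\<in>{..<n}. h i) = (\<Oplus>\<^bsub>M\<^esub>i\<in>{..<n}. g i \<oplus>\<^bsub>M\<^esub> (h i \<ominus>\<^bsub>M\<^esub> g i))"
      proof (rule M.finsum_cong'[OF refl])
        show "h i = g i \<oplus>\<^bsub>M\<^esub> (h i \<ominus>\<^bsub>M\<^esub> g i)" if "i \<in> {..<n}" for i
        proof -
          have "g i \<in> carrier M" "h i \<in> carrier M" using funcset_mem[OF gc that] funcset_mem[OF hc that] by auto
          then show ?thesis by (simp add: a_minus_def M.a_comm[of "h i" "\<ominus>\<^bsub>M\<^esub> g i"] M.r_neg2)
        qed
      qed (use gc dc in auto)
      also have "\<dots> = (\<Oplus>\<^bsub>M\<^esub>i\<in>{..<n}. g i) \<oplus>\<^bsub>M\<^esub> (\<Oplus>\<^bsub>M\<^esub>i\<in>{..<n}. h i \<ominus>\<^bsub>M\<^esub> g i)"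
        by (rule M.finsum_addf[OF gc dc])
      finally have "x \<oplus>\<^bsub>M\<^esub> (\<Oplus>\<^bsub>M\<^esub>i\<in>{..<n}. h i \<ominus>\<^bsub>M\<^esub> g i) = x"
        unfolding g(2)[symmetric] conjunct2[OF h, symmetric] by (rule sym)
      then have "(\<Oplus>\<^bsub>M\<^esub>i\<in>{..<n}. h i \<ominus>\<^bsub>M\<^esub> g i) = \<zero>\<^bsub>M\<^esub>"
        by (rule iffD1[OF M.add.l_cancel_one[OF \<open>x \<in> carrier M\<close> M.finsum_closed[OF dc]]])
      moreover have "\<forall>i<n. h i \<ominus>\<^bsub>M\<^esub> g i \<in> f i"
        using hf g(1) submoduleD(4,5)[OF sub] unfolding a_minus_def by simp
      ultimately have d0: "\<forall>i<n. h i \<ominus>\<^bsub>M\<^esub> g i = \<zero>\<^bsub>M\<^esub>" by (rule indep[rotated])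
      show "h = restrict g {..<n}"
      proof
        fix i show "h i = restrict g {..<n} i"
        proof (cases "i < n")
          case True
          then have "g i \<in> carrier M" "h i \<in> carrier M"
            using funcset_mem[OF gc, of i] funcset_mem[OF hc, of i] by simp_all
          moreover have "h i \<ominus>\<^bsub>M\<^esub> g i = \<zero>\<^bsub>M\<^esub>" using d0 True by simp
          ultimately show ?thesis using M.minus_equality[of "h i" "\<ominus>\<^bsub>M\<^esub> g i"] True by (simp add: a_minus_def)
        next
          case False
          then show ?thesis using h by (auto simp: PiE_def extensional_def)
        qed
      qed
    qed
  qed (use sub in auto)
  then show ?thesis unfolding indecomposable_decomposition_def using ind by blast
qed

text \<open>The maps are the coordinates of the unique expansion. Uniqueness itself makes them
  homomorphisms: sums and multiples of expansions are expansions.\<close>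

lemma internal_direct_sum_projections:
  assumes ds: "internal_direct_sum R M I N" and fin: "finite I"
  obtains p where "\<And>i. i \<in> I \<Longrightarrow> p i \<in> mod_hom R M M"
    "\<And>i x. \<lbrakk>i \<in> I; x \<in> carrier M\<rbrakk> \<Longrightarrow> p i x \<in> N i"
    "\<And>x. x \<in> carrier M \<Longrightarrow> x = (\<Oplus>\<^bsub>M\<^esub>i\<in>I. p i x)"
    "\<And>i x. \<lbrakk>i \<in> I; x \<in> N i\<rbrakk> \<Longrightarrow> p i x = x"
    "\<And>i j x. \<lbrakk>i \<in> I; j \<in> I; i \<noteq> j; x \<in> N i\<rbrakk> \<Longrightarrow> p j x = \<zero>\<^bsub>M\<^esub>"
proof -
  have sub: "\<And>i. i \<in> I \<Longrightarrow> submodule (N i) R M" using ds by (simp add: internal_direct_sum_def)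
  define c where "c x = (THE f. f \<in> (\<Pi>\<^sub>E i\<in>I. N i) \<and> x = (\<Oplus>\<^bsub>M\<^esub>i\<in>I. f i))" for x
  have ex1: "\<exists>!f. f \<in> (\<Pi>\<^sub>E i\<in>I. N i) \<and> x = (\<Oplus>\<^bsub>M\<^esub>i\<in>I. f i)" if "x \<in> carrier M" for x
    using ds that unfolding internal_direct_sum_def by blast
  have c: "c x \<in> (\<Pi>\<^sub>E i\<in>I. N i)" "x = (\<Oplus>\<^bsub>M\<^esub>i\<in>I. c x i)" if "x \<in> carrier M" for x
    using theI'[OF ex1[OF that]] by (simp_all add: c_def)
  have cN: "c x i \<in> N i" if "x \<in> carrier M" "i \<in> I" for x i using c(1)[OF that(1)] that(2) by auto
  have cM: "c x i \<in> carrier M" if "x \<in> carrier M" "i \<in> I" for x i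
    using submoduleD(2)[OF sub] cN that by blast
  have uniq: "c x i = f i" if x: "x \<in> carrier M" and f: "\<And>i. i \<in> I \<Longrightarrow> f i \<in> N i"
    and s: "x = (\<Oplus>\<^bsub>M\<^esub>i\<in>I. f i)" and i: "i \<in> I" for x f i
  proof -
    have "f \<in> I \<rightarrow> carrier M" using f submoduleD(2)[OF sub] by auto
    then have "(\<Oplus>\<^bsub>M\<^esub>i\<in>I. restrict f I i) = (\<Oplus>\<^bsub>M\<^esub>i\<in>I. f i)"
      by (intro M.finsum_cong') auto
    then have "c x = restrict f I"
      unfolding c_def using f s by (intro the1_equality[OF ex1[OF x]]) auto
    then show ?thesis using i by simp
  qed
  have single: "x = (\<Oplus>\<^bsub>M\<^esub>j\<in>I. if i = j then x else \<zero>\<^bsub>M\<^esub>)" if "i \<in> I" "x \<in> N i" for i x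
    using M.finsum_singleton[OF that(1) fin, of "\<lambda>_. x"] submoduleD(2)[OF sub[OF that(1)] that(2)] by simp
  show thesis
  proof
    fix i assume i: "i \<in> I"
    show "(\<lambda>x. c x i) \<in> mod_hom R M M"
    proof (rule mod_homI)
      fix x assume x: "x \<in> carrier M"
      show "c x i \<in> carrier M" using cM x i by simp
      show "c (x \<oplus>\<^bsub>M\<^esub> y) i = c x i \<oplus>\<^bsub>M\<^esub> c y i" if y: "y \<in> carrier M" for y
      proof (rule uniq[of _ "\<lambda>i. c x i \<oplus>\<^bsub>M\<^esub> c y i"])
        have "(\<Oplus>\<^bsub>M\<^esub>i\<in>I. c x i \<oplus>\<^bsub>M\<^esub> c y i) = (\<Oplus>\<^bsub>M\<^esub>i\<in>I. c x i) \<oplus>\<^bsub>M\<^esub> (\<Oplus>\<^bsub>M\<^esub>i\<in>I. c y i)"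
          using cM x y by (intro M.finsum_addf) auto
        then show "x \<oplus>\<^bsub>M\<^esub> y = (\<Oplus>\<^bsub>M\<^esub>i\<in>I. c x i \<oplus>\<^bsub>M\<^esub> c y i)"
          using c(2)[OF x] c(2)[OF y] by simp
      qed (use x y i cN submoduleD(4)[OF sub] in auto)
      show "c (r \<odot>\<^bsub>M\<^esub> x) i = r \<odot>\<^bsub>M\<^esub> c x i" if r: "r \<in> carrier R" for r
      proof (rule uniq[of _ "\<lambda>i. r \<odot>\<^bsub>M\<^esub> c x i"])
        have "r \<odot>\<^bsub>M\<^esub> (\<Oplus>\<^bsub>M\<^esub>i\<in>J. c x i) = (\<Oplus>\<^bsub>M\<^esub>i\<in>J. r \<odot>\<^bsub>M\<^esub> c x i)" if "J \<subseteq> I" for J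
          using finite_subset[OF that fin] that
        proof (induction J rule: finite_induct)
          case (insert j J)
          then show ?case using r cM x by (simp add: Pi_def subset_iff smult_add_right smult_closed)
        qed (use r in \<open>simp add: smult_zero_right\<close>)
        from this[of I] show "r \<odot>\<^bsub>M\<^esub> x = (\<Oplus>\<^bsub>M\<^esub>i\<in>I. r \<odot>\<^bsub>M\<^esub> c x i)" using c(2)[OF x] by simp
      qed (use x r i cN smult_closed submoduleD(6)[OF sub] in auto)
    qed
    fix x
    show "c x i \<in> N i" if "x \<in> carrier M" using cN that i .
    assume xi: "x \<in> N i"
    have xM: "x \<in> carrier M" using submoduleD(2)[OF sub[OF i] xi] .
    have mem: "(if i = j then x else \<zero>\<^bsub>M\<^esub>) \<in> N j" if "j \<in> I" for j
      using xi submoduleD(3)[OF sub[OF that]] by (cases "i = j") simp_all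
    show "c x i = x" using uniq[OF xM mem single[OF i xi] i] by simp
    show "c x j = \<zero>\<^bsub>M\<^esub>" if "j \<in> I" "i \<noteq> j" for j
      using uniq[OF xM mem single[OF i xi] that(1)] that(2) by simp
  qed (use c(2) in simp)
qed

end

section \<open>Induction along a split quotient of a corner algebra\<close>

lemma regular_left_module:
  fixes A :: "('k, 'a) module"
  assumes "ring A" shows "left_module A (regular_module A)"
proof -
  interpret A: ring A by fact
  have "abelian_group (regular_module A)"
  proof (rule abelian_groupI)
    fix x assume "x \<in> carrier (regular_module A)"
    then show "\<exists>y\<in>carrier (regular_module A). y \<oplus>\<^bsub>regular_module A\<^esub> x = \<zero>\<^bsub>regular_module A\<^esub>"
      by (intro bexI[of _ "\<ominus>\<^bsub>A\<^esub> x"]) (simp_all add: regular_module_def A.l_neg)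
  qed (simp_all add: regular_module_def A.a_ac)
  then show ?thesis
    by (intro left_module.intro left_module_axioms.intro A.ring_axioms)
      (simp_all add: regular_module_def A.l_distr A.r_distr A.m_assoc)
qed

text \<open>The component in \<open>N\<close> is well defined because two candidates for it differ
  by an element of both submodules.\<close>

lemma (in left_module) complementary_projection:
  assumes "complementary R M N N'"
  obtains p where "p \<in> mod_hom R M (M\<lparr>carrier := N\<rparr>)" "\<And>x. x \<in> N \<Longrightarrow> p x = x"
proof -
  have N: "submodule N R M" and N': "submodule N' R M" and int: "N \<inter> N' = {\<zero>\<^bsub>M\<^esub>}"
    and sum: "N <+>\<^bsub>M\<^esub> N' = carrier M" using assms by (simp_all add: complementary_def)
  note sN = submoduleD[OF N] and sN' = submoduleD[OF N']
  have ex: "\<exists>y. y \<in> N \<and> (\<exists>z\<in>N'. x = y \<oplus>\<^bsub>M\<^esub> z)" if "x \<in> carrier M" for x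
    using that unfolding sum[symmetric] set_add_def' by blast
  define p where "p x = (SOME y. y \<in> N \<and> (\<exists>z\<in>N'. x = y \<oplus>\<^bsub>M\<^esub> z))" for x
  have p: "p x \<in> N \<and> (\<exists>z\<in>N'. x = p x \<oplus>\<^bsub>M\<^esub> z)" if "x \<in> carrier M" for x
    unfolding p_def by (rule someI_ex[OF ex[OF that]])
  have uniq: "p x = y" if y: "y \<in> N" "z \<in> N'" and x: "x = y \<oplus>\<^bsub>M\<^esub> z" for x y z
  proof -
    have c: "y \<in> carrier M" "z \<in> carrier M" using y sN(2) sN'(2) by auto
    then have xc: "x \<in> carrier M" using x by simp
    obtain w where w: "w \<in> N'" "x = p x \<oplus>\<^bsub>M\<^esub> w" using p[OF xc] by (elim conjE bexE)
    have pN: "p x \<in> N" using p[OF xc] ..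
    have c': "p x \<in> carrier M" "w \<in> carrier M" using pN w sN(2) sN'(2) by auto
    have "p x \<oplus>\<^bsub>M\<^esub> w = y \<oplus>\<^bsub>M\<^esub> z" using w(2) x by simp
    then have "\<ominus>\<^bsub>M\<^esub> y \<oplus>\<^bsub>M\<^esub> (p x \<oplus>\<^bsub>M\<^esub> w) \<oplus>\<^bsub>M\<^esub> \<ominus>\<^bsub>M\<^esub> w = \<ominus>\<^bsub>M\<^esub> y \<oplus>\<^bsub>M\<^esub> (y \<oplus>\<^bsub>M\<^esub> z) \<oplus>\<^bsub>M\<^esub> \<ominus>\<^bsub>M\<^esub> w" by simp
    then have eq: "\<ominus>\<^bsub>M\<^esub> y \<oplus>\<^bsub>M\<^esub> p x = z \<oplus>\<^bsub>M\<^esub> \<ominus>\<^bsub>M\<^esub> w"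
      using c c' by (simp add: M.a_assoc M.r_neg M.r_neg1)
    have "\<ominus>\<^bsub>M\<^esub> y \<oplus>\<^bsub>M\<^esub> p x \<in> N" using sN(4,5) y pN by simp
    moreover have "\<ominus>\<^bsub>M\<^esub> y \<oplus>\<^bsub>M\<^esub> p x \<in> N'" unfolding eq using sN'(4,5) y w by simp
    ultimately have "\<ominus>\<^bsub>M\<^esub> y \<oplus>\<^bsub>M\<^esub> p x = \<zero>\<^bsub>M\<^esub>" using int by blast
    then have "\<ominus>\<^bsub>M\<^esub> (p x) = \<ominus>\<^bsub>M\<^esub> y" using c c' by (intro M.minus_equality) simp_all
    then show ?thesis using c c' by (metis M.minus_minus)
  qed
  show thesis
  proof
    show "p x = x" if "x \<in> N" for x
      using uniq[OF that sN'(3)] sN(2)[OF that] by simp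
    show "p \<in> mod_hom R M (M\<lparr>carrier := N\<rparr>)"
    proof (rule mod_homI)
      fix x assume x: "x \<in> carrier M"
      obtain w where w: "w \<in> N'" "x = p x \<oplus>\<^bsub>M\<^esub> w" using p[OF x] by (elim conjE bexE)
      have pN: "p x \<in> N" using p[OF x] ..
      then show "p x \<in> carrier (M\<lparr>carrier := N\<rparr>)" by simp
      have c: "p x \<in> carrier M" "w \<in> carrier M" using pN w sN(2) sN'(2) by auto
      show "p (x \<oplus>\<^bsub>M\<^esub> y) = p x \<oplus>\<^bsub>M\<lparr>carrier := N\<rparr>\<^esub> p y" if y: "y \<in> carrier M" for y
      proof -
        obtain v where v: "v \<in> N'" "y = p y \<oplus>\<^bsub>M\<^esub> v" using p[OF y] by (elim conjE bexE)
        have pN': "p y \<in> N" using p[OF y] ..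
        have d: "p y \<in> carrier M" "v \<in> carrier M" using pN' v sN(2) sN'(2) by auto
        have "x \<oplus>\<^bsub>M\<^esub> y = (p x \<oplus>\<^bsub>M\<^esub> w) \<oplus>\<^bsub>M\<^esub> (p y \<oplus>\<^bsub>M\<^esub> v)" using w(2) v(2) by simp
        also have "\<dots> = (p x \<oplus>\<^bsub>M\<^esub> p y) \<oplus>\<^bsub>M\<^esub> (w \<oplus>\<^bsub>M\<^esub> v)"
          using c d by (simp add: M.a_assoc M.a_lcomm[of w "p y" v])
        finally have "x \<oplus>\<^bsub>M\<^esub> y = (p x \<oplus>\<^bsub>M\<^esub> p y) \<oplus>\<^bsub>M\<^esub> (w \<oplus>\<^bsub>M\<^esub> v)" .
        from uniq[OF sN(4)[OF pN pN'] sN'(4)[OF w(1) v(1)] this] show ?thesis by simp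
      qed
      show "p (r \<odot>\<^bsub>M\<^esub> x) = r \<odot>\<^bsub>M\<lparr>carrier := N\<rparr>\<^esub> p x" if r: "r \<in> carrier R" for r
      proof -
        have "r \<odot>\<^bsub>M\<^esub> x = r \<odot>\<^bsub>M\<^esub> (p x \<oplus>\<^bsub>M\<^esub> w)" using w(2) by simp
        also have "\<dots> = r \<odot>\<^bsub>M\<^esub> p x \<oplus>\<^bsub>M\<^esub> r \<odot>\<^bsub>M\<^esub> w" using r c by (rule smult_add_right)
        finally have "r \<odot>\<^bsub>M\<^esub> x = r \<odot>\<^bsub>M\<^esub> p x \<oplus>\<^bsub>M\<^esub> r \<odot>\<^bsub>M\<^esub> w" .
        from uniq[OF sN(6)[OF r pN] sN'(6)[OF r w(1)] this] show ?thesis by simp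
      qed
    qed
  qed
qed

text \<open>In the application \<open>e\<close> is \<open>e\<^sub>l\<close>, \<open>h\<close> is the embedding of \<open>B\<^sub>l\<close> and \<open>pr\<close> the quotient map
  \<open>e\<^sub>l A e\<^sub>l \<rightarrow> B\<^sub>l\<close>.\<close>

locale split_corner = A: ring A + B: ring B
  for A :: "('k, 'a) module" and B :: "('k, 'b) module" +
  fixes e :: 'a and h :: "'b \<Rightarrow> 'a" and pr :: "'a \<Rightarrow> 'b"
  assumes e_closed: "e \<in> carrier A" and e_idem: "e \<otimes>\<^bsub>A\<^esub> e = e"
    and h_corner: "b \<in> carrier B \<Longrightarrow> h b \<in> carrier (corner A e)"
    and h_add: "\<lbrakk>b \<in> carrier B; c \<in> carrier B\<rbrakk> \<Longrightarrow> h (b \<oplus>\<^bsub>B\<^esub> c) = h b \<oplus>\<^bsub>A\<^esub> h c"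
    and h_mult: "\<lbrakk>b \<in> carrier B; c \<in> carrier B\<rbrakk> \<Longrightarrow> h (b \<otimes>\<^bsub>B\<^esub> c) = h b \<otimes>\<^bsub>A\<^esub> h c"
    and h_one: "h \<one>\<^bsub>B\<^esub> = e"
    and pr_closed: "x \<in> carrier (corner A e) \<Longrightarrow> pr x \<in> carrier B"
    and pr_add: "\<lbrakk>x \<in> carrier (corner A e); y \<in> carrier (corner A e)\<rbrakk>
      \<Longrightarrow> pr (x \<oplus>\<^bsub>A\<^esub> y) = pr x \<oplus>\<^bsub>B\<^esub> pr y"
    and pr_mult: "\<lbrakk>x \<in> carrier (corner A e); y \<in> carrier (corner A e)\<rbrakk>
      \<Longrightarrow> pr (x \<otimes>\<^bsub>A\<^esub> y) = pr x \<otimes>\<^bsub>B\<^esub> pr y"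
    and pr_h: "b \<in> carrier B \<Longrightarrow> pr (h b) = b"
begin

lemma corner_iff: "x \<in> carrier (corner A e) \<longleftrightarrow> x \<in> carrier A \<and> e \<otimes>\<^bsub>A\<^esub> x = x \<and> x \<otimes>\<^bsub>A\<^esub> e = x"
proof
  assume "x \<in> carrier (corner A e)"
  then obtain a where "a \<in> carrier A" "x = e \<otimes>\<^bsub>A\<^esub> a \<otimes>\<^bsub>A\<^esub> e" by (auto simp: corner_def)
  then show "x \<in> carrier A \<and> e \<otimes>\<^bsub>A\<^esub> x = x \<and> x \<otimes>\<^bsub>A\<^esub> e = x"
    using e_closed e_idem by (simp add: A.m_assoc) (simp add: A.m_assoc[symmetric] e_idem)
next
  assume "x \<in> carrier A \<and> e \<otimes>\<^bsub>A\<^esub> x = x \<and> x \<otimes>\<^bsub>A\<^esub> e = x"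
  then have "x = e \<otimes>\<^bsub>A\<^esub> x \<otimes>\<^bsub>A\<^esub> e" "x \<in> carrier A" by simp_all
  then show "x \<in> carrier (corner A e)" unfolding corner_def by auto
qed

lemma h_closed: "b \<in> carrier B \<Longrightarrow> h b \<in> carrier A"
  using h_corner corner_iff by blast

lemma e_h: "b \<in> carrier B \<Longrightarrow> e \<otimes>\<^bsub>A\<^esub> h b = h b"
  using h_corner corner_iff by blast

lemma h_e: "b \<in> carrier B \<Longrightarrow> h b \<otimes>\<^bsub>A\<^esub> e = h b"
  using h_corner corner_iff by blast

lemma pr_e: "pr e = \<one>\<^bsub>B\<^esub>"
  using pr_h[OF B.one_closed] h_one by simp

abbreviation Ae where "Ae \<equiv> left_ideal_module A e"

lemma Ae_carrier: "x \<in> carrier Ae \<longleftrightarrow> x \<in> carrier A \<and> x \<otimes>\<^bsub>A\<^esub> e = x"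
proof
  assume "x \<in> carrier Ae"
  then obtain a where "a \<in> carrier A" "x = a \<otimes>\<^bsub>A\<^esub> e" by (auto simp: left_ideal_module_def)
  then show "x \<in> carrier A \<and> x \<otimes>\<^bsub>A\<^esub> e = x"
    using e_closed e_idem by (simp add: A.m_assoc)
next
  assume "x \<in> carrier A \<and> x \<otimes>\<^bsub>A\<^esub> e = x"
  then have "x = x \<otimes>\<^bsub>A\<^esub> e" "x \<in> carrier A" by simp_all
  then show "x \<in> carrier Ae" unfolding left_ideal_module_def by auto
qed

lemma Ae_simps:
  "x \<oplus>\<^bsub>Ae\<^esub> y = x \<oplus>\<^bsub>A\<^esub> y" "a \<odot>\<^bsub>Ae\<^esub> x = a \<otimes>\<^bsub>A\<^esub> x" "\<zero>\<^bsub>Ae\<^esub> = \<zero>\<^bsub>A\<^esub>"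
  by (simp_all add: left_ideal_module_def regular_module_def)

lemma Ae_left_module: "left_module A Ae"
proof -
  interpret L: left_module A "regular_module A" by (rule regular_left_module[OF A.ring_axioms])
  have "submodule (carrier Ae) A (regular_module A)"
  proof (rule L.left_submoduleI)
    show "carrier Ae \<subseteq> carrier (regular_module A)"
      using Ae_carrier by (auto simp: regular_module_def)
  qed (use e_closed in \<open>simp_all add: Ae_carrier regular_module_def A.l_distr A.m_assoc\<close>)
  then have "left_module A (regular_module A\<lparr>carrier := carrier Ae\<rparr>)" by (rule L.submodule_left_module)
  then show ?thesis by (simp add: left_ideal_module_def)
qed

lemma e_Ae: "e \<in> carrier Ae"
  using e_closed e_idem by (simp add: Ae_carrier)

lemma e_x_corner: "x \<in> carrier Ae \<Longrightarrow> e \<otimes>\<^bsub>A\<^esub> x \<in> carrier (corner A e)"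
  using e_closed e_idem by (simp add: Ae_carrier corner_iff A.m_assoc) (simp add: A.m_assoc[symmetric])

lemma Ae_corner: "\<lbrakk>x \<in> carrier Ae; y \<in> carrier (corner A e)\<rbrakk> \<Longrightarrow> x \<otimes>\<^bsub>A\<^esub> y \<in> carrier Ae"
  using e_closed by (simp add: Ae_carrier corner_iff A.m_assoc)

lemma pr_e_mult:
  assumes "x \<in> carrier Ae" "y \<in> carrier (corner A e)"
  shows "pr (e \<otimes>\<^bsub>A\<^esub> (x \<otimes>\<^bsub>A\<^esub> y)) = pr (e \<otimes>\<^bsub>A\<^esub> x) \<otimes>\<^bsub>B\<^esub> pr y"
proof -
  have "e \<otimes>\<^bsub>A\<^esub> (x \<otimes>\<^bsub>A\<^esub> y) = (e \<otimes>\<^bsub>A\<^esub> x) \<otimes>\<^bsub>A\<^esub> y"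
    using assms e_closed by (simp add: Ae_carrier corner_iff A.m_assoc)
  then show ?thesis using pr_mult[OF e_x_corner[OF assms(1)] assms(2)] by simp
qed

lemma pr_e_h:
  assumes "x \<in> carrier Ae" "b \<in> carrier B"
  shows "pr (e \<otimes>\<^bsub>A\<^esub> (h b \<otimes>\<^bsub>A\<^esub> x)) = b \<otimes>\<^bsub>B\<^esub> pr (e \<otimes>\<^bsub>A\<^esub> x)"
proof -
  have x: "x \<in> carrier A" using assms(1) by (simp add: Ae_carrier)
  \<comment> \<open>\<open>h b\<close> lies in the corner, so it absorbs \<open>e\<close> on either
    side.\<close>
  have "e \<otimes>\<^bsub>A\<^esub> (h b \<otimes>\<^bsub>A\<^esub> x) = h b \<otimes>\<^bsub>A\<^esub> (e \<otimes>\<^bsub>A\<^esub> x)"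
    using x assms(2) e_closed h_closed[OF assms(2)]
    by (simp add: A.m_assoc[symmetric] e_h h_e)
  then show ?thesis
    using pr_mult[OF h_corner[OF assms(2)] e_x_corner[OF assms(1)]] pr_h[OF assms(2)] by simp
qed

end

section \<open>The modules \<open>Ind M\<close> and \<open>ind Y\<close> and the maps linking them
  to \<open>M\<close> and \<open>Y\<close>\<close>

locale induced_modules = split_corner A B e h pr + M: left_module B M
  for A :: "('k, 'a) module" and B :: "('k, 'b) module" and e h pr
    and M :: "('b, 'x) module" +
  fixes Y :: "'x set"
  assumes Y: "submodule Y B M"
begin

abbreviation MY where "MY \<equiv> M\<lparr>carrier := Y\<rparr>"
abbreviation IndM where "IndM \<equiv> tensor B (\<lambda>x b. x \<otimes>\<^bsub>A\<^esub> h b) Ae M"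
abbreviation indY where "indY \<equiv> tensor (corner A e) (monoid.mult A) Ae (restrict_scalars pr MY)"

sublocale MY: left_module B MY by (rule M.submodule_left_module[OF Y])

sublocale L: left_module A Ae by (rule Ae_left_module)

lemma restrict_simps:
  "carrier (restrict_scalars pr MY) = Y" "x \<oplus>\<^bsub>restrict_scalars pr MY\<^esub> y = x \<oplus>\<^bsub>M\<^esub> y"
  "\<zero>\<^bsub>restrict_scalars pr MY\<^esub> = \<zero>\<^bsub>M\<^esub>" "a \<odot>\<^bsub>restrict_scalars pr MY\<^esub> x = pr a \<odot>\<^bsub>M\<^esub> x"
  by (simp_all add: restrict_scalars_def)

lemma restrict_abelian_group: "abelian_group (restrict_scalars pr MY)"
proof (rule abelian_groupI)
  fix x assume "x \<in> carrier (restrict_scalars pr MY)"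
  then show "\<exists>y\<in>carrier (restrict_scalars pr MY).
      y \<oplus>\<^bsub>restrict_scalars pr MY\<^esub> x = \<zero>\<^bsub>restrict_scalars pr MY\<^esub>"
    using M.submoduleD[OF Y] by (intro bexI[of _ "\<ominus>\<^bsub>M\<^esub> x"]) (simp_all add: restrict_simps M.M.l_neg)
qed (use M.submoduleD[OF Y] in \<open>simp_all add: restrict_simps M.M.a_ac\<close>)

sublocale P: tensor_product A Ae B "\<lambda>x b. x \<otimes>\<^bsub>A\<^esub> h b" M
proof (intro tensor_product.intro tensor_product_axioms.intro)
  show "x \<otimes>\<^bsub>A\<^esub> h r \<in> carrier Ae" if "x \<in> carrier Ae" "r \<in> carrier B" for x r
    using Ae_corner h_corner that by simp
  show "(a \<odot>\<^bsub>Ae\<^esub> x) \<otimes>\<^bsub>A\<^esub> h r = a \<odot>\<^bsub>Ae\<^esub> (x \<otimes>\<^bsub>A\<^esub> h r)"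
    if "a \<in> carrier A" "x \<in> carrier Ae" "r \<in> carrier B" for a x r
    using that h_closed by (simp add: Ae_simps Ae_carrier A.m_assoc)
qed (simp_all add: A.ring_axioms Ae_left_module M.M.abelian_group_axioms M.smult_closed)

sublocale Q: tensor_product A Ae "corner A e" "monoid.mult A" "restrict_scalars pr MY"
proof (intro tensor_product.intro tensor_product_axioms.intro restrict_abelian_group)
  show "(a \<odot>\<^bsub>Ae\<^esub> x) \<otimes>\<^bsub>A\<^esub> r = a \<odot>\<^bsub>Ae\<^esub> (x \<otimes>\<^bsub>A\<^esub> r)"
    if "a \<in> carrier A" "x \<in> carrier Ae" "r \<in> carrier (corner A e)" for a x r
    using that by (simp add: Ae_simps Ae_carrier corner_iff A.m_assoc)
  show "r \<odot>\<^bsub>restrict_scalars pr MY\<^esub> y \<in> carrier (restrict_scalars pr MY)"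
    if "r \<in> carrier (corner A e)" "y \<in> carrier (restrict_scalars pr MY)" for r y
    using that M.submoduleD(6)[OF Y] pr_closed by (simp add: restrict_simps)
qed (simp_all add: A.ring_axioms Ae_left_module Ae_corner)

sublocale PM: left_module A IndM by (rule P.T_left_module)
sublocale QM: left_module A indY by (rule Q.T_left_module)

text \<open>With \<open>\<kappa>\<close>, the units of the two inductions. The left ideal
  \<open>Ae\<close> is generated by \<open>e\<close>, so \<open>e \<otimes> m\<close> is the element
  informally written \<open>1 \<otimes> m\<close>.\<close>

definition \<iota> where "\<iota> m = P.pure e m"
definition \<kappa> where "\<kappa> y = Q.pure e y"

lemma \<iota>_closed: "m \<in> carrier M \<Longrightarrow> \<iota> m \<in> carrier IndM"
  unfolding \<iota>_def by (rule P.pure_closed[OF e_Ae])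

lemma \<kappa>_closed: "y \<in> Y \<Longrightarrow> \<kappa> y \<in> carrier indY"
  unfolding \<kappa>_def by (rule Q.pure_closed[OF e_Ae]) (simp add: restrict_simps)

lemma P_pure: "\<lbrakk>x \<in> carrier Ae; m \<in> carrier M\<rbrakk> \<Longrightarrow> P.pure x m = x \<odot>\<^bsub>IndM\<^esub> \<iota> m"
  unfolding \<iota>_def using P.smult_pure[of x e m] e_Ae by (simp add: Ae_simps Ae_carrier)

lemma Q_pure: "\<lbrakk>x \<in> carrier Ae; y \<in> Y\<rbrakk> \<Longrightarrow> Q.pure x y = x \<odot>\<^bsub>indY\<^esub> \<kappa> y"
  unfolding \<kappa>_def using Q.smult_pure[of x e y] e_Ae by (simp add: Ae_simps Ae_carrier restrict_simps)

lemma e_\<iota>: "m \<in> carrier M \<Longrightarrow> e \<odot>\<^bsub>IndM\<^esub> \<iota> m = \<iota> m"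
  using P_pure[OF e_Ae] by (simp add: \<iota>_def)

lemma \<iota>_smult: "\<lbrakk>b \<in> carrier B; m \<in> carrier M\<rbrakk> \<Longrightarrow> \<iota> (b \<odot>\<^bsub>M\<^esub> m) = h b \<odot>\<^bsub>IndM\<^esub> \<iota> m"
  using P.pure_balanced[OF e_Ae, of b m] P_pure[of "h b" m] h_closed h_e
  by (simp add: \<iota>_def[symmetric] e_h Ae_carrier)

lemma \<iota>_add: "\<lbrakk>m \<in> carrier M; m' \<in> carrier M\<rbrakk> \<Longrightarrow> \<iota> (m \<oplus>\<^bsub>M\<^esub> m') = \<iota> m \<oplus>\<^bsub>IndM\<^esub> \<iota> m'"
  unfolding \<iota>_def by (rule P.pure_add_right[OF e_Ae])

text \<open>A corner element passes across the tensor sign, and on the right it acts through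
  \<open>pr\<close>.\<close>

lemma corner_\<kappa>:
  "\<lbrakk>x \<in> carrier (corner A e); y \<in> Y\<rbrakk> \<Longrightarrow> x \<odot>\<^bsub>indY\<^esub> \<kappa> y = \<kappa> (pr x \<odot>\<^bsub>M\<^esub> y)"
  using Q.pure_balanced[OF e_Ae, of x y] Q_pure[of x y]
  by (simp add: \<kappa>_def[symmetric] restrict_simps corner_iff Ae_carrier)

text \<open>A retraction of \<open>\<iota>\<close>: cut \<open>x\<close> down to \<open>e x\<close>
  and project it to \<open>B\<close>. Balancedness over \<open>B\<close> is multiplicativity of
  \<open>pr\<close> together with \<open>pr (h b) = b\<close>. As \<open>M\<close> carries no action
  of \<open>A\<close>, only an additive map is asked for; compatibility with \<open>B\<close>
  through \<open>h\<close> is \<open>\<gamma>_h\<close>.\<close>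

lemma exists_\<gamma>:
  "\<exists>\<gamma>. (\<forall>u\<in>carrier IndM. \<gamma> u \<in> carrier M) \<and>
    (\<forall>u\<in>carrier IndM. \<forall>v\<in>carrier IndM. \<gamma> (u \<oplus>\<^bsub>IndM\<^esub> v) = \<gamma> u \<oplus>\<^bsub>M\<^esub> \<gamma> v) \<and>
    (\<forall>x\<in>carrier Ae. \<forall>m\<in>carrier M. \<gamma> (P.pure x m) = pr (e \<otimes>\<^bsub>A\<^esub> x) \<odot>\<^bsub>M\<^esub> m)"
proof (rule P.tensor_lift[of M "\<lambda>x m. pr (e \<otimes>\<^bsub>A\<^esub> x) \<odot>\<^bsub>M\<^esub> m"])
  show "pr (e \<otimes>\<^bsub>A\<^esub> x) \<odot>\<^bsub>M\<^esub> m \<in> carrier M" if "x \<in> carrier Ae" "m \<in> carrier M" for x m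
    using that by (simp add: M.smult_closed pr_closed e_x_corner)
  show "pr (e \<otimes>\<^bsub>A\<^esub> (x \<oplus>\<^bsub>Ae\<^esub> x')) \<odot>\<^bsub>M\<^esub> m = pr (e \<otimes>\<^bsub>A\<^esub> x) \<odot>\<^bsub>M\<^esub> m \<oplus>\<^bsub>M\<^esub> pr (e \<otimes>\<^bsub>A\<^esub> x') \<odot>\<^bsub>M\<^esub> m"
    if x: "x \<in> carrier Ae" "x' \<in> carrier Ae" and m: "m \<in> carrier M" for x x' m
  proof -
    have "e \<otimes>\<^bsub>A\<^esub> (x \<oplus>\<^bsub>Ae\<^esub> x') = e \<otimes>\<^bsub>A\<^esub> x \<oplus>\<^bsub>A\<^esub> e \<otimes>\<^bsub>A\<^esub> x'"
      using x e_closed by (simp add: Ae_simps Ae_carrier A.r_distr)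
    then show ?thesis using x m by (simp add: pr_add e_x_corner M.smult_add_left pr_closed)
  qed
  show "pr (e \<otimes>\<^bsub>A\<^esub> (x \<otimes>\<^bsub>A\<^esub> h r)) \<odot>\<^bsub>M\<^esub> m = pr (e \<otimes>\<^bsub>A\<^esub> x) \<odot>\<^bsub>M\<^esub> (r \<odot>\<^bsub>M\<^esub> m)"
    if "x \<in> carrier Ae" "r \<in> carrier B" "m \<in> carrier M" for x r m
    using that by (simp add: pr_e_mult h_corner pr_h M.smult_assoc pr_closed e_x_corner)
  show "pr (e \<otimes>\<^bsub>A\<^esub> x) \<odot>\<^bsub>M\<^esub> (m \<oplus>\<^bsub>M\<^esub> m') = pr (e \<otimes>\<^bsub>A\<^esub> x) \<odot>\<^bsub>M\<^esub> m \<oplus>\<^bsub>M\<^esub> pr (e \<otimes>\<^bsub>A\<^esub> x) \<odot>\<^bsub>M\<^esub> m'"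
    if "x \<in> carrier Ae" "m \<in> carrier M" "m' \<in> carrier M" for x m m'
    using that by (simp add: M.smult_add_right pr_closed e_x_corner)
  fix \<gamma> assume "\<And>u. u \<in> carrier IndM \<Longrightarrow> \<gamma> u \<in> carrier M"
    "\<And>u v. \<lbrakk>u \<in> carrier IndM; v \<in> carrier IndM\<rbrakk> \<Longrightarrow> \<gamma> (u \<oplus>\<^bsub>IndM\<^esub> v) = \<gamma> u \<oplus>\<^bsub>M\<^esub> \<gamma> v"
    "\<And>x m. \<lbrakk>x \<in> carrier Ae; m \<in> carrier M\<rbrakk> \<Longrightarrow> \<gamma> (P.pure x m) = pr (e \<otimes>\<^bsub>A\<^esub> x) \<odot>\<^bsub>M\<^esub> m"
  then show ?thesis by (intro exI[of _ \<gamma>] conjI ballI)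
qed (rule M.M.abelian_group_axioms)

definition \<gamma> where "\<gamma> = (SOME \<gamma>. (\<forall>u\<in>carrier IndM. \<gamma> u \<in> carrier M) \<and>
    (\<forall>u\<in>carrier IndM. \<forall>v\<in>carrier IndM. \<gamma> (u \<oplus>\<^bsub>IndM\<^esub> v) = \<gamma> u \<oplus>\<^bsub>M\<^esub> \<gamma> v) \<and>
    (\<forall>x\<in>carrier Ae. \<forall>m\<in>carrier M. \<gamma> (P.pure x m) = pr (e \<otimes>\<^bsub>A\<^esub> x) \<odot>\<^bsub>M\<^esub> m))"

lemma \<gamma>_closed: "u \<in> carrier IndM \<Longrightarrow> \<gamma> u \<in> carrier M"
  and \<gamma>_add: "\<lbrakk>u \<in> carrier IndM; v \<in> carrier IndM\<rbrakk> \<Longrightarrow> \<gamma> (u \<oplus>\<^bsub>IndM\<^esub> v) = \<gamma> u \<oplus>\<^bsub>M\<^esub> \<gamma> v"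
  and \<gamma>_pure: "\<lbrakk>x \<in> carrier Ae; m \<in> carrier M\<rbrakk> \<Longrightarrow> \<gamma> (P.pure x m) = pr (e \<otimes>\<^bsub>A\<^esub> x) \<odot>\<^bsub>M\<^esub> m"
  using someI_ex[OF exists_\<gamma>] unfolding \<gamma>_def by blast+

text \<open>The formula of \<open>\<gamma>\<close>, now on \<open>ind Y\<close>. Here balancedness
  is required over the whole corner, and multiplicativity of \<open>pr\<close> gives it because the
  corner acts on \<open>Y\<close> through \<open>pr\<close>. By \<open>\<rho>_\<kappa>\<close> and
  \<open>e_indY\<close> the map inverts \<open>\<kappa>\<close> on \<open>e (ind Y)\<close>.\<close>

lemma exists_\<rho>:
  "\<exists>\<rho>. (\<forall>u\<in>carrier indY. \<rho> u \<in> Y) \<and>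
    (\<forall>u\<in>carrier indY. \<forall>v\<in>carrier indY. \<rho> (u \<oplus>\<^bsub>indY\<^esub> v) = \<rho> u \<oplus>\<^bsub>M\<^esub> \<rho> v) \<and>
    (\<forall>x\<in>carrier Ae. \<forall>y\<in>Y. \<rho> (Q.pure x y) = pr (e \<otimes>\<^bsub>A\<^esub> x) \<odot>\<^bsub>M\<^esub> y)"
proof (rule Q.tensor_lift[of MY "\<lambda>x m. pr (e \<otimes>\<^bsub>A\<^esub> x) \<odot>\<^bsub>M\<^esub> m"])
  note YM = M.submoduleD(2)[OF Y]
  show "pr (e \<otimes>\<^bsub>A\<^esub> x) \<odot>\<^bsub>M\<^esub> m \<in> carrier MY"
    if "x \<in> carrier Ae" "m \<in> carrier (restrict_scalars pr MY)" for x m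
    using that M.submoduleD(6)[OF Y] by (simp add: restrict_simps pr_closed e_x_corner)
  show "pr (e \<otimes>\<^bsub>A\<^esub> (x \<oplus>\<^bsub>Ae\<^esub> x')) \<odot>\<^bsub>M\<^esub> m = pr (e \<otimes>\<^bsub>A\<^esub> x) \<odot>\<^bsub>M\<^esub> m \<oplus>\<^bsub>MY\<^esub> pr (e \<otimes>\<^bsub>A\<^esub> x') \<odot>\<^bsub>M\<^esub> m"
    if x: "x \<in> carrier Ae" "x' \<in> carrier Ae" and m: "m \<in> carrier (restrict_scalars pr MY)" for x x' m
  proof -
    have "e \<otimes>\<^bsub>A\<^esub> (x \<oplus>\<^bsub>Ae\<^esub> x') = e \<otimes>\<^bsub>A\<^esub> x \<oplus>\<^bsub>A\<^esub> e \<otimes>\<^bsub>A\<^esub> x'"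
      using x e_closed by (simp add: Ae_simps Ae_carrier A.r_distr)
    then show ?thesis
      using x m YM by (simp add: pr_add e_x_corner M.smult_add_left pr_closed restrict_simps)
  qed
  show "pr (e \<otimes>\<^bsub>A\<^esub> (x \<otimes>\<^bsub>A\<^esub> r)) \<odot>\<^bsub>M\<^esub> m = pr (e \<otimes>\<^bsub>A\<^esub> x) \<odot>\<^bsub>M\<^esub> (r \<odot>\<^bsub>restrict_scalars pr MY\<^esub> m)"
    if "x \<in> carrier Ae" "r \<in> carrier (corner A e)" "m \<in> carrier (restrict_scalars pr MY)" for x r m
    using that YM by (simp add: pr_e_mult restrict_simps M.smult_assoc pr_closed e_x_corner)
  show "pr (e \<otimes>\<^bsub>A\<^esub> x) \<odot>\<^bsub>M\<^esub> (m \<oplus>\<^bsub>restrict_scalars pr MY\<^esub> m')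
      = pr (e \<otimes>\<^bsub>A\<^esub> x) \<odot>\<^bsub>M\<^esub> m \<oplus>\<^bsub>MY\<^esub> pr (e \<otimes>\<^bsub>A\<^esub> x) \<odot>\<^bsub>M\<^esub> m'"
    if "x \<in> carrier Ae" "m \<in> carrier (restrict_scalars pr MY)" "m' \<in> carrier (restrict_scalars pr MY)"
    for x m m'
    using that YM by (simp add: M.smult_add_right pr_closed e_x_corner restrict_simps)
  fix \<rho> assume *: "\<And>u. u \<in> carrier indY \<Longrightarrow> \<rho> u \<in> carrier MY"
    "\<And>u v. \<lbrakk>u \<in> carrier indY; v \<in> carrier indY\<rbrakk> \<Longrightarrow> \<rho> (u \<oplus>\<^bsub>indY\<^esub> v) = \<rho> u \<oplus>\<^bsub>MY\<^esub> \<rho> v"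
    "\<And>x m. \<lbrakk>x \<in> carrier Ae; m \<in> carrier (restrict_scalars pr MY)\<rbrakk>
      \<Longrightarrow> \<rho> (Q.pure x m) = pr (e \<otimes>\<^bsub>A\<^esub> x) \<odot>\<^bsub>M\<^esub> m"
  show ?thesis using * by (intro exI[of _ \<rho>] conjI ballI) (simp_all add: restrict_simps)
qed (rule MY.M.abelian_group_axioms)

definition \<rho> where "\<rho> = (SOME \<rho>. (\<forall>u\<in>carrier indY. \<rho> u \<in> Y) \<and>
    (\<forall>u\<in>carrier indY. \<forall>v\<in>carrier indY. \<rho> (u \<oplus>\<^bsub>indY\<^esub> v) = \<rho> u \<oplus>\<^bsub>M\<^esub> \<rho> v) \<and>
    (\<forall>x\<in>carrier Ae. \<forall>y\<in>Y. \<rho> (Q.pure x y) = pr (e \<otimes>\<^bsub>A\<^esub> x) \<odot>\<^bsub>M\<^esub> y))"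

lemma \<rho>_closed: "u \<in> carrier indY \<Longrightarrow> \<rho> u \<in> Y"
  and \<rho>_add: "\<lbrakk>u \<in> carrier indY; v \<in> carrier indY\<rbrakk> \<Longrightarrow> \<rho> (u \<oplus>\<^bsub>indY\<^esub> v) = \<rho> u \<oplus>\<^bsub>M\<^esub> \<rho> v"
  and \<rho>_pure: "\<lbrakk>x \<in> carrier Ae; y \<in> Y\<rbrakk> \<Longrightarrow> \<rho> (Q.pure x y) = pr (e \<otimes>\<^bsub>A\<^esub> x) \<odot>\<^bsub>M\<^esub> y"
  using someI_ex[OF exists_\<rho>] unfolding \<rho>_def by blast+

lemma \<rho>_\<kappa>: "y \<in> Y \<Longrightarrow> \<rho> (\<kappa> y) = y"
  unfolding \<kappa>_def using M.submoduleD(2)[OF Y] by (simp add: \<rho>_pure e_Ae e_idem pr_e M.smult_one)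

lemma \<gamma>_h:
  assumes b: "b \<in> carrier B" and "u \<in> carrier IndM"
  shows "\<gamma> (h b \<odot>\<^bsub>IndM\<^esub> u) = b \<odot>\<^bsub>M\<^esub> \<gamma> u"
  using assms(2)
proof (induction rule: P.tensor_induct)
  case (pure x m)
  then show ?case
    using b L.smult_closed[OF h_closed[OF b] pure(1)]
    by (simp add: P.smult_pure h_closed \<gamma>_pure Ae_simps pr_e_h M.smult_assoc pr_closed e_x_corner)
next
  case (add u v)
  then show ?case
    using b by (simp add: P.T_smult_add P.T_smult_closed h_closed \<gamma>_add M.smult_add_right \<gamma>_closed)
qed

lemma \<rho>_h:
  assumes b: "b \<in> carrier B" and "u \<in> carrier indY"
  shows "\<rho> (h b \<odot>\<^bsub>indY\<^esub> u) = b \<odot>\<^bsub>M\<^esub> \<rho> u"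
  using assms(2)
proof (induction rule: Q.tensor_induct)
  case (pure x y)
  then show ?case
    using b L.smult_closed[OF h_closed[OF b] pure(1)] M.submoduleD(2)[OF Y]
    by (simp add: Q.smult_pure h_closed \<rho>_pure Ae_simps pr_e_h M.smult_assoc pr_closed e_x_corner restrict_simps)
next
  case (add u v)
  then show ?case
    using b M.submoduleD(2)[OF Y]
    by (simp add: Q.T_smult_add Q.T_smult_closed h_closed \<rho>_add M.smult_add_right \<rho>_closed)
qed

lemma \<kappa>_add: "\<lbrakk>y \<in> Y; y' \<in> Y\<rbrakk> \<Longrightarrow> \<kappa> (y \<oplus>\<^bsub>M\<^esub> y') = \<kappa> y \<oplus>\<^bsub>indY\<^esub> \<kappa> y'"
  unfolding \<kappa>_def using Q.pure_add_right[OF e_Ae, of y y'] by (simp add: restrict_simps)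

text \<open>For \<open>x\<close> in \<open>Ae\<close> the product \<open>e x\<close> lies in the
  corner, and corner elements pass across the tensor sign. In \<open>Ind M\<close> the relations
  move only elements of the image of \<open>h\<close>, so the argument is specific to
  \<open>ind Y\<close>.\<close>

lemma e_indY:
  assumes "u \<in> carrier indY"
  shows "e \<odot>\<^bsub>indY\<^esub> u = \<kappa> (\<rho> u)"
  using assms
proof (induction rule: Q.tensor_induct)
  case (pure x y)
  have "e \<odot>\<^bsub>indY\<^esub> Q.pure x y = Q.pure (e \<otimes>\<^bsub>A\<^esub> x) y"
    using Q.smult_pure[OF e_closed pure] by (simp add: Ae_simps)
  also have "\<dots> = (e \<otimes>\<^bsub>A\<^esub> x) \<odot>\<^bsub>indY\<^esub> \<kappa> y"
    using pure e_x_corner[OF pure(1)] by (intro Q_pure) (simp_all add: corner_iff Ae_carrier restrict_simps)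
  also have "\<dots> = \<kappa> (pr (e \<otimes>\<^bsub>A\<^esub> x) \<odot>\<^bsub>M\<^esub> y)"
    using pure by (intro corner_\<kappa>) (simp_all add: e_x_corner restrict_simps)
  finally show ?case using pure by (simp add: \<rho>_pure restrict_simps)
next
  case (add u v)
  then show ?case by (simp add: Q.T_smult_add e_closed \<rho>_add \<kappa>_add \<rho>_closed)
qed

text \<open>Homomorphisms \<open>Ind M \<rightarrow> ind Y\<close> correspond to homomorphisms \<open>M \<rightarrow> Y\<close>.\<close>

definition flat where "flat g m = \<rho> (g (\<iota> m))"

context
  fixes g assumes g: "g \<in> mod_hom A IndM indY"
begin

lemma flat_hom: "flat g \<in> mod_hom B M MY"
proof (rule mod_homI)
  note gD = mod_homD[OF g]
  fix m assume m: "m \<in> carrier M"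
  show "flat g m \<in> carrier MY" using m by (simp add: flat_def \<rho>_closed gD(1) \<iota>_closed)
  show "flat g (m \<oplus>\<^bsub>M\<^esub> m') = flat g m \<oplus>\<^bsub>MY\<^esub> flat g m'" if "m' \<in> carrier M" for m'
    using m that by (simp add: flat_def \<iota>_add gD \<iota>_closed \<rho>_add)
  show "flat g (b \<odot>\<^bsub>M\<^esub> m) = b \<odot>\<^bsub>MY\<^esub> flat g m" if "b \<in> carrier B" for b
    using m that by (simp add: flat_def \<iota>_smult gD \<iota>_closed h_closed \<rho>_h)
qed

text \<open>\<open>e\<close> fixes \<open>\<iota> m\<close>, so every \<open>A\<close>-homomorphism
  sends it into \<open>e (ind Y)\<close>, the copy of \<open>Y\<close>.\<close>

lemma hom_\<iota>: "m \<in> carrier M \<Longrightarrow> g (\<iota> m) = \<kappa> (flat g m)"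
proof -
  assume m: "m \<in> carrier M"
  have "g (\<iota> m) = g (e \<odot>\<^bsub>IndM\<^esub> \<iota> m)" using m by (simp add: e_\<iota>)
  also have "\<dots> = e \<odot>\<^bsub>indY\<^esub> g (\<iota> m)" using m by (intro mod_homD(3)[OF g] e_closed \<iota>_closed)
  also have "\<dots> = \<kappa> (flat g m)"
    unfolding flat_def using m by (intro e_indY mod_homD(1)[OF g] \<iota>_closed)
  finally show ?thesis .
qed

text \<open>After \<open>\<rho>\<close>, a homomorphism sees only the retraction of its argument.
  Whatever \<open>\<gamma>\<close> kills in \<open>Ind M\<close> cannot influence the induced map
  into \<open>Y\<close>, and this allows summands of \<open>Ind M\<close> to be tested inside
  \<open>M\<close>.\<close>

lemma flat_\<gamma>:
  assumes "u \<in> carrier IndM" shows "\<rho> (g u) = flat g (\<gamma> u)"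
  using assms
proof (induction rule: P.tensor_induct)
  case (pure x m)
  have x: "x \<in> carrier A" using pure(1) by (simp add: Ae_carrier)
  have y: "flat g m \<in> Y" using mod_homD(1)[OF flat_hom] pure(2) by simp
  have "g (P.pure x m) = x \<odot>\<^bsub>indY\<^esub> \<kappa> (flat g m)"
    using pure x by (simp add: P_pure mod_homD(3)[OF g] \<iota>_closed hom_\<iota>)
  also have "\<dots> = Q.pure x (flat g m)" by (rule Q_pure[OF pure(1) y, symmetric])
  finally have "\<rho> (g (P.pure x m)) = pr (e \<otimes>\<^bsub>A\<^esub> x) \<odot>\<^bsub>M\<^esub> flat g m"
    using pure(1) y by (simp add: \<rho>_pure)
  also have "\<dots> = flat g (pr (e \<otimes>\<^bsub>A\<^esub> x) \<odot>\<^bsub>M\<^esub> m)"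
    using mod_homD(3)[OF flat_hom pr_closed[OF e_x_corner[OF pure(1)]] pure(2)] by simp
  finally show ?case using pure by (simp add: \<gamma>_pure)
next
  case (add u v)
  then show ?case
    using mod_homD(2)[OF flat_hom \<gamma>_closed \<gamma>_closed, of u v]
    by (simp add: mod_homD[OF g] \<rho>_add \<gamma>_add)
qed

text \<open>A preimage of \<open>\<kappa> y\<close> in \<open>Ind M\<close>, retracted by
  \<open>\<gamma>\<close>, is a preimage of \<open>y\<close>.\<close>

lemma flat_surj:
  assumes "g ` carrier IndM = carrier indY" shows "flat g ` carrier M = Y"
proof (rule equalityI)
  show "flat g ` carrier M \<subseteq> Y" using mod_homD(1)[OF flat_hom] by auto
  show "Y \<subseteq> flat g ` carrier M"
  proof
    fix y assume y: "y \<in> Y"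
    then have "\<kappa> y \<in> g ` carrier IndM" using assms \<kappa>_closed by simp
    then obtain u where u: "u \<in> carrier IndM" "\<kappa> y = g u" by (elim imageE)
    have "y = flat g (\<gamma> u)" using \<rho>_\<kappa>[OF y] flat_\<gamma>[OF u(1)] u(2) by simp
    then show "y \<in> flat g ` carrier M" using \<gamma>_closed[OF u(1)] by (rule image_eqI)
  qed
qed

text \<open>The elements \<open>\<kappa> y\<close> generate \<open>ind Y\<close> over
  \<open>A\<close>, and \<open>hom_\<iota>\<close> puts them into the image of
  \<open>g\<close>.\<close>

lemma surj_flat:
  assumes "flat g ` carrier M = Y" shows "g ` carrier IndM = carrier indY"
proof (rule equalityI)
  interpret g: left_module_hom A IndM indY g
    by (intro left_module_hom.intro left_module_hom_axioms.intro g PM.left_module_axioms QM.left_module_axioms)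
  note im = QM.submoduleD[OF g.image_submodule[OF PM.carrier_submodule]]
  show "g ` carrier IndM \<subseteq> carrier indY" by (rule im(1))
  show "carrier indY \<subseteq> g ` carrier IndM"
  proof
    fix u assume "u \<in> carrier indY"
    then show "u \<in> g ` carrier IndM"
    proof (induction rule: Q.tensor_induct)
      case (pure x y)
      have y: "y \<in> Y" using pure(2) by (simp add: restrict_simps)
      then have "y \<in> flat g ` carrier M" using assms by simp
      then obtain m where m: "m \<in> carrier M" "y = flat g m" by (elim imageE)
      have "\<kappa> y = g (\<iota> m)" using hom_\<iota>[OF m(1)] m(2) by simp
      then have "\<kappa> y \<in> g ` carrier IndM" using \<iota>_closed[OF m(1)] by (rule image_eqI)
      then show ?case
        unfolding Q_pure[OF pure(1) y] using pure(1) by (intro im(6)) (simp add: Ae_carrier)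
    qed (rule im(4))
  qed
qed

end

text \<open>Tensoring \<open>p\<close> with \<open>Ae\<close> also changes the ring of the tensor
  product from \<open>B\<close> to the corner. The relations over \<open>B\<close> survive because
  \<open>h b\<close> belongs to the corner and acts on \<open>Y\<close> as
  \<open>pr (h b) = b\<close>.\<close>

lemma exists_lift:
  assumes p: "p \<in> mod_hom B M MY"
  obtains f where "f \<in> mod_hom A IndM indY" "\<And>m. m \<in> carrier M \<Longrightarrow> f (\<iota> m) = \<kappa> (p m)"
proof -
  note pD = mod_homD[OF p, simplified]
  have pR: "p m \<in> carrier (restrict_scalars pr MY)" if "m \<in> carrier M" for m
    using pD(1)[OF that] by (simp add: restrict_simps)
  show thesis
  proof (rule P.tensor_lift[of indY "\<lambda>x m. Q.pure x (p m)"])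
    show "abelian_group indY" by (rule Q.T_abelian_group)
    show "Q.pure x (p m) \<in> carrier indY" if "x \<in> carrier Ae" "m \<in> carrier M" for x m
      using that by (intro Q.pure_closed pR)
    show "Q.pure (x \<oplus>\<^bsub>Ae\<^esub> x') (p m) = Q.pure x (p m) \<oplus>\<^bsub>indY\<^esub> Q.pure x' (p m)"
      if "x \<in> carrier Ae" "x' \<in> carrier Ae" "m \<in> carrier M" for x x' m
      using that by (intro Q.pure_add_left pR)
    show "Q.pure x (p (m \<oplus>\<^bsub>M\<^esub> m')) = Q.pure x (p m) \<oplus>\<^bsub>indY\<^esub> Q.pure x (p m')"
      if "x \<in> carrier Ae" "m \<in> carrier M" "m' \<in> carrier M" for x m m'
      using that Q.pure_add_right[of x "p m" "p m'"] pR by (simp add: pD restrict_simps)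
    show "Q.pure (x \<otimes>\<^bsub>A\<^esub> h b) (p m) = Q.pure x (p (b \<odot>\<^bsub>M\<^esub> m))"
      if "x \<in> carrier Ae" "b \<in> carrier B" "m \<in> carrier M" for x b m
      using that Q.pure_balanced[of x "h b" "p m"] pR by (simp add: pD h_corner restrict_simps pr_h)
  next
    fix f assume f: "\<And>u. u \<in> carrier IndM \<Longrightarrow> f u \<in> carrier indY"
      "\<And>u v. \<lbrakk>u \<in> carrier IndM; v \<in> carrier IndM\<rbrakk> \<Longrightarrow> f (u \<oplus>\<^bsub>IndM\<^esub> v) = f u \<oplus>\<^bsub>indY\<^esub> f v"
      "\<And>x m. \<lbrakk>x \<in> carrier Ae; m \<in> carrier M\<rbrakk> \<Longrightarrow> f (P.pure x m) = Q.pure x (p m)"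
    have "f (a \<odot>\<^bsub>IndM\<^esub> u) = a \<odot>\<^bsub>indY\<^esub> f u" if a: "a \<in> carrier A" and u: "u \<in> carrier IndM" for a u
      using u
    proof (induction rule: P.tensor_induct)
      case (pure x m)
      then show ?case
        using a L.smult_closed[OF a pure(1)] pR[OF pure(2)] by (simp add: P.smult_pure Q.smult_pure f(3))
    next
      case (add u v)
      then show ?case
        using a by (simp add: P.T_smult_add Q.T_smult_add P.T_smult_closed f(1,2))
    qed
    then have "f \<in> mod_hom A IndM indY" using f(1,2) by (intro mod_homI)
    moreover have "f (\<iota> m) = \<kappa> (p m)" if "m \<in> carrier M" for m
      unfolding \<iota>_def \<kappa>_def using f(3)[OF e_Ae that] .
    ultimately show thesis by (rule that)
  qed
qed

text \<open>\<open>Ind M\<close> is generated over \<open>A\<close> by \<open>\<iota> t\<close>,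
  hence is a quotient of the regular module and inherits its finite length.\<close>

lemma finite_length_cyclic:
  assumes fl: "finite_length A (regular_module A)"
    and t: "t \<in> carrier M" and cyc: "\<And>m. m \<in> carrier M \<Longrightarrow> \<exists>b\<in>carrier B. m = b \<odot>\<^bsub>M\<^esub> t"
  shows "finite_length A IndM"
proof -
  let ?f = "\<lambda>a. a \<odot>\<^bsub>IndM\<^esub> \<iota> t"
  have "?f \<in> mod_hom A (regular_module A) IndM"
    using \<iota>_closed[OF t]
    by (intro mod_homI) (simp_all add: regular_module_def PM.smult_closed PM.smult_add_left PM.smult_assoc)
  then interpret f: left_module_hom A "regular_module A" IndM ?f
    by (intro left_module_hom.intro left_module_hom_axioms.intro PM.left_module_axioms
        regular_left_module A.ring_axioms)
  have "submodule (carrier (regular_module A)) A (regular_module A)"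
    by (rule left_module.carrier_submodule[OF regular_left_module[OF A.ring_axioms]])
  note im = PM.submoduleD[OF f.image_submodule[OF this]]
  have "?f ` carrier (regular_module A) = carrier IndM"
  proof (rule equalityI)
    show "?f ` carrier (regular_module A) \<subseteq> carrier IndM" by (rule im(1))
    show "carrier IndM \<subseteq> ?f ` carrier (regular_module A)"
    proof
      fix u assume "u \<in> carrier IndM"
      then show "u \<in> ?f ` carrier (regular_module A)"
      proof (induction rule: P.tensor_induct)
        case (pure x m)
        obtain b where b: "b \<in> carrier B" "m = b \<odot>\<^bsub>M\<^esub> t" using cyc[OF pure(2)] by (elim bexE)
        have x: "x \<in> carrier A" using pure(1) by (simp add: Ae_carrier)
        have "P.pure x m = x \<odot>\<^bsub>IndM\<^esub> (h b \<odot>\<^bsub>IndM\<^esub> \<iota> t)"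
          using P_pure[OF pure] \<iota>_smult[OF b(1) t] b(2) by simp
        also have "\<dots> = ?f (x \<otimes>\<^bsub>A\<^esub> h b)"
          using PM.smult_assoc[OF x h_closed[OF b(1)] \<iota>_closed[OF t]] by simp
        finally show ?case
          by (rule image_eqI) (simp add: regular_module_def x h_closed[OF b(1)])
      qed (rule im(4))
    qed
  qed
  then show ?thesis by (rule f.finite_length_surj[OF fl])
qed

end

text \<open>The element \<open>\<eta>\<close> of \<open>B\<close> maps \<open>M\<close> onto the line spanned by \<open>z \<in> Y\<close>, so every endomorphism of \<open>M\<close>
  acts on \<open>z\<close> by a scalar.  This forces \<open>Y\<close> to occur exactly once in \<open>M\<close>.\<close>

theorem (in induced_modules) unique_summand:
  assumes K: "field K" and alg: "assoc_algebra K B"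
    and flA: "finite_length A (regular_module A)" and flB: "finite_length B (regular_module B)"
    and t: "t \<in> carrier M" and cyc: "\<And>m. m \<in> carrier M \<Longrightarrow> \<exists>b\<in>carrier B. m = b \<odot>\<^bsub>M\<^esub> t"
    and summand: "direct_summand B M Y" and ind: "indecomposable B MY"
    and \<eta>: "\<eta> \<in> carrier B" and t0: "t0 \<in> carrier M" and z: "z = \<eta> \<odot>\<^bsub>M\<^esub> t0" "z \<in> Y" "z \<noteq> \<zero>\<^bsub>M\<^esub>"
    and line: "\<And>m. m \<in> carrier M \<Longrightarrow> \<exists>c\<in>carrier K. \<eta> \<odot>\<^bsub>M\<^esub> m = (c \<odot>\<^bsub>B\<^esub> \<one>\<^bsub>B\<^esub>) \<odot>\<^bsub>M\<^esub> z"
  shows "unique_summand_with_quotient A IndM indY"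
proof -
  interpret K: field K by (rule K)
  interpret BA: assoc_algebra K B by (rule alg)
  note YM = M.submoduleD(2)[OF Y]
  have zM: "z \<in> carrier M" using z(2) YM by simp
  define sc where "sc c = c \<odot>\<^bsub>B\<^esub> \<one>\<^bsub>B\<^esub>" for c
  have sc: "sc c \<in> carrier B" if "c \<in> carrier K" for c
    unfolding sc_def using that by (intro BA.smult_closed) simp_all
  have sc_zero: "sc \<zero>\<^bsub>K\<^esub> \<odot>\<^bsub>M\<^esub> m = \<zero>\<^bsub>M\<^esub>" if "m \<in> carrier M" for m
    unfolding sc_def using that by (simp add: M.smult_zero_left)
  \<comment> \<open>Scalars act as elements \<open>c 1\<close> of \<open>B\<close>; an inverse in
    the field makes a nonzero one act injectively.\<close>
  have sc_nonzero: "sc c \<odot>\<^bsub>M\<^esub> m \<noteq> \<zero>\<^bsub>M\<^esub>"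
    if c: "c \<in> carrier K" "c \<noteq> \<zero>\<^bsub>K\<^esub>" and m: "m \<in> carrier M" "m \<noteq> \<zero>\<^bsub>M\<^esub>" for c m
  proof
    assume 0: "sc c \<odot>\<^bsub>M\<^esub> m = \<zero>\<^bsub>M\<^esub>"
    have inv: "inv\<^bsub>K\<^esub> c \<in> carrier K" "inv\<^bsub>K\<^esub> c \<otimes>\<^bsub>K\<^esub> c = \<one>\<^bsub>K\<^esub>" using c K.field_Units by auto
    have "sc (inv\<^bsub>K\<^esub> c) \<otimes>\<^bsub>B\<^esub> sc c = \<one>\<^bsub>B\<^esub>"
      unfolding sc_def using inv c(1)
      by (simp add: BA.smult_mult_left BA.smult_assoc1[symmetric])
    then have "m = sc (inv\<^bsub>K\<^esub> c) \<odot>\<^bsub>M\<^esub> (sc c \<odot>\<^bsub>M\<^esub> m)"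
      using M.smult_assoc[OF sc[OF inv(1)] sc[OF c(1)] m(1)] M.smult_one[OF m(1)] by simp
    then show False using 0 M.smult_zero_right[OF sc[OF inv(1)]] m(2) by simp
  qed
  have flM: "finite_length B M"
  proof -
    let ?f = "\<lambda>b. b \<odot>\<^bsub>M\<^esub> t"
    have "?f \<in> mod_hom B (regular_module B) M"
      using t by (intro mod_homI) (simp_all add: regular_module_def M.smult_closed M.smult_add_left M.smult_assoc)
    then interpret f: left_module_hom B "regular_module B" M ?f
      by (intro left_module_hom.intro left_module_hom_axioms.intro M.left_module_axioms
          regular_left_module B.ring_axioms)
    have "?f ` carrier (regular_module B) = carrier M"
    proof (rule equalityI)
      show "?f ` carrier (regular_module B) \<subseteq> carrier M" using f.hom_closed by auto
      show "carrier M \<subseteq> ?f ` carrier (regular_module B)"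
        using cyc by (intro subsetI) (fastforce simp: regular_module_def)
    qed
    then show ?thesis by (rule f.finite_length_surj[OF flB])
  qed
  obtain Y' where compl: "complementary B M Y Y'" using summand unfolding direct_summand_def by (elim exE)
  obtain p where p: "p \<in> mod_hom B M MY" and p_id: "\<And>y. y \<in> Y \<Longrightarrow> p y = y"
    using M.complementary_projection[OF compl] by blast
  \<comment> \<open>Since \<open>z = \<eta> t0\<close>, a homomorphism sends it to
    \<open>\<eta> (q t0)\<close>, which lies on the line of \<open>z\<close>.\<close>
  have line': "\<exists>c\<in>carrier K. q z = sc c \<odot>\<^bsub>M\<^esub> z" if q: "q \<in> mod_hom B M MY" for q
  proof -
    have "q z = \<eta> \<odot>\<^bsub>M\<^esub> q t0" using mod_homD(3)[OF q \<eta> t0] z(1) by simp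
    moreover have "q t0 \<in> carrier M" using mod_homD(1)[OF q t0] YM by simp
    ultimately show ?thesis using line[of "q t0"] unfolding sc_def by simp
  qed
  have "\<exists>!i. i < n \<and> has_quotient_isomorphic_to A (IndM\<lparr>carrier := N i\<rparr>) indY"
    if dec: "indecomposable_decomposition A IndM n N" for n N
  proof -
    have ds: "internal_direct_sum A IndM {..<n} N"
      using dec by (simp add: indecomposable_decomposition_def)
    have sub: "submodule (N i) A IndM" if "i < n" for i
      using ds that by (simp add: internal_direct_sum_def)
    obtain pi where pi: "\<And>i. i \<in> {..<n} \<Longrightarrow> pi i \<in> mod_hom A IndM IndM"
      "\<And>i u. \<lbrakk>i \<in> {..<n}; u \<in> carrier IndM\<rbrakk> \<Longrightarrow> pi i u \<in> N i"
      "\<And>u. u \<in> carrier IndM \<Longrightarrow> u = (\<Oplus>\<^bsub>IndM\<^esub>i\<in>{..<n}. pi i u)"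
      "\<And>i u. \<lbrakk>i \<in> {..<n}; u \<in> N i\<rbrakk> \<Longrightarrow> pi i u = u"
      "\<And>i j u. \<lbrakk>i \<in> {..<n}; j \<in> {..<n}; i \<noteq> j; u \<in> N i\<rbrakk> \<Longrightarrow> pi j u = \<zero>\<^bsub>IndM\<^esub>"
      by (rule PM.internal_direct_sum_projections[OF ds finite_lessThan]) (rule that; assumption)
    show ?thesis
    proof (rule ex_ex1I)
      obtain f where f: "f \<in> mod_hom A IndM indY" "\<And>m. m \<in> carrier M \<Longrightarrow> f (\<iota> m) = \<kappa> (p m)"
        using exists_lift[OF p] by blast
      interpret f: left_module_hom A IndM indY f
        by (intro left_module_hom.intro left_module_hom_axioms.intro f PM.left_module_axioms QM.left_module_axioms)
      let ?g = "\<lambda>i u. f (pi i u)"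
      have g: "?g i \<in> mod_hom A IndM indY" if "i < n" for i
        using that by (intro mod_hom_comp[OF pi(1) f(1)]) simp
      \<comment> \<open>The maps \<open>?g i\<close> are the components of \<open>f\<close>, which
        is induced by the projection \<open>p\<close> onto \<open>Y\<close>. They add up to
        \<open>f\<close>, and \<open>f (\<iota> z) = \<kappa> z\<close> is nonzero because
        \<open>\<rho>\<close> recovers \<open>z\<close> from it.\<close>
      have "\<exists>i<n. flat (?g i) z \<noteq> \<zero>\<^bsub>M\<^esub>"
      proof (rule ccontr)
        assume *: "\<not> (\<exists>i<n. flat (?g i) z \<noteq> \<zero>\<^bsub>M\<^esub>)"
        have "f (pi i (\<iota> z)) = \<zero>\<^bsub>indY\<^esub>" if i: "i < n" for i
        proof -
          have "f (pi i (\<iota> z)) = \<kappa> \<zero>\<^bsub>M\<^esub>" using hom_\<iota>[OF g[OF i] zM] * i by simp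
          also have "\<dots> = \<zero>\<^bsub>indY\<^esub>"
            unfolding \<kappa>_def using Q.pure_zero_right[OF e_Ae] by (simp add: restrict_simps)
          finally show ?thesis .
        qed
        then have "(\<Oplus>\<^bsub>indY\<^esub>i\<in>{..<n}. f (pi i (\<iota> z))) = (\<Oplus>\<^bsub>indY\<^esub>i\<in>{..<n}. \<zero>\<^bsub>indY\<^esub>)"
          by (intro Q.T.finsum_cong') simp_all
        also have "\<dots> = \<zero>\<^bsub>indY\<^esub>" by simp
        also have "(\<Oplus>\<^bsub>indY\<^esub>i\<in>{..<n}. f (pi i (\<iota> z))) = f (\<Oplus>\<^bsub>IndM\<^esub>i\<in>{..<n}. pi i (\<iota> z))"
          using mod_homD(1)[OF pi(1)] \<iota>_closed[OF zM] by (intro f.hom_finsum[symmetric]) auto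
        also have "(\<Oplus>\<^bsub>IndM\<^esub>i\<in>{..<n}. pi i (\<iota> z)) = \<iota> z"
          by (rule pi(3)[OF \<iota>_closed[OF zM], symmetric])
        finally have "\<kappa> z = \<zero>\<^bsub>indY\<^esub>" using f(2)[OF zM] p_id[OF z(2)] by simp
        also have "\<dots> = \<kappa> \<zero>\<^bsub>M\<^esub>"
          unfolding \<kappa>_def using Q.pure_zero_right[OF e_Ae] by (simp add: restrict_simps)
        finally have "\<rho> (\<kappa> z) = \<rho> (\<kappa> \<zero>\<^bsub>M\<^esub>)" by simp
        then show False using z(2,3) \<rho>_\<kappa> M.submoduleD(3)[OF Y] by simp
      qed
      then obtain i where i: "i < n" "flat (?g i) z \<noteq> \<zero>\<^bsub>M\<^esub>" by (elim exE conjE)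
      let ?q = "flat (?g i)"
      have q: "?q \<in> mod_hom B M MY" by (rule flat_hom[OF g[OF i(1)]])
      have qY: "?q \<in> mod_hom B MY MY" using mod_hom_restrict[OF q M.submoduleD(1)[OF Y]] by simp
      obtain c where c: "c \<in> carrier K" "?q z = sc c \<odot>\<^bsub>M\<^esub> z" using line'[OF q] by (elim bexE)
      have c0: "c \<noteq> \<zero>\<^bsub>K\<^esub>" using i(2) c(2) sc_zero[OF zM] by auto
      \<comment> \<open>\<open>?q\<close> multiplies \<open>z\<close> by the nonzero scalar
        \<open>c\<close>, so no power of it kills \<open>z\<close>; Fitting's lemma leaves
        surjectivity on \<open>Y\<close>.\<close>
      have "(?q ^^ k) z \<noteq> \<zero>\<^bsub>M\<^esub>" for k
      proof (induction k)
        case (Suc k)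
        note qk = mod_hom_funpow[OF qY, of k]
        have "(?q ^^ Suc k) z = (?q ^^ k) (sc c \<odot>\<^bsub>M\<^esub> z)"
          unfolding funpow_Suc_right comp_apply c(2) ..
        also have "\<dots> = sc c \<odot>\<^bsub>M\<^esub> (?q ^^ k) z"
          using mod_homD(3)[OF qk sc[OF c(1)], of z] z(2) by simp
        also have "\<dots> \<noteq> \<zero>\<^bsub>M\<^esub>"
          using mod_homD(1)[OF qk, of z] z(2) YM by (intro sc_nonzero[OF c(1) c0 _ Suc.IH]) simp
        finally show ?case .
      qed (use z(3) in simp)
      then have nn: "\<not> (\<exists>k. \<forall>y\<in>carrier MY. (?q ^^ k) y = \<zero>\<^bsub>MY\<^esub>)" using z(2) by auto
      have "?q ` carrier MY = carrier MY"
        using MY.indecomposable_endomorphism[OF M.finite_length_submodule[OF flM Y] ind qY] nn by argo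
      then have "Y \<subseteq> ?q ` carrier M" using M.submoduleD(1)[OF Y] by auto
      moreover have "?q ` carrier M \<subseteq> Y" using mod_homD(1)[OF q] by auto
      ultimately have "?q ` carrier M = Y" by (intro equalityI)
      then have surj: "?g i ` carrier IndM = carrier indY" by (rule surj_flat[OF g[OF i(1)]])
      \<comment> \<open>\<open>?g i\<close> factors through the summand \<open>N i\<close>, so its
        surjectivity passes to \<open>f\<close> restricted to \<open>N i\<close>.\<close>
      have fN: "f \<in> mod_hom A (IndM\<lparr>carrier := N i\<rparr>) indY"
        by (rule mod_hom_restrict[OF f(1) PM.submoduleD(1)[OF sub[OF i(1)]]])
      interpret fN: left_module_hom A "IndM\<lparr>carrier := N i\<rparr>" indY f
        by (intro left_module_hom.intro left_module_hom_axioms.intro fN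
            PM.submodule_left_module[OF sub[OF i(1)]] QM.left_module_axioms)
      have "f ` carrier (IndM\<lparr>carrier := N i\<rparr>) = carrier indY"
      proof (rule equalityI)
        show "f ` carrier (IndM\<lparr>carrier := N i\<rparr>) \<subseteq> carrier indY" using fN.hom_closed by auto
        have "?g i ` carrier IndM \<subseteq> f ` N i" using pi(2)[of i] i(1) by auto
        then show "carrier indY \<subseteq> f ` carrier (IndM\<lparr>carrier := N i\<rparr>)" using surj by simp
      qed
      then have "has_quotient_isomorphic_to A (IndM\<lparr>carrier := N i\<rparr>) indY" by (rule fN.surj_has_quotient)
      then show "\<exists>i. i < n \<and> has_quotient_isomorphic_to A (IndM\<lparr>carrier := N i\<rparr>) indY"
        using i(1) by (intro exI conjI)
    next
      \<comment> \<open>A map of one summand onto \<open>ind Y\<close> is extended by zero to the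
        other summands, so that it becomes a map on \<open>Ind M\<close> and \<open>flat\<close>
        applies.\<close>
      have surjection: "\<exists>g. g \<in> mod_hom A IndM indY \<and> flat g z \<noteq> \<zero>\<^bsub>M\<^esub> \<and>
          (\<forall>u\<in>carrier IndM. g (pi i u) = g u) \<and>
          (\<forall>j<n. j \<noteq> i \<longrightarrow> (\<forall>u\<in>carrier IndM. g (pi j u) = \<zero>\<^bsub>indY\<^esub>))"
        if i: "i < n" and quot: "has_quotient_isomorphic_to A (IndM\<lparr>carrier := N i\<rparr>) indY" for i
      proof -
        obtain g0 where g0: "g0 \<in> mod_hom A (IndM\<lparr>carrier := N i\<rparr>) indY"
          "g0 ` carrier (IndM\<lparr>carrier := N i\<rparr>) = carrier indY"
          using left_module.has_quotientD[OF PM.submodule_left_module[OF sub[OF i]] quot] by blast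
        interpret g0: left_module_hom A "IndM\<lparr>carrier := N i\<rparr>" indY g0
          by (intro left_module_hom.intro left_module_hom_axioms.intro g0(1)
              PM.submodule_left_module[OF sub[OF i]] QM.left_module_axioms)
        have "pi i \<in> mod_hom A IndM (IndM\<lparr>carrier := N i\<rparr>)"
          using mod_homD[OF pi(1)[of i]] pi(2)[of i] i by (intro mod_homI) simp_all
        from mod_hom_comp[OF this g0(1)] have g: "(\<lambda>u. g0 (pi i u)) \<in> mod_hom A IndM indY" .
        define g where "g = (\<lambda>u. g0 (pi i u))"
        have g: "g \<in> mod_hom A IndM indY" unfolding g_def by (rule g)
        have "g ` carrier IndM = carrier indY"
        proof (rule equalityI)
          show "g ` carrier IndM \<subseteq> carrier indY" using mod_homD(1)[OF g] by auto
          show "carrier indY \<subseteq> g ` carrier IndM"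
          proof
            fix w assume "w \<in> carrier indY"
            then have "w \<in> g0 ` N i" using g0(2) by simp
            then obtain u where u: "u \<in> N i" "w = g0 u" by (elim imageE)
            then have "w = g u" unfolding g_def using pi(4)[of i u] i by simp
            then show "w \<in> g ` carrier IndM" using PM.submoduleD(2)[OF sub[OF i] u(1)] by (rule image_eqI)
          qed
        qed
        then have surj: "flat g ` carrier M = Y" by (rule flat_surj[OF g])
        note q = flat_hom[OF g]
        \<comment> \<open>Surjectivity is used at \<open>p t0\<close>: a preimage \<open>m\<close>
          satisfies \<open>flat g (\<eta> m) = \<eta> (p t0) = p z = z\<close>, while
          \<open>\<eta> m\<close> is a multiple of \<open>z\<close>; so \<open>flat g\<close> cannot
          kill \<open>z\<close>.\<close>
        have "p t0 \<in> flat g ` carrier M" using mod_homD(1)[OF p t0] surj by simp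
        then obtain m where m: "m \<in> carrier M" "p t0 = flat g m" by (elim imageE)
        have "flat g (\<eta> \<odot>\<^bsub>M\<^esub> m) = z"
          using mod_homD(3)[OF q \<eta> m(1)] mod_homD(3)[OF p \<eta> t0] m(2) z(1) p_id[OF z(2)] by simp
        moreover obtain c where c: "c \<in> carrier K" "\<eta> \<odot>\<^bsub>M\<^esub> m = sc c \<odot>\<^bsub>M\<^esub> z"
          using line[OF m(1)] unfolding sc_def by (elim bexE)
        ultimately have "sc c \<odot>\<^bsub>M\<^esub> flat g z = z"
          using mod_homD(3)[OF q sc[OF c(1)] zM] by simp
        then have "flat g z \<noteq> \<zero>\<^bsub>M\<^esub>" using z(3) M.smult_zero_right[OF sc[OF c(1)]] by auto
        moreover have "g (pi i u) = g u" if "u \<in> carrier IndM" for u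
          unfolding g_def using pi(4)[of i "pi i u"] pi(2)[of i u] that i by simp
        moreover have "g (pi j u) = \<zero>\<^bsub>indY\<^esub>" if "j < n" "j \<noteq> i" "u \<in> carrier IndM" for j u
          unfolding g_def using pi(5)[of j i "pi j u"] pi(2)[of j u] that i g0.hom_zero by simp
        ultimately show ?thesis using g by (intro exI[of _ g] conjI ballI allI impI)
      qed
      fix i j
      assume "i < n \<and> has_quotient_isomorphic_to A (IndM\<lparr>carrier := N i\<rparr>) indY"
        and "j < n \<and> has_quotient_isomorphic_to A (IndM\<lparr>carrier := N j\<rparr>) indY"
      then have ij: "i < n" "has_quotient_isomorphic_to A (IndM\<lparr>carrier := N i\<rparr>) indY"
        "j < n" "has_quotient_isomorphic_to A (IndM\<lparr>carrier := N j\<rparr>) indY" by simp_all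
      show "i = j"
      proof (rule ccontr)
        assume ne: "i \<noteq> j"
        obtain g where g: "g \<in> mod_hom A IndM indY" "flat g z \<noteq> \<zero>\<^bsub>M\<^esub>"
          "\<forall>j<n. j \<noteq> i \<longrightarrow> (\<forall>u\<in>carrier IndM. g (pi j u) = \<zero>\<^bsub>indY\<^esub>)"
          using surjection[OF ij(1,2)] by (elim exE conjE)
        obtain g' where g': "g' \<in> mod_hom A IndM indY" "flat g' z \<noteq> \<zero>\<^bsub>M\<^esub>"
          "\<forall>u\<in>carrier IndM. g' (pi j u) = g' u"
          using surjection[OF ij(3,4)] by (elim exE conjE)
        have piz: "pi j (\<iota> z) \<in> carrier IndM"
          using mod_homD(1)[OF pi(1)[of j] \<iota>_closed[OF zM]] ij(3) by simp
        have pit: "pi j (\<iota> t0) \<in> carrier IndM"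
          using mod_homD(1)[OF pi(1)[of j] \<iota>_closed[OF t0]] ij(3) by simp
        \<comment> \<open>The projection commutes with \<open>h \<eta>\<close>, so the retraction of
          \<open>pi j (\<iota> z)\<close> is again \<open>\<eta>\<close> applied to a vector of
          \<open>M\<close>, that is, a multiple \<open>a\<close> of \<open>z\<close>. The maps
          \<open>g\<close> and \<open>g'\<close> will give contradictory information about
          \<open>a\<close>.\<close>
        have "pi j (\<iota> z) = h \<eta> \<odot>\<^bsub>IndM\<^esub> pi j (\<iota> t0)"
          using mod_homD(3)[OF pi(1)[of j] h_closed[OF \<eta>] \<iota>_closed[OF t0]] ij(3) \<iota>_smult[OF \<eta> t0] z(1) by simp
        then have "\<gamma> (pi j (\<iota> z)) = \<eta> \<odot>\<^bsub>M\<^esub> \<gamma> (pi j (\<iota> t0))" using \<gamma>_h[OF \<eta> pit] by simp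
        then obtain a where a: "a \<in> carrier K" "\<gamma> (pi j (\<iota> z)) = sc a \<odot>\<^bsub>M\<^esub> z"
          using line[OF \<gamma>_closed[OF pit]] unfolding sc_def by auto
        have \<rho>0: "\<rho> \<zero>\<^bsub>indY\<^esub> = \<zero>\<^bsub>M\<^esub>"
          using \<rho>_add[of "\<zero>\<^bsub>indY\<^esub>" "\<zero>\<^bsub>indY\<^esub>"] \<rho>_closed[of "\<zero>\<^bsub>indY\<^esub>"] YM by simp
        \<comment> \<open>\<open>g\<close> vanishes on the summand \<open>j\<close>, so
          \<open>a\<close> annihilates the nonzero vector \<open>flat g z\<close> and must be
          zero.\<close>
        have "flat g (\<gamma> (pi j (\<iota> z))) = \<rho> (g (pi j (\<iota> z)))"
          by (rule flat_\<gamma>[OF g(1) piz, symmetric])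
        also have "\<dots> = \<zero>\<^bsub>M\<^esub>" using g(3) ij(3) ne \<iota>_closed[OF zM] \<rho>0 by simp
        finally have "sc a \<odot>\<^bsub>M\<^esub> flat g z = \<zero>\<^bsub>M\<^esub>"
          unfolding a(2) using mod_homD(3)[OF flat_hom[OF g(1)] sc[OF a(1)] zM] by simp
        then have "a = \<zero>\<^bsub>K\<^esub>"
          using sc_nonzero[OF a(1) _ _ g(2)] mod_homD(1)[OF flat_hom[OF g(1)] zM] YM by auto
        then have "\<gamma> (pi j (\<iota> z)) = \<zero>\<^bsub>M\<^esub>" using a(2) sc_zero[OF zM] by simp
        \<comment> \<open>\<open>g'\<close> sees only the summand \<open>j\<close>: it agrees at
          \<open>\<iota> z\<close> and at \<open>pi j (\<iota> z)\<close>, whose retraction is zero.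
          Hence \<open>flat g' z\<close> would vanish.\<close>
        then have "flat g' \<zero>\<^bsub>M\<^esub> = \<rho> (g' (pi j (\<iota> z)))" using flat_\<gamma>[OF g'(1) piz] by simp
        also have "\<dots> = flat g' z" using g'(3) \<iota>_closed[OF zM] by (simp add: flat_def)
        finally have "flat g' z = flat g' \<zero>\<^bsub>M\<^esub>" by simp
        also have "\<dots> = \<zero>\<^bsub>MY\<^esub>"
          by (rule left_module_hom.hom_zero[OF left_module_hom.intro[OF M.left_module_axioms
              MY.left_module_axioms left_module_hom_axioms.intro[OF flat_hom[OF g'(1)]]]])
        finally show False using g'(2) by simp
      qed
    qed
  qed
  moreover have "\<exists>n N. indecomposable_decomposition A IndM n N"
    by (rule PM.exists_indecomposable_decomposition[OF finite_length_cyclic[OF flA t cyc]])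
  ultimately show ?thesis unfolding unique_summand_with_quotient_def by (intro conjI allI impI)
qed

section \<open>Stratified algebras\<close>

lemma assoc_algebra_left_module: "assoc_algebra K A \<Longrightarrow> left_module K A"
  by (intro module_imp_left_module assoc_algebra.axioms(1))

text \<open>Left ideals are subspaces, as \<open>c x = (c 1) x\<close>, so a rank for subspaces also
  ranks left ideals.\<close>

lemma finite_length_regular:
  fixes A :: "('k, 'a) module"
  assumes alg: "assoc_algebra K A" and fl: "finite_length K A"
  shows "finite_length A (regular_module A)"
proof -
  interpret assoc_algebra K A by (rule alg)
  interpret KA: left_module K A by (rule assoc_algebra_left_module[OF alg])
  interpret L: left_module A "regular_module A" by (rule regular_left_module[OF assoc_algebra.axioms(2)[OF alg]])
  have sub: "submodule N K A" if N: "submodule N A (regular_module A)" for N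
  proof (rule KA.left_submoduleI)
    note sN = L.submoduleD[OF N]
    show N1: "N \<subseteq> carrier A" "\<zero>\<^bsub>A\<^esub> \<in> N" using sN(1,3) by (simp_all add: regular_module_def)
    show "x \<oplus>\<^bsub>A\<^esub> y \<in> N" if "x \<in> N" "y \<in> N" for x y
      using sN(4)[OF that] by (simp add: regular_module_def)
    show "c \<odot>\<^bsub>A\<^esub> x \<in> N" if c: "c \<in> carrier K" and x: "x \<in> N" for c x
    proof -
      have xA: "x \<in> carrier A" using N1 x by auto
      have "(c \<odot>\<^bsub>A\<^esub> \<one>\<^bsub>A\<^esub>) \<otimes>\<^bsub>A\<^esub> x \<in> N"
        using sN(6)[of "c \<odot>\<^bsub>A\<^esub> \<one>\<^bsub>A\<^esub>" x] c x by (simp add: regular_module_def)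
      then show ?thesis using c xA by (simp add: smult_mult_left)
    qed
  qed
  obtain rk :: "'a set \<Rightarrow> nat" and b where *: "\<forall>N. submodule N K A \<longrightarrow> rk N \<le> b"
    "\<forall>N N'. submodule N K A \<longrightarrow> submodule N' K A \<longrightarrow> N \<subset> N' \<longrightarrow> rk N < rk N'"
    using fl unfolding finite_length_def by (elim exE conjE)
  show ?thesis
    by (rule finite_lengthI[of A _ rk b]) (use * sub in simp_all)
qed

lemma lin_basis_span:
  assumes V: "left_module K V" and b: "lin_basis K V I b"
  shows "finite (b ` I)" "b ` I \<subseteq> carrier V" "lin_span K V (b ` I) = carrier V"
proof -
  interpret left_module K V by (rule V)
  show "finite (b ` I)" using b by (simp add: lin_basis_def)
  show bI: "b ` I \<subseteq> carrier V" using b by (auto simp: lin_basis_def)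
  note W = submoduleD[OF lin_span_submodule[OF V bI]]
  show "lin_span K V (b ` I) = carrier V"
  proof (rule equalityI[OF W(1)], rule subsetI)
    fix x assume "x \<in> carrier V"
    then have "\<exists>!c. c \<in> I \<rightarrow>\<^sub>E carrier K \<and> x = (\<Oplus>\<^bsub>V\<^esub>i\<in>I. c i \<odot>\<^bsub>V\<^esub> b i)"
      using b by (simp add: lin_basis_def)
    then obtain c where c: "c \<in> I \<rightarrow>\<^sub>E carrier K" "x = (\<Oplus>\<^bsub>V\<^esub>i\<in>I. c i \<odot>\<^bsub>V\<^esub> b i)"
      by (elim ex1E conjE)
    have "(\<lambda>i. c i \<odot>\<^bsub>V\<^esub> b i) \<in> I \<rightarrow> lin_span K V (b ` I)"
    proof
      fix i assume i: "i \<in> I"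
      then have "b i \<in> lin_span K V (b ` I)" using lin_span_superset[of "b ` I" K V] by auto
      moreover have "c i \<in> carrier K" using c(1) i by auto
      ultimately show "c i \<odot>\<^bsub>V\<^esub> b i \<in> lin_span K V (b ` I)" by (intro W(6))
    qed
    then show "x \<in> lin_span K V (b ` I)"
      unfolding c(2) using b
      by (intro submodule_finsum_closed[OF lin_span_submodule[OF V bI]]) (simp_all add: lin_basis_def)
  qed
qed

section \<open>Layers as threefold tensor products over the field\<close>

lemma vs_tensor_product:
  assumes K: "cring K" and V: "left_module K V" and W: "left_module K W"
  shows "tensor_product K V K (\<lambda>x c. c \<odot>\<^bsub>V\<^esub> x) W"
proof -
  interpret K: cring K by (rule K)
  interpret V: left_module K V by (rule V)
  interpret W: left_module K W by (rule W)
  show ?thesis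
  proof (intro tensor_product.intro tensor_product_axioms.intro)
    fix a x r assume "a \<in> carrier K" "x \<in> carrier V" "r \<in> carrier K"
    then show "r \<odot>\<^bsub>V\<^esub> (a \<odot>\<^bsub>V\<^esub> x) = a \<odot>\<^bsub>V\<^esub> (r \<odot>\<^bsub>V\<^esub> x)"
      by (simp add: V.smult_assoc[symmetric] K.m_comm)
  qed (simp_all add: K.ring_axioms V W.M.abelian_group_axioms V.smult_closed W.smult_closed)
qed

locale inflation_layer = K: cring K + A: left_module K A + B: left_module K B + V: left_module K V
  for K :: "'k ring" and A :: "('k, 'a) module" and B :: "('k, 'b) module" and V :: "('k, 'v) module" +
  fixes inc
  assumes inc: "inc \<in> mod_hom K (vs_tensor K (vs_tensor K B V) V) A"
begin

sublocale T1: tensor_product K B K "\<lambda>x c. c \<odot>\<^bsub>B\<^esub> x" V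
  by (rule vs_tensor_product[OF K.cring_axioms B.left_module_axioms V.left_module_axioms])

sublocale T2: tensor_product K T1.T K "\<lambda>x c. c \<odot>\<^bsub>T1.T\<^esub> x" V
  by (rule vs_tensor_product[OF K.cring_axioms T1.T_left_module V.left_module_axioms])

definition el where "el b x y = inc (T2.pure (T1.pure b x) y)"

lemmas incD = mod_homD[OF inc]

lemma el_closed: "\<lbrakk>b \<in> carrier B; x \<in> carrier V; y \<in> carrier V\<rbrakk> \<Longrightarrow> el b x y \<in> carrier A"
  unfolding el_def by (intro incD T2.pure_closed T1.pure_closed)

lemma el_add1: "\<lbrakk>b \<in> carrier B; b' \<in> carrier B; x \<in> carrier V; y \<in> carrier V\<rbrakk>
    \<Longrightarrow> el (b \<oplus>\<^bsub>B\<^esub> b') x y = el b x y \<oplus>\<^bsub>A\<^esub> el b' x y"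
  unfolding el_def
  by (simp add: T1.pure_add_left T1.pure_closed T2.pure_add_left T2.pure_closed incD)

lemma el_add2: "\<lbrakk>b \<in> carrier B; x \<in> carrier V; x' \<in> carrier V; y \<in> carrier V\<rbrakk>
    \<Longrightarrow> el b (x \<oplus>\<^bsub>V\<^esub> x') y = el b x y \<oplus>\<^bsub>A\<^esub> el b x' y"
  unfolding el_def
  by (simp add: T1.pure_add_right T1.pure_closed T2.pure_add_left T2.pure_closed incD)

lemma el_add3: "\<lbrakk>b \<in> carrier B; x \<in> carrier V; y \<in> carrier V; y' \<in> carrier V\<rbrakk>
    \<Longrightarrow> el b x (y \<oplus>\<^bsub>V\<^esub> y') = el b x y \<oplus>\<^bsub>A\<^esub> el b x y'"
  unfolding el_def
  by (simp add: T1.pure_closed T2.pure_add_right T2.pure_closed incD)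

lemma el_smult1: "\<lbrakk>c \<in> carrier K; b \<in> carrier B; x \<in> carrier V; y \<in> carrier V\<rbrakk>
    \<Longrightarrow> el (c \<odot>\<^bsub>B\<^esub> b) x y = c \<odot>\<^bsub>A\<^esub> el b x y"
  unfolding el_def
  by (simp add: T1.smult_pure[symmetric] T1.pure_closed T2.smult_pure[symmetric] T2.pure_closed incD)

lemma el_smult2: "\<lbrakk>c \<in> carrier K; b \<in> carrier B; x \<in> carrier V; y \<in> carrier V\<rbrakk>
    \<Longrightarrow> el b (c \<odot>\<^bsub>V\<^esub> x) y = c \<odot>\<^bsub>A\<^esub> el b x y"
  using el_smult1[of c b x y] by (simp add: el_def T1.pure_balanced)

lemma el_smult3:
  assumes "c \<in> carrier K" "b \<in> carrier B" "x \<in> carrier V" "y \<in> carrier V"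
  shows "el b x (c \<odot>\<^bsub>V\<^esub> y) = c \<odot>\<^bsub>A\<^esub> el b x y"
proof -
  have "el b x (c \<odot>\<^bsub>V\<^esub> y) = inc (T2.pure (c \<odot>\<^bsub>T1.T\<^esub> T1.pure b x) y)"
    unfolding el_def using T2.pure_balanced[of "T1.pure b x" c y] assms by (simp add: T1.pure_closed)
  also have "\<dots> = el (c \<odot>\<^bsub>B\<^esub> b) x y" unfolding el_def using assms by (simp add: T1.smult_pure)
  finally show ?thesis using el_smult1[OF assms] by simp
qed

text \<open>One tensor induction for each of the two tensor signs, the outer one first.\<close>

lemma layer_induct [consumes 1, case_names el add]:
  assumes a: "a \<in> inc ` carrier T2.T"
    and el: "\<And>b x y. \<lbrakk>b \<in> carrier B; x \<in> carrier V; y \<in> carrier V\<rbrakk> \<Longrightarrow> P (el b x y)"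
    and add: "\<And>a a'. \<lbrakk>a \<in> carrier A; a' \<in> carrier A; P a; P a'\<rbrakk> \<Longrightarrow> P (a \<oplus>\<^bsub>A\<^esub> a')"
  shows "P a"
proof -
  obtain u where u: "u \<in> carrier T2.T" "a = inc u" using a by (elim imageE)
  from u(1) have "P (inc u)"
  proof (induction rule: T2.tensor_induct)
    case (pure w y)
    from pure(1) show ?case
    proof (induction rule: T1.tensor_induct)
      case (pure b x)
      then show ?case using el \<open>y \<in> carrier V\<close> unfolding el_def by simp
    next
      case (add w w')
      then show ?case
        using \<open>y \<in> carrier V\<close> assms(3)[of "inc (T2.pure w y)" "inc (T2.pure w' y)"]
        by (simp add: T2.pure_add_left incD T2.pure_closed)
    qed
  next
    case (add u v)
    then show ?case using assms(3)[of "inc u" "inc v"] by (simp add: incD)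
  qed
  then show ?thesis using u(2) by simp
qed

lemma layer_submodule: "submodule (inc ` carrier T2.T) K A"
  by (rule left_module_hom.image_submodule[OF left_module_hom.intro[OF T2.T_left_module
      A.left_module_axioms left_module_hom_axioms.intro[OF inc]]])
    (rule left_module.carrier_submodule[OF T2.T_left_module])

text \<open>Trilinearity: elements built from spanning vectors span, as is seen by freeing one
  argument at a time.\<close>

lemma layer_span:
  assumes SB: "finite SB" "SB \<subseteq> carrier B" "lin_span K B SB = carrier B"
    and SV: "finite SV" "SV \<subseteq> carrier V" "lin_span K V SV = carrier V"
  shows "\<exists>S. finite S \<and> S \<subseteq> carrier A \<and> inc ` carrier T2.T \<subseteq> lin_span K A S"
proof (intro exI conjI)
  let ?S = "(\<lambda>(b, x, y). el b x y) ` (SB \<times> SV \<times> SV)"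
  show "finite ?S" using SB(1) SV(1) by simp
  show S: "?S \<subseteq> carrier A"
  proof
    fix a assume "a \<in> ?S"
    then obtain b x y where "b \<in> SB" "x \<in> SV" "y \<in> SV" "a = el b x y" by auto
    then show "a \<in> carrier A" using el_closed[of b x y] SB(2) SV(2) by auto
  qed
  let ?W = "lin_span K A ?S"
  note W = A.submoduleD[OF lin_span_submodule[OF A.left_module_axioms S]]
  have 0: "el b x y \<in> ?W" if "b \<in> SB" "x \<in> SV" "y \<in> SV" for b x y
  proof -
    have "el b x y \<in> ?S" using that by (intro image_eqI[of _ _ "(b, x, y)"]) simp_all
    then show ?thesis by (rule subsetD[OF lin_span_superset])
  qed
  \<comment> \<open>The preimage of \<open>?W\<close> under a linear map is a subspace, so
    membership need only be tested on a spanning set.\<close>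
  have linear: "f v \<in> ?W" if f: "f \<in> mod_hom K U A" and U: "left_module K U"
    and span: "lin_span K U SU = carrier U" and gen: "\<And>s. s \<in> SU \<Longrightarrow> f s \<in> ?W"
    and SU: "SU \<subseteq> carrier U" and v: "v \<in> carrier U" for f and U :: "('k, 'u) module" and SU v
  proof -
    have "submodule {v \<in> carrier U. f v \<in> ?W} K U"
      by (rule left_module_hom.vimage_submodule[OF left_module_hom.intro[OF U A.left_module_axioms
          left_module_hom_axioms.intro[OF f]] lin_span_submodule[OF A.left_module_axioms S]])
    moreover have "SU \<subseteq> {v \<in> carrier U. f v \<in> ?W}" using gen SU by auto
    ultimately have "lin_span K U SU \<subseteq> {v \<in> carrier U. f v \<in> ?W}" by (rule lin_span_least)
    then show ?thesis using v span by auto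
  qed
  have 1: "el b x y \<in> ?W" if "b \<in> carrier B" "x \<in> SV" "y \<in> SV" for b x y
  proof -
    have xy: "x \<in> carrier V" "y \<in> carrier V" using that SV(2) by auto
    have "(\<lambda>b. el b x y) \<in> mod_hom K B A"
      using xy by (intro mod_homI) (simp_all add: el_closed el_add1 el_smult1)
    from linear[OF this B.left_module_axioms SB(3) _ SB(2) that(1)] show ?thesis
      using 0 that by simp
  qed
  have 2: "el b x y \<in> ?W" if "b \<in> carrier B" "x \<in> carrier V" "y \<in> SV" for b x y
  proof -
    have y: "y \<in> carrier V" using that SV(2) by auto
    have "(\<lambda>x. el b x y) \<in> mod_hom K V A"
      using y that(1) by (intro mod_homI) (simp_all add: el_closed el_add2 el_smult2)
    from linear[OF this V.left_module_axioms SV(3) _ SV(2) that(2)] show ?thesis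
      using 1 that by simp
  qed
  have 3: "el b x y \<in> ?W" if "b \<in> carrier B" "x \<in> carrier V" "y \<in> carrier V" for b x y
  proof -
    have "(\<lambda>y. el b x y) \<in> mod_hom K V A"
      using that(1,2) by (intro mod_homI) (simp_all add: el_closed el_add3 el_smult3)
    from linear[OF this V.left_module_axioms SV(3) _ SV(2) that(3)] show ?thesis
      using 2 that by simp
  qed
  show "inc ` carrier T2.T \<subseteq> ?W"
  proof
    fix a assume "a \<in> inc ` carrier T2.T"
    then show "a \<in> ?W" by (induction rule: layer_induct) (simp_all add: 3 W(4))
  qed
qed

end

locale stratification =
  fixes K :: "'k ring" and A :: "('k, 'a) module" and \<iota>A iB \<phi>
    and D :: "('k, 'a, 'b, 'v) strat_data"
  assumes K: "field K" and inflation: "iterated_inflation K A \<iota>A iB \<phi> D"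
begin

sublocale K: field K by (rule K)

sublocale A: assoc_algebra K A
  using inflation by (simp add: iterated_inflation_def)

sublocale KA: left_module K A by (rule assoc_algebra_left_module[OF A.assoc_algebra_axioms])

lemma inflationD:
  assumes "l \<le> depth D"
  shows "assoc_algebra K (input D l)" "module K (space D l)" "fin_dim K (space D l)"
    "incl D l \<in> mod_hom K (layer_space K D l) A"
    "\<And>x. x \<in> carrier (space D l) \<Longrightarrow> \<phi> l x \<in> mod_hom K (space D l) (input D l)"
    "ideal (layers_below K A D (Suc l)) A"
    "\<And>b b' x y x' y'. \<lbrakk>b \<in> carrier (input D l); b' \<in> carrier (input D l); x \<in> carrier (space D l);
      y \<in> carrier (space D l); x' \<in> carrier (space D l); y' \<in> carrier (space D l)\<rbrakk> \<Longrightarrow>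
      layer_elem K D l b x y \<otimes>\<^bsub>A\<^esub> layer_elem K D l b' x' y'
        \<ominus>\<^bsub>A\<^esub> layer_elem K D l (b \<otimes>\<^bsub>input D l\<^esub> \<phi> l y x' \<otimes>\<^bsub>input D l\<^esub> b') x y'
      \<in> layers_below K A D l"
  using inflation assms unfolding iterated_inflation_def by simp_all

lemma inflation_sum: "internal_direct_sum K A {..depth D} (layer K D)"
  using inflation unfolding iterated_inflation_def by simp

lemma inflation_layer:
  assumes l: "l \<le> depth D"
  shows "inflation_layer K A (input D l) (space D l) (incl D l)"
  using inflationD(4)[OF l] assoc_algebra_left_module[OF inflationD(1)[OF l]]
    module_imp_left_module[OF inflationD(2)[OF l]]
  unfolding layer_space_def
  by (intro inflation_layer.intro inflation_layer_axioms.intro K.cring_axioms KA.left_module_axioms)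

lemma layer_eq: "layer K D l = incl D l ` carrier (vs_tensor K (vs_tensor K (input D l) (space D l)) (space D l))"
  by (simp add: layer_def layer_space_def)

lemma layer_submodule: "l \<le> depth D \<Longrightarrow> submodule (layer K D l) K A"
  unfolding layer_eq by (rule inflation_layer.layer_submodule[OF inflation_layer])

text \<open>\<open>A\<close> is a finite sum of layers, each spanned by finitely many elements. So
  every input algebra, not only that of the layer under study, must be finitely spanned.\<close>

lemma finite_length_A:
  assumes fin: "\<And>l. l \<le> depth D \<Longrightarrow> \<exists>S. finite S \<and> S \<subseteq> carrier (input D l) \<and>
      lin_span K (input D l) S = carrier (input D l)"
  shows "finite_length A (regular_module A)"
proof (rule finite_length_regular[OF A.assoc_algebra_axioms])
  have "\<forall>l. \<exists>S. l \<le> depth D \<longrightarrow> finite S \<and> S \<subseteq> carrier A \<and> layer K D l \<subseteq> lin_span K A S"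
  proof (intro allI)
    fix l
    show "\<exists>S. l \<le> depth D \<longrightarrow> finite S \<and> S \<subseteq> carrier A \<and> layer K D l \<subseteq> lin_span K A S"
    proof (cases "l \<le> depth D")
      case True
      obtain SB where SB: "finite SB" "SB \<subseteq> carrier (input D l)"
        "lin_span K (input D l) SB = carrier (input D l)" using fin[OF True] by (elim exE conjE)
      obtain n v where "lin_basis K (space D l) {..<n::nat} v"
        using inflationD(3)[OF True] unfolding fin_dim_def by (elim exE)
      note SV = lin_basis_span[OF module_imp_left_module[OF inflationD(2)[OF True]] this]
      show ?thesis
        using inflation_layer.layer_span[OF inflation_layer[OF True] SB SV]
        unfolding layer_eq by simp
    qed simp
  qed
  then obtain S where S: "\<forall>l\<le>depth D. finite (S l) \<and> S l \<subseteq> carrier A \<and> layer K D l \<subseteq> lin_span K A (S l)"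
    by metis
  let ?S = "\<Union>l\<le>depth D. S l"
  have SA: "?S \<subseteq> carrier A" using S by auto
  note W = lin_span_submodule[OF KA.left_module_axioms SA]
  have layer: "layer K D l \<subseteq> lin_span K A ?S" if "l \<le> depth D" for l
  proof -
    have "S l \<subseteq> lin_span K A ?S" using that lin_span_superset[of ?S K A] by auto
    then have "lin_span K A (S l) \<subseteq> lin_span K A ?S" by (rule lin_span_least[OF W])
    then show ?thesis using S that by auto
  qed
  have "carrier A \<subseteq> lin_span K A ?S"
  proof
    fix a assume "a \<in> carrier A"
    then have "\<exists>!f. f \<in> (\<Pi>\<^sub>E l\<in>{..depth D}. layer K D l) \<and> a = (\<Oplus>\<^bsub>A\<^esub>l\<in>{..depth D}. f l)"
      using inflation_sum unfolding internal_direct_sum_def by simp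
    then obtain f where f: "f \<in> (\<Pi>\<^sub>E l\<in>{..depth D}. layer K D l)" "a = (\<Oplus>\<^bsub>A\<^esub>l\<in>{..depth D}. f l)"
      by (elim ex1E conjE)
    have "f l \<in> lin_span K A ?S" if "l \<in> {..depth D}" for l
      using PiE_mem[OF f(1) that] layer that by auto
    then show "a \<in> lin_span K A ?S"
      unfolding f(2) by (intro KA.submodule_finsum_closed[OF W]) auto
  qed
  then have "lin_span K A ?S = carrier A" using KA.submoduleD(1)[OF W] by auto
  then show "finite_length K A"
    using S SA by (intro finite_length_vector_space[OF K KA.left_module_axioms, of ?S]) auto
qed

lemma layer_elem_closed:
  assumes l: "l \<le> depth D" and "b \<in> carrier (input D l)" "x \<in> carrier (space D l)" "y \<in> carrier (space D l)"
  shows "layer_elem K D l b x y \<in> layer K D l" "layer_elem K D l b x y \<in> carrier A"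
proof -
  interpret L: inflation_layer K A "input D l" "space D l" "incl D l" by (rule inflation_layer[OF l])
  have "layer_elem K D l b x y = incl D l (L.T2.pure (L.T1.pure b x) y)" by (simp add: layer_elem_def)
  then show "layer_elem K D l b x y \<in> layer K D l"
    unfolding layer_eq using assms(2-4) L.T2.pure_closed[OF L.T1.pure_closed] by auto
  then show "layer_elem K D l b x y \<in> carrier A" using KA.submoduleD(2)[OF layer_submodule[OF l]] by simp
qed

text \<open>The index is shifted by one: the inflation axioms speak of \<open>J_l\<close>, the value
  at \<open>Suc l\<close>, and the value at \<open>0\<close> is the zero ideal
  \<open>J_{-1}\<close>.\<close>

lemma layers_below_ideal: "l \<le> Suc (depth D) \<Longrightarrow> ideal (layers_below K A D l) A"
proof (cases l)
  case 0
  have "layers_below K A D 0 = {\<zero>\<^bsub>A\<^esub>}" by (simp add: layers_below_def)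
  then show ?thesis using 0 A.zeroideal by simp
next
  case (Suc j)
  then show "l \<le> Suc (depth D) \<Longrightarrow> ?thesis" using inflationD(6) by simp
qed

lemma layers_below_Suc:
  assumes l: "l \<le> depth D" and a: "a \<in> layers_below K A D (Suc l)"
  obtains x y where "x \<in> layer K D l" "y \<in> layers_below K A D l" "a = x \<oplus>\<^bsub>A\<^esub> y"
proof -
  obtain f where f: "\<forall>j<Suc l. f j \<in> layer K D j" "a = (\<Oplus>\<^bsub>A\<^esub>j\<in>{..<Suc l}. f j)"
    using a unfolding layers_below_def by blast
  have fA: "f j \<in> carrier A" if "j \<le> l" for j
    using f(1) KA.submoduleD(2)[OF layer_submodule, of j "f j"] that l by simp
  have "a = f l \<oplus>\<^bsub>A\<^esub> (\<Oplus>\<^bsub>A\<^esub>j\<in>{..<l}. f j)"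
    unfolding f(2) lessThan_Suc using fA by (intro A.finsum_insert) auto
  moreover have "(\<Oplus>\<^bsub>A\<^esub>j\<in>{..<l}. f j) \<in> layers_below K A D l"
    unfolding layers_below_def using f(1) by (intro CollectI exI[of _ f]) simp
  ultimately show thesis using f(1) by (intro that) simp_all
qed

lemma layer_layers_below:
  assumes l: "l \<le> depth D" shows "layer K D l \<subseteq> layers_below K A D (Suc l)"
proof
  fix a assume a: "a \<in> layer K D l"
  let ?f = "\<lambda>j. if l = j then a else \<zero>\<^bsub>A\<^esub>"
  have "\<forall>j<Suc l. ?f j \<in> layer K D j"
    using a l KA.submoduleD(3)[OF layer_submodule] by simp
  moreover have "a = (\<Oplus>\<^bsub>A\<^esub>j\<in>{..<Suc l}. ?f j)"
    using A.finsum_singleton[of l "{..<Suc l}" "\<lambda>_. a"] KA.submoduleD(2)[OF layer_submodule[OF l] a] by simp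
  ultimately show "a \<in> layers_below K A D (Suc l)"
    unfolding layers_below_def by (intro CollectI exI[of _ ?f] conjI)
qed

text \<open>The projection onto layer \<open>l\<close> fixes the element as a member of that layer
  and kills it as a sum of members of lower layers.\<close>

lemma layer_inter_layers_below:
  assumes l: "l \<le> depth D" and a: "a \<in> layer K D l" "a \<in> layers_below K A D l"
  shows "a = \<zero>\<^bsub>A\<^esub>"
proof -
  obtain p where p: "\<And>i. i \<in> {..depth D} \<Longrightarrow> p i \<in> mod_hom K A A"
    "\<And>i x. \<lbrakk>i \<in> {..depth D}; x \<in> carrier A\<rbrakk> \<Longrightarrow> p i x \<in> layer K D i"
    "\<And>x. x \<in> carrier A \<Longrightarrow> x = (\<Oplus>\<^bsub>A\<^esub>i\<in>{..depth D}. p i x)"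
    "\<And>i x. \<lbrakk>i \<in> {..depth D}; x \<in> layer K D i\<rbrakk> \<Longrightarrow> p i x = x"
    "\<And>i j x. \<lbrakk>i \<in> {..depth D}; j \<in> {..depth D}; i \<noteq> j; x \<in> layer K D i\<rbrakk> \<Longrightarrow> p j x = \<zero>\<^bsub>A\<^esub>"
    by (rule KA.internal_direct_sum_projections[OF inflation_sum finite_atMost]) (rule that; assumption)
  obtain f where f: "\<forall>j<l. f j \<in> layer K D j" "a = (\<Oplus>\<^bsub>A\<^esub>j\<in>{..<l}. f j)"
    using a(2) unfolding layers_below_def by blast
  have fA: "f \<in> {..<l} \<rightarrow> carrier A"
  proof
    fix j assume "j \<in> {..<l}"
    then show "f j \<in> carrier A" using f(1) l by (intro KA.submoduleD(2)[OF layer_submodule, of j]) simp_all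
  qed
  have lD: "l \<in> {..depth D}" using l by simp
  interpret pl: left_module_hom K A A "p l"
    by (intro left_module_hom.intro left_module_hom_axioms.intro KA.left_module_axioms p(1) lD)
  have "a = p l a" using p(4)[OF lD a(1)] by simp
  also have "\<dots> = (\<Oplus>\<^bsub>A\<^esub>j\<in>{..<l}. p l (f j))" unfolding f(2) using fA by (intro pl.hom_finsum) simp_all
  also have "\<dots> = (\<Oplus>\<^bsub>A\<^esub>j\<in>{..<l}. \<zero>\<^bsub>A\<^esub>)"
  proof (rule A.finsum_cong'[OF refl])
    fix j assume "j \<in> {..<l}"
    then show "p l (f j) = \<zero>\<^bsub>A\<^esub>" using f(1) l by (intro p(5)[of j l]) simp_all
  qed simp
  also have "\<dots> = \<zero>\<^bsub>A\<^esub>" by simp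
  finally show ?thesis .
qed

text \<open>Modulo \<open>J_{l-1}\<close> the corner is the image of \<open>h\<close>: the
  multiplication rule of the layer puts \<open>e a e\<close> there. The layer meets
  \<open>J_{l-1}\<close> trivially and \<open>h\<close> is injective, so the representative in
  \<open>B_l\<close> is unique. As \<open>J_{l-1}\<close> is an ideal, taking representatives
  respects sums and products.\<close>

theorem split_corner:
  assumes l: "l \<le> depth D"
    and uv: "uvec D l \<in> carrier (space D l)" "vvec D l \<in> carrier (space D l)"
    and idem: "idem K D l \<otimes>\<^bsub>A\<^esub> idem K D l = idem K D l"
    and emb: "algebra_embedding K (input D l) (corner A (idem K D l)) (input_emb K D l)"
  shows "split_corner A (input D l) (idem K D l) (input_emb K D l) (corner_proj K A D l)"
proof -
  interpret L: inflation_layer K A "input D l" "space D l" "incl D l" by (rule inflation_layer[OF l])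
  interpret B: assoc_algebra K "input D l" by (rule inflationD(1)[OF l])
  interpret J: ideal "layers_below K A D l" A by (rule layers_below_ideal) (use l in simp)
  interpret J': ideal "layers_below K A D (Suc l)" A by (rule layers_below_ideal) (use l in simp)
  let ?B = "input D l" and ?e = "idem K D l" and ?h = "input_emb K D l" and ?J = "layers_below K A D l"
    and ?u = "uvec D l" and ?v = "vvec D l" and ?el = "layer_elem K D l" and ?pr = "corner_proj K A D l"
  let ?E = "carrier (corner A ?e)"
  have e_layer: "?e \<in> layer K D l" and e: "?e \<in> carrier A"
    using layer_elem_closed[OF l B.one_closed uv] by (simp_all add: idem_def)
  have hom: "?h \<in> ring_hom ?B (corner A ?e)" and inj: "inj_on ?h (carrier ?B)"
    using emb by (simp_all add: algebra_embedding_def)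
  have hE: "?h b \<in> ?E" if "b \<in> carrier ?B" for b using ring_hom_closed[OF hom that] .
  have h_mult: "?h (b \<otimes>\<^bsub>?B\<^esub> c) = ?h b \<otimes>\<^bsub>A\<^esub> ?h c" if "b \<in> carrier ?B" "c \<in> carrier ?B" for b c
    using ring_hom_mult[OF hom that] by (simp add: corner_def)
  have h_add: "?h (b \<oplus>\<^bsub>?B\<^esub> c) = ?h b \<oplus>\<^bsub>A\<^esub> ?h c" if "b \<in> carrier ?B" "c \<in> carrier ?B" for b c
    using ring_hom_add[OF hom that] by (simp add: corner_def)
  have h_one: "?h \<one>\<^bsub>?B\<^esub> = ?e" by (simp add: input_emb_def idem_def)
  have hA: "?h b \<in> carrier A" and h_layer: "?h b \<in> layer K D l" if "b \<in> carrier ?B" for b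
    using layer_elem_closed[OF l that uv] by (simp_all add: input_emb_def)
  have EA: "x \<in> carrier A" if "x \<in> ?E" for x using that e by (auto simp: corner_def)
  have exe: "?e \<otimes>\<^bsub>A\<^esub> x \<otimes>\<^bsub>A\<^esub> ?e = x" if x: "x \<in> ?E" for x
  proof -
    obtain a where a: "a \<in> carrier A" "x = ?e \<otimes>\<^bsub>A\<^esub> a \<otimes>\<^bsub>A\<^esub> ?e" using x by (auto simp: corner_def)
    have "?e \<otimes>\<^bsub>A\<^esub> x \<otimes>\<^bsub>A\<^esub> ?e = (?e \<otimes>\<^bsub>A\<^esub> ?e) \<otimes>\<^bsub>A\<^esub> a \<otimes>\<^bsub>A\<^esub> (?e \<otimes>\<^bsub>A\<^esub> ?e)"
      unfolding a(2) using a(1) e by (simp add: A.m_assoc)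
    then show ?thesis using a(2) idem by simp
  qed
  define cong where "cong a a' \<longleftrightarrow> a \<ominus>\<^bsub>A\<^esub> a' \<in> ?J" for a a'
  have cong_trans: "cong a c" if "cong a b" "cong b c" "a \<in> carrier A" "b \<in> carrier A" "c \<in> carrier A" for a b c
  proof -
    have "a \<ominus>\<^bsub>A\<^esub> c = (a \<ominus>\<^bsub>A\<^esub> b) \<oplus>\<^bsub>A\<^esub> (b \<ominus>\<^bsub>A\<^esub> c)"
      using that(3-5) by (simp add: a_minus_def A.a_assoc A.r_neg1)
    then show ?thesis using that(1,2) unfolding cong_def by simp
  qed
  have cong_sym: "cong b a" if "cong a b" "a \<in> carrier A" "b \<in> carrier A" for a b
  proof -
    have "b \<ominus>\<^bsub>A\<^esub> a = \<ominus>\<^bsub>A\<^esub> (a \<ominus>\<^bsub>A\<^esub> b)"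
      using that(2,3) by (simp add: a_minus_def A.minus_add A.a_comm)
    then show ?thesis using that(1) unfolding cong_def by simp
  qed
  have cong_add: "cong (a \<oplus>\<^bsub>A\<^esub> b) (a' \<oplus>\<^bsub>A\<^esub> b')" if "cong a a'" "cong b b'"
    "a \<in> carrier A" "a' \<in> carrier A" "b \<in> carrier A" "b' \<in> carrier A" for a a' b b'
  proof -
    have "(a \<oplus>\<^bsub>A\<^esub> b) \<ominus>\<^bsub>A\<^esub> (a' \<oplus>\<^bsub>A\<^esub> b') = (a \<ominus>\<^bsub>A\<^esub> a') \<oplus>\<^bsub>A\<^esub> (b \<ominus>\<^bsub>A\<^esub> b')"
      using that(3-6) by (simp add: a_minus_def A.minus_add A.a_ac)
    then show ?thesis using that(1,2) unfolding cong_def by simp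
  qed
  have cong_mult_right: "cong (a \<otimes>\<^bsub>A\<^esub> c) (b \<otimes>\<^bsub>A\<^esub> c)" if "cong a b"
    "a \<in> carrier A" "b \<in> carrier A" "c \<in> carrier A" for a b c
  proof -
    have "a \<otimes>\<^bsub>A\<^esub> c \<ominus>\<^bsub>A\<^esub> b \<otimes>\<^bsub>A\<^esub> c = (a \<ominus>\<^bsub>A\<^esub> b) \<otimes>\<^bsub>A\<^esub> c"
      using that(2-4) by (simp add: a_minus_def A.l_distr A.l_minus)
    then show ?thesis using that(1,4) J.I_r_closed unfolding cong_def by simp
  qed
  have cong_mult_left: "cong (c \<otimes>\<^bsub>A\<^esub> a) (c \<otimes>\<^bsub>A\<^esub> b)" if "cong a b"
    "a \<in> carrier A" "b \<in> carrier A" "c \<in> carrier A" for a b c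
  proof -
    have "c \<otimes>\<^bsub>A\<^esub> a \<ominus>\<^bsub>A\<^esub> c \<otimes>\<^bsub>A\<^esub> b = c \<otimes>\<^bsub>A\<^esub> (a \<ominus>\<^bsub>A\<^esub> b)"
      using that(2-4) by (simp add: a_minus_def A.r_distr A.r_minus)
    then show ?thesis using that(1,4) J.I_l_closed unfolding cong_def by simp
  qed
  have mult: "cong (?el b x y \<otimes>\<^bsub>A\<^esub> ?el b' x' y') (?el (b \<otimes>\<^bsub>?B\<^esub> \<phi> l y x' \<otimes>\<^bsub>?B\<^esub> b') x y')"
    if "b \<in> carrier ?B" "b' \<in> carrier ?B" "x \<in> carrier (space D l)" "y \<in> carrier (space D l)"
      "x' \<in> carrier (space D l)" "y' \<in> carrier (space D l)" for b b' x y x' y'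
    unfolding cong_def using inflationD(7)[OF l that] .
  have \<phi>: "\<phi> l x y \<in> carrier ?B" if "x \<in> carrier (space D l)" "y \<in> carrier (space D l)" for x y
    using mod_homD(1)[OF inflationD(5)[OF l that(1)] that(2)] .
  have el_closed: "?el b x y \<in> carrier A"
    if "b \<in> carrier ?B" "x \<in> carrier (space D l)" "y \<in> carrier (space D l)" for b x y
    using layer_elem_closed(2)[OF l that] .
  have L_el: "L.el b x y = ?el b x y" for b x y by (simp add: L.el_def layer_elem_def)
  \<comment> \<open>The layer rule is applied twice: \<open>(1 \<otimes> u \<otimes> v) (b \<otimes>
    x \<otimes> y) (1 \<otimes> u \<otimes> v)\<close> is congruent to
    \<open>\<phi>(v,x) b \<phi>(y,u) \<otimes> u \<otimes> v\<close>.\<close>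
  have e_layer_e: "\<exists>b\<in>carrier ?B. cong (?e \<otimes>\<^bsub>A\<^esub> a \<otimes>\<^bsub>A\<^esub> ?e) (?h b)" if "a \<in> layer K D l" for a
    using that unfolding layer_eq
  proof (induction rule: L.layer_induct)
    case (el b x y)
    define c where "c = \<one>\<^bsub>?B\<^esub> \<otimes>\<^bsub>?B\<^esub> \<phi> l ?v x \<otimes>\<^bsub>?B\<^esub> b"
    define d where "d = c \<otimes>\<^bsub>?B\<^esub> \<phi> l y ?u \<otimes>\<^bsub>?B\<^esub> \<one>\<^bsub>?B\<^esub>"
    have c: "c \<in> carrier ?B" using el uv \<phi> by (simp add: c_def)
    have d: "d \<in> carrier ?B" using el uv \<phi> c by (simp add: d_def)
    have "cong (?e \<otimes>\<^bsub>A\<^esub> ?el b x y) (?el c ?u y)"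
      unfolding idem_def c_def using el uv by (intro mult) simp_all
    then have "cong (?e \<otimes>\<^bsub>A\<^esub> ?el b x y \<otimes>\<^bsub>A\<^esub> ?e) (?el c ?u y \<otimes>\<^bsub>A\<^esub> ?e)"
      using el uv e c by (intro cong_mult_right) (simp_all add: el_closed)
    moreover have "cong (?el c ?u y \<otimes>\<^bsub>A\<^esub> ?e) (?h d)"
      unfolding idem_def input_emb_def d_def using el uv c by (intro mult) simp_all
    ultimately have "cong (?e \<otimes>\<^bsub>A\<^esub> ?el b x y \<otimes>\<^bsub>A\<^esub> ?e) (?h d)"
      by (rule cong_trans) (use el uv e c d in \<open>simp_all add: el_closed hA\<close>)
    then show ?case unfolding L_el using d by (intro bexI)
  next
    case (add a a')
    obtain b where b: "b \<in> carrier ?B" "cong (?e \<otimes>\<^bsub>A\<^esub> a \<otimes>\<^bsub>A\<^esub> ?e) (?h b)" using add(3) by (elim bexE)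
    obtain b' where b': "b' \<in> carrier ?B" "cong (?e \<otimes>\<^bsub>A\<^esub> a' \<otimes>\<^bsub>A\<^esub> ?e) (?h b')" using add(4) by (elim bexE)
    have "cong (?e \<otimes>\<^bsub>A\<^esub> a \<otimes>\<^bsub>A\<^esub> ?e \<oplus>\<^bsub>A\<^esub> ?e \<otimes>\<^bsub>A\<^esub> a' \<otimes>\<^bsub>A\<^esub> ?e) (?h b \<oplus>\<^bsub>A\<^esub> ?h b')"
      by (rule cong_add[OF b(2) b'(2)]) (use add e hA b b' in simp_all)
    then have "cong (?e \<otimes>\<^bsub>A\<^esub> (a \<oplus>\<^bsub>A\<^esub> a') \<otimes>\<^bsub>A\<^esub> ?e) (?h (b \<oplus>\<^bsub>?B\<^esub> b'))"
      using add e b b' by (simp add: A.l_distr A.r_distr h_add)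
    then show ?case using b(1) b'(1) by (intro bexI[of _ "b \<oplus>\<^bsub>?B\<^esub> b'"]) simp_all
  qed
  \<comment> \<open>The corner lies in \<open>J_l\<close> because \<open>e\<close> does. Its element
    is split into a part in layer \<open>l\<close> and a rest in \<open>J_{l-1}\<close>, which stays
    there when multiplied by \<open>e\<close> on both sides.\<close>
  have ex: "\<exists>b\<in>carrier ?B. cong x (?h b)" if x: "x \<in> ?E" for x
  proof -
    obtain a where a: "a \<in> carrier A" "x = ?e \<otimes>\<^bsub>A\<^esub> a \<otimes>\<^bsub>A\<^esub> ?e" using x by (auto simp: corner_def)
    have "?e \<in> layers_below K A D (Suc l)" using layer_layers_below[OF l] e_layer by auto
    then have "x \<in> layers_below K A D (Suc l)" unfolding a(2) using a(1) e by (simp add: J'.I_r_closed J'.I_l_closed)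
    then obtain y w where yw: "y \<in> layer K D l" "w \<in> ?J" "x = y \<oplus>\<^bsub>A\<^esub> w" by (rule layers_below_Suc[OF l])
    have yA: "y \<in> carrier A" using KA.submoduleD(2)[OF layer_submodule[OF l] yw(1)] .
    have wA: "w \<in> carrier A" using J.a_subset yw(2) by auto
    obtain b where b: "b \<in> carrier ?B" "cong (?e \<otimes>\<^bsub>A\<^esub> y \<otimes>\<^bsub>A\<^esub> ?e) (?h b)" using e_layer_e[OF yw(1)] by (elim bexE)
    have "?e \<otimes>\<^bsub>A\<^esub> w \<otimes>\<^bsub>A\<^esub> ?e \<in> ?J" using yw(2) e by (simp add: J.I_r_closed J.I_l_closed)
    then have 0: "cong (?e \<otimes>\<^bsub>A\<^esub> w \<otimes>\<^bsub>A\<^esub> ?e) \<zero>\<^bsub>A\<^esub>" unfolding cong_def a_minus_def using wA e by simp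
    have "x = ?e \<otimes>\<^bsub>A\<^esub> y \<otimes>\<^bsub>A\<^esub> ?e \<oplus>\<^bsub>A\<^esub> ?e \<otimes>\<^bsub>A\<^esub> w \<otimes>\<^bsub>A\<^esub> ?e"
      using exe[OF x] unfolding yw(3) using yA wA e by (simp add: A.l_distr A.r_distr)
    moreover have "cong (?e \<otimes>\<^bsub>A\<^esub> y \<otimes>\<^bsub>A\<^esub> ?e \<oplus>\<^bsub>A\<^esub> ?e \<otimes>\<^bsub>A\<^esub> w \<otimes>\<^bsub>A\<^esub> ?e) (?h b \<oplus>\<^bsub>A\<^esub> \<zero>\<^bsub>A\<^esub>)"
      by (rule cong_add[OF b(2) 0]) (use yA wA e hA b in simp_all)
    ultimately have "cong x (?h b)" using hA[OF b(1)] by simp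
    then show ?thesis using b(1) by (intro bexI)
  qed
  have uniq: "b = b'" if b: "b \<in> carrier ?B" "b' \<in> carrier ?B" and "cong (?h b) (?h b')" for b b'
  proof -
    have "?h b \<ominus>\<^bsub>A\<^esub> ?h b' \<in> ?J" using that(3) by (simp add: cong_def)
    moreover have "?h b \<ominus>\<^bsub>A\<^esub> ?h b' \<in> layer K D l"
      unfolding a_minus_def using KA.submoduleD(4,5)[OF layer_submodule[OF l]] h_layer b by simp
    ultimately have "?h b \<ominus>\<^bsub>A\<^esub> ?h b' = \<zero>\<^bsub>A\<^esub>" by (intro layer_inter_layers_below[OF l])
    then have "?h b = ?h b'" using hA b A.minus_equality[of "?h b" "\<ominus>\<^bsub>A\<^esub> ?h b'"] by (simp add: a_minus_def)
    then show ?thesis using inj b by (simp add: inj_on_def)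
  qed
  have pr_eqI: "?pr x = b" if x: "x \<in> carrier A" and b: "b \<in> carrier ?B" "cong x (?h b)" for x b
    unfolding corner_proj_def
  proof (rule the_equality)
    show "b \<in> carrier ?B \<and> x \<ominus>\<^bsub>A\<^esub> ?h b \<in> ?J" using b by (simp add: cong_def)
    fix b' assume b': "b' \<in> carrier ?B \<and> x \<ominus>\<^bsub>A\<^esub> ?h b' \<in> ?J"
    then have "cong x (?h b')" by (simp add: cong_def)
    then have "cong (?h b') (?h b)"
      using cong_trans[OF cong_sym[OF _ x hA] b(2) hA x hA, of b'] b(1) b' by simp
    then show "b' = b" using uniq b(1) b' by simp
  qed
  have pr: "?pr x \<in> carrier ?B \<and> cong x (?h (?pr x))" if x: "x \<in> ?E" for x
  proof -
    obtain b where b: "b \<in> carrier ?B" "cong x (?h b)" using ex[OF x] by (elim bexE)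
    then show ?thesis using pr_eqI[OF EA[OF x] b] by simp
  qed
  show ?thesis
  proof (intro split_corner.intro split_corner_axioms.intro)
    show "ring A" by (rule assoc_algebra.axioms(2)[OF A.assoc_algebra_axioms])
    show "ring ?B" by (rule assoc_algebra.axioms(2)[OF inflationD(1)[OF l]])
    show "?e \<in> carrier A" by (rule e)
    show "?e \<otimes>\<^bsub>A\<^esub> ?e = ?e" by (rule idem)
    show "?h \<one>\<^bsub>?B\<^esub> = ?e" by (rule h_one)
    fix x assume x: "x \<in> ?E"
    show "?pr x \<in> carrier ?B" using pr[OF x] ..
    fix y assume y: "y \<in> ?E"
    have c: "x \<in> carrier A" "y \<in> carrier A" "?h (?pr x) \<in> carrier A" "?h (?pr y) \<in> carrier A"
      "?pr x \<in> carrier ?B" "?pr y \<in> carrier ?B"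
      using EA x y pr hA by simp_all
    have "cong (x \<oplus>\<^bsub>A\<^esub> y) (?h (?pr x) \<oplus>\<^bsub>A\<^esub> ?h (?pr y))"
      using pr[OF x] pr[OF y] c by (intro cong_add) simp_all
    then show "?pr (x \<oplus>\<^bsub>A\<^esub> y) = ?pr x \<oplus>\<^bsub>?B\<^esub> ?pr y"
      using c by (intro pr_eqI) (simp_all add: h_add)
    have "cong (x \<otimes>\<^bsub>A\<^esub> y) (?h (?pr x) \<otimes>\<^bsub>A\<^esub> y)"
      using pr[OF x] c by (intro cong_mult_right) simp_all
    moreover have "cong (?h (?pr x) \<otimes>\<^bsub>A\<^esub> y) (?h (?pr x) \<otimes>\<^bsub>A\<^esub> ?h (?pr y))"
      using pr[OF y] c by (intro cong_mult_left) simp_all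
    ultimately have "cong (x \<otimes>\<^bsub>A\<^esub> y) (?h (?pr x) \<otimes>\<^bsub>A\<^esub> ?h (?pr y))"
      by (rule cong_trans) (use c in simp_all)
    then show "?pr (x \<otimes>\<^bsub>A\<^esub> y) = ?pr x \<otimes>\<^bsub>?B\<^esub> ?pr y"
      using c by (intro pr_eqI) (simp_all add: h_mult)
  next
    fix b assume b: "b \<in> carrier ?B"
    show "?h b \<in> ?E" by (rule hE[OF b])
    have "cong (?h b) (?h b)" unfolding cong_def a_minus_def using hA[OF b] by (simp add: A.r_neg)
    then show "?pr (?h b) = b" by (rule pr_eqI[OF hA[OF b] b])
    fix c assume c: "c \<in> carrier ?B"
    show "?h (b \<oplus>\<^bsub>?B\<^esub> c) = ?h b \<oplus>\<^bsub>A\<^esub> ?h c" by (rule h_add[OF b c])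
    show "?h (b \<otimes>\<^bsub>?B\<^esub> c) = ?h b \<otimes>\<^bsub>A\<^esub> ?h c" by (rule h_mult[OF b c])
  qed
qed

end

section \<open>Lengths of permutations\<close>

abbreviation adj :: "nat \<Rightarrow> nat \<Rightarrow> nat" where "adj i \<equiv> transpose i (Suc i)"

lemma adj_permutes: "\<lbrakk>1 \<le> i; i < m\<rbrakk> \<Longrightarrow> adj i permutes {1..m}"
  by (intro permutes_swap_id) auto

lemma adj_adj: "adj i \<circ> (adj i \<circ> w) = w" "(w \<circ> adj i) \<circ> adj i = w"
  by (simp_all add: fun_eq_iff)

text \<open>Multiplication by \<open>adj i\<close> on the left exchanges the values \<open>i\<close>
  and \<open>Suc i\<close>. Only the pair of positions carrying them changes its order, and it
  becomes an inversion.\<close>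

lemma perm_length_adj_left:
  assumes w: "w permutes {1..m}" and i: "1 \<le> i" "i < m" and lt: "inv' w i < inv' w (Suc i)"
  shows "perm_length m (adj i \<circ> w) = Suc (perm_length m w)"
proof -
  define a b where "a = inv' w i" and "b = inv' w (Suc i)"
  have wab: "w a = i" "w b = Suc i" unfolding a_def b_def by (simp_all add: permutes_inverses[OF w])
  have ab: "a < b" using lt by (simp add: a_def b_def)
  have mem: "a \<in> {1..m}" "b \<in> {1..m}"
    using permutes_in_image[OF w, of a] permutes_in_image[OF w, of b] wab i by auto
  have inj: "w p = w q \<longleftrightarrow> p = q" for p q using permutes_inj[OF w] by (simp add: inj_eq)
  let ?I = "{(p, q). 1 \<le> p \<and> p < q \<and> q \<le> m \<and> w q < w p}"
  have fin: "finite ?I" by (rule finite_subset[of _ "{1..m} \<times> {1..m}"]) auto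
  have "{(p, q). 1 \<le> p \<and> p < q \<and> q \<le> m \<and> (adj i \<circ> w) q < (adj i \<circ> w) p} = insert (a, b) ?I"
  proof (rule Set.set_eqI)
    fix pq :: "nat \<times> nat"
    obtain p q where pq: "pq = (p, q)" by (cases pq)
    \<comment> \<open>\<open>adj i\<close> keeps the order of any two distinct values except the
      neighbours \<open>i\<close> and \<open>Suc i\<close>.\<close>
    have key: "adj i y < adj i x \<longleftrightarrow> (y < x \<and> \<not> (x = Suc i \<and> y = i)) \<or> (x = i \<and> y = Suc i)"
      if "x \<noteq> y" for x y using that by (auto simp: transpose_def)
    have "(p, q) \<in> {(p, q). 1 \<le> p \<and> p < q \<and> q \<le> m \<and> (adj i \<circ> w) q < (adj i \<circ> w) p}
        \<longleftrightarrow> (p, q) \<in> insert (a, b) ?I"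
    proof (cases "p < q")
      case True
      have "(w p = Suc i \<and> w q = i) = (p = b \<and> q = a)" using inj wab by metis
      then have 1: "\<not> (w p = Suc i \<and> w q = i)" using ab True by auto
      have 2: "(w p = i \<and> w q = Suc i) = (p = a \<and> q = b)" using inj wab by metis
      have "w p \<noteq> w q" using inj True by simp
      then show ?thesis using key[of "w p" "w q"] 1 2 mem ab by auto
    qed (use ab in auto)
    then show "pq \<in> {(p, q). 1 \<le> p \<and> p < q \<and> q \<le> m \<and> (adj i \<circ> w) q < (adj i \<circ> w) p}
        \<longleftrightarrow> pq \<in> insert (a, b) ?I"
      unfolding pq .
  qed
  moreover have "(a, b) \<notin> ?I" using wab by simp
  ultimately show ?thesis using fin unfolding perm_length_def by simp
qed

text \<open>Inversions of a permutation and of its inverse correspond by passing from positions to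
  values and exchanging the two entries of the pair.\<close>

lemma perm_length_inv:
  assumes w: "w permutes {1..m}"
  shows "perm_length m (inv' w) = perm_length m w"
  unfolding perm_length_def
proof (rule bij_betw_same_card[of "\<lambda>(p, q). (inv' w q, inv' w p)"], rule bij_betw_byWitness[of _ "\<lambda>(p, q). (w q, w p)"])
  have img: "1 \<le> w p \<and> w p \<le> m" if "1 \<le> p" "p \<le> m" for p
    using permutes_in_image[OF w, of p] that by simp
  have img': "1 \<le> inv' w p \<and> inv' w p \<le> m" if "1 \<le> p" "p \<le> m" for p
    using permutes_in_image[OF permutes_inv[OF w], of p] that by simp
  show "(\<lambda>(p, q). (inv' w q, inv' w p)) ` {(i, j). 1 \<le> i \<and> i < j \<and> j \<le> m \<and> inv' w j < inv' w i}
      \<subseteq> {(i, j). 1 \<le> i \<and> i < j \<and> j \<le> m \<and> w j < w i}"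
    using img' by (auto simp: permutes_inverses[OF w])
  show "(\<lambda>(p, q). (w q, w p)) ` {(i, j). 1 \<le> i \<and> i < j \<and> j \<le> m \<and> w j < w i}
      \<subseteq> {(i, j). 1 \<le> i \<and> i < j \<and> j \<le> m \<and> inv' w j < inv' w i}"
    using img by (auto simp: permutes_inverses[OF w])
qed (auto simp: permutes_inverses[OF w])

lemma inv_comp_adj:
  assumes w: "w permutes {1..m}" and i: "1 \<le> i" "i < m"
  shows "inv' (w \<circ> adj i) = adj i \<circ> inv' w" "inv' (adj i \<circ> w) = inv' w \<circ> adj i"
  using permutes_inv_o(1)[OF w] o_inv_distrib[of w "adj i"] o_inv_distrib[of "adj i" w]
    permutes_bij[OF w] by simp_all

lemma perm_length_adj_right:
  assumes w: "w permutes {1..m}" and i: "1 \<le> i" "i < m" and lt: "w i < w (Suc i)"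
  shows "perm_length m (w \<circ> adj i) = Suc (perm_length m w)"
proof -
  have "perm_length m (w \<circ> adj i) = perm_length m (adj i \<circ> inv' w)"
    using perm_length_inv[OF permutes_compose[OF adj_permutes[OF i] w]] inv_comp_adj[OF w i] by simp
  also have "\<dots> = Suc (perm_length m (inv' w))"
    by (rule perm_length_adj_left[OF permutes_inv[OF w] i]) (simp add: inv_inv_eq[OF permutes_bij[OF w]] lt)
  finally show ?thesis using perm_length_inv[OF w] by simp
qed

lemma perm_length_adj_left_down:
  assumes w: "w permutes {1..m}" and i: "1 \<le> i" "i < m" and gt: "inv' w (Suc i) < inv' w i"
  shows "perm_length m w = Suc (perm_length m (adj i \<circ> w))"
proof -
  have "perm_length m (adj i \<circ> (adj i \<circ> w)) = Suc (perm_length m (adj i \<circ> w))"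
    by (rule perm_length_adj_left[OF permutes_compose[OF w adj_permutes[OF i]] i])
      (use gt in \<open>simp add: inv_comp_adj[OF w i]\<close>)
  then show ?thesis by (simp only: adj_adj)
qed

lemma perm_length_adj_right_down:
  assumes w: "w permutes {1..m}" and i: "1 \<le> i" "i < m" and gt: "w (Suc i) < w i"
  shows "perm_length m w = Suc (perm_length m (w \<circ> adj i))"
proof -
  have "perm_length m ((w \<circ> adj i) \<circ> adj i) = Suc (perm_length m (w \<circ> adj i))"
    by (rule perm_length_adj_right[OF permutes_compose[OF adj_permutes[OF i] w] i]) (use gt in simp)
  then show ?thesis by (simp only: adj_adj)
qed

lemma perm_length_id: "perm_length m id = 0"
proof -
  have "{(i, j). 1 \<le> i \<and> i < j \<and> j \<le> m \<and> id j < id i} = {}" by auto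
  then show ?thesis by (simp only: perm_length_def card.empty)
qed

lemma permutes_neq: "w permutes {1..m} \<Longrightarrow> p \<noteq> q \<Longrightarrow> w p \<noteq> w q"
  using permutes_inj by (metis injD)

text \<open>Without a descent \<open>w\<close> increases on \<open>{1..m}\<close>, so
  \<open>p \<le> w p\<close> for every \<open>p\<close>; only the identity permutes an initial
  segment in this way.\<close>

lemma exists_descent:
  assumes w: "w permutes {1..m}" and ne: "w \<noteq> id"
  shows "\<exists>i. 1 \<le> i \<and> i < m \<and> w (Suc i) < w i"
proof (rule ccontr)
  assume *: "\<not> ?thesis"
  have inc: "w i < w (Suc i)" if "1 \<le> i" "i < m" for i
    using * that permutes_neq[OF w, of i "Suc i"] by (metis linorder_neqE_nat n_not_Suc_n)
  have "p \<le> w p" if "p \<in> {1..m}" for p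
    using that
  proof (induction p)
    case (Suc p)
    show ?case
    proof (cases "p = 0")
      case True
      then show ?thesis using permutes_in_image[OF w, of "Suc p"] Suc.prems by auto
    next
      case False
      then show ?thesis using Suc inc[of p] by auto
    qed
  qed simp
  then have "w = id" using permutes_natset_ge[OF w] by blast
  then show False using ne by simp
qed

text \<open>Removing a descent changes both parities. The lemma will match the signs of the column
  antisymmetrizer with powers of \<open>-1\<close> indexed by length.\<close>

lemma evenperm_perm_length:
  assumes "w permutes {1..m}" shows "evenperm w \<longleftrightarrow> even (perm_length m w)"
  using assms
proof (induction "perm_length m w" arbitrary: w rule: less_induct)
  case less
  show ?case
  proof (cases "w = id")
    case True
    then show ?thesis by (simp add: perm_length_id)
  next
    case False
    obtain i where i: "1 \<le> i" "i < m" "w (Suc i) < w i" using exists_descent[OF less.prems False] by blast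
    have len: "perm_length m w = Suc (perm_length m (w \<circ> adj i))"
      by (rule perm_length_adj_right_down[OF less.prems i])
    have p: "w \<circ> adj i permutes {1..m}" by (rule permutes_compose[OF adj_permutes[OF i(1,2)] less.prems])
    have "evenperm (w \<circ> adj i) \<longleftrightarrow> even (perm_length m (w \<circ> adj i))" using less.hyps[OF _ p] len by simp
    moreover have "evenperm (w \<circ> adj i) \<longleftrightarrow> \<not> evenperm w"
      using evenperm_comp[of w "adj i"] permutation_permutes[of w] less.prems permutation_swap_id[of i "Suc i"]
        evenperm_swap[of i "Suc i"] by auto
    ultimately have "evenperm w \<longleftrightarrow> \<not> even (perm_length m (w \<circ> adj i))" by argo
    then show ?thesis using len by simp
  qed
qed

text \<open>Below \<open>\<beta>\<close> is always weakly increasing, so that its level sets are intervals.\<close>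

definition parabolic :: "nat \<Rightarrow> (nat \<Rightarrow> nat) \<Rightarrow> (nat \<Rightarrow> nat) set" where
  "parabolic m \<beta> = {w. w permutes {1..m} \<and> (\<forall>p\<in>{1..m}. \<beta> (w p) = \<beta> p)}"

lemma parabolicD: "w \<in> parabolic m \<beta> \<Longrightarrow> w permutes {1..m}"
  "w \<in> parabolic m \<beta> \<Longrightarrow> p \<in> {1..m} \<Longrightarrow> \<beta> (w p) = \<beta> p"
  by (auto simp: parabolic_def)

lemma finite_parabolic: "finite (parabolic m \<beta>)"
  by (rule finite_subset[OF _ finite_permutations[of "{1..m}"]]) (auto simp: parabolic_def)

lemma id_parabolic: "id \<in> parabolic m \<beta>"
  by (simp add: parabolic_def permutes_id)

lemma parabolic_comp:
  assumes "v \<in> parabolic m \<beta>" "w \<in> parabolic m \<beta>" shows "v \<circ> w \<in> parabolic m \<beta>"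
  using assms permutes_compose[of w "{1..m}" v] permutes_in_image[of w "{1..m}"]
  by (auto simp: parabolic_def)

lemma parabolic_inv:
  assumes w: "w \<in> parabolic m \<beta>" shows "inv' w \<in> parabolic m \<beta>"
proof -
  note p = parabolicD(1)[OF w]
  have "\<beta> (inv' w x) = \<beta> x" if "x \<in> {1..m}" for x
    using parabolicD(2)[OF w, of "inv' w x"] permutes_in_image[OF permutes_inv[OF p], of x] that
    by (simp add: permutes_inverses[OF p])
  then show ?thesis using permutes_inv[OF p] by (simp add: parabolic_def)
qed

lemma adj_parabolic:
  assumes "1 \<le> i" "i < m" "\<beta> i = \<beta> (Suc i)" shows "adj i \<in> parabolic m \<beta>"
  using assms adj_permutes[of i m] by (auto simp: parabolic_def transpose_def)

text \<open>At a descent, monotonicity gives \<open>\<beta> (w (Suc i)) \<le> \<beta> (w i)\<close>;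
  as \<open>w\<close> preserves \<open>\<beta>\<close>, the positions \<open>i\<close> and
  \<open>Suc i\<close> lie on one level. Hence inductions on length can stay inside the parabolic
  subgroup.\<close>

lemma parabolic_descent:
  assumes mono: "mono_on {1..m} \<beta>" and w: "w \<in> parabolic m \<beta>" and ne: "w \<noteq> id"
  obtains i where "1 \<le> i" "i < m" "w (Suc i) < w i" "\<beta> i = \<beta> (Suc i)"
proof -
  note p = parabolicD(1)[OF w]
  obtain i where i: "1 \<le> i" "i < m" "w (Suc i) < w i" using exists_descent[OF p ne] by blast
  have m: "i \<in> {1..m}" "Suc i \<in> {1..m}" using i by auto
  have m': "w i \<in> {1..m}" "w (Suc i) \<in> {1..m}" using permutes_in_image[OF p] m by auto
  have "\<beta> (w (Suc i)) \<le> \<beta> (w i)" using i m' by (intro mono_onD[OF mono]) simp_all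
  moreover have "\<beta> i \<le> \<beta> (Suc i)" using m by (intro mono_onD[OF mono]) simp_all
  ultimately show thesis using parabolicD(2)[OF w] m i by (intro that[of i]) auto
qed

text \<open>All indices between two points of one level lie on that level too, so the steps between
  neighbours chain together.\<close>

lemma increasing_on_levels:
  fixes f :: "nat \<Rightarrow> nat"
  assumes mono: "mono_on {1..m} \<beta>"
    and step: "\<And>j. \<lbrakk>1 \<le> j; j < m; \<beta> j = \<beta> (Suc j)\<rbrakk> \<Longrightarrow> f j < f (Suc j)"
    and pq: "1 \<le> p" "p < q" "q \<le> m" "\<beta> p = (\<beta> q :: nat)"
  shows "f p < f q"
proof -
  have "Suc p \<le> q" using pq(2) by simp
  then have "\<beta> p = \<beta> q \<longrightarrow> f p < f q" using pq(3)
  proof (induction q rule: nat_induct_at_least[of "Suc p"])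
    case base
    then show ?case using Suc_leI pq(1) step[of p] by simp
  next
    case (Suc n)
    show ?case
    proof
      assume eq: "\<beta> p = \<beta> (Suc n)"
      have "\<beta> p \<le> \<beta> n" "\<beta> n \<le> \<beta> (Suc n)" using Suc pq(1) by (auto intro!: mono_onD[OF mono])
      then have "\<beta> p = \<beta> n" "\<beta> n = \<beta> (Suc n)" using eq by auto
      then show "f p < f (Suc n)" using Suc step[of n] pq(1) by auto
    qed
  qed
  then show ?thesis using pq by simp
qed

section \<open>Hecke algebras\<close>

text \<open>By uniqueness of the expansion a coordinate can be read off from any family of
  coefficients, extensional or not; linearity of the coordinates will follow from this.\<close>

lemma lin_coord:
  assumes V: "left_module K V" and b: "lin_basis K V I b"
  shows "x \<in> carrier V \<Longrightarrow> lin_coord K V I b x \<in> I \<rightarrow>\<^sub>E carrier K"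
    "x \<in> carrier V \<Longrightarrow> x = (\<Oplus>\<^bsub>V\<^esub>i\<in>I. lin_coord K V I b x i \<odot>\<^bsub>V\<^esub> b i)"
    "\<lbrakk>c \<in> I \<rightarrow> carrier K; x = (\<Oplus>\<^bsub>V\<^esub>i\<in>I. c i \<odot>\<^bsub>V\<^esub> b i); i \<in> I\<rbrakk> \<Longrightarrow> lin_coord K V I b x i = c i"
proof -
  interpret left_module K V by (rule V)
  have bV: "b i \<in> carrier V" if "i \<in> I" for i using b that by (auto simp: lin_basis_def)
  have ex1: "\<exists>!c. c \<in> I \<rightarrow>\<^sub>E carrier K \<and> x = (\<Oplus>\<^bsub>V\<^esub>i\<in>I. c i \<odot>\<^bsub>V\<^esub> b i)" if "x \<in> carrier V" for x
    using b that by (simp add: lin_basis_def)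
  show "x \<in> carrier V \<Longrightarrow> lin_coord K V I b x \<in> I \<rightarrow>\<^sub>E carrier K"
    "x \<in> carrier V \<Longrightarrow> x = (\<Oplus>\<^bsub>V\<^esub>i\<in>I. lin_coord K V I b x i \<odot>\<^bsub>V\<^esub> b i)"
    using theI'[OF ex1[of x]] by (simp_all add: lin_coord_def)
  assume c: "c \<in> I \<rightarrow> carrier K" and x: "x = (\<Oplus>\<^bsub>V\<^esub>i\<in>I. c i \<odot>\<^bsub>V\<^esub> b i)" and i: "i \<in> I"
  have cl: "(\<lambda>i. c i \<odot>\<^bsub>V\<^esub> b i) \<in> I \<rightarrow> carrier V" using c bV smult_closed by auto
  have xV: "x \<in> carrier V" unfolding x by (rule M.finsum_closed[OF cl])
  have "(\<Oplus>\<^bsub>V\<^esub>i\<in>I. restrict c I i \<odot>\<^bsub>V\<^esub> b i) = x"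
    unfolding x by (rule M.finsum_cong'[OF refl cl]) simp
  then have "lin_coord K V I b x = restrict c I"
    unfolding lin_coord_def using c by (intro the1_equality[OF ex1[OF xV]]) auto
  then show "lin_coord K V I b x i = c i" using i by simp
qed

lemma lin_coord_closed:
  "\<lbrakk>left_module K V; lin_basis K V I b; x \<in> carrier V; i \<in> I\<rbrakk> \<Longrightarrow> lin_coord K V I b x i \<in> carrier K"
  using lin_coord(1) by (metis PiE_mem)

lemma lin_coord_add:
  assumes V: "left_module K V" and b: "lin_basis K V I b"
    and x: "x \<in> carrier V" and y: "y \<in> carrier V" and i: "i \<in> I"
  shows "lin_coord K V I b (x \<oplus>\<^bsub>V\<^esub> y) i = lin_coord K V I b x i \<oplus>\<^bsub>K\<^esub> lin_coord K V I b y i"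
proof (rule lin_coord(3)[OF V b _ _ i])
  interpret left_module K V by (rule V)
  let ?c = "lin_coord K V I b"
  have bV: "b i \<in> carrier V" if "i \<in> I" for i using b that by (auto simp: lin_basis_def)
  note cl = lin_coord_closed[OF V b x] lin_coord_closed[OF V b y]
  show "(\<lambda>i. ?c x i \<oplus>\<^bsub>K\<^esub> ?c y i) \<in> I \<rightarrow> carrier K" using cl by simp
  have "(\<Oplus>\<^bsub>V\<^esub>i\<in>I. (?c x i \<oplus>\<^bsub>K\<^esub> ?c y i) \<odot>\<^bsub>V\<^esub> b i)
      = (\<Oplus>\<^bsub>V\<^esub>i\<in>I. ?c x i \<odot>\<^bsub>V\<^esub> b i \<oplus>\<^bsub>V\<^esub> ?c y i \<odot>\<^bsub>V\<^esub> b i)"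
    using cl bV by (intro M.finsum_cong') (auto simp: smult_add_left smult_closed)
  also have "\<dots> = (\<Oplus>\<^bsub>V\<^esub>i\<in>I. ?c x i \<odot>\<^bsub>V\<^esub> b i) \<oplus>\<^bsub>V\<^esub> (\<Oplus>\<^bsub>V\<^esub>i\<in>I. ?c y i \<odot>\<^bsub>V\<^esub> b i)"
    using cl bV by (intro M.finsum_addf) (auto simp: smult_closed)
  finally show "x \<oplus>\<^bsub>V\<^esub> y = (\<Oplus>\<^bsub>V\<^esub>i\<in>I. (?c x i \<oplus>\<^bsub>K\<^esub> ?c y i) \<odot>\<^bsub>V\<^esub> b i)"
    using lin_coord(2)[OF V b x] lin_coord(2)[OF V b y] by simp
qed

lemma lin_coord_smult:
  assumes V: "left_module K V" and b: "lin_basis K V I b"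
    and c: "c \<in> carrier K" and x: "x \<in> carrier V" and i: "i \<in> I"
  shows "lin_coord K V I b (c \<odot>\<^bsub>V\<^esub> x) i = c \<otimes>\<^bsub>K\<^esub> lin_coord K V I b x i"
proof (rule lin_coord(3)[OF V b _ _ i])
  interpret left_module K V by (rule V)
  let ?c = "lin_coord K V I b"
  have bV: "b i \<in> carrier V" if "i \<in> I" for i using b that by (auto simp: lin_basis_def)
  note cl = lin_coord_closed[OF V b x]
  show "(\<lambda>i. c \<otimes>\<^bsub>K\<^esub> ?c x i) \<in> I \<rightarrow> carrier K" using cl c by simp
  have fin: "finite I" using b by (simp add: lin_basis_def)
  have "c \<odot>\<^bsub>V\<^esub> (\<Oplus>\<^bsub>V\<^esub>i\<in>J. ?c x i \<odot>\<^bsub>V\<^esub> b i) = (\<Oplus>\<^bsub>V\<^esub>i\<in>J. (c \<otimes>\<^bsub>K\<^esub> ?c x i) \<odot>\<^bsub>V\<^esub> b i)" if "J \<subseteq> I" for J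
    using finite_subset[OF that fin] that
  proof (induction J rule: finite_induct)
    case (insert j J)
    then show ?case
      using c cl bV by (simp add: Pi_def subset_iff smult_add_right smult_closed smult_assoc)
  qed (use c in \<open>simp add: smult_zero_right\<close>)
  from this[of I] show "c \<odot>\<^bsub>V\<^esub> x = (\<Oplus>\<^bsub>V\<^esub>i\<in>I. (c \<otimes>\<^bsub>K\<^esub> ?c x i) \<odot>\<^bsub>V\<^esub> b i)"
    using lin_coord(2)[OF V b x] by simp
qed

lemma lin_coord_basis:
  assumes V: "left_module K V" and b: "lin_basis K V I b" and i: "i \<in> I" and j: "j \<in> I"
  shows "lin_coord K V I b (b j) i = (if j = i then \<one>\<^bsub>K\<^esub> else \<zero>\<^bsub>K\<^esub>)"
proof (rule lin_coord(3)[OF V b _ _ i])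
  interpret left_module K V by (rule V)
  have fin: "finite I" using b by (simp add: lin_basis_def)
  have bV: "b i \<in> carrier V" if "i \<in> I" for i using b that by (auto simp: lin_basis_def)
  have "(\<Oplus>\<^bsub>V\<^esub>i\<in>I. (if j = i then \<one>\<^bsub>K\<^esub> else \<zero>\<^bsub>K\<^esub>) \<odot>\<^bsub>V\<^esub> b i) = (\<Oplus>\<^bsub>V\<^esub>i\<in>I. if j = i then b i else \<zero>\<^bsub>V\<^esub>)"
    using bV by (intro M.finsum_cong') (auto simp: smult_one smult_zero_left)
  also have "\<dots> = b j" using bV by (intro M.finsum_singleton[OF j fin]) auto
  finally show "b j = (\<Oplus>\<^bsub>V\<^esub>i\<in>I. (if j = i then \<one>\<^bsub>K\<^esub> else \<zero>\<^bsub>K\<^esub>) \<odot>\<^bsub>V\<^esub> b i)" by (rule sym)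
  show "(\<lambda>i. if j = i then \<one>\<^bsub>K\<^esub> else \<zero>\<^bsub>K\<^esub>) \<in> I \<rightarrow> carrier K" by simp
qed

lemma adj_less: "\<lbrakk>x < y; \<not> (x = i \<and> y = Suc i)\<rbrakk> \<Longrightarrow> adj i x < adj i y"
  by (auto simp: transpose_def)

locale hecke_algebra = K: field K
  for K :: "'k ring" +
  fixes q :: 'k and m :: nat and B :: "('k, 'b) module" and T :: "(nat \<Rightarrow> nat) \<Rightarrow> 'b"
  assumes hecke: "is_hecke_algebra K q m B T"
begin

sublocale B: assoc_algebra K B
  using hecke by (simp add: is_hecke_algebra_def)

sublocale KB: left_module K B by (rule assoc_algebra_left_module[OF B.assoc_algebra_axioms])

lemma q_Units: "q \<in> Units K" using hecke by (simp add: is_hecke_algebra_def)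

lemma q_closed: "q \<in> carrier K" using q_Units by (rule K.Units_closed)

lemma T_basis: "lin_basis K B (carrier (sym_group m)) T"
  using hecke by (simp add: is_hecke_algebra_def)

lemma T_closed: "w permutes {1..m} \<Longrightarrow> T w \<in> carrier B"
  using T_basis by (auto simp: lin_basis_def sym_group_carrier)

lemma T_id: "T id = \<one>\<^bsub>B\<^esub>" using hecke by (simp add: is_hecke_algebra_def)

lemma T_adj_closed: "\<lbrakk>1 \<le> i; i < m\<rbrakk> \<Longrightarrow> T (adj i) \<in> carrier B"
  by (intro T_closed adj_permutes)

lemma T_adj_mult:
  assumes "1 \<le> i" "i < m" "w permutes {1..m}"
  shows "T (adj i) \<otimes>\<^bsub>B\<^esub> T w =
         (if perm_length m w < perm_length m (adj i \<circ> w) then T (adj i \<circ> w)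
          else q \<odot>\<^bsub>B\<^esub> T (adj i \<circ> w) \<oplus>\<^bsub>B\<^esub> (q \<ominus>\<^bsub>K\<^esub> \<one>\<^bsub>K\<^esub>) \<odot>\<^bsub>B\<^esub> T w)"
  using hecke assms unfolding is_hecke_algebra_def Let_def sym_group_carrier by simp

lemma T_left_up:
  assumes w: "w permutes {1..m}" and i: "1 \<le> i" "i < m" and lt: "inv' w i < inv' w (Suc i)"
  shows "T (adj i) \<otimes>\<^bsub>B\<^esub> T w = T (adj i \<circ> w)"
  using T_adj_mult[OF i w] perm_length_adj_left[OF w i lt] by simp

lemma T_adj_square:
  assumes i: "1 \<le> i" "i < m"
  shows "T (adj i) \<otimes>\<^bsub>B\<^esub> T (adj i) = q \<odot>\<^bsub>B\<^esub> \<one>\<^bsub>B\<^esub> \<oplus>\<^bsub>B\<^esub> (q \<ominus>\<^bsub>K\<^esub> \<one>\<^bsub>K\<^esub>) \<odot>\<^bsub>B\<^esub> T (adj i)"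
proof -
  have "adj i \<circ> adj i = id" by (simp add: fun_eq_iff)
  then show ?thesis
    using T_adj_mult[OF i adj_permutes[OF i]] T_id perm_length_id[of m] by simp
qed

text \<open>The defining relations describe multiplication by simple reflections from the left only.
  A left descent \<open>j\<close> is peeled off \<open>w\<close>, and associativity lets the right
  factor act on the shorter permutation.\<close>

lemma T_right_up:
  assumes "w permutes {1..m}" and i: "1 \<le> i" "i < m" and "w i < w (Suc i)"
  shows "T w \<otimes>\<^bsub>B\<^esub> T (adj i) = T (w \<circ> adj i)"
  using assms(1,4)
proof (induction "perm_length m w" arbitrary: w rule: less_induct)
  case less
  note w = less.prems(1)
  show ?case
  proof (cases "w = id")
    case True
    then show ?thesis using T_adj_closed[OF i] by (simp add: T_id)
  next
    case False
    have "inv' w \<noteq> id" using False inv_inv_eq[OF permutes_bij[OF w]] by auto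
    then obtain j where j: "1 \<le> j" "j < m" "inv' w (Suc j) < inv' w j"
      using exists_descent[OF permutes_inv[OF w]] by blast
    define w' where "w' = adj j \<circ> w"
    have w': "w' permutes {1..m}" unfolding w'_def by (rule permutes_compose[OF w adj_permutes[OF j(1,2)]])
    have ww': "w = adj j \<circ> w'" by (simp add: w'_def adj_adj)
    have inv_w': "inv' w' = inv' w \<circ> adj j" unfolding w'_def by (rule inv_comp_adj[OF w j(1,2)])
    have up: "inv' w' j < inv' w' (Suc j)" using j(3) by (simp add: inv_w')
    have Tw: "T w = T (adj j) \<otimes>\<^bsub>B\<^esub> T w'" using T_left_up[OF w' j(1,2) up] ww' by simp
    \<comment> \<open>The only way in which \<open>adj j\<close> could spoil the ascent of
      \<open>w\<close> at \<open>i\<close>; it would contradict the left descent at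
      \<open>j\<close>.\<close>
    have "\<not> (w i = j \<and> w (Suc i) = Suc j)"
      using j(3) permutes_inverses(2)[OF w, of i] permutes_inverses(2)[OF w, of "Suc i"] by auto
    then have w'_up: "w' i < w' (Suc i)" unfolding w'_def comp_apply by (rule adj_less[OF less.prems(2)])
    have w's: "w' \<circ> adj i permutes {1..m}" by (rule permutes_compose[OF adj_permutes[OF i] w'])
    have IH: "T w' \<otimes>\<^bsub>B\<^esub> T (adj i) = T (w' \<circ> adj i)"
      using perm_length_adj_left_down[OF w j, folded w'_def] by (intro less.hyps[OF _ w' w'_up]) simp
    \<comment> \<open>In this case \<open>adj j \<circ> w'\<close> would equal
      \<open>w' \<circ> adj i\<close>, and \<open>w\<close> would descend at \<open>i\<close>.
      Otherwise the left factor still lengthens \<open>w' \<circ> adj i\<close>.\<close>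
    have "\<not> (inv' w' j = i \<and> inv' w' (Suc j) = Suc i)"
    proof
      assume "inv' w' j = i \<and> inv' w' (Suc j) = Suc i"
      then have "w' i = j" "w' (Suc i) = Suc j"
        using permutes_inverses(1)[OF w', of j] permutes_inverses(1)[OF w', of "Suc j"] by auto
      then have "w i = Suc j" "w (Suc i) = j" unfolding ww' by simp_all
      then show False using less.prems(2) by simp
    qed
    then have up': "inv' (w' \<circ> adj i) j < inv' (w' \<circ> adj i) (Suc j)"
      unfolding inv_comp_adj(1)[OF w' i] comp_apply by (rule adj_less[OF up])
    have "T w \<otimes>\<^bsub>B\<^esub> T (adj i) = T (adj j) \<otimes>\<^bsub>B\<^esub> (T w' \<otimes>\<^bsub>B\<^esub> T (adj i))"
      unfolding Tw using T_closed[OF w'] T_adj_closed[OF i] T_adj_closed[OF j(1,2)] by (simp add: B.m_assoc)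
    also have "\<dots> = T (adj j \<circ> (w' \<circ> adj i))"
      unfolding IH by (rule T_left_up[OF w's j(1,2) up'])
    also have "adj j \<circ> (w' \<circ> adj i) = w \<circ> adj i" unfolding ww' by (simp add: comp_assoc)
    finally show ?thesis .
  qed
qed

lemma scalar_mult:
  assumes "c \<in> carrier K" "b \<in> carrier B"
  shows "(c \<odot>\<^bsub>B\<^esub> \<one>\<^bsub>B\<^esub>) \<otimes>\<^bsub>B\<^esub> b = c \<odot>\<^bsub>B\<^esub> b" "b \<otimes>\<^bsub>B\<^esub> (c \<odot>\<^bsub>B\<^esub> \<one>\<^bsub>B\<^esub>) = c \<odot>\<^bsub>B\<^esub> b"
  using assms by (simp_all add: B.smult_mult_left B.smult_mult_right)

definition x_elem :: "(nat \<Rightarrow> nat) \<Rightarrow> 'b" where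
  "x_elem \<beta> = (\<Oplus>\<^bsub>B\<^esub>w\<in>parabolic m \<beta>. T w)"

text \<open>This is \<open>-1/q\<close>: it makes \<open>1 + r T_s\<close> a multiple of
  \<open>T_s - q\<close>, which is an eigenvector of \<open>T_s\<close> for the eigenvalue
  \<open>-1\<close>.\<close>

definition r where "r = inv\<^bsub>K\<^esub> (\<ominus>\<^bsub>K\<^esub> q)"

definition y_elem :: "(nat \<Rightarrow> nat) \<Rightarrow> 'b" where
  "y_elem \<beta> = (\<Oplus>\<^bsub>B\<^esub>w\<in>parabolic m \<beta>. (r [^]\<^bsub>K\<^esub> perm_length m w) \<odot>\<^bsub>B\<^esub> T w)"

lemma r_closed: "r \<in> carrier K" and r_q: "r \<otimes>\<^bsub>K\<^esub> q = \<ominus>\<^bsub>K\<^esub> \<one>\<^bsub>K\<^esub>"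
proof -
  have "q \<noteq> \<zero>\<^bsub>K\<^esub>" using q_Units K.field_Units by auto
  then have "\<ominus>\<^bsub>K\<^esub> q \<noteq> \<zero>\<^bsub>K\<^esub>" using q_closed by (metis K.minus_minus K.minus_zero)
  then have U: "\<ominus>\<^bsub>K\<^esub> q \<in> Units K" using q_closed K.field_Units by auto
  then show r: "r \<in> carrier K" unfolding r_def by (rule K.Units_inv_closed)
  have "r \<otimes>\<^bsub>K\<^esub> (\<ominus>\<^bsub>K\<^esub> q) = \<one>\<^bsub>K\<^esub>" unfolding r_def by (rule K.Units_l_inv[OF U])
  then have "\<ominus>\<^bsub>K\<^esub> (r \<otimes>\<^bsub>K\<^esub> q) = \<one>\<^bsub>K\<^esub>" using r q_closed by (simp add: K.r_minus)
  then show "r \<otimes>\<^bsub>K\<^esub> q = \<ominus>\<^bsub>K\<^esub> \<one>\<^bsub>K\<^esub>" using r q_closed by (metis K.m_closed K.minus_minus)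
qed

lemma x_closed: "x_elem \<beta> \<in> carrier B"
  unfolding x_elem_def by (rule B.finsum_closed) (auto intro: T_closed parabolicD(1))

lemma y_term_closed: "w \<in> parabolic m \<beta> \<Longrightarrow> (r [^]\<^bsub>K\<^esub> n) \<odot>\<^bsub>B\<^esub> T w \<in> carrier B" for n :: nat
  using r_closed T_closed[OF parabolicD(1)] by simp

lemma y_closed: "y_elem \<beta> \<in> carrier B"
  unfolding y_elem_def by (rule B.finsum_closed) (simp add: y_term_closed)

text \<open>Pairing \<open>w\<close> with \<open>s w\<close> for \<open>s = adj i\<close> factors
  \<open>x\<close> as \<open>(1 + T_s) a\<close>, and \<open>T_s (1 + T_s) = q (1 + T_s)\<close> by
  the quadratic relation.\<close>

lemma T_adj_x:
  assumes i: "1 \<le> i" "i < m" "\<beta> i = \<beta> (Suc i)"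
  shows "T (adj i) \<otimes>\<^bsub>B\<^esub> x_elem \<beta> = q \<odot>\<^bsub>B\<^esub> x_elem \<beta>"
proof -
  note s = adj_parabolic[OF i]
  let ?W = "parabolic m \<beta>" and ?Ts = "T (adj i)"
  \<comment> \<open>The shorter member of each pair \<open>w\<close>, \<open>s w\<close>; the longer
    members are identified in \<open>sU\<close>.\<close>
  define U where "U = {w \<in> ?W. inv' w i < inv' w (Suc i)}"
  have fin: "finite U" unfolding U_def using finite_parabolic by simp
  have UD: "w permutes {1..m}" "inv' w i < inv' w (Suc i)" if "w \<in> U" for w
    using that parabolicD(1) by (auto simp: U_def)
  have sU: "(\<lambda>w. adj i \<circ> w) ` U = {w \<in> ?W. inv' w (Suc i) < inv' w i}"
  proof (rule equalityI; rule subsetI)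
    fix w assume "w \<in> (\<lambda>w. adj i \<circ> w) ` U"
    then obtain v where v: "v \<in> U" "w = adj i \<circ> v" by (elim imageE)
    then have "w \<in> ?W" using parabolic_comp[OF s, of v] by (simp add: U_def)
    then show "w \<in> {w \<in> ?W. inv' w (Suc i) < inv' w i}"
      using UD[OF v(1)] unfolding v(2) by (simp add: inv_comp_adj[OF _ i(1,2)])
  next
    fix w assume w: "w \<in> {w \<in> ?W. inv' w (Suc i) < inv' w i}"
    then have wW: "w \<in> ?W" and lt: "inv' w (Suc i) < inv' w i" by simp_all
    have "adj i \<circ> w \<in> U"
      using parabolic_comp[OF s wW] lt by (simp add: U_def inv_comp_adj(2)[OF parabolicD(1)[OF wW] i(1,2)])
    moreover have "w = adj i \<circ> (adj i \<circ> w)" by (simp only: adj_adj)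
    ultimately show "w \<in> (\<lambda>w. adj i \<circ> w) ` U" by (rule rev_image_eqI[of _ U w "\<lambda>w. adj i \<circ> w"])
  qed
  have W: "?W = U \<union> (\<lambda>w. adj i \<circ> w) ` U"
  proof -
    have "inv' w i \<noteq> inv' w (Suc i)" if "w \<in> ?W" for w
      using permutes_neq[OF permutes_inv[OF parabolicD(1)[OF that]], of i "Suc i"] by simp
    then show ?thesis unfolding sU by (auto simp: U_def neq_iff)
  qed
  have disj: "U \<inter> (\<lambda>w. adj i \<circ> w) ` U = {}" unfolding sU by (auto simp: U_def)
  have inj: "inj_on (\<lambda>w. adj i \<circ> w) U" by (rule inj_onI) (metis adj_adj(1))
  have clT: "T \<in> U \<rightarrow> carrier B" using T_closed UD(1) by auto
  have clT': "T \<in> (\<lambda>w. adj i \<circ> w) ` U \<rightarrow> carrier B" unfolding sU using T_closed parabolicD(1) by auto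
  have Ts: "?Ts \<in> carrier B" by (rule T_adj_closed[OF i(1,2)])
  define a where "a = (\<Oplus>\<^bsub>B\<^esub>w\<in>U. T w)"
  have a: "a \<in> carrier B" unfolding a_def by (rule B.finsum_closed[OF clT])
  have "x_elem \<beta> = a \<oplus>\<^bsub>B\<^esub> (\<Oplus>\<^bsub>B\<^esub>w\<in>(\<lambda>w. adj i \<circ> w) ` U. T w)"
    unfolding x_elem_def a_def W by (rule B.finsum_Un_disjoint[OF fin finite_imageI[OF fin] disj clT clT'])
  also have "(\<Oplus>\<^bsub>B\<^esub>w\<in>(\<lambda>w. adj i \<circ> w) ` U. T w) = (\<Oplus>\<^bsub>B\<^esub>w\<in>U. T (adj i \<circ> w))"
    by (rule B.finsum_reindex[OF clT' inj])
  also have "\<dots> = (\<Oplus>\<^bsub>B\<^esub>w\<in>U. ?Ts \<otimes>\<^bsub>B\<^esub> T w)"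
    using T_left_up[OF UD(1) i(1,2) UD(2)] Ts clT by (intro B.finsum_cong') auto
  also have "\<dots> = ?Ts \<otimes>\<^bsub>B\<^esub> a"
    unfolding a_def by (rule B.finsum_rdistr[OF fin Ts clT, symmetric])
  finally have x: "x_elem \<beta> = a \<oplus>\<^bsub>B\<^esub> ?Ts \<otimes>\<^bsub>B\<^esub> a" .
  have "?Ts \<otimes>\<^bsub>B\<^esub> (?Ts \<otimes>\<^bsub>B\<^esub> a) = q \<odot>\<^bsub>B\<^esub> a \<oplus>\<^bsub>B\<^esub> (q \<ominus>\<^bsub>K\<^esub> \<one>\<^bsub>K\<^esub>) \<odot>\<^bsub>B\<^esub> (?Ts \<otimes>\<^bsub>B\<^esub> a)"
    using Ts a q_closed T_adj_square[OF i(1,2)]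
    by (simp add: B.m_assoc[symmetric] B.l_distr B.smult_mult_left)
  then have "?Ts \<otimes>\<^bsub>B\<^esub> x_elem \<beta>
      = q \<odot>\<^bsub>B\<^esub> a \<oplus>\<^bsub>B\<^esub> (?Ts \<otimes>\<^bsub>B\<^esub> a \<oplus>\<^bsub>B\<^esub> (q \<ominus>\<^bsub>K\<^esub> \<one>\<^bsub>K\<^esub>) \<odot>\<^bsub>B\<^esub> (?Ts \<otimes>\<^bsub>B\<^esub> a))"
    unfolding x using Ts a q_closed by (simp add: B.r_distr B.M.a_lcomm)
  also have "?Ts \<otimes>\<^bsub>B\<^esub> a \<oplus>\<^bsub>B\<^esub> (q \<ominus>\<^bsub>K\<^esub> \<one>\<^bsub>K\<^esub>) \<odot>\<^bsub>B\<^esub> (?Ts \<otimes>\<^bsub>B\<^esub> a)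
      = (\<one>\<^bsub>K\<^esub> \<oplus>\<^bsub>K\<^esub> (q \<ominus>\<^bsub>K\<^esub> \<one>\<^bsub>K\<^esub>)) \<odot>\<^bsub>B\<^esub> (?Ts \<otimes>\<^bsub>B\<^esub> a)"
    using Ts a q_closed by (simp add: B.smult_l_distr)
  also have "\<one>\<^bsub>K\<^esub> \<oplus>\<^bsub>K\<^esub> (q \<ominus>\<^bsub>K\<^esub> \<one>\<^bsub>K\<^esub>) = q"
    using q_closed by (simp add: a_minus_def K.a_lcomm K.r_neg)
  finally show ?thesis unfolding x using Ts a q_closed by (simp add: B.smult_r_distr)
qed

text \<open>Now \<open>w\<close> is paired with \<open>w s\<close> on the right: the extra length
  contributes one more factor \<open>r\<close>. The right factor \<open>1 + r T_s\<close> is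
  responsible both for the sign rule \<open>y_T_adj\<close> and for the vanishing of
  \<open>y T_w t\<close> when \<open>s w = w s'\<close>.\<close>

lemma y_factor:
  assumes i: "1 \<le> i" "i < m" "\<beta> i = \<beta> (Suc i)"
  obtains y' where "y' \<in> carrier B" "y_elem \<beta> = y' \<otimes>\<^bsub>B\<^esub> (\<one>\<^bsub>B\<^esub> \<oplus>\<^bsub>B\<^esub> r \<odot>\<^bsub>B\<^esub> T (adj i))"
proof -
  note s = adj_parabolic[OF i]
  let ?W = "parabolic m \<beta>" and ?Ts = "T (adj i)" and ?R = "\<lambda>w. w \<circ> adj i"
  let ?c = "\<lambda>w. r [^]\<^bsub>K\<^esub> perm_length m w"
  define U where "U = {w \<in> ?W. w i < w (Suc i)}"
  have fin: "finite U" unfolding U_def using finite_parabolic by simp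
  have UD: "w permutes {1..m}" "w i < w (Suc i)" "w \<in> ?W" if "w \<in> U" for w
    using that parabolicD(1) by (auto simp: U_def)
  have sU: "?R ` U = {w \<in> ?W. w (Suc i) < w i}"
  proof (rule equalityI; rule subsetI)
    fix w assume "w \<in> ?R ` U"
    then obtain v where v: "v \<in> U" "w = v \<circ> adj i" by (elim imageE)
    then have "w \<in> ?W" using parabolic_comp[OF _ s, of v] by (simp add: U_def)
    then show "w \<in> {w \<in> ?W. w (Suc i) < w i}" using UD[OF v(1)] unfolding v(2) by simp
  next
    fix w assume w: "w \<in> {w \<in> ?W. w (Suc i) < w i}"
    then have "w \<circ> adj i \<in> U" using parabolic_comp[OF _ s, of w] by (simp add: U_def)
    moreover have "w = w \<circ> adj i \<circ> adj i" by (simp only: adj_adj)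
    ultimately show "w \<in> ?R ` U" by (rule rev_image_eqI[of _ U w ?R])
  qed
  have W: "?W = U \<union> ?R ` U"
  proof -
    have "w i \<noteq> w (Suc i)" if "w \<in> ?W" for w
      using permutes_neq[OF parabolicD(1)[OF that], of i "Suc i"] by simp
    then show ?thesis unfolding sU by (auto simp: U_def neq_iff)
  qed
  have disj: "U \<inter> ?R ` U = {}" unfolding sU by (auto simp: U_def)
  have inj: "inj_on ?R U" by (rule inj_onI) (metis adj_adj(2))
  let ?t = "\<lambda>w. ?c w \<odot>\<^bsub>B\<^esub> T w"
  have clt: "?t \<in> U \<rightarrow> carrier B" using y_term_closed UD(3) by auto
  have clt': "?t \<in> ?R ` U \<rightarrow> carrier B" unfolding sU using y_term_closed by auto
  have Ts: "?Ts \<in> carrier B" by (rule T_adj_closed[OF i(1,2)])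
  have rTs: "r \<odot>\<^bsub>B\<^esub> ?Ts \<in> carrier B" using Ts r_closed by simp
  define a where "a = (\<Oplus>\<^bsub>B\<^esub>w\<in>U. ?t w)"
  have a: "a \<in> carrier B" unfolding a_def by (rule B.finsum_closed[OF clt])
  have step: "?t (w \<circ> adj i) = ?t w \<otimes>\<^bsub>B\<^esub> (r \<odot>\<^bsub>B\<^esub> ?Ts)" if w: "w \<in> U" for w
  proof -
    have c: "?c w \<in> carrier K" using r_closed by simp
    have "?t w \<otimes>\<^bsub>B\<^esub> (r \<odot>\<^bsub>B\<^esub> ?Ts) = (r \<otimes>\<^bsub>K\<^esub> ?c w) \<odot>\<^bsub>B\<^esub> (T w \<otimes>\<^bsub>B\<^esub> ?Ts)"
      using c T_closed[OF UD(1)[OF w]] Ts r_closed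
      by (simp add: B.smult_mult_left B.smult_mult_right B.smult_assoc1)
    then show ?thesis
      using T_right_up[OF UD(1)[OF w] i(1,2) UD(2)[OF w]] perm_length_adj_right[OF UD(1)[OF w] i(1,2) UD(2)[OF w]]
        K.m_comm[OF r_closed c] by simp
  qed
  have "y_elem \<beta> = a \<oplus>\<^bsub>B\<^esub> (\<Oplus>\<^bsub>B\<^esub>w\<in>?R ` U. ?t w)"
    unfolding y_elem_def a_def W by (rule B.finsum_Un_disjoint[OF fin finite_imageI[OF fin] disj clt clt'])
  also have "(\<Oplus>\<^bsub>B\<^esub>w\<in>?R ` U. ?t w) = (\<Oplus>\<^bsub>B\<^esub>w\<in>U. ?t (w \<circ> adj i))"
    by (rule B.finsum_reindex[OF clt' inj])
  also have "\<dots> = (\<Oplus>\<^bsub>B\<^esub>w\<in>U. ?t w \<otimes>\<^bsub>B\<^esub> (r \<odot>\<^bsub>B\<^esub> ?Ts))"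
    using step clt rTs by (intro B.finsum_cong') auto
  also have "\<dots> = a \<otimes>\<^bsub>B\<^esub> (r \<odot>\<^bsub>B\<^esub> ?Ts)"
    unfolding a_def by (rule B.finsum_ldistr[OF fin rTs clt, symmetric])
  finally have "y_elem \<beta> = a \<otimes>\<^bsub>B\<^esub> (\<one>\<^bsub>B\<^esub> \<oplus>\<^bsub>B\<^esub> r \<odot>\<^bsub>B\<^esub> ?Ts)"
    using a rTs by (simp add: B.r_distr)
  then show thesis using a by (intro that)
qed

text \<open>The last factor of \<open>y\<close> is an eigenvector of \<open>T_s\<close> for the
  eigenvalue \<open>-1\<close>, because \<open>r q = -1\<close>.\<close>

lemma y_T_adj:
  assumes i: "1 \<le> i" "i < m" "\<beta> i = \<beta> (Suc i)"
  shows "y_elem \<beta> \<otimes>\<^bsub>B\<^esub> T (adj i) = \<ominus>\<^bsub>B\<^esub> y_elem \<beta>"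
proof -
  obtain y' where y': "y' \<in> carrier B" "y_elem \<beta> = y' \<otimes>\<^bsub>B\<^esub> (\<one>\<^bsub>B\<^esub> \<oplus>\<^bsub>B\<^esub> r \<odot>\<^bsub>B\<^esub> T (adj i))"
    by (rule y_factor[OF i])
  let ?Ts = "T (adj i)"
  have Ts: "?Ts \<in> carrier B" by (rule T_adj_closed[OF i(1,2)])
  have c: "r \<otimes>\<^bsub>K\<^esub> (q \<ominus>\<^bsub>K\<^esub> \<one>\<^bsub>K\<^esub>) = \<ominus>\<^bsub>K\<^esub> \<one>\<^bsub>K\<^esub> \<ominus>\<^bsub>K\<^esub> r"
    using r_closed q_closed r_q by (simp add: a_minus_def K.r_distr K.r_minus)
  have "(\<one>\<^bsub>B\<^esub> \<oplus>\<^bsub>B\<^esub> r \<odot>\<^bsub>B\<^esub> ?Ts) \<otimes>\<^bsub>B\<^esub> ?Ts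
      = ?Ts \<oplus>\<^bsub>B\<^esub> ((r \<otimes>\<^bsub>K\<^esub> q) \<odot>\<^bsub>B\<^esub> \<one>\<^bsub>B\<^esub> \<oplus>\<^bsub>B\<^esub> (r \<otimes>\<^bsub>K\<^esub> (q \<ominus>\<^bsub>K\<^esub> \<one>\<^bsub>K\<^esub>)) \<odot>\<^bsub>B\<^esub> ?Ts)"
    using Ts r_closed q_closed
    by (simp add: B.l_distr B.smult_mult_left T_adj_square[OF i(1,2)] B.smult_r_distr B.smult_assoc1)
  also have "\<dots> = ?Ts \<oplus>\<^bsub>B\<^esub> (\<ominus>\<^bsub>B\<^esub> \<one>\<^bsub>B\<^esub> \<oplus>\<^bsub>B\<^esub> (\<ominus>\<^bsub>B\<^esub> ?Ts \<oplus>\<^bsub>B\<^esub> \<ominus>\<^bsub>B\<^esub> (r \<odot>\<^bsub>B\<^esub> ?Ts)))"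
    unfolding c r_q using Ts r_closed by (simp add: a_minus_def B.smult_l_distr B.smult_l_minus)
  also have "\<dots> = \<ominus>\<^bsub>B\<^esub> (\<one>\<^bsub>B\<^esub> \<oplus>\<^bsub>B\<^esub> r \<odot>\<^bsub>B\<^esub> ?Ts)"
    using Ts r_closed by (simp add: B.minus_add B.M.a_lcomm[of ?Ts "\<ominus>\<^bsub>B\<^esub> \<one>\<^bsub>B\<^esub>"] B.r_neg2)
  finally show ?thesis
    unfolding y'(2) using y'(1) Ts r_closed by (simp add: B.m_assoc B.r_minus)
qed

end

text \<open>Row index \<open>\<rho>\<close>, column index \<open>\<gamma>\<close> of positions and the permutation \<open>wl\<close> from the row reading to the
  column reading of a Young diagram.  The last assumption says that \<open>wl\<close> represents the only double
  coset of the two Young subgroups with trivial intersection property.\<close>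

locale hecke_pair = hecke_algebra K q m B T
  for K :: "'k ring" and q :: 'k and m :: nat and B :: "('k, 'b) module" and T +
  fixes \<rho> \<gamma> :: "nat \<Rightarrow> nat" and wl :: "nat \<Rightarrow> nat"
  assumes \<rho>_mono: "mono_on {1..m} \<rho>" and \<gamma>_mono: "mono_on {1..m} \<gamma>"
    and wl: "wl permutes {1..m}"
    and wl_rows: "\<lbrakk>1 \<le> p; p < s; s \<le> m; \<rho> p = \<rho> s\<rbrakk> \<Longrightarrow> wl p < wl s \<and> \<gamma> (wl p) \<noteq> \<gamma> (wl s)"
    and wl_columns: "\<lbrakk>1 \<le> p; p < s; s \<le> m; \<gamma> p = \<gamma> s\<rbrakk> \<Longrightarrow> \<rho> (inv' wl p) < \<rho> (inv' wl s)"
    and wl_unique: "\<And>w. \<lbrakk>w permutes {1..m};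
      \<And>p s. \<lbrakk>1 \<le> p; p < s; s \<le> m; \<rho> p = \<rho> s\<rbrakk> \<Longrightarrow> \<gamma> (w p) < \<gamma> (w s);
      \<And>p s. \<lbrakk>1 \<le> p; p < s; s \<le> m; \<gamma> p = \<gamma> s\<rbrakk> \<Longrightarrow> inv' w p < inv' w s\<rbrakk> \<Longrightarrow> w = wl"
begin

text \<open>The line \<open>y T\<^sub>w\<^sub>l t\<close> absorbs all of \<open>y T\<^sub>w t\<close>: by induction on the length one may take \<open>w\<close> of minimal
  length in its double coset, and then either \<open>s w = w s'\<close> for simple reflections \<open>s\<close>, \<open>s'\<close> of the
  two Young subgroups, which makes \<open>y T\<^sub>w t\<close> vanish, or \<open>w = wl\<close>.\<close>

lemma y_T_line:
  assumes M: "left_module B M" and t: "t \<in> carrier M"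
    and Tt: "\<And>i. \<lbrakk>1 \<le> i; i < m; \<rho> i = \<rho> (Suc i)\<rbrakk> \<Longrightarrow> T (adj i) \<odot>\<^bsub>M\<^esub> t = (q \<odot>\<^bsub>B\<^esub> \<one>\<^bsub>B\<^esub>) \<odot>\<^bsub>M\<^esub> t"
    and "w permutes {1..m}"
  shows "\<exists>c\<in>carrier K. (y_elem \<gamma> \<otimes>\<^bsub>B\<^esub> T w) \<odot>\<^bsub>M\<^esub> t = (c \<odot>\<^bsub>B\<^esub> \<one>\<^bsub>B\<^esub>) \<odot>\<^bsub>M\<^esub> ((y_elem \<gamma> \<otimes>\<^bsub>B\<^esub> T wl) \<odot>\<^bsub>M\<^esub> t)"
  using assms(4)
proof (induction "perm_length m w" arbitrary: w rule: less_induct)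
  case less
  interpret M: left_module B M by (rule M)
  note w = less.prems
  let ?y = "y_elem \<gamma>" and ?z = "(y_elem \<gamma> \<otimes>\<^bsub>B\<^esub> T wl) \<odot>\<^bsub>M\<^esub> t"
  have y: "?y \<in> carrier B" by (rule y_closed)
  have z: "?z \<in> carrier M" using t y T_closed[OF wl] by (simp add: M.smult_closed)
  have sc: "c \<odot>\<^bsub>B\<^esub> \<one>\<^bsub>B\<^esub> \<in> carrier B" if "c \<in> carrier K" for c using that by simp
  have scaled: "\<exists>c\<in>carrier K. (a \<odot>\<^bsub>B\<^esub> (?y \<otimes>\<^bsub>B\<^esub> T v)) \<odot>\<^bsub>M\<^esub> t = (c \<odot>\<^bsub>B\<^esub> \<one>\<^bsub>B\<^esub>) \<odot>\<^bsub>M\<^esub> ?z"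
    if a: "a \<in> carrier K" and v: "v permutes {1..m}" and len: "perm_length m v < perm_length m w" for a v
  proof -
    obtain c where c: "c \<in> carrier K" "(?y \<otimes>\<^bsub>B\<^esub> T v) \<odot>\<^bsub>M\<^esub> t = (c \<odot>\<^bsub>B\<^esub> \<one>\<^bsub>B\<^esub>) \<odot>\<^bsub>M\<^esub> ?z"
      using less.hyps[OF len v] by (elim bexE)
    have yv: "?y \<otimes>\<^bsub>B\<^esub> T v \<in> carrier B" using y T_closed[OF v] by simp
    have "(a \<odot>\<^bsub>B\<^esub> (?y \<otimes>\<^bsub>B\<^esub> T v)) \<odot>\<^bsub>M\<^esub> t = (a \<odot>\<^bsub>B\<^esub> \<one>\<^bsub>B\<^esub>) \<odot>\<^bsub>M\<^esub> ((?y \<otimes>\<^bsub>B\<^esub> T v) \<odot>\<^bsub>M\<^esub> t)"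
      using M.smult_assoc[OF sc[OF a] yv t] scalar_mult(1)[OF a yv] by simp
    also have "\<dots> = ((a \<odot>\<^bsub>B\<^esub> \<one>\<^bsub>B\<^esub>) \<otimes>\<^bsub>B\<^esub> (c \<odot>\<^bsub>B\<^esub> \<one>\<^bsub>B\<^esub>)) \<odot>\<^bsub>M\<^esub> ?z"
      unfolding c(2) by (rule M.smult_assoc[OF sc[OF a] sc[OF c(1)] z, symmetric])
    also have "(a \<odot>\<^bsub>B\<^esub> \<one>\<^bsub>B\<^esub>) \<otimes>\<^bsub>B\<^esub> (c \<odot>\<^bsub>B\<^esub> \<one>\<^bsub>B\<^esub>) = (a \<otimes>\<^bsub>K\<^esub> c) \<odot>\<^bsub>B\<^esub> \<one>\<^bsub>B\<^esub>"
      using a c(1) by (simp add: scalar_mult(1) B.smult_assoc1)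
    finally show ?thesis using a c(1) by (intro bexI[of _ "a \<otimes>\<^bsub>K\<^esub> c"]) simp_all
  qed
  have q_t: "b \<odot>\<^bsub>M\<^esub> (T (adj i) \<odot>\<^bsub>M\<^esub> t) = (q \<odot>\<^bsub>B\<^esub> b) \<odot>\<^bsub>M\<^esub> t"
    if "b \<in> carrier B" "1 \<le> i" "i < m" "\<rho> i = \<rho> (Suc i)" for b i
    using M.smult_assoc[OF that(1) sc[OF q_closed] t] scalar_mult(2)[OF q_closed that(1)] Tt[OF that(2-4)] by simp
  \<comment> \<open>A right descent inside a row or a left descent inside a column shortens
    \<open>w\<close> at the cost of a scalar; without either, \<open>w\<close> is minimal in its
    double coset.\<close>
  consider (row) i where "1 \<le> i" "i < m" "\<rho> i = \<rho> (Suc i)" "w (Suc i) < w i"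
    | (column) i where "1 \<le> i" "i < m" "\<gamma> i = \<gamma> (Suc i)" "inv' w (Suc i) < inv' w i"
    | (minimal) "\<And>i. \<lbrakk>1 \<le> i; i < m; \<rho> i = \<rho> (Suc i)\<rbrakk> \<Longrightarrow> w i < w (Suc i)"
      "\<And>i. \<lbrakk>1 \<le> i; i < m; \<gamma> i = \<gamma> (Suc i)\<rbrakk> \<Longrightarrow> inv' w i < inv' w (Suc i)"
    using permutes_neq[OF w] permutes_neq[OF permutes_inv[OF w]] by (metis linorder_neqE_nat n_not_Suc_n)
  then show ?case
  proof cases
    case (row i)
    define v where "v = w \<circ> adj i"
    have v: "v permutes {1..m}" unfolding v_def by (rule permutes_compose[OF adj_permutes[OF row(1,2)] w])
    have len: "perm_length m v < perm_length m w"
      using perm_length_adj_right_down[OF w row(1,2,4)] by (simp add: v_def)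
    have "T v \<otimes>\<^bsub>B\<^esub> T (adj i) = T w"
      using T_right_up[OF v row(1,2)] row(4) by (simp add: v_def adj_adj)
    then have "?y \<otimes>\<^bsub>B\<^esub> T w = (?y \<otimes>\<^bsub>B\<^esub> T v) \<otimes>\<^bsub>B\<^esub> T (adj i)"
      using y T_closed[OF v] T_adj_closed[OF row(1,2)] by (simp add: B.m_assoc)
    then have "(?y \<otimes>\<^bsub>B\<^esub> T w) \<odot>\<^bsub>M\<^esub> t = (?y \<otimes>\<^bsub>B\<^esub> T v) \<odot>\<^bsub>M\<^esub> (T (adj i) \<odot>\<^bsub>M\<^esub> t)"
      using M.smult_assoc[of "?y \<otimes>\<^bsub>B\<^esub> T v" "T (adj i)" t] y T_closed[OF v] T_adj_closed[OF row(1,2)] t by simp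
    also have "\<dots> = (q \<odot>\<^bsub>B\<^esub> (?y \<otimes>\<^bsub>B\<^esub> T v)) \<odot>\<^bsub>M\<^esub> t"
      using y T_closed[OF v] row by (intro q_t) simp_all
    finally show ?thesis using scaled[OF q_closed v len] by simp
  next
    case (column i)
    define v where "v = adj i \<circ> w"
    have v: "v permutes {1..m}" unfolding v_def by (rule permutes_compose[OF w adj_permutes[OF column(1,2)]])
    have len: "perm_length m v < perm_length m w"
      using perm_length_adj_left_down[OF w column(1,2,4)] by (simp add: v_def)
    have "inv' v i < inv' v (Suc i)" using column(4) by (simp add: v_def inv_comp_adj[OF w column(1,2)])
    then have "T (adj i) \<otimes>\<^bsub>B\<^esub> T v = T w"
      using T_left_up[OF v column(1,2)] by (simp add: v_def adj_adj)
    then have "?y \<otimes>\<^bsub>B\<^esub> T w = (?y \<otimes>\<^bsub>B\<^esub> T (adj i)) \<otimes>\<^bsub>B\<^esub> T v"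
      using y T_closed[OF v] T_adj_closed[OF column(1,2)] by (simp add: B.m_assoc)
    also have "\<dots> = (\<ominus>\<^bsub>K\<^esub> \<one>\<^bsub>K\<^esub>) \<odot>\<^bsub>B\<^esub> (?y \<otimes>\<^bsub>B\<^esub> T v)"
      unfolding y_T_adj[OF column(1-3)] using y T_closed[OF v] by (simp add: B.l_minus B.smult_l_minus)
    finally show ?thesis using scaled[OF _ v len, of "\<ominus>\<^bsub>K\<^esub> \<one>\<^bsub>K\<^esub>"] by simp
  next
    case minimal
    have inc: "w p < w s" if "1 \<le> p" "p < s" "s \<le> m" "\<rho> p = \<rho> s" for p s
      by (rule increasing_on_levels[where \<beta> = \<rho> and f = w, OF \<rho>_mono minimal(1) that])
    have inc': "inv' w p < inv' w s" if "1 \<le> p" "p < s" "s \<le> m" "\<gamma> p = \<gamma> s" for p s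
      by (rule increasing_on_levels[where \<beta> = \<gamma> and f = "inv' w", OF \<gamma>_mono minimal(2) that])
    show ?thesis
    \<comment> \<open>Either two neighbours of one row land in one column, which kills the product,
      or all rows go to strictly increasing columns and \<open>w\<close> is
      \<open>wl\<close>.\<close>
    proof (cases "\<exists>j. 1 \<le> j \<and> j < m \<and> \<rho> j = \<rho> (Suc j) \<and> \<gamma> (w j) = \<gamma> (w (Suc j))")
      case True
      then obtain j where j: "1 \<le> j" "j < m" "\<rho> j = \<rho> (Suc j)" "\<gamma> (w j) = \<gamma> (w (Suc j))" by blast
      define i where "i = w j"
      have lt: "w j < w (Suc j)" using minimal(1)[OF j(1-3)] .
      have wj: "w j \<in> {1..m}" "w (Suc j) \<in> {1..m}" using permutes_in_image[OF w] j(1,2) by simp_all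
      have i: "1 \<le> i" "i < m" using wj lt by (simp_all add: i_def)
      \<comment> \<open>A value strictly between \<open>w j\<close> and \<open>w (Suc j)\<close>
        would lie on the same column level, where the inverse of \<open>w\<close> increases; its
        position would be strictly between \<open>j\<close> and \<open>Suc j\<close>.\<close>
      have Suc_i: "w (Suc j) = Suc i"
      proof (rule ccontr)
        assume "w (Suc j) \<noteq> Suc i"
        then have k: "i < Suc i" "Suc i < w (Suc j)" using lt by (simp_all add: i_def)
        have "\<gamma> i \<le> \<gamma> (Suc i)" "\<gamma> (Suc i) \<le> \<gamma> (w (Suc j))"
          using k wj i by (auto intro!: mono_onD[OF \<gamma>_mono])
        then have "\<gamma> i = \<gamma> (Suc i)" "\<gamma> (Suc i) = \<gamma> (w (Suc j))" using j(4) by (simp_all add: i_def)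
        then have "inv' w i < inv' w (Suc i)" "inv' w (Suc i) < inv' w (w (Suc j))"
          using k wj i by (auto intro!: inc')
        then show False by (simp add: i_def permutes_inverses[OF w])
      qed
      have \<gamma>i: "\<gamma> i = \<gamma> (Suc i)" using j(4) Suc_i by (simp add: i_def)
      have inv: "inv' w i = j" "inv' w (Suc i) = Suc j"
        unfolding i_def Suc_i[unfolded i_def, symmetric] by (simp_all add: permutes_inverses[OF w])
      have comm: "adj i \<circ> w = w \<circ> adj j"
      proof
        fix p
        have "w p = i \<longleftrightarrow> p = j" "w p = Suc i \<longleftrightarrow> p = Suc j"
          using inv permutes_inverses[OF w] by metis+
        then show "(adj i \<circ> w) p = (w \<circ> adj j) p"
          using Suc_i by (auto simp: transpose_def i_def)
      qed
      obtain y' where y': "y' \<in> carrier B" "?y = y' \<otimes>\<^bsub>B\<^esub> (\<one>\<^bsub>B\<^esub> \<oplus>\<^bsub>B\<^esub> r \<odot>\<^bsub>B\<^esub> T (adj i))"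
        by (rule y_factor[OF i \<gamma>i])
      have Tw: "T w \<in> carrier B" and Ti: "T (adj i) \<in> carrier B" and Tj: "T (adj j) \<in> carrier B"
        by (rule T_closed[OF w], rule T_adj_closed[OF i], rule T_adj_closed[OF j(1,2)])
      \<comment> \<open>With \<open>s = adj i\<close> and \<open>s' = adj j\<close> this gives
        \<open>T_s T_w t = T_w T_s' t = q T_w t\<close>, so the factor \<open>1 + r T_s\<close> of
        \<open>y\<close> contributes \<open>1 + r q = 0\<close>.\<close>
      have "T (adj i) \<otimes>\<^bsub>B\<^esub> T w = T w \<otimes>\<^bsub>B\<^esub> T (adj j)"
        using T_left_up[OF w i] T_right_up[OF w j(1,2) lt] comm inv by simp
      then have "(T (adj i) \<otimes>\<^bsub>B\<^esub> T w) \<odot>\<^bsub>M\<^esub> t = (q \<odot>\<^bsub>B\<^esub> T w) \<odot>\<^bsub>M\<^esub> t"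
        using M.smult_assoc[OF Tw Tj t] q_t[OF Tw j(1-3)] by simp
      then have e1: "(r \<odot>\<^bsub>B\<^esub> (T (adj i) \<otimes>\<^bsub>B\<^esub> T w)) \<odot>\<^bsub>M\<^esub> t = (r \<odot>\<^bsub>B\<^esub> (q \<odot>\<^bsub>B\<^esub> T w)) \<odot>\<^bsub>M\<^esub> t"
        using M.smult_assoc[OF sc[OF r_closed] _ t, of "T (adj i) \<otimes>\<^bsub>B\<^esub> T w"]
          M.smult_assoc[OF sc[OF r_closed] _ t, of "q \<odot>\<^bsub>B\<^esub> T w"] Ti Tw q_closed r_closed
        by (simp add: scalar_mult(1))
      have "r \<odot>\<^bsub>B\<^esub> (q \<odot>\<^bsub>B\<^esub> T w) = \<ominus>\<^bsub>B\<^esub> T w"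
        using Tw q_closed r_closed by (simp add: B.smult_assoc1[symmetric] r_q B.smult_l_minus)
      then have e2: "(r \<odot>\<^bsub>B\<^esub> (T (adj i) \<otimes>\<^bsub>B\<^esub> T w)) \<odot>\<^bsub>M\<^esub> t = \<ominus>\<^bsub>M\<^esub> (T w \<odot>\<^bsub>M\<^esub> t)"
        using e1 Tw t by (simp add: M.smult_minus_left)
      have "?y \<otimes>\<^bsub>B\<^esub> T w = y' \<otimes>\<^bsub>B\<^esub> (T w \<oplus>\<^bsub>B\<^esub> r \<odot>\<^bsub>B\<^esub> (T (adj i) \<otimes>\<^bsub>B\<^esub> T w))"
        unfolding y'(2) using y'(1) Tw Ti r_closed by (simp add: B.m_assoc B.l_distr B.smult_mult_left)
      then have "(?y \<otimes>\<^bsub>B\<^esub> T w) \<odot>\<^bsub>M\<^esub> t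
          = y' \<odot>\<^bsub>M\<^esub> (T w \<odot>\<^bsub>M\<^esub> t \<oplus>\<^bsub>M\<^esub> (r \<odot>\<^bsub>B\<^esub> (T (adj i) \<otimes>\<^bsub>B\<^esub> T w)) \<odot>\<^bsub>M\<^esub> t)"
        using y'(1) Tw Ti r_closed t by (simp add: M.smult_assoc M.smult_add_left)
      also have "\<dots> = \<zero>\<^bsub>M\<^esub>"
        unfolding e2 using y'(1) Tw t by (simp add: M.M.r_neg M.smult_closed M.smult_zero_right)
      also have "\<dots> = (\<zero>\<^bsub>K\<^esub> \<odot>\<^bsub>B\<^esub> \<one>\<^bsub>B\<^esub>) \<odot>\<^bsub>M\<^esub> ?z" using z by (simp add: M.smult_zero_left)
      finally show ?thesis by (intro bexI[of _ "\<zero>\<^bsub>K\<^esub>"]) simp_all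
    next
      case False
      have step: "\<gamma> (w j) < \<gamma> (w (Suc j))" if j: "1 \<le> j" "j < m" "\<rho> j = \<rho> (Suc j)" for j
      proof -
        have "w j \<in> {1..m}" "w (Suc j) \<in> {1..m}" using permutes_in_image[OF w] j(1,2) by simp_all
        then have "\<gamma> (w j) \<le> \<gamma> (w (Suc j))"
          using minimal(1)[OF j] by (intro mono_onD[OF \<gamma>_mono]) simp_all
        moreover have "\<gamma> (w j) \<noteq> \<gamma> (w (Suc j))" using False j by blast
        ultimately show ?thesis by simp
      qed
      have "w = wl"
      proof (rule wl_unique[OF w])
        show "\<gamma> (w p) < \<gamma> (w s)" if "1 \<le> p" "p < s" "s \<le> m" "\<rho> p = \<rho> s" for p s
          by (rule increasing_on_levels[where \<beta> = \<rho> and f = "\<lambda>p. \<gamma> (w p)", OF \<rho>_mono step that])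
      qed (rule inc')
      moreover have "?z = (\<one>\<^bsub>K\<^esub> \<odot>\<^bsub>B\<^esub> \<one>\<^bsub>B\<^esub>) \<odot>\<^bsub>M\<^esub> ?z" using z by (simp add: M.smult_one)
      ultimately show ?thesis by (intro bexI[of _ "\<one>\<^bsub>K\<^esub>"]) simp_all
    qed
  qed
qed

text \<open>Linear extension of \<open>y_T_line\<close>: the \<open>b\<close> for which
  \<open>y b t\<close> is a multiple of the fixed vector form a subspace containing every
  \<open>T w\<close>.\<close>

lemma y_line:
  assumes M: "left_module B M" and t: "t \<in> carrier M"
    and Tt: "\<And>i. \<lbrakk>1 \<le> i; i < m; \<rho> i = \<rho> (Suc i)\<rbrakk> \<Longrightarrow> T (adj i) \<odot>\<^bsub>M\<^esub> t = (q \<odot>\<^bsub>B\<^esub> \<one>\<^bsub>B\<^esub>) \<odot>\<^bsub>M\<^esub> t"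
    and b: "b \<in> carrier B"
  shows "\<exists>c\<in>carrier K. y_elem \<gamma> \<odot>\<^bsub>M\<^esub> (b \<odot>\<^bsub>M\<^esub> t) = (c \<odot>\<^bsub>B\<^esub> \<one>\<^bsub>B\<^esub>) \<odot>\<^bsub>M\<^esub> (y_elem \<gamma> \<odot>\<^bsub>M\<^esub> (T wl \<odot>\<^bsub>M\<^esub> t))"
proof -
  interpret M: left_module B M by (rule M)
  let ?y = "y_elem \<gamma>" and ?z = "(y_elem \<gamma> \<otimes>\<^bsub>B\<^esub> T wl) \<odot>\<^bsub>M\<^esub> t"
  have y: "?y \<in> carrier B" by (rule y_closed)
  have z: "?z \<in> carrier M" using t y T_closed[OF wl] by (simp add: M.smult_closed)
  have sc: "c \<odot>\<^bsub>B\<^esub> \<one>\<^bsub>B\<^esub> \<in> carrier B" if "c \<in> carrier K" for c using that by simp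
  let ?W = "{b \<in> carrier B. \<exists>c\<in>carrier K. (?y \<otimes>\<^bsub>B\<^esub> b) \<odot>\<^bsub>M\<^esub> t = (c \<odot>\<^bsub>B\<^esub> \<one>\<^bsub>B\<^esub>) \<odot>\<^bsub>M\<^esub> ?z}"
  have "submodule ?W K B"
  proof (rule KB.left_submoduleI)
    have "(?y \<otimes>\<^bsub>B\<^esub> \<zero>\<^bsub>B\<^esub>) \<odot>\<^bsub>M\<^esub> t = (\<zero>\<^bsub>K\<^esub> \<odot>\<^bsub>B\<^esub> \<one>\<^bsub>B\<^esub>) \<odot>\<^bsub>M\<^esub> ?z"
      using y t z by (simp add: M.smult_zero_left)
    then show "\<zero>\<^bsub>B\<^esub> \<in> ?W" by (intro CollectI conjI bexI[of _ "\<zero>\<^bsub>K\<^esub>"]) simp_all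
  next
    fix a b assume "a \<in> ?W" "b \<in> ?W"
    then obtain c d where *: "a \<in> carrier B" "b \<in> carrier B" "c \<in> carrier K" "d \<in> carrier K"
      "(?y \<otimes>\<^bsub>B\<^esub> a) \<odot>\<^bsub>M\<^esub> t = (c \<odot>\<^bsub>B\<^esub> \<one>\<^bsub>B\<^esub>) \<odot>\<^bsub>M\<^esub> ?z" "(?y \<otimes>\<^bsub>B\<^esub> b) \<odot>\<^bsub>M\<^esub> t = (d \<odot>\<^bsub>B\<^esub> \<one>\<^bsub>B\<^esub>) \<odot>\<^bsub>M\<^esub> ?z"
      by (elim CollectE conjE bexE)
    have "(?y \<otimes>\<^bsub>B\<^esub> (a \<oplus>\<^bsub>B\<^esub> b)) \<odot>\<^bsub>M\<^esub> t = ((c \<oplus>\<^bsub>K\<^esub> d) \<odot>\<^bsub>B\<^esub> \<one>\<^bsub>B\<^esub>) \<odot>\<^bsub>M\<^esub> ?z"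
      using * y t z by (simp add: B.r_distr M.smult_add_left B.smult_l_distr)
    then show "a \<oplus>\<^bsub>B\<^esub> b \<in> ?W" using * by (intro CollectI conjI bexI[of _ "c \<oplus>\<^bsub>K\<^esub> d"]) simp_all
  next
    fix a b assume a: "a \<in> carrier K" and "b \<in> ?W"
    then obtain c where *: "b \<in> carrier B" "c \<in> carrier K"
      "(?y \<otimes>\<^bsub>B\<^esub> b) \<odot>\<^bsub>M\<^esub> t = (c \<odot>\<^bsub>B\<^esub> \<one>\<^bsub>B\<^esub>) \<odot>\<^bsub>M\<^esub> ?z"
      by (elim CollectE conjE bexE)
    have yb: "?y \<otimes>\<^bsub>B\<^esub> b \<in> carrier B" using y * by simp
    have "(?y \<otimes>\<^bsub>B\<^esub> (a \<odot>\<^bsub>B\<^esub> b)) \<odot>\<^bsub>M\<^esub> t = (a \<odot>\<^bsub>B\<^esub> \<one>\<^bsub>B\<^esub>) \<odot>\<^bsub>M\<^esub> ((?y \<otimes>\<^bsub>B\<^esub> b) \<odot>\<^bsub>M\<^esub> t)"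
      using M.smult_assoc[OF sc[OF a] yb t] scalar_mult(1)[OF a yb] a y *(1) by (simp add: B.smult_mult_right)
    also have "\<dots> = ((a \<otimes>\<^bsub>K\<^esub> c) \<odot>\<^bsub>B\<^esub> \<one>\<^bsub>B\<^esub>) \<odot>\<^bsub>M\<^esub> ?z"
      unfolding *(3) M.smult_assoc[OF sc[OF a] sc[OF *(2)] z, symmetric]
      using a *(2) by (simp add: scalar_mult(1) B.smult_assoc1)
    finally show "a \<odot>\<^bsub>B\<^esub> b \<in> ?W" using * a by (intro CollectI conjI bexI[of _ "a \<otimes>\<^bsub>K\<^esub> c"]) simp_all
  qed simp
  moreover have "T ` carrier (sym_group m) \<subseteq> ?W"
  proof (rule image_subsetI)
    fix w assume "w \<in> carrier (sym_group m)"
    then have w: "w permutes {1..m}" by (simp add: sym_group_carrier)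
    show "T w \<in> ?W" using y_T_line[OF M t Tt w] T_closed[OF w] by (intro CollectI conjI)
  qed
  ultimately have "lin_span K B (T ` carrier (sym_group m)) \<subseteq> ?W" by (rule lin_span_least)
  then have "b \<in> ?W" using b lin_basis_span(3)[OF KB.left_module_axioms T_basis] by auto
  then show ?thesis
    using M.smult_assoc[OF y b t] M.smult_assoc[OF y T_closed[OF wl] t] by simp
qed

text \<open>A permutation increasing on every row is of minimal length in its coset of the row
  group, so lengths add. The right factor grows by simple reflections of the row group, each of
  which meets an ascent of \<open>w \<circ> u\<close>.\<close>

lemma T_mult_row:
  assumes v: "v \<in> parabolic m \<rho>" and w: "w permutes {1..m}"
    and inc: "\<And>p s. \<lbrakk>1 \<le> p; p < s; s \<le> m; \<rho> p = \<rho> s\<rbrakk> \<Longrightarrow> w p < w s"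
  shows "T w \<otimes>\<^bsub>B\<^esub> T v = T (w \<circ> v)"
  using v
proof (induction "perm_length m v" arbitrary: v rule: less_induct)
  case less
  note v = parabolicD[OF less.prems]
  show ?case
  proof (cases "v = id")
    case True
    then show ?thesis using T_closed[OF w] by (simp add: T_id)
  next
    case False
    obtain i where i: "1 \<le> i" "i < m" "v (Suc i) < v i" "\<rho> i = \<rho> (Suc i)"
      using parabolic_descent[OF \<rho>_mono less.prems False] by blast
    define u where "u = v \<circ> adj i"
    have u: "u \<in> parabolic m \<rho>"
      unfolding u_def by (rule parabolic_comp[OF less.prems adj_parabolic[OF i(1,2,4)]])
    have up: "u permutes {1..m}" by (rule parabolicD(1)[OF u])
    have vu: "v = u \<circ> adj i" by (simp add: u_def adj_adj)
    have u_lt: "u i < u (Suc i)" using i(3) by (simp add: u_def)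
    have mem: "i \<in> {1..m}" "Suc i \<in> {1..m}" using i by simp_all
    have "\<rho> (u i) = \<rho> (u (Suc i))" using parabolicD(2)[OF u] mem i(4) by simp
    then have "w (u i) < w (u (Suc i))"
      using permutes_in_image[OF up, of i] permutes_in_image[OF up, of "Suc i"] mem u_lt
      by (intro inc) simp_all
    then have "T (w \<circ> u) \<otimes>\<^bsub>B\<^esub> T (adj i) = T (w \<circ> u \<circ> adj i)"
      by (intro T_right_up[OF permutes_compose[OF up w] i(1,2)]) simp
    moreover have "T w \<otimes>\<^bsub>B\<^esub> T u = T (w \<circ> u)"
      using perm_length_adj_right_down[OF v(1) i(1-3), folded u_def] by (intro less.hyps u) simp
    moreover have "T v = T u \<otimes>\<^bsub>B\<^esub> T (adj i)" using T_right_up[OF up i(1,2) u_lt] vu by simp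
    ultimately show ?thesis
      using T_closed[OF w] T_closed[OF up] T_adj_closed[OF i(1,2)] vu
      by (simp add: B.m_assoc[symmetric] comp_assoc)
  qed
qed

text \<open>The mirror image of \<open>T_mult_row\<close>, for left factors from the column
  group.\<close>

lemma T_mult_column:
  assumes u: "u \<in> parabolic m \<gamma>" and w: "w permutes {1..m}"
    and inc: "\<And>p s. \<lbrakk>1 \<le> p; p < s; s \<le> m; \<gamma> p = \<gamma> s\<rbrakk> \<Longrightarrow> inv' w p < inv' w s"
  shows "T u \<otimes>\<^bsub>B\<^esub> T w = T (u \<circ> w)"
  using u
proof (induction "perm_length m u" arbitrary: u rule: less_induct)
  case less
  note u = parabolicD[OF less.prems]
  show ?case
  proof (cases "u = id")
    case True
    then show ?thesis using T_closed[OF w] by (simp add: T_id)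
  next
    case False
    then have "inv' u \<noteq> id" using inv_inv_eq[OF permutes_bij[OF u(1)]] by auto
    then obtain i where i: "1 \<le> i" "i < m" "inv' u (Suc i) < inv' u i" "\<gamma> i = \<gamma> (Suc i)"
      using parabolic_descent[OF \<gamma>_mono parabolic_inv[OF less.prems]] by blast
    define v where "v = adj i \<circ> u"
    have v: "v \<in> parabolic m \<gamma>"
      unfolding v_def by (rule parabolic_comp[OF adj_parabolic[OF i(1,2,4)] less.prems])
    have vp: "v permutes {1..m}" by (rule parabolicD(1)[OF v])
    have uv: "u = adj i \<circ> v" by (simp add: v_def adj_adj)
    have v_lt: "inv' v i < inv' v (Suc i)" using i(3) by (simp add: v_def inv_comp_adj(2)[OF u(1) i(1,2)])
    have mem: "i \<in> {1..m}" "Suc i \<in> {1..m}" using i by simp_all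
    have "\<gamma> (inv' v i) = \<gamma> (inv' v (Suc i))" using parabolicD(2)[OF parabolic_inv[OF v]] mem i(4) by simp
    then have "inv' w (inv' v i) < inv' w (inv' v (Suc i))"
      using permutes_in_image[OF permutes_inv[OF vp], of i]
        permutes_in_image[OF permutes_inv[OF vp], of "Suc i"] mem v_lt
      by (intro inc) simp_all
    then have "T (adj i) \<otimes>\<^bsub>B\<^esub> T (v \<circ> w) = T (adj i \<circ> (v \<circ> w))"
      using o_inv_distrib[OF permutes_bij[OF vp] permutes_bij[OF w]]
      by (intro T_left_up[OF permutes_compose[OF w vp] i(1,2)]) simp
    moreover have "T v \<otimes>\<^bsub>B\<^esub> T w = T (v \<circ> w)"
      using perm_length_adj_left_down[OF u(1) i(1-3), folded v_def] by (intro less.hyps v) simp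
    moreover have "T u = T (adj i) \<otimes>\<^bsub>B\<^esub> T v" using T_left_up[OF vp i(1,2) v_lt] uv by simp
    ultimately show ?thesis
      using T_closed[OF w] T_closed[OF vp] T_adj_closed[OF i(1,2)] uv
      by (simp add: B.m_assoc comp_assoc)
  qed
qed

text \<open>The coefficient of \<open>T\<^sub>w\<^sub>l\<close> in \<open>y T\<^sub>w\<^sub>l x\<close> is \<open>1\<close>.\<close>

lemma y_wl_x_nonzero: "y_elem \<gamma> \<otimes>\<^bsub>B\<^esub> T wl \<otimes>\<^bsub>B\<^esub> x_elem \<rho> \<noteq> \<zero>\<^bsub>B\<^esub>"
proof
  assume eq0: "y_elem \<gamma> \<otimes>\<^bsub>B\<^esub> T wl \<otimes>\<^bsub>B\<^esub> x_elem \<rho> = \<zero>\<^bsub>B\<^esub>"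
  let ?S = "carrier (sym_group m)" and ?P = "parabolic m \<rho>" and ?G = "parabolic m \<gamma>"
  \<comment> \<open>The coordinate at \<open>T wl\<close>. Only the trivial pair satisfies
    \<open>u wl v = wl\<close>, so the expanded product has coordinate \<open>1\<close>
    there.\<close>
  define \<chi> where "\<chi> b = lin_coord K B ?S T b wl" for b
  note KB = KB.left_module_axioms
  have wlS: "wl \<in> ?S" using wl by (simp add: sym_group_carrier)
  have \<chi>_closed: "\<chi> b \<in> carrier K" if "b \<in> carrier B" for b
    unfolding \<chi>_def by (rule lin_coord_closed[OF KB T_basis that wlS])
  have \<chi>_add: "\<chi> (a \<oplus>\<^bsub>B\<^esub> b) = \<chi> a \<oplus>\<^bsub>K\<^esub> \<chi> b" if "a \<in> carrier B" "b \<in> carrier B" for a b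
    unfolding \<chi>_def by (rule lin_coord_add[OF KB T_basis that wlS])
  have \<chi>_smult: "\<chi> (c \<odot>\<^bsub>B\<^esub> b) = c \<otimes>\<^bsub>K\<^esub> \<chi> b" if "c \<in> carrier K" "b \<in> carrier B" for c b
    unfolding \<chi>_def by (rule lin_coord_smult[OF KB T_basis that wlS])
  have \<chi>_T: "\<chi> (T w) = (if w = wl then \<one>\<^bsub>K\<^esub> else \<zero>\<^bsub>K\<^esub>)" if "w permutes {1..m}" for w
    unfolding \<chi>_def using that by (intro lin_coord_basis[OF KB T_basis wlS]) (simp add: sym_group_carrier)
  have \<chi>_zero: "\<chi> \<zero>\<^bsub>B\<^esub> = \<zero>\<^bsub>K\<^esub>" using \<chi>_smult[of "\<zero>\<^bsub>K\<^esub>" "\<zero>\<^bsub>B\<^esub>"] \<chi>_closed by simp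
  have \<chi>_sum0: "\<chi> (\<Oplus>\<^bsub>B\<^esub>i\<in>I. f i) = \<zero>\<^bsub>K\<^esub>"
    if "finite I" "\<And>i. i \<in> I \<Longrightarrow> f i \<in> carrier B" "\<And>i. i \<in> I \<Longrightarrow> \<chi> (f i) = \<zero>\<^bsub>K\<^esub>" for I and f :: "(nat \<Rightarrow> nat) \<Rightarrow> 'b"
    using that
  proof (induction I rule: finite_induct)
    case (insert i I)
    then have "(\<Oplus>\<^bsub>B\<^esub>i\<in>insert i I. f i) = f i \<oplus>\<^bsub>B\<^esub> (\<Oplus>\<^bsub>B\<^esub>i\<in>I. f i)" by (intro B.finsum_insert) auto
    moreover have "(\<Oplus>\<^bsub>B\<^esub>i\<in>I. f i) \<in> carrier B" using insert by (intro B.finsum_closed) auto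
    ultimately show ?case using insert \<chi>_add by simp
  qed (simp add: \<chi>_zero)
  have wlv: "wl \<circ> v permutes {1..m}" if "v \<in> ?P" for v
    by (rule permutes_compose[OF parabolicD(1)[OF that] wl])
  \<comment> \<open>Along a column the rows of the positions under the inverse of \<open>wl\<close>
    strictly increase, and \<open>v\<close> moves positions only within rows. So \<open>wl v\<close>
    is still increasing along columns and \<open>T_mult_column\<close> applies.\<close>
  have column_inc: "inv' (wl \<circ> v) p < inv' (wl \<circ> v) s"
    if v: "v \<in> ?P" and ps: "1 \<le> p" "p < s" "s \<le> m" "\<gamma> p = \<gamma> s" for v p s
  proof (rule ccontr)
    note vp = parabolicD(1)[OF v]
    have inv: "inv' (wl \<circ> v) x = inv' v (inv' wl x)" for x
      using o_inv_distrib[OF permutes_bij[OF wl] permutes_bij[OF vp]] by simp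
    have mem: "inv' wl p \<in> {1..m}" "inv' wl s \<in> {1..m}"
      using permutes_in_image[OF permutes_inv[OF wl]] ps by simp_all
    have mem': "inv' v (inv' wl p) \<in> {1..m}" "inv' v (inv' wl s) \<in> {1..m}"
      using permutes_in_image[OF permutes_inv[OF vp]] mem by simp_all
    assume "\<not> inv' (wl \<circ> v) p < inv' (wl \<circ> v) s"
    then have "\<rho> (inv' v (inv' wl s)) \<le> \<rho> (inv' v (inv' wl p))"
      using mem' by (intro mono_onD[OF \<rho>_mono]) (simp_all add: inv)
    then have "\<rho> (inv' wl s) \<le> \<rho> (inv' wl p)" using parabolicD(2)[OF parabolic_inv[OF v]] mem by simp
    then show False using wl_columns[OF ps] by simp
  qed
  have uwlv: "T u \<otimes>\<^bsub>B\<^esub> T (wl \<circ> v) = T (u \<circ> (wl \<circ> v))" if "u \<in> ?G" "v \<in> ?P" for u v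
    by (rule T_mult_column[OF that(1) wlv[OF that(2)] column_inc[OF that(2)]])
  \<comment> \<open>A row and a column of the diagram share at most one cell: \<open>p\<close> and
    \<open>v p\<close> lie in one row, and \<open>u wl v = wl\<close> puts their images into one
    column.\<close>
  have trivial: "v = id" if u: "u \<in> ?G" and v: "v \<in> ?P" and eq: "u \<circ> (wl \<circ> v) = wl" for u v
  proof
    note vp = parabolicD(1)[OF v]
    fix p
    show "v p = id p"
    proof (cases "p \<in> {1..m}")
      case True
      have vp': "v p \<in> {1..m}" using permutes_in_image[OF vp] True by simp
      have "\<gamma> (wl (v p)) = \<gamma> (u (wl (v p)))"
        using parabolicD(2)[OF u, of "wl (v p)"] permutes_in_image[OF wl] vp' by simp
      also have "u (wl (v p)) = wl p" using fun_cong[OF eq, of p] by simp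
      finally have "\<gamma> (wl (v p)) = \<gamma> (wl p)" .
      then show ?thesis
        using wl_rows[of p "v p"] wl_rows[of "v p" p] parabolicD(2)[OF v True] True vp'
        by (metis atLeastAtMost_iff id_apply linorder_neqE_nat)
    next
      case False
      then show ?thesis using vp by (simp add: permutes_def)
    qed
  qed
  have u_id: "u = id" if u: "u \<in> ?G" and v: "v \<in> ?P" and eq: "u \<circ> (wl \<circ> v) = wl" for u v
  proof -
    have "u \<circ> wl = wl" using trivial[OF that] eq by simp
    then have "u \<circ> wl \<circ> inv' wl = wl \<circ> inv' wl" by simp
    then show ?thesis by (simp add: comp_assoc permutes_inv_o(1)[OF wl])
  qed
  define z where "z = T wl \<otimes>\<^bsub>B\<^esub> x_elem \<rho>"
  have zB: "z \<in> carrier B" unfolding z_def using T_closed[OF wl] x_closed by simp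
  have Twl_v: "T wl \<otimes>\<^bsub>B\<^esub> T v = T (wl \<circ> v)" if "v \<in> ?P" for v
    using wl_rows by (intro T_mult_row[OF that wl]) blast
  have clT: "T \<in> ?P \<rightarrow> carrier B" using T_closed parabolicD(1) by auto
  have clTv: "(\<lambda>v. T (wl \<circ> v)) \<in> ?P \<rightarrow> carrier B" using T_closed wlv by auto
  have "z = (\<Oplus>\<^bsub>B\<^esub>v\<in>?P. T wl \<otimes>\<^bsub>B\<^esub> T v)"
    unfolding z_def x_elem_def by (rule B.finsum_rdistr[OF finite_parabolic T_closed[OF wl] clT])
  also have "\<dots> = (\<Oplus>\<^bsub>B\<^esub>v\<in>?P. T (wl \<circ> v))"
    by (rule B.finsum_cong'[OF refl clTv Twl_v])
  finally have z: "z = (\<Oplus>\<^bsub>B\<^esub>v\<in>?P. T (wl \<circ> v))" .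
  have z': "z = T wl \<oplus>\<^bsub>B\<^esub> (\<Oplus>\<^bsub>B\<^esub>v\<in>?P - {id}. T (wl \<circ> v))"
  proof -
    have "?P = insert id (?P - {id})" using id_parabolic by auto
    then have "z = (\<Oplus>\<^bsub>B\<^esub>v\<in>insert id (?P - {id}). T (wl \<circ> v))" unfolding z by simp
    also have "\<dots> = T (wl \<circ> id) \<oplus>\<^bsub>B\<^esub> (\<Oplus>\<^bsub>B\<^esub>v\<in>?P - {id}. T (wl \<circ> v))"
      using clTv finite_parabolic T_closed[OF wl] by (intro B.finsum_insert) auto
    finally show ?thesis by simp
  qed
  have "\<chi> (\<Oplus>\<^bsub>B\<^esub>v\<in>?P - {id}. T (wl \<circ> v)) = \<zero>\<^bsub>K\<^esub>"
  proof (rule \<chi>_sum0)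
    show "finite (?P - {id})" using finite_parabolic by simp
    fix v assume v: "v \<in> ?P - {id}"
    then show "T (wl \<circ> v) \<in> carrier B" using T_closed wlv by simp
    have "wl \<circ> v \<noteq> wl" using trivial[OF id_parabolic, of v] v by auto
    then show "\<chi> (T (wl \<circ> v)) = \<zero>\<^bsub>K\<^esub>" using \<chi>_T wlv v by simp
  qed
  moreover have "(\<Oplus>\<^bsub>B\<^esub>v\<in>?P - {id}. T (wl \<circ> v)) \<in> carrier B"
    using clTv by (intro B.finsum_closed) auto
  ultimately have \<chi>z: "\<chi> z = \<one>\<^bsub>K\<^esub>" unfolding z' using T_closed[OF wl] \<chi>_T[OF wl] by (simp add: \<chi>_add)
  let ?t = "\<lambda>u. (r [^]\<^bsub>K\<^esub> perm_length m u) \<odot>\<^bsub>B\<^esub> T u"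
  have clt: "?t \<in> ?G \<rightarrow> carrier B" using y_term_closed by auto
  have cltz: "(\<lambda>u. ?t u \<otimes>\<^bsub>B\<^esub> z) \<in> ?G \<rightarrow> carrier B" using y_term_closed zB by auto
  have "y_elem \<gamma> \<otimes>\<^bsub>B\<^esub> T wl \<otimes>\<^bsub>B\<^esub> x_elem \<rho> = y_elem \<gamma> \<otimes>\<^bsub>B\<^esub> z"
    unfolding z_def using y_closed T_closed[OF wl] x_closed by (simp add: B.m_assoc)
  also have "\<dots> = (\<Oplus>\<^bsub>B\<^esub>u\<in>?G. ?t u \<otimes>\<^bsub>B\<^esub> z)"
    unfolding y_elem_def by (rule B.finsum_ldistr[OF finite_parabolic zB clt])
  also have "\<dots> = z \<oplus>\<^bsub>B\<^esub> (\<Oplus>\<^bsub>B\<^esub>u\<in>?G - {id}. ?t u \<otimes>\<^bsub>B\<^esub> z)"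
  proof -
    have "?G = insert id (?G - {id})" using id_parabolic by auto
    then have "(\<Oplus>\<^bsub>B\<^esub>u\<in>?G. ?t u \<otimes>\<^bsub>B\<^esub> z) = (\<Oplus>\<^bsub>B\<^esub>u\<in>insert id (?G - {id}). ?t u \<otimes>\<^bsub>B\<^esub> z)" by simp
    also have "\<dots> = ?t id \<otimes>\<^bsub>B\<^esub> z \<oplus>\<^bsub>B\<^esub> (\<Oplus>\<^bsub>B\<^esub>u\<in>?G - {id}. ?t u \<otimes>\<^bsub>B\<^esub> z)"
      using cltz finite_parabolic funcset_mem[OF cltz id_parabolic] by (intro B.finsum_insert) auto
    also have "?t id \<otimes>\<^bsub>B\<^esub> z = z" using zB by (simp add: perm_length_id T_id)
    finally show ?thesis .
  qed
  finally have sum: "z \<oplus>\<^bsub>B\<^esub> (\<Oplus>\<^bsub>B\<^esub>u\<in>?G - {id}. ?t u \<otimes>\<^bsub>B\<^esub> z) = \<zero>\<^bsub>B\<^esub>" using eq0 by simp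
  have "\<chi> (\<Oplus>\<^bsub>B\<^esub>u\<in>?G - {id}. ?t u \<otimes>\<^bsub>B\<^esub> z) = \<zero>\<^bsub>K\<^esub>"
  proof (rule \<chi>_sum0)
    show "finite (?G - {id})" using finite_parabolic by simp
    fix u assume u: "u \<in> ?G - {id}"
    then have uG: "u \<in> ?G" and Tu: "T u \<in> carrier B" using T_closed parabolicD(1) by auto
    show "?t u \<otimes>\<^bsub>B\<^esub> z \<in> carrier B" using y_term_closed[OF uG] zB by simp
    have "T u \<otimes>\<^bsub>B\<^esub> z = (\<Oplus>\<^bsub>B\<^esub>v\<in>?P. T u \<otimes>\<^bsub>B\<^esub> T (wl \<circ> v))"
      unfolding z by (rule B.finsum_rdistr[OF finite_parabolic Tu clTv])
    also have "\<chi> \<dots> = \<zero>\<^bsub>K\<^esub>"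
    proof (rule \<chi>_sum0[OF finite_parabolic])
      fix v assume v: "v \<in> ?P"
      show "T u \<otimes>\<^bsub>B\<^esub> T (wl \<circ> v) \<in> carrier B" using Tu T_closed[OF wlv[OF v]] by simp
      have "u \<circ> (wl \<circ> v) \<noteq> wl" using u_id[OF uG v] u by auto
      then show "\<chi> (T u \<otimes>\<^bsub>B\<^esub> T (wl \<circ> v)) = \<zero>\<^bsub>K\<^esub>"
        unfolding uwlv[OF uG v] using \<chi>_T[OF permutes_compose[OF wlv[OF v] parabolicD(1)[OF uG]]] by simp
    qed
    finally have "\<chi> (T u \<otimes>\<^bsub>B\<^esub> z) = \<zero>\<^bsub>K\<^esub>" .
    then show "\<chi> (?t u \<otimes>\<^bsub>B\<^esub> z) = \<zero>\<^bsub>K\<^esub>"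
      using Tu zB r_closed by (simp add: B.smult_mult_left \<chi>_smult)
  qed
  moreover have "(\<Oplus>\<^bsub>B\<^esub>u\<in>?G - {id}. ?t u \<otimes>\<^bsub>B\<^esub> z) \<in> carrier B"
    using cltz by (intro B.finsum_closed) auto
  ultimately have "\<chi> \<zero>\<^bsub>B\<^esub> = \<one>\<^bsub>K\<^esub>" unfolding sum[symmetric] using zB \<chi>z by (simp add: \<chi>_add)
  then show False using \<chi>_zero by simp
qed

end

section \<open>Young diagrams\<close>

lemma sum_list_take_Suc: "i < length mu \<Longrightarrow> sum_list (take (Suc i) mu) = sum_list (take i mu) + (mu ! i :: nat)"
  by (simp add: take_Suc_conv_app_nth)

lemma sum_list_take_mono: "i \<le> i' \<Longrightarrow> sum_list (take i mu) \<le> sum_list (take i' (mu :: nat list))"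
  by (metis le_add1 le_add_diff_inverse sum_list_append take_add)

lemma row_tableau_less:
  assumes "i < i'" "i < length mu" "j < mu ! i"
  shows "row_tableau mu i j < row_tableau mu i' j'"
proof -
  have "row_tableau mu i j \<le> sum_list (take (Suc i) mu)"
    using assms by (simp add: row_tableau_def sum_list_take_Suc)
  also have "\<dots> \<le> sum_list (take i' mu)" using assms(1) by (intro sum_list_take_mono) simp
  finally show ?thesis by (simp add: row_tableau_def)
qed

lemma row_tableau_mem:
  assumes "i < length mu" "j < mu ! i" shows "row_tableau mu i j \<in> {1..sum_list mu}"
proof -
  have "row_tableau mu i j \<le> sum_list (take (Suc i) mu)"
    using assms by (simp add: row_tableau_def sum_list_take_Suc)
  also have "\<dots> \<le> sum_list (take (length mu) mu)" using assms(1) by (intro sum_list_take_mono) simp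
  finally show ?thesis by (simp add: row_tableau_def)
qed

text \<open>Either \<open>p\<close> lies in the first row, or subtracting the length of that row
  reduces to the remaining ones.\<close>

lemma row_tableau_surj:
  assumes "p \<in> {1..sum_list mu}"
  shows "\<exists>i j. i < length mu \<and> j < mu ! i \<and> p = row_tableau mu i j"
  using assms
proof (induction mu arbitrary: p)
  case (Cons a mu)
  show ?case
  proof (cases "p \<le> a")
    case True
    then show ?thesis
      using Cons.prems by (intro exI[of _ 0] exI[of _ "p - 1"]) (auto simp: row_tableau_def)
  next
    case False
    then have "p - a \<in> {1..sum_list mu}" using Cons.prems by auto
    then obtain i j where "i < length mu" "j < mu ! i" "p - a = row_tableau mu i j" using Cons.IH by blast
    then show ?thesis
      using False by (intro exI[of _ "Suc i"] exI[of _ j]) (simp add: row_tableau_def)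
  qed
qed simp

lemma row_tableau_cases:
  assumes "p \<in> {1..sum_list mu}"
  obtains i j where "i < length mu" "j < mu ! i" "p = row_tableau mu i j"
proof -
  from row_tableau_surj[OF assms] obtain i j where "i < length mu" "j < mu ! i" "p = row_tableau mu i j"
    by (elim exE conjE)
  then show thesis by (rule that)
qed

lemma row_tableau_inj:
  assumes "i < length mu" "j < mu ! i" "i' < length mu" "j' < mu ! i'"
    and eq: "row_tableau mu i j = row_tableau mu i' j'"
  shows "i = i' \<and> j = j'"
proof -
  have "i = i'"
    using row_tableau_less[of i i' mu j j'] row_tableau_less[of i' i mu j' j] assms
    by (metis less_irrefl linorder_neqE_nat)
  then show ?thesis using eq by (simp add: row_tableau_def)
qed

text \<open>For the conjugate shape the same function gives the column number in the
  column-by-column filling, so one notion serves both as \<open>\<rho>\<close> and as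
  \<open>\<gamma>\<close>. Outside \<open>{1..sum_list mu}\<close> the value is unspecified.\<close>

definition block :: "nat list \<Rightarrow> nat \<Rightarrow> nat" where
  "block mu p = (THE i. \<exists>j. i < length mu \<and> j < mu ! i \<and> p = row_tableau mu i j)"

lemma block_row_tableau: "\<lbrakk>i < length mu; j < mu ! i\<rbrakk> \<Longrightarrow> block mu (row_tableau mu i j) = i"
  unfolding block_def by (rule the_equality) (use row_tableau_inj in blast)+

lemma block_mono: "mono_on {1..sum_list mu} (block mu)"
proof (rule mono_onI)
  fix p s assume "p \<in> {1..sum_list mu}" "s \<in> {1..sum_list mu}" and le: "p \<le> s"
  then obtain i j i' j' where *: "i < length mu" "j < mu ! i" "p = row_tableau mu i j"
    "i' < length mu" "j' < mu ! i'" "s = row_tableau mu i' j'"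
    by (elim row_tableau_cases)
  have "\<not> i' < i" using row_tableau_less[of i' i mu j' j] * le by auto
  then show "block mu p \<le> block mu s" using * by (simp add: block_row_tableau)
qed

lemma block_level:
  assumes i: "i < length mu"
  shows "{row_tableau mu i j | j. j < mu ! i} = {p \<in> {1..sum_list mu}. block mu p = i}"
proof (rule equalityI; rule subsetI)
  fix p assume "p \<in> {row_tableau mu i j | j. j < mu ! i}"
  then obtain j where "j < mu ! i" "p = row_tableau mu i j" by blast
  then show "p \<in> {p \<in> {1..sum_list mu}. block mu p = i}"
    using row_tableau_mem[OF i] block_row_tableau[OF i] by simp
next
  fix p assume p: "p \<in> {p \<in> {1..sum_list mu}. block mu p = i}"
  then have "p \<in> {1..sum_list mu}" by simp
  then obtain k j where kj: "k < length mu" "j < mu ! k" "p = row_tableau mu k j" by (rule row_tableau_cases)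
  have "k = i" using p block_row_tableau[OF kj(1,2)] kj(3) by simp
  then show "p \<in> {row_tableau mu i j | j. j < mu ! i}" using kj by (intro CollectI exI[of _ j]) simp
qed

text \<open>An injective map of a finite level into itself is onto, so preserving
  \<open>\<beta>\<close> pointwise amounts to stabilizing each level as a set.\<close>

lemma level_stabilizer:
  fixes m :: nat
  assumes w: "w permutes {1..m}"
  shows "(\<forall>p\<in>{1..m}. \<beta> (w p) = \<beta> p) \<longleftrightarrow>
    (\<forall>i. w ` {p \<in> {1..m}. \<beta> p = i} = {p \<in> {1..m}. \<beta> p = i})"
proof
  assume *: "\<forall>p\<in>{1..m}. \<beta> (w p) = \<beta> p"
  show "\<forall>i. w ` {p \<in> {1..m}. \<beta> p = i} = {p \<in> {1..m}. \<beta> p = i}"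
  proof (intro allI card_subset_eq)
    fix i
    show "w ` {p \<in> {1..m}. \<beta> p = i} \<subseteq> {p \<in> {1..m}. \<beta> p = i}"
      using * permutes_in_image[OF w] by auto
    show "finite {p \<in> {1..m}. \<beta> p = i}" by (rule finite_subset[of _ "{1..m}"]) auto
    show "card (w ` {p \<in> {1..m}. \<beta> p = i}) = card {p \<in> {1..m}. \<beta> p = i}"
      using permutes_inj[OF w] by (intro card_image) (metis inj_on_subset subset_UNIV)
  qed
next
  assume "\<forall>i. w ` {p \<in> {1..m}. \<beta> p = i} = {p \<in> {1..m}. \<beta> p = i}"
  then show "\<forall>p\<in>{1..m}. \<beta> (w p) = \<beta> p" by blast
qed

lemma young_subgroup_parabolic:
  assumes mu: "sum_list mu = m"
  shows "young_subgroup m mu = parabolic m (block mu)"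
proof (rule Set.set_eqI)
  fix w
  let ?L = "\<lambda>i. {p \<in> {1..m}. block mu p = i}"
  \<comment> \<open>Indices beyond the last row have empty levels, so quantifying over all
    \<open>i\<close> instead of the rows changes nothing.\<close>
  have empty: "?L i = {}" if i: "\<not> i < length mu" for i
  proof (rule ccontr)
    assume "?L i \<noteq> {}"
    then obtain p where p: "p \<in> {1..sum_list mu}" "block mu p = i" using mu by auto
    from p(1) obtain i' j where "i' < length mu" "j < mu ! i'" "p = row_tableau mu i' j"
      by (rule row_tableau_cases)
    then show False using p(2) i by (simp add: block_row_tableau)
  qed
  have "w ` ?L i = ?L i" if "\<not> i < length mu" for i by (simp only: empty[OF that] image_empty)
  then have "(\<forall>i<length mu. w ` ?L i = ?L i) \<longleftrightarrow> (\<forall>i. w ` ?L i = ?L i)" by meson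
  moreover have "w \<in> young_subgroup m mu \<longleftrightarrow> w permutes {1..m} \<and> (\<forall>i<length mu. w ` ?L i = ?L i)"
    by (simp add: young_subgroup_def sym_group_carrier block_level mu)
  ultimately show "w \<in> young_subgroup m mu \<longleftrightarrow> w \<in> parabolic m (block mu)"
    using level_stabilizer[of w m "block mu"] unfolding parabolic_def mem_Collect_eq by argo
qed

lemma down_closed_card:
  assumes fin: "finite (D :: nat set)" and down: "\<And>i k. \<lbrakk>k \<in> D; i \<le> k\<rbrakk> \<Longrightarrow> i \<in> D"
  shows "i \<in> D \<longleftrightarrow> i < card D"
proof
  assume "i \<in> D"
  then have "{..i} \<subseteq> D" using down by auto
  then have "card {..i} \<le> card D" by (rule card_mono[OF fin])
  then show "i < card D" by simp
next
  assume lt: "i < card D"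
  show "i \<in> D"
  proof (rule ccontr)
    assume "i \<notin> D"
    then have "D \<subseteq> {..<i}" using down by (meson lessThan_iff linorder_not_less subsetI)
    then have "card D \<le> card {..<i}" by (intro card_mono) simp
    then show False using lt by simp
  qed
qed

lemma card_cells: "card (SIGMA i:{..<length mu}. {..<mu ! i}) = sum_list mu"
  by (simp add: sum_list_sum_nth atLeast0LessThan)

section \<open>Conjugate partitions and the permutation from row reading to column reading\<close>

locale partition =
  fixes lam :: "nat list" and m :: nat
  assumes lam: "is_partition lam m"
begin

abbreviation lam' where "lam' \<equiv> conj_partition lam"

lemma sum_lam: "sum_list lam = m" using lam by (simp add: is_partition_def)

lemma lam_decreasing: "\<lbrakk>i \<le> k; k < length lam\<rbrakk> \<Longrightarrow> lam ! k \<le> lam ! i"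
  using lam sorted_wrt_nth_less[of "(\<ge>)" lam i k] by (cases "i = k") (auto simp: is_partition_def)

text \<open>Row lengths decrease, so the rows meeting column \<open>j\<close> form an initial
  segment of the indices. An initial segment is determined by its cardinality, which is what the
  conjugate partition records.\<close>

lemma conj_cells: "(j < length lam' \<and> i < lam' ! j) \<longleftrightarrow> (i < length lam \<and> j < lam ! i)"
proof -
  let ?D = "{i. i < length lam \<and> j < lam ! i}"
  have D: "i \<in> ?D \<longleftrightarrow> i < card ?D"
    by (rule down_closed_card) (use lam_decreasing in \<open>auto intro: less_le_trans\<close>)
  have len: "length lam' = (if lam = [] then 0 else hd lam)" by (simp add: conj_partition_def)
  show ?thesis
  proof (cases "j < length lam'")
    case True
    then have "lam' ! j = card ?D" by (simp add: conj_partition_def)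
    then show ?thesis using True D by simp
  next
    case False
    have "\<not> (i < length lam \<and> j < lam ! i)"
    proof
      assume *: "i < length lam \<and> j < lam ! i"
      then have "lam \<noteq> []" by auto
      then have "lam ! i \<le> hd lam" using lam_decreasing[of 0 i] * by (simp add: hd_conv_nth)
      then show False using * False len \<open>lam \<noteq> []\<close> by simp
    qed
    then show ?thesis using False by simp
  qed
qed

text \<open>Transposing the diagram preserves the number of its cells.\<close>

lemma sum_lam': "sum_list lam' = m"
proof -
  have "(SIGMA j:{..<length lam'}. {..<lam' ! j}) = prod.swap ` (SIGMA i:{..<length lam}. {..<lam ! i})"
  proof (rule Set.set_eqI)
    fix z :: "nat \<times> nat"
    show "z \<in> (SIGMA j:{..<length lam'}. {..<lam' ! j}) \<longleftrightarrow>
        z \<in> prod.swap ` (SIGMA i:{..<length lam}. {..<lam ! i})"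
      using conj_cells[of "fst z" "snd z"] by (cases z) (simp add: pair_in_swap_image)
  qed
  then have "card (SIGMA j:{..<length lam'}. {..<lam' ! j}) = card (SIGMA i:{..<length lam}. {..<lam ! i})"
    by (simp add: card_image)
  then show ?thesis using sum_lam by (simp only: card_cells)
qed

lemma col_row: "col_tableau lam i j = row_tableau lam' j i"
  by (simp add: col_tableau_def row_tableau_def)

text \<open>An explicit form of \<open>tableau_perm\<close>: the row of \<open>p\<close> is its
  block and the column is its offset there, with \<open>- 1\<close> because entries start at
  \<open>1\<close> but columns at \<open>0\<close>. Points outside \<open>{1..m}\<close> are fixed,
  as \<open>permutes\<close> demands.\<close>

definition wl :: "nat \<Rightarrow> nat" where
  "wl p = (if p \<in> {1..m} then col_tableau lam (block lam p) (p - sum_list (take (block lam p) lam) - 1) else p)"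

lemma row_mem: "\<lbrakk>i < length lam; j < lam ! i\<rbrakk> \<Longrightarrow> row_tableau lam i j \<in> {1..m}"
  using row_tableau_mem sum_lam by blast

lemma wl_row:
  assumes "i < length lam" "j < lam ! i" shows "wl (row_tableau lam i j) = col_tableau lam i j"
proof -
  have "row_tableau lam i j - sum_list (take i lam) - 1 = j" by (simp add: row_tableau_def)
  then show ?thesis using block_row_tableau[OF assms] row_mem[OF assms] by (simp add: wl_def)
qed

lemma row_cases:
  assumes "p \<in> {1..m}" obtains i j where "i < length lam" "j < lam ! i" "p = row_tableau lam i j"
proof -
  from assms have "p \<in> {1..sum_list lam}" by (simp only: sum_lam)
  then obtain i j where "i < length lam" "j < lam ! i" "p = row_tableau lam i j"
    by (rule row_tableau_cases)
  then show thesis by (rule that)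
qed

lemma col_cases:
  assumes "p \<in> {1..m}" obtains i j where "i < length lam" "j < lam ! i" "p = col_tableau lam i j"
proof -
  from assms have "p \<in> {1..sum_list lam'}" by (simp only: sum_lam')
  then obtain j i where "j < length lam'" "i < lam' ! j" "p = row_tableau lam' j i"
    by (rule row_tableau_cases)
  then show thesis using conj_cells[of j i] col_row[of i j] by (intro that[of i j]) simp_all
qed

lemma block_col: "\<lbrakk>i < length lam; j < lam ! i\<rbrakk> \<Longrightarrow> block lam' (col_tableau lam i j) = j"
  unfolding col_row using conj_cells by (intro block_row_tableau) auto

lemma wl_permutes: "wl permutes {1..m}"
proof (rule bij_imp_permutes)
  have "wl p \<in> {1..m}" if p: "p \<in> {1..m}" for p
  proof -
    from p obtain i j where ij: "i < length lam" "j < lam ! i" "p = row_tableau lam i j"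
      by (rule row_cases)
    have "row_tableau lam' j i \<in> {1..sum_list lam'}" using conj_cells[of j i] ij by (intro row_tableau_mem) simp_all
    then show ?thesis using wl_row ij col_row sum_lam' by simp
  qed
  moreover have "{1..m} \<subseteq> wl ` {1..m}"
  proof
    fix v assume "v \<in> {1..m}"
    then obtain i j where ij: "i < length lam" "j < lam ! i" "v = col_tableau lam i j"
      by (rule col_cases)
    then have "v = wl (row_tableau lam i j)" using wl_row by simp
    then show "v \<in> wl ` {1..m}" using row_mem[OF ij(1,2)] by (rule image_eqI)
  qed
  ultimately have "wl ` {1..m} = {1..m}" by blast
  moreover have "inj_on wl {1..m}" using \<open>{1..m} \<subseteq> wl ` {1..m}\<close> by (intro finite_surj_inj) simp_all
  ultimately show "bij_betw wl {1..m} {1..m}" by (simp add: bij_betw_def)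
  show "wl p = p" if "p \<notin> {1..m}" for p using that by (simp only: wl_def if_False)
qed

lemma tableau_perm: "tableau_perm m lam = wl"
  unfolding tableau_perm_def
proof (rule the_equality)
  show "wl \<in> carrier (sym_group m) \<and>
      (\<forall>i<length lam. \<forall>j<lam ! i. wl (row_tableau lam i j) = col_tableau lam i j)"
    using wl_permutes wl_row by (simp add: sym_group_carrier)
  fix w assume w: "w \<in> carrier (sym_group m) \<and>
      (\<forall>i<length lam. \<forall>j<lam ! i. w (row_tableau lam i j) = col_tableau lam i j)"
  then have wp: "w permutes {1..m}" by (simp add: sym_group_carrier)
  show "w = wl"
  proof
    fix p show "w p = wl p"
    proof (cases "p \<in> {1..m}")
      case True
      then obtain i j where "i < length lam" "j < lam ! i" "p = row_tableau lam i j" by (rule row_cases)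
      then show ?thesis using w wl_row by simp
    next
      case False
      then show ?thesis using wp wl_permutes by (metis permutes_not_in)
    qed
  qed
qed

lemma wl_rows:
  assumes "1 \<le> p" "p < s" "s \<le> m" and eq: "block lam p = block lam s"
  shows "wl p < wl s \<and> block lam' (wl p) < block lam' (wl s)"
proof -
  obtain i j where p: "i < length lam" "j < lam ! i" "p = row_tableau lam i j"
    by (rule row_cases[of p]) (use assms in simp)
  obtain i' k where s: "i' < length lam" "k < lam ! i'" "s = row_tableau lam i' k"
    by (rule row_cases[of s]) (use assms in simp)
  have i: "i' = i" using eq p s block_row_tableau by simp
  have "j < k" using assms(2) p(3) s(3) i by (simp add: row_tableau_def)
  moreover have "col_tableau lam i j < col_tableau lam i k"
    unfolding col_row using \<open>j < k\<close> conj_cells p by (intro row_tableau_less) auto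
  ultimately show ?thesis using p s i wl_row block_col by simp
qed

lemma wl_columns:
  assumes "1 \<le> p" "p < s" "s \<le> m" and eq: "block lam' p = block lam' s"
  shows "block lam (inv' wl p) < block lam (inv' wl s)" "inv' wl p < inv' wl s"
proof -
  obtain i j where p: "i < length lam" "j < lam ! i" "p = col_tableau lam i j"
    by (rule col_cases[of p]) (use assms in simp)
  obtain i' k where s: "i' < length lam" "k < lam ! i'" "s = col_tableau lam i' k"
    by (rule col_cases[of s]) (use assms in simp)
  have j: "k = j" using eq p s block_col by simp
  have lt: "i < i'" using assms(2) p(3) s(3) j by (simp add: col_tableau_def)
  have "inv' wl p = row_tableau lam i j"
    using wl_row[OF p(1,2)] p(3) permutes_inverses(2)[OF wl_permutes] by metis
  moreover have "inv' wl s = row_tableau lam i' j"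
    using wl_row[OF s(1,2)] s(3) j permutes_inverses(2)[OF wl_permutes] by metis
  ultimately show "block lam (inv' wl p) < block lam (inv' wl s)" "inv' wl p < inv' wl s"
    using lt p s j block_row_tableau row_tableau_less[OF lt p(1,2)] by simp_all
qed

text \<open>If \<open>w\<close> sends the entries of every row to strictly increasing columns, then it sends each entry at
  least as far to the right as \<open>wl\<close> does.  The sums over all entries of the column indices
  agree, hence so do the indices.\<close>

lemma wl_unique:
  assumes w: "w permutes {1..m}"
    and rows: "\<And>p s. \<lbrakk>1 \<le> p; p < s; s \<le> m; block lam p = block lam s\<rbrakk> \<Longrightarrow> block lam' (w p) < block lam' (w s)"
    and columns: "\<And>p s. \<lbrakk>1 \<le> p; p < s; s \<le> m; block lam' p = block lam' s\<rbrakk> \<Longrightarrow> inv' w p < inv' w s"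
  shows "w = wl"
proof -
  let ?\<gamma> = "block lam'"
  have "?\<gamma> (wl p) \<le> ?\<gamma> (w p)" if p: "p \<in> {1..m}" for p
  proof -
    obtain i j where ij: "i < length lam" "j < lam ! i" "p = row_tableau lam i j"
      using p by (rule row_cases)
    \<comment> \<open>Column indices rise by at least one with every cell of the row, starting from
      at least \<open>0\<close>.\<close>
    have "j \<le> ?\<gamma> (w (row_tableau lam i j))" if "j < lam ! i" for j
      using that
    proof (induction j)
      case (Suc j)
      have "?\<gamma> (w (row_tableau lam i j)) < ?\<gamma> (w (row_tableau lam i (Suc j)))"
        using row_mem[of i j] row_mem[of i "Suc j"] Suc.prems ij(1) block_row_tableau[of i lam j] block_row_tableau[of i lam "Suc j"]
        by (intro rows) (simp_all add: row_tableau_def)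
      then show ?case using Suc by simp
    qed simp
    then show ?thesis using ij wl_row block_col by simp
  qed
  moreover have "(\<Sum>p\<in>{1..m}. ?\<gamma> (wl p)) = (\<Sum>p\<in>{1..m}. ?\<gamma> (w p))"
    using sum.permute[OF wl_permutes, of ?\<gamma>] sum.permute[OF w, of ?\<gamma>] by (simp add: comp_def)
  ultimately have eq: "?\<gamma> (wl p) = ?\<gamma> (w p)" if "p \<in> {1..m}" for p
    using sum_mono_inv[of "\<lambda>p. ?\<gamma> (wl p)" "{1..m}" "\<lambda>p. ?\<gamma> (w p)" p] that by simp
  \<comment> \<open>Having equal column indices, \<open>w\<close> and \<open>wl\<close> differ by a
    permutation inside the columns. Both inverses increase along columns, so \<open>u\<close> has no
    descent.\<close>
  define u where "u = w \<circ> inv' wl"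
  have u: "u permutes {1..m}" unfolding u_def by (rule permutes_compose[OF permutes_inv[OF wl_permutes] w])
  have inv_mem: "inv' wl v \<in> {1..m}" if "v \<in> {1..m}" for v
    using permutes_in_image[OF permutes_inv[OF wl_permutes]] that by simp
  have u\<gamma>: "?\<gamma> (u v) = ?\<gamma> v" if "v \<in> {1..m}" for v
    using eq[OF inv_mem[OF that]] by (simp add: u_def permutes_inverses[OF wl_permutes])
  then have up: "u \<in> parabolic m ?\<gamma>" using u by (simp add: parabolic_def)
  have "u = id"
  proof (rule ccontr)
    assume "u \<noteq> id"
    then obtain i where i: "1 \<le> i" "i < m" "u (Suc i) < u i" "?\<gamma> i = ?\<gamma> (Suc i)"
      using parabolic_descent[OF _ up] block_mono[of lam'] sum_lam' by metis
    have mem: "u i \<in> {1..m}" "u (Suc i) \<in> {1..m}"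
      using permutes_in_image[OF u, of i] permutes_in_image[OF u, of "Suc i"] i by simp_all
    have "inv' w (u (Suc i)) < inv' w (u i)"
      using i mem u\<gamma>[of i] u\<gamma>[of "Suc i"] by (intro columns) simp_all
    then have "inv' wl (Suc i) < inv' wl i" by (simp add: u_def permutes_inverses[OF w])
    moreover have "inv' wl i < inv' wl (Suc i)" using i by (intro wl_columns(2)) simp_all
    ultimately show False by simp
  qed
  then have "w \<circ> inv' wl \<circ> wl = wl" by (simp add: u_def)
  then show ?thesis by (simp add: comp_assoc permutes_inv_o(2)[OF wl_permutes])
qed

text \<open>In the row filling the column of \<open>p\<close> is the block of \<open>wl p\<close>
  for the conjugate shape. Transport by \<open>wl\<close> therefore turns column-preserving
  permutations into the Young subgroup of \<open>lam'\<close>.\<close>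

lemma column_stabilizer:
  "column_stabilizer m lam = (\<lambda>u. inv' wl \<circ> u \<circ> wl) ` parabolic m (block lam')"
proof -
  let ?\<beta> = "\<lambda>p. block lam' (wl p)"
  have level: "{row_tableau lam i j | i. i < length lam \<and> j < lam ! i} = {p \<in> {1..m}. ?\<beta> p = j}" for j
  proof (rule equalityI; rule subsetI)
    fix p assume "p \<in> {row_tableau lam i j | i. i < length lam \<and> j < lam ! i}"
    then show "p \<in> {p \<in> {1..m}. ?\<beta> p = j}" using row_mem wl_row block_col by auto
  next
    fix p assume p: "p \<in> {p \<in> {1..m}. ?\<beta> p = j}"
    then have "p \<in> {1..m}" by simp
    then obtain i k where "i < length lam" "k < lam ! i" "p = row_tableau lam i k" by (rule row_cases)
    then show "p \<in> {row_tableau lam i j | i. i < length lam \<and> j < lam ! i}"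
      using p wl_row block_col by auto
  qed
  have "w \<in> column_stabilizer m lam \<longleftrightarrow> w permutes {1..m} \<and> (\<forall>p\<in>{1..m}. ?\<beta> (w p) = ?\<beta> p)" for w
    unfolding column_stabilizer_def level sym_group_carrier using level_stabilizer[of w m ?\<beta>] by auto
  then have cs: "column_stabilizer m lam = parabolic m ?\<beta>" by (auto simp: parabolic_def)
  show ?thesis
    unfolding cs
  proof (rule equalityI; rule subsetI)
    fix w assume w: "w \<in> parabolic m ?\<beta>"
    have eq: "w = inv' wl \<circ> (wl \<circ> w \<circ> inv' wl) \<circ> wl"
      by (simp add: fun_eq_iff permutes_inverses[OF wl_permutes])
    have "wl \<circ> w \<circ> inv' wl permutes {1..m}"
      by (intro permutes_compose parabolicD(1)[OF w] wl_permutes permutes_inv)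
    moreover have "block lam' ((wl \<circ> w \<circ> inv' wl) p) = block lam' p" if "p \<in> {1..m}" for p
      using parabolicD(2)[OF w, of "inv' wl p"] permutes_in_image[OF permutes_inv[OF wl_permutes], of p] that
      by (simp add: permutes_inverses[OF wl_permutes])
    ultimately have "wl \<circ> w \<circ> inv' wl \<in> parabolic m (block lam')" by (simp add: parabolic_def)
    with eq show "w \<in> (\<lambda>u. inv' wl \<circ> u \<circ> wl) ` parabolic m (block lam')" by (rule image_eqI)
  next
    fix w assume "w \<in> (\<lambda>u. inv' wl \<circ> u \<circ> wl) ` parabolic m (block lam')"
    then obtain u where u: "u \<in> parabolic m (block lam')" "w = inv' wl \<circ> u \<circ> wl" by (elim imageE)
    have "w permutes {1..m}"
      unfolding u(2) by (intro permutes_compose parabolicD(1)[OF u(1)] wl_permutes permutes_inv)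
    moreover have "?\<beta> (w p) = ?\<beta> p" if "p \<in> {1..m}" for p
      using parabolicD(2)[OF u(1), of "wl p"] permutes_in_image[OF wl_permutes, of p] that
      by (simp add: u(2) permutes_inverses[OF wl_permutes])
    ultimately show "w \<in> parabolic m ?\<beta>" by (simp add: parabolic_def)
  qed
qed

end

section \<open>Permutation modules\<close>

lemma left_ideal_left_module:
  fixes A :: "('k, 'a) module"
  assumes A: "ring A" and x: "x \<in> carrier A"
  shows "left_module A (left_ideal_module A x)"
proof -
  interpret A: ring A by (rule A)
  interpret L: left_module A "regular_module A" by (rule regular_left_module[OF A])
  have "(\<lambda>a. a \<otimes>\<^bsub>A\<^esub> x) \<in> mod_hom A (regular_module A) (regular_module A)"
    using x by (intro mod_homI) (simp_all add: regular_module_def A.l_distr A.m_assoc)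
  then interpret h: left_module_hom A "regular_module A" "regular_module A" "\<lambda>a. a \<otimes>\<^bsub>A\<^esub> x"
    by (intro left_module_hom.intro left_module_hom_axioms.intro L.left_module_axioms)
  have "(\<lambda>a. a \<otimes>\<^bsub>A\<^esub> x) ` carrier (regular_module A) = {a \<otimes>\<^bsub>A\<^esub> x | a. a \<in> carrier A}"
    by (auto simp: regular_module_def)
  then have "submodule {a \<otimes>\<^bsub>A\<^esub> x | a. a \<in> carrier A} A (regular_module A)"
    using h.image_submodule[OF L.carrier_submodule] by simp
  then show ?thesis unfolding left_ideal_module_def by (rule L.submodule_left_module)
qed

lemma (in hecke_algebra) finite_span:
  "\<exists>S. finite S \<and> S \<subseteq> carrier B \<and> lin_span K B S = carrier B"
  using lin_basis_span[OF KB.left_module_axioms T_basis] by (intro exI conjI)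

text \<open>At \<open>q = 1\<close> the coefficient \<open>q - 1\<close> vanishes, and both branches
  of the multiplication rule reduce to the group law.\<close>

lemma sym_group_algebra_is_hecke:
  assumes K: "field K" and sym: "is_sym_group_algebra K m B T"
  shows "is_hecke_algebra K \<one>\<^bsub>K\<^esub> m B T"
proof -
  interpret K: field K by (rule K)
  interpret B: assoc_algebra K B using sym by (simp add: is_sym_group_algebra_def)
  have T: "T w \<in> carrier B" if "w permutes {1..m}" for w
    using sym that by (auto simp: is_sym_group_algebra_def lin_basis_def sym_group_carrier)
  have mult: "T v \<otimes>\<^bsub>B\<^esub> T w = T (v \<circ> w)" if "v permutes {1..m}" "w permutes {1..m}" for v w
    using sym that by (simp add: is_sym_group_algebra_def sym_group_carrier)
  have "T (adj i) \<otimes>\<^bsub>B\<^esub> T w =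
      (if perm_length m w < perm_length m (adj i \<circ> w) then T (adj i \<circ> w)
       else \<one>\<^bsub>K\<^esub> \<odot>\<^bsub>B\<^esub> T (adj i \<circ> w) \<oplus>\<^bsub>B\<^esub> (\<one>\<^bsub>K\<^esub> \<ominus>\<^bsub>K\<^esub> \<one>\<^bsub>K\<^esub>) \<odot>\<^bsub>B\<^esub> T w)"
    if i: "1 \<le> i" "i < m" and w: "w permutes {1..m}" for i w
    using mult[OF adj_permutes[OF i] w] T[OF w] T[OF permutes_compose[OF w adj_permutes[OF i]]]
    by (simp add: a_minus_def K.r_neg)
  then show ?thesis
    using sym unfolding is_hecke_algebra_def is_sym_group_algebra_def Let_def sym_group_carrier by simp
qed

locale partition_hecke = hecke_algebra K q m B T + partition lam m
  for K :: "'k ring" and q m and B :: "('k, 'b) module" and T lam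
begin

sublocale hecke_pair K q m B T "block lam" "block lam'" wl
proof unfold_locales
  show "mono_on {1..m} (block lam)" using block_mono[of lam] by (simp only: sum_lam)
  show "mono_on {1..m} (block lam')" using block_mono[of lam'] by (simp only: sum_lam')
  show "wl permutes {1..m}" by (rule wl_permutes)
  show "wl p < wl s \<and> block lam' (wl p) \<noteq> block lam' (wl s)"
    if "1 \<le> p" "p < s" "s \<le> m" "block lam p = block lam s" for p s
    using wl_rows[OF that] by simp
qed (rule wl_columns wl_unique; assumption)+

lemma hecke_x: "hecke_x m B T lam = x_elem (block lam)"
  unfolding hecke_x_def x_elem_def young_subgroup_parabolic[OF sum_lam] ..

lemma hecke_y: "hecke_y K q m B T lam' = y_elem (block lam')"
  unfolding hecke_y_def y_elem_def r_def young_subgroup_parabolic[OF sum_lam'] ..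

end

section \<open>Application to stratified algebras\<close>

text \<open>The interface between module theory and combinatorics, shared by both kinds of
  permutation module. \<open>t\<close> is a cyclic generator, and the distinguished vector is
  \<open>\<eta> t0\<close>; its membership in the Specht module \<open>S\<close> places it in the
  Young module.\<close>

lemma unique_summand_stratified:
  fixes K :: "'k ring" and A :: "('k, 'a) module" and D :: "('k, 'a, 'b, 'v) strat_data"
    and M :: "('b, 'x) module"
  assumes K: "field K" and strat: "cellularly_stratified K A D" and l: "l \<le> depth D"
    and emb: "algebra_embedding K (input D l) (corner A (idem K D l)) (input_emb K D l)"
    and span: "\<And>j. j \<le> depth D \<Longrightarrow> \<exists>S. finite S \<and> S \<subseteq> carrier (input D j) \<and>
      lin_span K (input D j) S = carrier (input D j)"
    and M: "left_module (input D l) M" and young: "is_young_module (input D l) M S Y"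
    and t: "t \<in> carrier M" "\<And>m. m \<in> carrier M \<Longrightarrow> \<exists>b\<in>carrier (input D l). m = b \<odot>\<^bsub>M\<^esub> t"
    and \<eta>: "\<eta> \<in> carrier (input D l)" and t0: "t0 \<in> carrier M"
    and z: "\<eta> \<odot>\<^bsub>M\<^esub> t0 \<in> S" "\<eta> \<odot>\<^bsub>M\<^esub> t0 \<noteq> \<zero>\<^bsub>M\<^esub>"
    and line: "\<And>b. b \<in> carrier (input D l) \<Longrightarrow> \<exists>c\<in>carrier K.
      \<eta> \<odot>\<^bsub>M\<^esub> (b \<odot>\<^bsub>M\<^esub> t) = (c \<odot>\<^bsub>input D l\<^esub> \<one>\<^bsub>input D l\<^esub>) \<odot>\<^bsub>M\<^esub> (\<eta> \<odot>\<^bsub>M\<^esub> t0)"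
  shows "unique_summand_with_quotient A (ind_big K A D l M) (ind_small K A D l (M\<lparr>carrier := Y\<rparr>))"
proof -
  obtain \<iota> i \<phi> where infl: "iterated_inflation K A \<iota> i \<phi> D"
    using strat unfolding cellularly_stratified_def by (elim conjE exE)
  interpret stratification K A \<iota> i \<phi> D by (intro stratification.intro K infl)
  have idem: "uvec D l \<in> carrier (space D l)" "vvec D l \<in> carrier (space D l)"
    "idem K D l \<otimes>\<^bsub>A\<^esub> idem K D l = idem K D l"
    using strat l unfolding cellularly_stratified_def by simp_all
  interpret split_corner A "input D l" "idem K D l" "input_emb K D l" "corner_proj K A D l"
    by (rule split_corner[OF l idem emb])
  have alg: "assoc_algebra K (input D l)" by (rule inflationD(1)[OF l])
  have flB: "finite_length (input D l) (regular_module (input D l))"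
  proof -
    obtain S where S: "finite S" "S \<subseteq> carrier (input D l)" "lin_span K (input D l) S = carrier (input D l)"
      using span[OF l] by (elim exE conjE)
    show ?thesis
      by (rule finite_length_regular[OF alg finite_length_vector_space[OF K assoc_algebra_left_module[OF alg] S]])
  qed
  interpret M: left_module "input D l" M by (rule M)
  have summand: "direct_summand (input D l) M Y" and ind: "indecomposable (input D l) (M\<lparr>carrier := Y\<rparr>)"
    and SY: "S \<subseteq> Y"
    using young by (simp_all add: is_young_module_def)
  have Y: "submodule Y (input D l) M"
    using summand unfolding direct_summand_def complementary_def by (elim exE conjE)
  interpret induced_modules A "input D l" "idem K D l" "input_emb K D l" "corner_proj K A D l" M Y
    by (intro induced_modules.intro induced_modules_axioms.intro split_corner_axioms M Y)
  have zY: "\<eta> \<odot>\<^bsub>M\<^esub> t0 \<in> Y" using z(1) SY by auto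
  have line': "\<exists>c\<in>carrier K. \<eta> \<odot>\<^bsub>M\<^esub> m = (c \<odot>\<^bsub>input D l\<^esub> \<one>\<^bsub>input D l\<^esub>) \<odot>\<^bsub>M\<^esub> (\<eta> \<odot>\<^bsub>M\<^esub> t0)"
    if m: "m \<in> carrier M" for m
  proof -
    obtain b where b: "b \<in> carrier (input D l)" "m = b \<odot>\<^bsub>M\<^esub> t" using t(2)[OF m] by (elim bexE)
    show ?thesis unfolding b(2) by (rule line[OF b(1)])
  qed
  show ?thesis
    unfolding ind_big_def ind_small_def
    by (rule unique_summand[OF K alg finite_length_A[OF span] flB t summand ind \<eta> t0 refl zY z(2) line'])
qed

text \<open>The vector \<open>t\<close> is \<open>x_\<lambda>\<close>, \<open>\<eta>\<close> is the
  \<open>y\<close> of the conjugate partition, and \<open>t0\<close> is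
  \<open>T_w x_\<lambda>\<close> for \<open>w = wl\<close>. With these choices
  \<open>\<eta> t0\<close> is precisely the chosen generator of the Specht module.\<close>

lemma (in partition_hecke) young_hecke_data:
  defines "M \<equiv> perm_module_hecke m B T lam" and "t \<equiv> hecke_x m B T lam"
    and "\<eta> \<equiv> hecke_y K q m B T lam'"
  shows "left_module B M" "t \<in> carrier M" "\<And>m. m \<in> carrier M \<Longrightarrow> \<exists>b\<in>carrier B. m = b \<odot>\<^bsub>M\<^esub> t"
    "\<eta> \<in> carrier B" "T wl \<odot>\<^bsub>M\<^esub> t \<in> carrier M"
    "\<eta> \<odot>\<^bsub>M\<^esub> (T wl \<odot>\<^bsub>M\<^esub> t) \<in> specht_hecke K q m B T lam"
    "\<eta> \<odot>\<^bsub>M\<^esub> (T wl \<odot>\<^bsub>M\<^esub> t) \<noteq> \<zero>\<^bsub>M\<^esub>"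
    "\<And>b. b \<in> carrier B \<Longrightarrow> \<exists>c\<in>carrier K.
      \<eta> \<odot>\<^bsub>M\<^esub> (b \<odot>\<^bsub>M\<^esub> t) = (c \<odot>\<^bsub>B\<^esub> \<one>\<^bsub>B\<^esub>) \<odot>\<^bsub>M\<^esub> (\<eta> \<odot>\<^bsub>M\<^esub> (T wl \<odot>\<^bsub>M\<^esub> t))"
proof -
  have ring: "ring B" by (rule assoc_algebra.axioms(2)[OF B.assoc_algebra_axioms])
  have tB: "t \<in> carrier B" unfolding t_def hecke_x by (rule x_closed)
  have \<eta>: "\<eta> = y_elem (block lam')" unfolding \<eta>_def by (rule hecke_y)
  have M_simps: "carrier M = {a \<otimes>\<^bsub>B\<^esub> t | a. a \<in> carrier B}" "a \<odot>\<^bsub>M\<^esub> x = a \<otimes>\<^bsub>B\<^esub> x" "\<zero>\<^bsub>M\<^esub> = \<zero>\<^bsub>B\<^esub>" for a x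
    by (simp_all add: M_def t_def perm_module_hecke_def left_ideal_module_def regular_module_def)
  show M: "left_module B M"
    unfolding M_def perm_module_hecke_def t_def[symmetric] by (rule left_ideal_left_module[OF ring tB])
  interpret M: left_module B M by (rule M)
  have "t = \<one>\<^bsub>B\<^esub> \<otimes>\<^bsub>B\<^esub> t" using tB by simp
  then show tM: "t \<in> carrier M" unfolding M_simps(1) by blast
  show "\<exists>b\<in>carrier B. m = b \<odot>\<^bsub>M\<^esub> t" if "m \<in> carrier M" for m
    using that unfolding M_simps by blast
  show \<eta>B: "\<eta> \<in> carrier B" unfolding \<eta> by (rule y_closed)
  show wt: "T wl \<odot>\<^bsub>M\<^esub> t \<in> carrier M" by (rule M.smult_closed[OF T_closed[OF wl] tM])
  have zM: "\<eta> \<odot>\<^bsub>M\<^esub> (T wl \<odot>\<^bsub>M\<^esub> t) \<in> carrier M" by (rule M.smult_closed[OF \<eta>B wt])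
  have z: "\<eta> \<odot>\<^bsub>M\<^esub> (T wl \<odot>\<^bsub>M\<^esub> t) = \<eta> \<otimes>\<^bsub>B\<^esub> T wl \<otimes>\<^bsub>B\<^esub> t"
    unfolding M_simps using \<eta>B T_closed[OF wl] tB by (simp add: B.m_assoc)
  have "\<eta> \<odot>\<^bsub>M\<^esub> (T wl \<odot>\<^bsub>M\<^esub> t) = \<one>\<^bsub>B\<^esub> \<odot>\<^bsub>M\<^esub> (\<eta> \<otimes>\<^bsub>B\<^esub> T wl \<otimes>\<^bsub>B\<^esub> t)"
    using M.smult_one[OF zM] z by simp
  then show "\<eta> \<odot>\<^bsub>M\<^esub> (T wl \<odot>\<^bsub>M\<^esub> t) \<in> specht_hecke K q m B T lam"
    unfolding specht_hecke_def cyclic_submodule_def tableau_perm M_def[symmetric] t_def[symmetric] \<eta>_def[symmetric]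
    by (intro CollectI exI[of _ "\<one>\<^bsub>B\<^esub>"]) simp
  have "\<eta> \<otimes>\<^bsub>B\<^esub> T wl \<otimes>\<^bsub>B\<^esub> t \<noteq> \<zero>\<^bsub>B\<^esub>"
    unfolding \<eta> t_def hecke_x by (rule y_wl_x_nonzero)
  then show "\<eta> \<odot>\<^bsub>M\<^esub> (T wl \<odot>\<^bsub>M\<^esub> t) \<noteq> \<zero>\<^bsub>M\<^esub>" unfolding z M_simps(3) .
  have Tt: "T (adj i) \<odot>\<^bsub>M\<^esub> t = (q \<odot>\<^bsub>B\<^esub> \<one>\<^bsub>B\<^esub>) \<odot>\<^bsub>M\<^esub> t"
    if i: "1 \<le> i" "i < m" "block lam i = block lam (Suc i)" for i
    unfolding M_simps using T_adj_x[where \<beta> = "block lam", OF i] scalar_mult(1)[OF q_closed tB] by (simp add: t_def hecke_x)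
  show "\<exists>c\<in>carrier K. \<eta> \<odot>\<^bsub>M\<^esub> (b \<odot>\<^bsub>M\<^esub> t) = (c \<odot>\<^bsub>B\<^esub> \<one>\<^bsub>B\<^esub>) \<odot>\<^bsub>M\<^esub> (\<eta> \<odot>\<^bsub>M\<^esub> (T wl \<odot>\<^bsub>M\<^esub> t))"
    if "b \<in> carrier B" for b
    unfolding \<eta> by (rule y_line[OF M tM Tt that])
qed

section \<open>Permutation modules of symmetric groups as tensor products\<close>

locale partition_sym = partition lam m + K: field K
  for K :: "'k ring" and m and B :: "('k, 'b) module" and T lam +
  assumes sym: "is_sym_group_algebra K m B T"
begin

sublocale partition_hecke K "\<one>\<^bsub>K\<^esub>" m B T lam
  by (intro partition_hecke.intro hecke_algebra.intro hecke_algebra_axioms.intro partition_axioms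
      K.field_axioms sym_group_algebra_is_hecke sym)

lemma T_mult: "\<lbrakk>v permutes {1..m}; w permutes {1..m}\<rbrakk> \<Longrightarrow> T v \<otimes>\<^bsub>B\<^esub> T w = T (v \<circ> w)"
  using sym by (simp add: is_sym_group_algebra_def sym_group_carrier)

abbreviation x where "x \<equiv> x_elem (block lam)"
abbreviation y where "y \<equiv> y_elem (block lam')"

text \<open>Left translation by \<open>w\<close> permutes the row group over which \<open>x\<close>
  is summed.\<close>

lemma T_x:
  assumes w: "w \<in> parabolic m (block lam)" shows "T w \<otimes>\<^bsub>B\<^esub> x = x"
proof -
  let ?P = "parabolic m (block lam)"
  note wp = parabolicD(1)[OF w]
  have cl: "T \<in> ?P \<rightarrow> carrier B" using T_closed parabolicD(1) by auto
  have img: "(\<lambda>v. w \<circ> v) ` ?P = ?P"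
  proof (rule equalityI; rule subsetI)
    fix v assume "v \<in> (\<lambda>v. w \<circ> v) ` ?P"
    then show "v \<in> ?P" using parabolic_comp[OF w] by auto
  next
    fix v assume v: "v \<in> ?P"
    have "v = w \<circ> (inv' w \<circ> v)" by (simp add: fun_eq_iff permutes_inverses[OF wp])
    then show "v \<in> (\<lambda>v. w \<circ> v) ` ?P" using parabolic_comp[OF parabolic_inv[OF w] v] by (rule image_eqI)
  qed
  have inj: "inj_on (\<lambda>v. w \<circ> v) ?P"
  proof (rule inj_onI)
    fix u v assume "w \<circ> u = w \<circ> v"
    then have "inv' w \<circ> (w \<circ> u) = inv' w \<circ> (w \<circ> v)" by simp
    then show "u = v" by (simp add: fun_eq_iff permutes_inverses[OF wp])
  qed
  have "T w \<otimes>\<^bsub>B\<^esub> x = (\<Oplus>\<^bsub>B\<^esub>v\<in>?P. T w \<otimes>\<^bsub>B\<^esub> T v)"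
    unfolding x_elem_def by (rule B.finsum_rdistr[OF finite_parabolic T_closed[OF wp] cl])
  also have "\<dots> = (\<Oplus>\<^bsub>B\<^esub>v\<in>?P. T (w \<circ> v))"
    using T_mult[OF wp parabolicD(1)] T_closed[OF permutes_compose[OF parabolicD(1) wp]]
    by (intro B.finsum_cong') auto
  also have "\<dots> = (\<Oplus>\<^bsub>B\<^esub>v\<in>(\<lambda>v. w \<circ> v) ` ?P. T v)"
    by (rule B.finsum_reindex[OF _ inj, symmetric]) (simp only: img cl)
  also have "\<dots> = x" unfolding img x_elem_def ..
  finally show ?thesis .
qed

text \<open>The augmentation of the group algebra: the scalar by which an element acts on the
  trivial module.\<close>

definition aug :: "'b \<Rightarrow> 'k" where
  "aug b = (\<Oplus>\<^bsub>K\<^esub>w\<in>carrier (sym_group m). lin_coord K B (carrier (sym_group m)) T b w)"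

lemma coord_closed: "b \<in> carrier B \<Longrightarrow>
    lin_coord K B (carrier (sym_group m)) T b \<in> carrier (sym_group m) \<rightarrow> carrier K"
  using lin_coord_closed[OF KB.left_module_axioms T_basis] by auto

lemma finite_sym: "finite (carrier (sym_group m))"
  using T_basis by (simp add: lin_basis_def)

lemma aug_closed: "b \<in> carrier B \<Longrightarrow> aug b \<in> carrier K"
  unfolding aug_def by (intro K.finsum_closed coord_closed)

lemma aug_add: "\<lbrakk>a \<in> carrier B; b \<in> carrier B\<rbrakk> \<Longrightarrow> aug (a \<oplus>\<^bsub>B\<^esub> b) = aug a \<oplus>\<^bsub>K\<^esub> aug b"
proof -
  assume ab: "a \<in> carrier B" "b \<in> carrier B"
  let ?c = "lin_coord K B (carrier (sym_group m)) T"
  have "aug (a \<oplus>\<^bsub>B\<^esub> b) = (\<Oplus>\<^bsub>K\<^esub>w\<in>carrier (sym_group m). ?c a w \<oplus>\<^bsub>K\<^esub> ?c b w)"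
    unfolding aug_def using lin_coord_add[OF KB.left_module_axioms T_basis ab] coord_closed ab
    by (intro K.finsum_cong') (auto intro!: K.a_closed dest: funcset_mem)
  also have "\<dots> = aug a \<oplus>\<^bsub>K\<^esub> aug b"
    unfolding aug_def by (intro K.finsum_addf coord_closed ab)
  finally show ?thesis .
qed

lemma aug_smult: "\<lbrakk>c \<in> carrier K; b \<in> carrier B\<rbrakk> \<Longrightarrow> aug (c \<odot>\<^bsub>B\<^esub> b) = c \<otimes>\<^bsub>K\<^esub> aug b"
proof -
  assume c: "c \<in> carrier K" and b: "b \<in> carrier B"
  let ?c = "lin_coord K B (carrier (sym_group m)) T"
  have "aug (c \<odot>\<^bsub>B\<^esub> b) = (\<Oplus>\<^bsub>K\<^esub>w\<in>carrier (sym_group m). c \<otimes>\<^bsub>K\<^esub> ?c b w)"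
    unfolding aug_def using lin_coord_smult[OF KB.left_module_axioms T_basis c b] coord_closed[OF b] c
    by (intro K.finsum_cong') (auto intro!: K.m_closed dest: funcset_mem)
  also have "\<dots> = c \<otimes>\<^bsub>K\<^esub> aug b"
    unfolding aug_def by (rule K.finsum_rdistr[OF finite_sym c coord_closed[OF b], symmetric])
  finally show ?thesis .
qed

lemma aug_T:
  assumes "w permutes {1..m}" shows "aug (T w) = \<one>\<^bsub>K\<^esub>"
proof -
  have w: "w \<in> carrier (sym_group m)" using assms by (simp add: sym_group_carrier)
  have "aug (T w) = (\<Oplus>\<^bsub>K\<^esub>v\<in>carrier (sym_group m). if w = v then \<one>\<^bsub>K\<^esub> else \<zero>\<^bsub>K\<^esub>)"
    unfolding aug_def using lin_coord_basis[OF KB.left_module_axioms T_basis _ w]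
    by (intro K.finsum_cong') auto
  also have "\<dots> = \<one>\<^bsub>K\<^esub>" using K.finsum_singleton[OF w finite_sym, of "\<lambda>_. \<one>\<^bsub>K\<^esub>"] by simp
  finally show ?thesis .
qed

abbreviation Yg where "Yg \<equiv> young_subalgebra K m B T lam"
abbreviation triv where "triv \<equiv> trivial_module K m B T"

lemma T_young: "T ` young_subgroup m lam \<subseteq> carrier B"
  unfolding young_subgroup_parabolic[OF sum_lam] using T_closed parabolicD(1) by auto

lemma Yg_carrier: "carrier Yg = lin_span K B (T ` young_subgroup m lam)"
  by (simp add: young_subalgebra_def)

lemma Yg_submodule: "submodule (carrier Yg) K B"
  unfolding Yg_carrier by (rule lin_span_submodule[OF KB.left_module_axioms T_young])

lemma T_Yg: "w \<in> parabolic m (block lam) \<Longrightarrow> T w \<in> carrier Yg"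
  unfolding Yg_carrier young_subgroup_parabolic[OF sum_lam]
  by (rule subsetD[OF lin_span_superset imageI])

text \<open>The Young subalgebra acts on \<open>x\<close> as on the trivial module. This makes
  \<open>b \<otimes> c \<mapsto> c (b x)\<close> balanced, and so compares the tensor-product
  permutation module with the left ideal of \<open>x\<close>.\<close>

lemma Yg_x:
  assumes "b \<in> carrier Yg" shows "b \<otimes>\<^bsub>B\<^esub> x = aug b \<odot>\<^bsub>B\<^esub> x"
proof -
  let ?W = "{b \<in> carrier B. b \<otimes>\<^bsub>B\<^esub> x = aug b \<odot>\<^bsub>B\<^esub> x}"
  have x: "x \<in> carrier B" by (rule x_closed)
  have "submodule ?W K B"
  proof (rule KB.left_submoduleI)
    show "\<zero>\<^bsub>B\<^esub> \<in> ?W" using x aug_smult[of "\<zero>\<^bsub>K\<^esub>" "\<zero>\<^bsub>B\<^esub>"] aug_closed by simp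
    show "a \<oplus>\<^bsub>B\<^esub> b \<in> ?W" if "a \<in> ?W" "b \<in> ?W" for a b
      using that x aug_closed by (simp add: aug_add B.l_distr B.smult_l_distr)
    show "c \<odot>\<^bsub>B\<^esub> b \<in> ?W" if "c \<in> carrier K" "b \<in> ?W" for c b
      using that x aug_closed by (simp add: aug_smult B.smult_mult_left B.smult_assoc1)
  qed simp
  moreover have "T ` young_subgroup m lam \<subseteq> ?W"
    unfolding young_subgroup_parabolic[OF sum_lam]
    using T_closed parabolicD(1) T_x aug_T x by auto
  ultimately have "carrier Yg \<subseteq> ?W" unfolding Yg_carrier by (rule lin_span_least)
  then show ?thesis using assms by auto
qed

lemma triv_simps: "carrier triv = carrier K" "\<zero>\<^bsub>triv\<^esub> = \<zero>\<^bsub>K\<^esub>" "c \<oplus>\<^bsub>triv\<^esub> d = c \<oplus>\<^bsub>K\<^esub> d"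
  "b \<odot>\<^bsub>triv\<^esub> c = aug b \<otimes>\<^bsub>K\<^esub> c"
  by (simp_all add: trivial_module_def aug_def)

lemma reg_simps: "carrier (regular_module B) = carrier B" "a \<oplus>\<^bsub>regular_module B\<^esub> b = a \<oplus>\<^bsub>B\<^esub> b"
  "a \<odot>\<^bsub>regular_module B\<^esub> b = a \<otimes>\<^bsub>B\<^esub> b"
  by (simp_all add: regular_module_def)

lemma ring_B: "ring B" by (rule assoc_algebra.axioms(2)[OF B.assoc_algebra_axioms])

sublocale P: tensor_product B "regular_module B" Yg "monoid.mult B" triv
proof (intro tensor_product.intro tensor_product_axioms.intro ring_B regular_left_module)
  show "abelian_group triv"
  proof (rule abelian_groupI)
    fix c assume "c \<in> carrier triv"
    then show "\<exists>d\<in>carrier triv. d \<oplus>\<^bsub>triv\<^esub> c = \<zero>\<^bsub>triv\<^esub>"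
      by (intro bexI[of _ "\<ominus>\<^bsub>K\<^esub> c"]) (simp_all add: triv_simps K.l_neg)
  qed (simp_all add: triv_simps K.a_ac)
  note Yg = KB.submoduleD(2)[OF Yg_submodule]
  show "a \<otimes>\<^bsub>B\<^esub> b \<in> carrier (regular_module B)" if "a \<in> carrier (regular_module B)" "b \<in> carrier Yg" for a b
    using that Yg by (simp add: reg_simps)
  show "(a \<odot>\<^bsub>regular_module B\<^esub> b) \<otimes>\<^bsub>B\<^esub> c = a \<odot>\<^bsub>regular_module B\<^esub> (b \<otimes>\<^bsub>B\<^esub> c)"
    if "a \<in> carrier B" "b \<in> carrier (regular_module B)" "c \<in> carrier Yg" for a b c
    using that Yg by (simp add: reg_simps B.m_assoc)
  show "b \<odot>\<^bsub>triv\<^esub> c \<in> carrier triv" if "b \<in> carrier Yg" "c \<in> carrier triv" for b c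
    using that Yg aug_closed by (simp add: triv_simps)
qed

abbreviation M where "M \<equiv> perm_module_sym K m B T lam"

lemma M_tensor: "M = P.T" by (simp add: perm_module_sym_def)

definition t where "t = P.pure \<one>\<^bsub>B\<^esub> \<one>\<^bsub>K\<^esub>"

lemma M_left_module: "left_module B M" unfolding M_tensor by (rule P.T_left_module)

lemma t_closed: "t \<in> carrier M"
  unfolding t_def M_tensor by (rule P.pure_closed) (simp_all add: reg_simps triv_simps)

lemma smult_t: "b \<in> carrier B \<Longrightarrow> b \<odot>\<^bsub>M\<^esub> t = P.pure b \<one>\<^bsub>K\<^esub>"
  unfolding t_def M_tensor by (simp add: P.smult_pure reg_simps triv_simps)

lemma Yg_t: "b \<in> carrier Yg \<Longrightarrow> b \<odot>\<^bsub>M\<^esub> t = P.pure \<one>\<^bsub>B\<^esub> (aug b)"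
  using P.pure_balanced[of "\<one>\<^bsub>B\<^esub>" b "\<one>\<^bsub>K\<^esub>"] KB.submoduleD(2)[OF Yg_submodule, of b] aug_closed[of b]
  by (simp add: smult_t reg_simps triv_simps)

text \<open>A coefficient \<open>c\<close> in the right factor is the action of \<open>c 1\<close>,
  an element of the Young subalgebra with augmentation \<open>c\<close>, and so moves to the left
  factor.\<close>

lemma t_generates:
  assumes "u \<in> carrier M" shows "\<exists>b\<in>carrier B. u = b \<odot>\<^bsub>M\<^esub> t"
  using assms unfolding M_tensor
proof (induction rule: P.tensor_induct)
  case (pure b c)
  then have b: "b \<in> carrier B" and c: "c \<in> carrier K" by (simp_all add: reg_simps triv_simps)
  have s: "c \<odot>\<^bsub>B\<^esub> \<one>\<^bsub>B\<^esub> \<in> carrier Yg"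
    using KB.submoduleD(6)[OF Yg_submodule c T_Yg[OF id_parabolic]] T_id by simp
  have "aug (c \<odot>\<^bsub>B\<^esub> \<one>\<^bsub>B\<^esub>) = c" using aug_smult[OF c] aug_T[OF permutes_id] c T_id by simp
  then have "P.pure b c = P.pure (b \<otimes>\<^bsub>B\<^esub> (c \<odot>\<^bsub>B\<^esub> \<one>\<^bsub>B\<^esub>)) \<one>\<^bsub>K\<^esub>"
    using P.pure_balanced[of b "c \<odot>\<^bsub>B\<^esub> \<one>\<^bsub>B\<^esub>" "\<one>\<^bsub>K\<^esub>"] b c s by (simp add: reg_simps triv_simps)
  also have "\<dots> = (b \<otimes>\<^bsub>B\<^esub> (c \<odot>\<^bsub>B\<^esub> \<one>\<^bsub>B\<^esub>)) \<odot>\<^bsub>P.T\<^esub> t"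
    using smult_t[of "b \<otimes>\<^bsub>B\<^esub> (c \<odot>\<^bsub>B\<^esub> \<one>\<^bsub>B\<^esub>)"] b c unfolding M_tensor by simp
  finally show ?case using b c by (intro bexI[of _ "b \<otimes>\<^bsub>B\<^esub> (c \<odot>\<^bsub>B\<^esub> \<one>\<^bsub>B\<^esub>)"]) simp_all
next
  case (add u v)
  obtain a b where ab: "a \<in> carrier B" "u = a \<odot>\<^bsub>P.T\<^esub> t" "b \<in> carrier B" "v = b \<odot>\<^bsub>P.T\<^esub> t"
    using add(3,4) by (elim bexE)
  have "u \<oplus>\<^bsub>P.T\<^esub> v = (a \<oplus>\<^bsub>B\<^esub> b) \<odot>\<^bsub>P.T\<^esub> t"
    using left_module.smult_add_left[OF P.T_left_module ab(1,3), of t] t_closed ab(2,4) by (simp add: M_tensor)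
  then show ?case using ab(1,3) by (intro bexI[of _ "a \<oplus>\<^bsub>B\<^esub> b"]) simp_all
qed

text \<open>Conjugation by \<open>wl\<close> carries the column stabilizer to the Young subgroup of
  \<open>lam'\<close>. It preserves signs, and at \<open>q = 1\<close> the weight \<open>r\<close>
  is \<open>-1\<close>, so the signed column sum turns into \<open>y\<close>.\<close>

lemma T_wl_kappa:
  "T wl \<otimes>\<^bsub>B\<^esub> (\<Oplus>\<^bsub>B\<^esub>w\<in>column_stabilizer m lam. if evenperm w then T w else \<ominus>\<^bsub>B\<^esub> T w) = y \<otimes>\<^bsub>B\<^esub> T wl"
proof -
  let ?G = "parabolic m (block lam')" and ?F = "\<lambda>u. inv' wl \<circ> u \<circ> wl"
  let ?s = "\<lambda>w. if evenperm w then T w else \<ominus>\<^bsub>B\<^esub> T w"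
  have Fp: "?F u permutes {1..m}" if "u \<in> ?G" for u
    by (rule permutes_compose[OF wl permutes_compose[OF parabolicD(1)[OF that] permutes_inv[OF wl]]])
  have wlF: "wl \<circ> ?F u = u \<circ> wl" for u by (simp add: fun_eq_iff permutes_inverses[OF wl])
  have inj: "inj_on ?F ?G"
  proof (rule inj_onI)
    fix u v assume "?F u = ?F v"
    then have "wl \<circ> ?F u \<circ> inv' wl = wl \<circ> ?F v \<circ> inv' wl" by simp
    then show "u = v" unfolding wlF by (simp add: fun_eq_iff permutes_inverses[OF wl])
  qed
  have s_closed: "?s w \<in> carrier B" if "w permutes {1..m}" for w using T_closed[OF that] by simp
  have clF: "(\<lambda>u. ?s (?F u)) \<in> ?G \<rightarrow> carrier B" using s_closed Fp by blast
  have cls: "?s \<in> ?F ` ?G \<rightarrow> carrier B" using s_closed Fp by blast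
  have even: "evenperm (?F u) = evenperm u" if u: "u \<in> ?G" for u
  proof -
    have p: "permutation u" "permutation wl" "permutation (inv' wl)"
      using parabolicD(1)[OF u] wl permutes_inv[OF wl] permutation_permutes by (metis finite_atLeastAtMost)+
    show ?thesis
      using evenperm_comp[OF permutation_compose[OF p(3,1)] p(2)] evenperm_comp[OF p(3,1)] evenperm_inv[OF p(2)]
      by auto
  qed
  have r_pow: "r [^]\<^bsub>K\<^esub> n = (if even n then \<one>\<^bsub>K\<^esub> else \<ominus>\<^bsub>K\<^esub> \<one>\<^bsub>K\<^esub>)" for n :: nat
  proof -
    have "r = \<ominus>\<^bsub>K\<^esub> \<one>\<^bsub>K\<^esub>" using r_q r_closed by simp
    then show ?thesis by (induction n) (simp_all add: K.l_minus)
  qed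
  have summand_eq: "T wl \<otimes>\<^bsub>B\<^esub> ?s (?F u) = ((r [^]\<^bsub>K\<^esub> perm_length m u) \<odot>\<^bsub>B\<^esub> T u) \<otimes>\<^bsub>B\<^esub> T wl" if u: "u \<in> ?G" for u
  proof -
    note up = parabolicD(1)[OF u]
    have T1: "T wl \<otimes>\<^bsub>B\<^esub> T (?F u) = T u \<otimes>\<^bsub>B\<^esub> T wl"
      using T_mult[OF wl Fp[OF u]] T_mult[OF up wl] wlF[of u] by simp
    show ?thesis
      unfolding even[OF u] r_pow evenperm_perm_length[OF up]
      using T1 T_closed[OF wl] T_closed[OF up] T_closed[OF Fp[OF u]]
      by (simp add: B.r_minus B.l_minus B.smult_l_minus)
  qed
  have clt: "(\<lambda>u. (r [^]\<^bsub>K\<^esub> perm_length m u) \<odot>\<^bsub>B\<^esub> T u) \<in> ?G \<rightarrow> carrier B" using y_term_closed by auto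
  have clt': "(\<lambda>u. ((r [^]\<^bsub>K\<^esub> perm_length m u) \<odot>\<^bsub>B\<^esub> T u) \<otimes>\<^bsub>B\<^esub> T wl) \<in> ?G \<rightarrow> carrier B"
    using y_term_closed T_closed[OF wl] by auto
  have "(\<Oplus>\<^bsub>B\<^esub>w\<in>column_stabilizer m lam. ?s w) = (\<Oplus>\<^bsub>B\<^esub>u\<in>?G. ?s (?F u))"
    unfolding column_stabilizer by (rule B.finsum_reindex[OF cls inj])
  then have "T wl \<otimes>\<^bsub>B\<^esub> (\<Oplus>\<^bsub>B\<^esub>w\<in>column_stabilizer m lam. ?s w) = (\<Oplus>\<^bsub>B\<^esub>u\<in>?G. T wl \<otimes>\<^bsub>B\<^esub> ?s (?F u))"
    using B.finsum_rdistr[OF finite_parabolic T_closed[OF wl] clF] by simp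
  also have "\<dots> = (\<Oplus>\<^bsub>B\<^esub>u\<in>?G. ((r [^]\<^bsub>K\<^esub> perm_length m u) \<odot>\<^bsub>B\<^esub> T u) \<otimes>\<^bsub>B\<^esub> T wl)"
    by (rule B.finsum_cong'[OF refl clt' summand_eq])
  also have "\<dots> = y \<otimes>\<^bsub>B\<^esub> T wl"
    unfolding y_elem_def by (rule B.finsum_ldistr[OF finite_parabolic T_closed[OF wl] clt, symmetric])
  finally show ?thesis .
qed

text \<open>By \<open>T_wl_kappa\<close>, the vector \<open>y T_wl t\<close> is \<open>T_wl\<close>
  applied to the polytabloid, hence lies in the Specht module.\<close>

lemma young_sym_data:
  "T wl \<odot>\<^bsub>M\<^esub> t \<in> carrier M" "y \<odot>\<^bsub>M\<^esub> (T wl \<odot>\<^bsub>M\<^esub> t) \<in> specht_sym K m B T lam"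
  "y \<odot>\<^bsub>M\<^esub> (T wl \<odot>\<^bsub>M\<^esub> t) \<noteq> \<zero>\<^bsub>M\<^esub>"
  "\<And>b. b \<in> carrier B \<Longrightarrow> \<exists>c\<in>carrier K.
      y \<odot>\<^bsub>M\<^esub> (b \<odot>\<^bsub>M\<^esub> t) = (c \<odot>\<^bsub>B\<^esub> \<one>\<^bsub>B\<^esub>) \<odot>\<^bsub>M\<^esub> (y \<odot>\<^bsub>M\<^esub> (T wl \<odot>\<^bsub>M\<^esub> t))"
proof -
  interpret M: left_module B M by (rule M_left_module)
  have yB: "y \<in> carrier B" and wB: "T wl \<in> carrier B" and ywB: "y \<otimes>\<^bsub>B\<^esub> T wl \<in> carrier B"
    using y_closed T_closed[OF wl] by simp_all
  show "T wl \<odot>\<^bsub>M\<^esub> t \<in> carrier M" by (rule M.smult_closed[OF wB t_closed])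
  have z: "y \<odot>\<^bsub>M\<^esub> (T wl \<odot>\<^bsub>M\<^esub> t) = (y \<otimes>\<^bsub>B\<^esub> T wl) \<odot>\<^bsub>M\<^esub> t"
    by (rule M.smult_assoc[OF yB wB t_closed, symmetric])
  let ?\<kappa> = "\<Oplus>\<^bsub>B\<^esub>w\<in>column_stabilizer m lam. if evenperm w then T w else \<ominus>\<^bsub>B\<^esub> T w"
  have \<kappa>: "?\<kappa> \<in> carrier B"
    using T_closed by (intro B.finsum_closed) (auto simp: column_stabilizer_def sym_group_carrier)
  have "y \<odot>\<^bsub>M\<^esub> (T wl \<odot>\<^bsub>M\<^esub> t) = T wl \<odot>\<^bsub>M\<^esub> (?\<kappa> \<odot>\<^bsub>M\<^esub> t)"
    unfolding z T_wl_kappa[symmetric] by (rule M.smult_assoc[OF wB \<kappa> t_closed])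
  then show "y \<odot>\<^bsub>M\<^esub> (T wl \<odot>\<^bsub>M\<^esub> t) \<in> specht_sym K m B T lam"
    unfolding specht_sym_def cyclic_submodule_def Let_def t_def using wB
    by (intro CollectI exI[of _ "T wl"]) simp
  show "y \<odot>\<^bsub>M\<^esub> (T wl \<odot>\<^bsub>M\<^esub> t) \<noteq> \<zero>\<^bsub>M\<^esub>"
  proof
    assume 0: "y \<odot>\<^bsub>M\<^esub> (T wl \<odot>\<^bsub>M\<^esub> t) = \<zero>\<^bsub>M\<^esub>"
    note Yg = KB.submoduleD(2)[OF Yg_submodule]
    have x: "x \<in> carrier B" by (rule x_closed)
    show False
    \<comment> \<open>A vector of a tensor product is shown to be nonzero by mapping it out: the
      image of \<open>y T_wl t\<close> in \<open>B\<close> is \<open>y T_wl x\<close>, which does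
      not vanish.\<close>
    proof (rule P.tensor_lift[of B "\<lambda>b c. c \<odot>\<^bsub>B\<^esub> (b \<otimes>\<^bsub>B\<^esub> x)"])
      show "abelian_group B" by (rule left_module.axioms(2)[OF KB.left_module_axioms])
      show "c \<odot>\<^bsub>B\<^esub> (b \<otimes>\<^bsub>B\<^esub> x) \<in> carrier B" if "b \<in> carrier (regular_module B)" "c \<in> carrier triv" for b c
        using that x by (simp add: reg_simps triv_simps)
      show "c \<odot>\<^bsub>B\<^esub> ((b \<oplus>\<^bsub>regular_module B\<^esub> b') \<otimes>\<^bsub>B\<^esub> x) = c \<odot>\<^bsub>B\<^esub> (b \<otimes>\<^bsub>B\<^esub> x) \<oplus>\<^bsub>B\<^esub> c \<odot>\<^bsub>B\<^esub> (b' \<otimes>\<^bsub>B\<^esub> x)"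
        if "b \<in> carrier (regular_module B)" "b' \<in> carrier (regular_module B)" "c \<in> carrier triv" for b b' c
        using that x by (simp add: reg_simps triv_simps B.l_distr B.smult_r_distr)
      show "(c \<oplus>\<^bsub>triv\<^esub> c') \<odot>\<^bsub>B\<^esub> (b \<otimes>\<^bsub>B\<^esub> x) = c \<odot>\<^bsub>B\<^esub> (b \<otimes>\<^bsub>B\<^esub> x) \<oplus>\<^bsub>B\<^esub> c' \<odot>\<^bsub>B\<^esub> (b \<otimes>\<^bsub>B\<^esub> x)"
        if "b \<in> carrier (regular_module B)" "c \<in> carrier triv" "c' \<in> carrier triv" for b c c'
        using that x by (simp add: reg_simps triv_simps B.smult_l_distr)
      show "c \<odot>\<^bsub>B\<^esub> (b \<otimes>\<^bsub>B\<^esub> a \<otimes>\<^bsub>B\<^esub> x) = (a \<odot>\<^bsub>triv\<^esub> c) \<odot>\<^bsub>B\<^esub> (b \<otimes>\<^bsub>B\<^esub> x)"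
        if "b \<in> carrier (regular_module B)" "a \<in> carrier Yg" "c \<in> carrier triv" for b a c
      proof -
        have abc: "b \<in> carrier B" "a \<in> carrier B" "c \<in> carrier K" "aug a \<in> carrier K"
          using that Yg aug_closed by (simp_all add: reg_simps triv_simps)
        have "b \<otimes>\<^bsub>B\<^esub> a \<otimes>\<^bsub>B\<^esub> x = aug a \<odot>\<^bsub>B\<^esub> (b \<otimes>\<^bsub>B\<^esub> x)"
          using abc x Yg_x[OF that(2)] by (simp add: B.m_assoc B.smult_mult_right)
        then show ?thesis
          using abc x by (simp add: triv_simps B.smult_assoc1[symmetric] K.m_comm)
      qed
    next
      fix h assume h: "\<And>u v. \<lbrakk>u \<in> carrier P.T; v \<in> carrier P.T\<rbrakk> \<Longrightarrow> h (u \<oplus>\<^bsub>P.T\<^esub> v) = h u \<oplus>\<^bsub>B\<^esub> h v"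
        "\<And>b c. \<lbrakk>b \<in> carrier (regular_module B); c \<in> carrier triv\<rbrakk> \<Longrightarrow> h (P.pure b c) = c \<odot>\<^bsub>B\<^esub> (b \<otimes>\<^bsub>B\<^esub> x)"
      have "P.pure (y \<otimes>\<^bsub>B\<^esub> T wl) \<one>\<^bsub>K\<^esub> = P.pure \<zero>\<^bsub>B\<^esub> \<one>\<^bsub>K\<^esub>"
        using 0 P.pure_zero_left[of "\<one>\<^bsub>K\<^esub>"] unfolding z smult_t[OF ywB]
        by (simp add: M_tensor triv_simps regular_module_def)
      then have "h (P.pure (y \<otimes>\<^bsub>B\<^esub> T wl) \<one>\<^bsub>K\<^esub>) = h (P.pure \<zero>\<^bsub>B\<^esub> \<one>\<^bsub>K\<^esub>)" by simp
      then have "y \<otimes>\<^bsub>B\<^esub> T wl \<otimes>\<^bsub>B\<^esub> x = \<zero>\<^bsub>B\<^esub>"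
        using h(2)[of "y \<otimes>\<^bsub>B\<^esub> T wl" "\<one>\<^bsub>K\<^esub>"] h(2)[of "\<zero>\<^bsub>B\<^esub>" "\<one>\<^bsub>K\<^esub>"] ywB x by (simp add: reg_simps triv_simps)
      then show False using y_wl_x_nonzero by simp
    qed
  qed
  \<comment> \<open>\<open>T (adj i)\<close> lies in the Young subalgebra and has augmentation
    \<open>1\<close>, which is the value of \<open>q\<close> here.\<close>
  have Tt: "T (adj i) \<odot>\<^bsub>M\<^esub> t = (\<one>\<^bsub>K\<^esub> \<odot>\<^bsub>B\<^esub> \<one>\<^bsub>B\<^esub>) \<odot>\<^bsub>M\<^esub> t"
    if i: "1 \<le> i" "i < m" "block lam i = block lam (Suc i)" for i
    using Yg_t[OF T_Yg[OF adj_parabolic[OF i]]] aug_T[OF adj_permutes[OF i(1,2)]] M.smult_one[OF t_closed]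
    by (simp add: t_def)
  show "\<exists>c\<in>carrier K. y \<odot>\<^bsub>M\<^esub> (b \<odot>\<^bsub>M\<^esub> t) = (c \<odot>\<^bsub>B\<^esub> \<one>\<^bsub>B\<^esub>) \<odot>\<^bsub>M\<^esub> (y \<odot>\<^bsub>M\<^esub> (T wl \<odot>\<^bsub>M\<^esub> t))"
    if "b \<in> carrier B" for b
    by (rule y_line[OF M_left_module t_closed Tt that])
qed

end

theorem theorem1:
  fixes K :: "'k ring" and A :: "('k, 'a) module"
    and D :: "('k, 'a, 'b, 'v) strat_data" and l :: nat
  assumes "algebraically_closed K"
    and "cellularly_stratified K A D"
    and "\<forall>j\<le>depth D.
      (\<exists>m T. is_sym_group_algebra K m (input D j) T) \<or>
      (\<exists>q m T. is_hecke_algebra K q m (input D j) T)"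
    and "\<forall>j\<le>depth D.
      algebra_embedding K (input D j) (corner A (idem K D j)) (input_emb K D j)"
    and "l \<le> depth D"
    and "corner_splits K A D l"
  shows "(\<forall>m T lam Y.
        is_sym_group_algebra K m (input D l) T \<and> is_partition lam m \<and>
        is_young_module (input D l) (perm_module_sym K m (input D l) T lam)
          (specht_sym K m (input D l) T lam) Y \<longrightarrow>
        unique_summand_with_quotient A
          (ind_big K A D l (perm_module_sym K m (input D l) T lam))
          (ind_small K A D l ((perm_module_sym K m (input D l) T lam)\<lparr>carrier := Y\<rparr>))) \<and>
      (\<forall>q m T lam Y.
        is_hecke_algebra K q m (input D l) T \<and> is_partition lam m \<and>
        is_young_module (input D l) (perm_module_hecke m (input D l) T lam)
          (specht_hecke K q m (input D l) T lam) Y \<longrightarrow>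
        unique_summand_with_quotient A
          (ind_big K A D l (perm_module_hecke m (input D l) T lam))
          (ind_small K A D l ((perm_module_hecke m (input D l) T lam)\<lparr>carrier := Y\<rparr>)))"
proof -
  have K: "field K" using assms(1) by (rule algebraically_closed.axioms(1))
  \<comment> \<open>Each input algebra is a Hecke algebra, with \<open>q = 1\<close> for group
    algebras, and so is spanned by its finite standard basis.\<close>
  have span: "\<exists>S. finite S \<and> S \<subseteq> carrier (input D j) \<and> lin_span K (input D j) S = carrier (input D j)"
    if j: "j \<le> depth D" for j
  proof -
    obtain q m T where "is_hecke_algebra K q m (input D j) T"
      using assms(3)[rule_format, OF j] sym_group_algebra_is_hecke[OF K] by blast
    then show ?thesis
      by (intro hecke_algebra.finite_span[of K q m _ T] hecke_algebra.intro hecke_algebra_axioms.intro K)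
  qed
  have emb: "algebra_embedding K (input D l) (corner A (idem K D l)) (input_emb K D l)"
    using assms(4,5) by simp
  note main = unique_summand_stratified[OF K assms(2,5) emb span]
  show ?thesis
  proof (intro conjI allI impI; elim conjE)
    fix m T lam Y
    assume "is_sym_group_algebra K m (input D l) T" "is_partition lam m"
      and young: "is_young_module (input D l) (perm_module_sym K m (input D l) T lam)
          (specht_sym K m (input D l) T lam) Y"
    then interpret partition_sym K m "input D l" T lam
      by (intro partition_sym.intro partition_sym_axioms.intro partition.intro K)
    show "unique_summand_with_quotient A
          (ind_big K A D l (perm_module_sym K m (input D l) T lam))
          (ind_small K A D l ((perm_module_sym K m (input D l) T lam)\<lparr>carrier := Y\<rparr>))"
      by (rule main[OF _ M_left_module young t_closed t_generates y_closed young_sym_data])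
  next
    fix q m T lam Y
    assume "is_hecke_algebra K q m (input D l) T" "is_partition lam m"
      and young: "is_young_module (input D l) (perm_module_hecke m (input D l) T lam)
          (specht_hecke K q m (input D l) T lam) Y"
    then interpret partition_hecke K q m "input D l" T lam
      by (intro partition_hecke.intro hecke_algebra.intro hecke_algebra_axioms.intro partition.intro K)
    show "unique_summand_with_quotient A
          (ind_big K A D l (perm_module_hecke m (input D l) T lam))
          (ind_small K A D l ((perm_module_hecke m (input D l) T lam)\<lparr>carrier := Y\<rparr>))"
      by (rule main[OF _ young_hecke_data(1) young young_hecke_data(2-)])
  qed
qed

end
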